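(* Let $(W,\mathfrak h)$ be an irreducible complex reflection group and let $\Gamma$ be either $\mathrm T$ (with $\dim\mathfrak h>1$), or $\mathrm{SL}_2$ (with $W$ a real reflection group and $\dim\mathfrak h>2$). Let $c:\mathcal S\to\mathbb C$ be a conjugation-invariant function and write $H_c=H_{0,c}$. Then there is an equality of commutative rings $$Z(H_c^{\Gamma})=Z(H_c)^{\Gamma}\otimes\mathbb C Z(W).$$ In particular, as a $Z(H_c)^{\Gamma}$-module, $Z(H_c^{\Gamma})=\bigoplus_{i=0}^{\ell-1}Z(H_c)^{\Gamma}\mathbf a_i$.
   Context: $\mathfrak h$ is a finite-dimensional complex vector space. A complex reflection is a finite-order $s\in GL(\mathfrak h)$ with $\operatorname{rank}(s-1)=1$. A complex reflection group $(W,\mathfrak h)$ is a finite subgroup $W\subset GL(\mathfrak h)$ generated by complex reflections; it is irreducible if $\mathfrak h$ is an irreducible representation. $\mathcal S$ is the set of complex reflections in $W$. For $s\in\mathcal S$, $\alpha_s\in\mathfrak h^*$ is such that $\ker\alpha_s$ is the hyperplane fixed by $s$, and $\alpha_s^\vee\in\mathfrak h$ is an eigenvector of $s$ with eigenvalue $\ne1$. For $t\in\mathbb C$ and conjugation-invariant $c:\mathcal S\to\mathbb C$, the rational Cherednik algebra $H_{t,c}$ is the quotient of $T(\mathfrak h\oplus\mathfrak h^* )\rtimes W$ by $[x,x']=0$, $[y,y']=0$, $[y,x]=t\,x(y)-\sum_{s\in\mathcal S}\frac{2c_s}{\alpha_s(\alpha_s^\vee)}x(\alpha_s^\vee)\alpha_s(y)\,s$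 for $x,x'\in\mathfrak h^*$, $y,y'\in\mathfrak h$. $\mathrm T=\mathbb C^\times$ acts on $H_{t,c}$ by algebra automorphisms: $\lambda\cdot x=\lambda x$, $\lambda\cdot y=\lambda^{-1}y$, $\lambda\cdot w=w$ ($x\in\mathfrak h^*,y\in\mathfrak h,w\in W$). If $W$ is a real reflection group ($\mathfrak h$ the complexification of a real reflection representation), fix the $W$-equivariant isomorphism $\mathfrak h\to\mathfrak h^*$, $v\mapsto v^*=(v,\cdot)$, from an invariant inner product extended bilinearly; each $\begin{pmatrix}a&b\\c&d\end{pmatrix}\in\mathrm{SL}_2(\mathbb C)$ acts by the automorphism fixing $W$ with $v\mapsto av+bv^*$, $v^*\mapsto cv+dv^*$. A superscript $\Gamma$ denotes the subalgebra of $\Gamma$-fixed elements. $Z(W)$ is the centre of $W$, cyclic of order $\ell$ (by irreducibility); $\mathbb CZ(W)$ is its group algebra and $\mathbf a_0,\dots,\mathbf a_{\ell-1}$ is its complete set of primitive idempotents. $Z(A)$ is the centre of an algebra $A$. Both $Z(H_c)^\Gamma$ and $\mathbb CZ(W)$ are subalgebras of $Z(H_c^\Gamma)$, and the equality is via multiplication. *)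

theory Defs
  imports
    "HOL-Analysis.Analysis"
    "HOL-Library.Poly_Mapping"
    "HOL-Algebra.Generated_Groups"
    "HOL-Algebra.QuotRing"
    "HOL-Algebra.Module"
begin

section \<open>Complex reflection groups\<close>

text \<open>
  The space \<open>h\<close> is \<^typ>\<open>complex^'n\<close>. Its dual is also written \<^typ>\<open>complex^'n\<close>, a covector
  being the tuple of its coordinates in the dual basis; \<open>pairing x y\<close> is \<open>x(y)\<close>.
\<close>

definition GL :: "(complex^'n^'n) monoid" where
  "GL = \<lparr>carrier = {A. invertible A}, monoid.mult = (**), one = mat 1\<rparr>"

definition complex_reflection :: "complex^'n^'n \<Rightarrow> bool" where
  "complex_reflection s \<longleftrightarrow>
     s \<in> carrier GL \<and> (\<exists>k::nat. k > 0 \<and> s [^]\<^bsub>GL\<^esub> k = \<one>\<^bsub>GL\<^esub>) \<and> rank (s - mat 1) = 1"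

definition reflections :: "(complex^'n^'n) set \<Rightarrow> (complex^'n^'n) set" where
  "reflections W = {s \<in> W. complex_reflection s}"

definition complex_reflection_group :: "(complex^'n^'n) set \<Rightarrow> bool" where
  "complex_reflection_group W \<longleftrightarrow>
     finite W \<and> subgroup W GL \<and> W = generate GL (reflections W)"

text \<open>The representation \<open>h\<close> is nonzero because the index type is nonempty.\<close>

definition irreducible_reflection_group :: "(complex^'n^'n) set \<Rightarrow> bool" where
  "irreducible_reflection_group W \<longleftrightarrow>
     complex_reflection_group W \<and>
     (\<forall>U. vec.subspace U \<and> (\<forall>w\<in>W. \<forall>u\<in>U. w *v u \<in> U) \<longrightarrow> U = {0} \<or> U = UNIV)"

definition pairing :: "complex^'n \<Rightarrow> complex^'n \<Rightarrow> complex" where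
  "pairing x y = (\<Sum>i\<in>UNIV. x $ i * y $ i)"

definition root_data ::
  "(complex^'n^'n) set \<Rightarrow> (complex^'n^'n \<Rightarrow> complex^'n) \<Rightarrow> (complex^'n^'n \<Rightarrow> complex^'n) \<Rightarrow> bool"
where
  "root_data W \<alpha> \<alpha>v \<longleftrightarrow>
     (\<forall>s\<in>reflections W.
        {y. pairing (\<alpha> s) y = 0} = {y. s *v y = y} \<and>
        \<alpha>v s \<noteq> 0 \<and> (\<exists>\<zeta>. \<zeta> \<noteq> 1 \<and> s *v \<alpha>v s = \<zeta> *s \<alpha>v s))"

definition conjugation_invariant :: "(complex^'n^'n) set \<Rightarrow> (complex^'n^'n \<Rightarrow> complex) \<Rightarrow> bool" where
  "conjugation_invariant W c \<longleftrightarrow>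
     (\<forall>s\<in>reflections W. \<forall>w\<in>W. c (w \<otimes>\<^bsub>GL\<^esub> s \<otimes>\<^bsub>GL\<^esub> inv\<^bsub>GL\<^esub> w) = c s)"

definition matrix_group :: "(complex^'n^'n) set \<Rightarrow> (complex^'n^'n) monoid" where
  "matrix_group W = GL\<lparr>carrier := W\<rparr>"

definition group_center :: "('g, 'm) monoid_scheme \<Rightarrow> ('g, 'm) monoid_scheme" where
  "group_center G =
     G\<lparr>carrier := {z \<in> carrier G. \<forall>g\<in>carrier G. z \<otimes>\<^bsub>G\<^esub> g = g \<otimes>\<^bsub>G\<^esub> z}\<rparr>"

text \<open>
  A real structure: \<open>h\<close> is the complexification of the \<open>W\<close>-stable real subspace \<open>U\<close>, and \<open>B\<close> is
  the complex bilinear extension of a \<open>W\<close>-invariant inner product on \<open>U\<close>. Each complex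
  reflection in \<open>W\<close> then restricts to a real reflection of \<open>U\<close>: it has finite order, preserves
  \<open>U\<close>, and fixes a real hyperplane of \<open>U\<close>.
\<close>

definition real_structure ::
  "(complex^'n^'n) set \<Rightarrow> (complex^'n) set \<Rightarrow> (complex^'n \<Rightarrow> complex^'n \<Rightarrow> complex) \<Rightarrow> bool"
where
  "real_structure W U B \<longleftrightarrow>
     subspace U \<and>
     (\<forall>w\<in>W. \<forall>u\<in>U. w *v u \<in> U) \<and>
     (\<forall>v. \<exists>!p. fst p \<in> U \<and> snd p \<in> U \<and> v = fst p + \<i> *s snd p) \<and>
     (\<forall>v. Vector_Spaces.linear (*s) (*) (B v)) \<and>
     (\<forall>v v'. B v v' = B v' v) \<and>
     (\<forall>w\<in>W. \<forall>v v'. B (w *v v) (w *v v') = B v v') \<and>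
     (\<forall>u\<in>U. \<forall>u'\<in>U. B u u' \<in> \<real>) \<and>
     (\<forall>u\<in>U. u \<noteq> 0 \<longrightarrow> Re (B u u) > 0)"


section \<open>The tensor algebra of the double of \<open>h\<close>\<close>

text \<open>Words, so that \<open>'a free_monoid \<Rightarrow>\<^sub>0 complex\<close> is the free algebra on \<open>'a\<close>.\<close>

datatype 'a free_monoid = Word (letters: "'a list")

instantiation free_monoid :: (type) monoid_add
begin

definition zero_free_monoid :: "'a free_monoid" where
  "0 = Word []"

definition plus_free_monoid :: "'a free_monoid \<Rightarrow> 'a free_monoid \<Rightarrow> 'a free_monoid" where
  "u + v = Word (letters u @ letters v)"

instance
  by standard (simp_all add: zero_free_monoid_def plus_free_monoid_def)

end

text \<open>
  Vectors of \<open>V = h \<oplus> h\<^sup>*\<close> are pairs \<open>(y, x)\<close>. The tensor algebra of \<open>V\<close> is the free algebra on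
  the basis of \<open>V\<close> formed by the standard basis of \<open>h\<close> (letters \<^term>\<open>Inl i\<close>) and the dual basis
  of \<open>h\<^sup>*\<close> (letters \<^term>\<open>Inr i\<close>).
\<close>

type_synonym 'n double = "(complex^'n) \<times> (complex^'n)"

type_synonym 'n tensor_alg = "('n + 'n) free_monoid \<Rightarrow>\<^sub>0 complex"

definition tensor_scale :: "complex \<Rightarrow> 'n tensor_alg \<Rightarrow> 'n tensor_alg" where
  "tensor_scale a p = Poly_Mapping.single 0 a * p"

definition basis_vector :: "'n + 'n \<Rightarrow> 'n::finite double" where
  "basis_vector l = (case l of Inl i \<Rightarrow> (axis i 1, 0) | Inr i \<Rightarrow> (0, axis i 1))"

definition tensor_of :: "'n::finite double \<Rightarrow> 'n tensor_alg" where
  "tensor_of v =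
     (\<Sum>i\<in>UNIV. Poly_Mapping.single (Word [Inl i]) (fst v $ i)) +
     (\<Sum>i\<in>UNIV. Poly_Mapping.single (Word [Inr i]) (snd v $ i))"

text \<open>The algebra endomorphism of the tensor algebra extending a linear endomorphism of \<open>V\<close>.\<close>

definition tensor_map :: "('n::finite double \<Rightarrow> 'n double) \<Rightarrow> 'n tensor_alg \<Rightarrow> 'n tensor_alg" where
  "tensor_map \<gamma> p =
     (\<Sum>u\<in>Poly_Mapping.keys p.
        tensor_scale (Poly_Mapping.lookup p u)
          (prod_list (map (\<lambda>l. tensor_of (\<gamma> (basis_vector l))) (letters u))))"

text \<open>On \<open>h\<^sup>*\<close> the action is \<open>(w x)(y) = x(w\<^sup>-\<^sup>1 y)\<close>.\<close>

definition double_act :: "complex^'n^'n \<Rightarrow> 'n double \<Rightarrow> 'n double" where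
  "double_act w v = (w *v fst v, snd v v* matrix_inv w)"


section \<open>Algebras\<close>

text \<open>
  Complex algebras are records of type \<^typ>\<open>(complex, 'a) module\<close>, that is, rings equipped with a
  multiplication by complex scalars.
\<close>

text \<open>
  The crossed product \<open>R \<rtimes> G\<close> of an algebra \<open>R\<close> (a type, with scalar multiplication \<open>scl\<close>) and a
  finite group \<open>G\<close> acting on it: \<open>f\<close> stands for the sum of the \<open>f(g) g\<close>, and
  \<open>(r g) (r' g') = r g(r') g g'\<close>.
\<close>

definition crossed_product ::
  "('g, 'm) monoid_scheme \<Rightarrow> (complex \<Rightarrow> 'r \<Rightarrow> 'r) \<Rightarrow> ('g \<Rightarrow> 'r \<Rightarrow> 'r::ring_1) \<Rightarrow>
     (complex, 'g \<Rightarrow> 'r) module"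
where
  "crossed_product G scl act =
     \<lparr>carrier = {f. \<forall>g. g \<notin> carrier G \<longrightarrow> f g = 0},
      monoid.mult = (\<lambda>f h k.
        \<Sum>(a, b) \<in> {(a, b). a \<in> carrier G \<and> b \<in> carrier G \<and> a \<otimes>\<^bsub>G\<^esub> b = k}. f a * act a (h b)),
      one = (\<lambda>g. if g = \<one>\<^bsub>G\<^esub> then 1 else 0),
      zero = (\<lambda>g. 0),
      add = (\<lambda>f h g. f g + h g),
      smult = (\<lambda>a f g. scl a (f g))\<rparr>"

definition group_algebra :: "('g, 'm) monoid_scheme \<Rightarrow> (complex, 'g \<Rightarrow> complex) module" where
  "group_algebra G = crossed_product G (*) (\<lambda>g r. r)"

definition quotient_algebra ::
  "(complex, 'a) module \<Rightarrow> 'a set \<Rightarrow> (complex, 'a set) module"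
where
  "quotient_algebra A I =
     ring.extend (A Quot I) (module.fields (\<lambda>a X. \<Union>x\<in>X. I +>\<^bsub>A\<^esub> (a \<odot>\<^bsub>A\<^esub> x)))"

definition center :: "('s, 'a) module \<Rightarrow> ('s, 'a) module" where
  "center A =
     A\<lparr>carrier := {z \<in> carrier A. \<forall>a\<in>carrier A. z \<otimes>\<^bsub>A\<^esub> a = a \<otimes>\<^bsub>A\<^esub> z}\<rparr>"

definition primitive_idempotent :: "('s, 'a) module \<Rightarrow> 'a \<Rightarrow> bool" where
  "primitive_idempotent A e \<longleftrightarrow>
     e \<in> carrier A \<and> e \<otimes>\<^bsub>A\<^esub> e = e \<and> e \<noteq> \<zero>\<^bsub>A\<^esub> \<and>
     (\<forall>f\<in>carrier A. \<forall>g\<in>carrier A.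
        f \<otimes>\<^bsub>A\<^esub> f = f \<and> g \<otimes>\<^bsub>A\<^esub> g = g \<and> f \<otimes>\<^bsub>A\<^esub> g = \<zero>\<^bsub>A\<^esub> \<and> g \<otimes>\<^bsub>A\<^esub> f = \<zero>\<^bsub>A\<^esub> \<and> e = f \<oplus>\<^bsub>A\<^esub> g
        \<longrightarrow> f = \<zero>\<^bsub>A\<^esub> \<or> g = \<zero>\<^bsub>A\<^esub>)"

text \<open>
  The tensor product of two algebras over the complex numbers: the algebra with basis the pairs
  \<open>(a, b)\<close>, multiplied componentwise, modulo the bilinearity relations.
\<close>

definition pair_algebra ::
  "(complex, 'a) module \<Rightarrow> (complex, 'b) module \<Rightarrow> ('a \<times> 'b \<Rightarrow>\<^sub>0 complex) ring"
where
  "pair_algebra A B =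
     \<lparr>carrier = {p. Poly_Mapping.keys p \<subseteq> carrier A \<times> carrier B},
      monoid.mult = (\<lambda>p q.
        \<Sum>(a, b)\<in>Poly_Mapping.keys p. \<Sum>(a', b')\<in>Poly_Mapping.keys q.
          Poly_Mapping.single (a \<otimes>\<^bsub>A\<^esub> a', b \<otimes>\<^bsub>B\<^esub> b')
            (Poly_Mapping.lookup p (a, b) * Poly_Mapping.lookup q (a', b'))),
      one = Poly_Mapping.single (\<one>\<^bsub>A\<^esub>, \<one>\<^bsub>B\<^esub>) 1,
      zero = 0,
      add = (+)\<rparr>"

definition bilinearity_relations ::
  "(complex, 'a) module \<Rightarrow> (complex, 'b) module \<Rightarrow> ('a \<times> 'b \<Rightarrow>\<^sub>0 complex) set"
where
  "bilinearity_relations A B =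
     {Poly_Mapping.single (a \<oplus>\<^bsub>A\<^esub> a', b) 1 - Poly_Mapping.single (a, b) 1
        - Poly_Mapping.single (a', b) 1 | a a' b.
        a \<in> carrier A \<and> a' \<in> carrier A \<and> b \<in> carrier B} \<union>
     {Poly_Mapping.single (a, b \<oplus>\<^bsub>B\<^esub> b') 1 - Poly_Mapping.single (a, b) 1
        - Poly_Mapping.single (a, b') 1 | a b b'.
        a \<in> carrier A \<and> b \<in> carrier B \<and> b' \<in> carrier B} \<union>
     {Poly_Mapping.single (k \<odot>\<^bsub>A\<^esub> a, b) 1 - Poly_Mapping.single (a, b) k | k a b.
        a \<in> carrier A \<and> b \<in> carrier B} \<union>
     {Poly_Mapping.single (a, k \<odot>\<^bsub>B\<^esub> b) 1 - Poly_Mapping.single (a, b) k | k a b.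
        a \<in> carrier A \<and> b \<in> carrier B}"

definition tensor_ideal ::
  "(complex, 'a) module \<Rightarrow> (complex, 'b) module \<Rightarrow> ('a \<times> 'b \<Rightarrow>\<^sub>0 complex) set"
where
  "tensor_ideal A B = Idl\<^bsub>pair_algebra A B\<^esub> (bilinearity_relations A B)"

definition tensor_product ::
  "(complex, 'a) module \<Rightarrow> (complex, 'b) module \<Rightarrow> ('a \<times> 'b \<Rightarrow>\<^sub>0 complex) set ring"
where
  "tensor_product A B = pair_algebra A B Quot tensor_ideal A B"

definition pure_tensor ::
  "(complex, 'a) module \<Rightarrow> (complex, 'b) module \<Rightarrow> 'a \<Rightarrow> 'b \<Rightarrow> ('a \<times> 'b \<Rightarrow>\<^sub>0 complex) set"
where
  "pure_tensor A B a b = tensor_ideal A B +>\<^bsub>pair_algebra A B\<^esub> Poly_Mapping.single (a, b) 1"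

definition internal_direct_sum ::
  "('a, 'm) ring_scheme \<Rightarrow> ('a, 'b) module \<Rightarrow> 'i set \<Rightarrow> ('i \<Rightarrow> 'b set) \<Rightarrow> bool"
where
  "internal_direct_sum R M I N \<longleftrightarrow>
     module R M \<and> (\<forall>i\<in>I. submodule (N i) R M) \<and>
     (\<forall>m\<in>carrier M. \<exists>!f. f \<in> (\<Pi>\<^sub>E i\<in>I. N i) \<and> m = (\<Oplus>\<^bsub>M\<^esub>i\<in>I. f i))"

text \<open>An overring as a module over a subring.\<close>

definition ring_as_module :: "('s, 'a) module \<Rightarrow> ('a, 'a) module" where
  "ring_as_module A =
     \<lparr>carrier = carrier A, monoid.mult = monoid.mult A, one = one A, zero = zero A, add = add A,
      smult = monoid.mult A\<rparr>"


section \<open>Rational Cherednik algebras\<close>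

definition smash_algebra ::
  "(complex^'n^'n) set \<Rightarrow> (complex, complex^'n^'n \<Rightarrow> 'n tensor_alg) module"
where
  "smash_algebra W =
     crossed_product (matrix_group W) tensor_scale (\<lambda>w. tensor_map (double_act w))"

definition smash_vector :: "'n double \<Rightarrow> complex^'n^'n \<Rightarrow> 'n tensor_alg" where
  "smash_vector v = (\<lambda>g. if g = mat 1 then tensor_of v else 0)"

definition smash_group :: "complex^'n^'n \<Rightarrow> complex^'n^'n \<Rightarrow> 'n tensor_alg" where
  "smash_group w = (\<lambda>g. if g = w then 1 else 0)"

definition commutator :: "('s, 'a) module \<Rightarrow> 'a \<Rightarrow> 'a \<Rightarrow> 'a" where
  "commutator A a b = (a \<otimes>\<^bsub>A\<^esub> b) \<ominus>\<^bsub>A\<^esub> (b \<otimes>\<^bsub>A\<^esub> a)"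

definition cherednik_relations ::
  "(complex^'n^'n) set \<Rightarrow> (complex^'n^'n \<Rightarrow> complex^'n) \<Rightarrow> (complex^'n^'n \<Rightarrow> complex^'n) \<Rightarrow>
     complex \<Rightarrow> (complex^'n^'n \<Rightarrow> complex) \<Rightarrow> (complex^'n^'n \<Rightarrow> 'n tensor_alg) set"
where
  "cherednik_relations W \<alpha> \<alpha>v t c =
     (let A = smash_algebra W in
       {commutator A (smash_vector (0, x)) (smash_vector (0, x')) | x x'. True} \<union>
       {commutator A (smash_vector (y, 0)) (smash_vector (y', 0)) | y y'. True} \<union>
       {commutator A (smash_vector (y, 0)) (smash_vector (0, x)) \<ominus>\<^bsub>A\<^esub>
          (((t * pairing x y) \<odot>\<^bsub>A\<^esub> \<one>\<^bsub>A\<^esub>) \<ominus>\<^bsub>A\<^esub>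
           (\<Oplus>\<^bsub>A\<^esub>s\<in>reflections W.
              (2 * c s / pairing (\<alpha> s) (\<alpha>v s) * pairing x (\<alpha>v s) * pairing (\<alpha> s) y)
                \<odot>\<^bsub>A\<^esub> smash_group s)) | x y. True})"

definition cherednik_ideal ::
  "(complex^'n^'n) set \<Rightarrow> (complex^'n^'n \<Rightarrow> complex^'n) \<Rightarrow> (complex^'n^'n \<Rightarrow> complex^'n) \<Rightarrow>
     complex \<Rightarrow> (complex^'n^'n \<Rightarrow> complex) \<Rightarrow> (complex^'n^'n \<Rightarrow> 'n tensor_alg) set"
where
  "cherednik_ideal W \<alpha> \<alpha>v t c = Idl\<^bsub>smash_algebra W\<^esub> (cherednik_relations W \<alpha> \<alpha>v t c)"

definition cherednik_algebra ::
  "(complex^'n^'n) set \<Rightarrow> (complex^'n^'n \<Rightarrow> complex^'n) \<Rightarrow> (complex^'n^'n \<Rightarrow> complex^'n) \<Rightarrow>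
     complex \<Rightarrow> (complex^'n^'n \<Rightarrow> complex) \<Rightarrow>
     (complex, (complex^'n^'n \<Rightarrow> 'n tensor_alg) set) module"
where
  "cherednik_algebra W \<alpha> \<alpha>v t c =
     quotient_algebra (smash_algebra W) (cherednik_ideal W \<alpha> \<alpha>v t c)"

text \<open>The canonical map from the group algebra of \<open>W\<close>, or of a subgroup of \<open>W\<close>.\<close>

definition cherednik_group_map ::
  "(complex^'n^'n) set \<Rightarrow> (complex^'n^'n \<Rightarrow> complex^'n) \<Rightarrow> (complex^'n^'n \<Rightarrow> complex^'n) \<Rightarrow>
     complex \<Rightarrow> (complex^'n^'n \<Rightarrow> complex) \<Rightarrow>
     (complex^'n^'n \<Rightarrow> complex) \<Rightarrow> (complex^'n^'n \<Rightarrow> 'n tensor_alg) set"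
where
  "cherednik_group_map W \<alpha> \<alpha>v t c b =
     cherednik_ideal W \<alpha> \<alpha>v t c +>\<^bsub>smash_algebra W\<^esub> (\<lambda>g. Poly_Mapping.single 0 (b g))"


section \<open>Group actions on Cherednik algebras\<close>

text \<open>
  An acting group is given by the set of the linear automorphisms of \<open>V\<close> through which it acts.
  Such a map acts on the crossed product, trivially on \<open>W\<close>. When it preserves the defining ideal,
  it sends cosets to cosets, and its action on the quotient is the image of cosets.
\<close>

definition smash_map ::
  "('n::finite double \<Rightarrow> 'n double) \<Rightarrow>
     (complex^'n^'n \<Rightarrow> 'n tensor_alg) \<Rightarrow> complex^'n^'n \<Rightarrow> 'n tensor_alg"
where
  "smash_map \<gamma> f = (\<lambda>w. tensor_map \<gamma> (f w))"

definition fixed_subalgebra ::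
  "('n::finite double \<Rightarrow> 'n double) set \<Rightarrow>
     (complex, (complex^'n^'n \<Rightarrow> 'n tensor_alg) set) module \<Rightarrow>
     (complex, (complex^'n^'n \<Rightarrow> 'n tensor_alg) set) module"
where
  "fixed_subalgebra \<Gamma> A = A\<lparr>carrier := {X \<in> carrier A. \<forall>\<gamma>\<in>\<Gamma>. smash_map \<gamma> ` X = X}\<rparr>"

definition torus :: "('n::finite double \<Rightarrow> 'n double) set" where
  "torus = {(\<lambda>v. (inverse k *s fst v, k *s snd v)) | k. k \<noteq> (0::complex)}"

text \<open>The map \<open>v \<mapsto> v\<^sup>* = B(v, _)\<close> from \<open>h\<close> to its dual, in coordinates.\<close>

definition flat :: "(complex^'n \<Rightarrow> complex^'n \<Rightarrow> complex) \<Rightarrow> complex^'n \<Rightarrow> complex^'n" where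
  "flat B v = (\<chi> i. B v (axis i 1))"

text \<open>
  With \<open>a, b\<close> and \<open>c, d\<close> the rows of \<open>g\<close>: \<open>v \<mapsto> a v + b v\<^sup>*\<close> and \<open>v\<^sup>* \<mapsto> c v + d v\<^sup>*\<close>.
\<close>

definition sl2 :: "(complex^'n \<Rightarrow> complex^'n \<Rightarrow> complex) \<Rightarrow> ('n double \<Rightarrow> 'n double) set" where
  "sl2 B =
     {(\<lambda>v. (g$1$1 *s fst v + g$2$1 *s inv_into UNIV (flat B) (snd v),
            g$1$2 *s flat B (fst v) + g$2$2 *s snd v)) | g :: complex^2^2. det g = 1}"

end

theory Submission
  imports Defs "HOL-Computational_Algebra.Fundamental_Theorem_Algebra" "HOL-Algebra.Multiplicative_Group"
begin

text \<open>
  Write \<open>H\<close> for the Cherednik algebra, \<open>A\<close> for the crossed product of which it is a quotient, and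
  \<open>Z\<close> for the centre of \<open>W\<close>. Elements of \<open>Z\<close> are scalar matrices by Schur's lemma. They act on
  \<open>H\<close> by conjugation as elements of \<open>\<Gamma>\<close>, so they commute with the invariants \<open>H\<^sup>\<Gamma>\<close>, and
  the products of the central invariants with \<open>Z\<close> are central in \<open>H\<^sup>\<Gamma>\<close>. The theorem says that
  there are no further central elements and that these products are independent over the central
  invariants.

  The proof takes place in the Dunkl representation at \<open>t = 0\<close>, in which covectors act as
  multiplication operators, group elements by translation, and a vector \<open>y\<close> acts as the momentum
  coordinate \<open>y\<close> plus a combination of reflections with poles along their hyperplanes. On a set of
  generic points of \<open>V\<close> every operator is uniquely a sum of coefficient functions times group
  elements. The Dunkl operators commute (\<open>comm_D_D\<close>), so \<open>H\<close> acts. The action is faithful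
  (\<open>Ich_iff\<close>): words in which the covectors precede the vectors span \<open>H\<close> over the group, and the
  leading terms of their operators in the momenta are distinct monomials (\<open>normal_independent\<close>).

  Let \<open>f\<close> be central in \<open>H\<^sup>\<Gamma>\<close>. A quadratic invariant \<open>q\<close> in \<open>h\<^sup>* h\<close> has as its leading term a
  function on \<open>V\<close>, and comparing leading terms in the commutator of \<open>f\<close> with \<open>q\<close> shows that a
  coefficient of \<open>f\<close> of maximal degree can only occur at group elements preserving this function.
  For the torus the functions are the \<open>x\<^sub>i y\<^sub>j\<close>, for the special linear group the
  \<open>x\<^sub>i y\<^sub>j - x\<^sub>j y\<^sub>i\<close>. Only scalars preserve all functions of the first family, and the same holds
  for the second one in dimension at least three (\<open>bivector_preserving_scalar\<close>). Splitting off the part supported on \<open>Z\<close>, which commutes with \<open>H\<^sup>\<Gamma>\<close> as well, one finds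
  that \<open>f\<close> is supported on \<open>Z\<close> (\<open>fixed_central_support\<close>).

  The component of \<open>f\<close> at each \<open>z\<close> is a priori only a localized element. Moving a coordinate \<open>x\<close>
  through \<open>z\<close> multiplies it by a scalar that determines \<open>z\<close>. As \<open>f x\<close> lies in \<open>H\<close> for each of two
  coordinates, which form a regular sequence, the element obtained from \<open>f\<close> by twisting its
  components with these scalars lies in \<open>H\<close>; distinct scalars then separate the components
  (\<open>realizable_twist\<close>, \<open>realizable_component\<close>). Divided by \<open>z\<close>, the component at \<open>z\<close> is an
  invariant function, hence central in \<open>H\<close>, and by uniqueness it is fixed by \<open>\<Gamma>\<close>
  (\<open>fixed_central_decomposition\<close>).

  So the centre of \<open>H\<^sup>\<Gamma>\<close> is free over the central invariants on the elements of \<open>Z\<close>. The statements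
  on tensor products and idempotents hold for any such algebra (\<open>tensor_iso\<close>, \<open>direct_sum\<close>): the
  primitive idempotents are another basis of the group algebra.
\<close>

section \<open>Free algebras\<close>

lemma sum_lookup_single: "(\<Sum>k\<in>Poly_Mapping.keys p. Poly_Mapping.single k (Poly_Mapping.lookup p k)) = p"
proof (rule poly_mapping_eqI)
  fix k
  show "Poly_Mapping.lookup (\<Sum>k\<in>Poly_Mapping.keys p. Poly_Mapping.single k (Poly_Mapping.lookup p k)) k
     = Poly_Mapping.lookup p k"
    by (simp add: lookup_sum lookup_single when_def in_keys_iff sum.delta)
qed

lemma poly_mapping_additive_induct [case_names zero single add]:
  assumes "P 0" "\<And>k a. P (Poly_Mapping.single k a)" "\<And>p q. P p \<Longrightarrow> P q \<Longrightarrow> P (p + q)"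
  shows "P (p :: 'k \<Rightarrow>\<^sub>0 'c::comm_monoid_add)"
proof -
  have "finite K \<Longrightarrow> P (\<Sum>k\<in>K. Poly_Mapping.single k (Poly_Mapping.lookup p k))" for K
    by (induction K rule: finite_induct) (auto intro: assms)
  from this[of "Poly_Mapping.keys p"] show ?thesis by (simp add: sum_lookup_single)
qed

definition free_lift ::
  "(complex \<Rightarrow> 'r::ring_1) \<Rightarrow> ('a \<Rightarrow> 'r) \<Rightarrow> ('a free_monoid \<Rightarrow>\<^sub>0 complex) \<Rightarrow> 'r"
where
  "free_lift \<sigma> X p =
     (\<Sum>u\<in>Poly_Mapping.keys p. \<sigma> (Poly_Mapping.lookup p u) * prod_list (map X (letters u)))"

text \<open>
  Complex algebras that are types are given by their structure map \<open>\<sigma>\<close>, which embeds the scalars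
  in the centre.
\<close>

locale central_scalars =
  fixes \<sigma> :: "complex \<Rightarrow> 'r::ring_1"
  assumes scalar_add: "\<sigma> (a + b) = \<sigma> a + \<sigma> b"
    and scalar_mult: "\<sigma> (a * b) = \<sigma> a * \<sigma> b"
    and scalar_one: "\<sigma> 1 = 1"
    and scalar_central: "\<sigma> a * r = r * \<sigma> a"
begin

lemma scalar_zero: "\<sigma> 0 = 0"
  using scalar_add[of 0 0] by simp

lemma scalar_uminus: "\<sigma> (- a) = - \<sigma> a"
  using scalar_add[of a "- a"] by (simp add: scalar_zero eq_neg_iff_add_eq_0 add.commute)

lemma scalar_diff: "\<sigma> (a - b) = \<sigma> a - \<sigma> b"
  using scalar_add[of a "- b"] by (simp add: scalar_uminus)

lemma free_lift_superset:
  assumes "finite K" "Poly_Mapping.keys p \<subseteq> K"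
  shows "free_lift \<sigma> X p = (\<Sum>u\<in>K. \<sigma> (Poly_Mapping.lookup p u) * prod_list (map X (letters u)))"
  unfolding free_lift_def
  by (rule sum.mono_neutral_left) (use assms in \<open>auto simp: in_keys_iff scalar_zero\<close>)

lemma free_lift_zero [simp]: "free_lift \<sigma> X 0 = 0"
  by (simp add: free_lift_def)

lemma free_lift_single: "free_lift \<sigma> X (Poly_Mapping.single u a) = \<sigma> a * prod_list (map X (letters u))"
  by (subst free_lift_superset[of "{u}"]) auto

lemma free_lift_add [simp]: "free_lift \<sigma> X (p + q) = free_lift \<sigma> X p + free_lift \<sigma> X q"
proof -
  let ?K = "Poly_Mapping.keys p \<union> Poly_Mapping.keys q"
  have "Poly_Mapping.keys (p + q) \<subseteq> ?K" by (rule Poly_Mapping.keys_add)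
  then show ?thesis
    by (simp add: free_lift_superset[of ?K] lookup_add scalar_add distrib_right sum.distrib)
qed

lemma free_lift_uminus [simp]: "free_lift \<sigma> X (- p) = - free_lift \<sigma> X p"
  using free_lift_add[of X p "- p"] by (simp add: eq_neg_iff_add_eq_0 add.commute del: free_lift_add)

lemma free_lift_diff [simp]: "free_lift \<sigma> X (p - q) = free_lift \<sigma> X p - free_lift \<sigma> X q"
  using free_lift_add[of X p "- q"] by simp

lemma free_lift_sum: "free_lift \<sigma> X (sum f S) = (\<Sum>i\<in>S. free_lift \<sigma> X (f i))"
  by (induction S rule: infinite_finite_induct) auto

lemma free_lift_mult [simp]: "free_lift \<sigma> X (p * q) = free_lift \<sigma> X p * free_lift \<sigma> X q"
proof (induction p arbitrary: q rule: poly_mapping_additive_induct)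
  case (single u a)
  show ?case
  proof (induction q rule: poly_mapping_additive_induct)
    case (single v b)
    have "\<sigma> a * \<sigma> b * (prod_list (map X (letters u)) * prod_list (map X (letters v))) =
          \<sigma> a * prod_list (map X (letters u)) * (\<sigma> b * prod_list (map X (letters v)))"
      by (metis mult.assoc scalar_central)
    then show ?case
      by (simp add: mult_single free_lift_single scalar_mult plus_free_monoid_def)
  qed (auto simp: distrib_left)
qed (auto simp: distrib_right)

lemma free_lift_const [simp]: "free_lift \<sigma> X (Poly_Mapping.single 0 a) = \<sigma> a"
  by (simp add: free_lift_single zero_free_monoid_def)

lemma free_lift_one [simp]: "free_lift \<sigma> X 1 = 1"
  by (metis free_lift_const scalar_one single_one)

lemma free_lift_letter: "free_lift \<sigma> X (Poly_Mapping.single (Word [l]) a) = \<sigma> a * X l"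
  by (simp add: free_lift_single)

text \<open>
  The universal property of the free algebra; identities between induced maps are proved by
  comparing both sides on letters.
\<close>

lemma free_lift_unique:
  assumes add: "\<And>p q. \<phi> (p + q) = \<phi> p + \<phi> q" and mult: "\<And>p q. \<phi> (p * q) = \<phi> p * \<phi> q"
    and const: "\<And>a. \<phi> (Poly_Mapping.single 0 a) = \<sigma> a"
    and letter: "\<And>l. \<phi> (Poly_Mapping.single (Word [l]) 1) = X l"
  shows "\<phi> p = free_lift \<sigma> X p"
proof (induction p rule: poly_mapping_additive_induct)
  case zero
  show ?case using const[of 0] by (simp add: scalar_zero)
next
  case (single u a)
  have word: "\<phi> (Poly_Mapping.single (Word ls) 1) = prod_list (map X ls)" for ls
  proof (induction ls)
    case Nil
    show ?case using const[of 1] by (simp add: scalar_one zero_free_monoid_def)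
  next
    case (Cons l ls)
    have "Poly_Mapping.single (Word (l # ls)) (1::complex) =
          Poly_Mapping.single (Word [l]) 1 * Poly_Mapping.single (Word ls) 1"
      by (simp add: mult_single plus_free_monoid_def)
    then show ?case by (simp add: mult letter Cons)
  qed
  have "Poly_Mapping.single u a = Poly_Mapping.single 0 a * Poly_Mapping.single (Word (letters u)) 1"
    by (simp add: mult_single)
  then have "\<phi> (Poly_Mapping.single u a) = \<sigma> a * prod_list (map X (letters u))"
    by (simp only: mult const word)
  then show ?case by (simp only: free_lift_single)
qed (simp add: add)

end

interpretation tensor: central_scalars "Poly_Mapping.single 0 :: complex \<Rightarrow> 'a free_monoid \<Rightarrow>\<^sub>0 complex"
proof
  fix a :: complex and r :: "'a free_monoid \<Rightarrow>\<^sub>0 complex"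
  show "Poly_Mapping.single 0 a * r = r * Poly_Mapping.single 0 a"
    by (induction r rule: poly_mapping_additive_induct)
      (auto simp: mult_single distrib_left distrib_right mult.commute)
qed (auto simp: single_add mult_single)

lemma tensor_map_free_lift:
  "tensor_map \<gamma> = free_lift (Poly_Mapping.single 0) (\<lambda>l. tensor_of (\<gamma> (basis_vector l)))"
  by (rule ext) (simp add: tensor_map_def free_lift_def tensor_scale_def)

lemma tensor_map_hom [simp]:
  "tensor_map \<gamma> 0 = 0" "tensor_map \<gamma> 1 = 1"
  "tensor_map \<gamma> (p + q) = tensor_map \<gamma> p + tensor_map \<gamma> q"
  "tensor_map \<gamma> (p - q) = tensor_map \<gamma> p - tensor_map \<gamma> q"
  "tensor_map \<gamma> (- p) = - tensor_map \<gamma> p"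
  "tensor_map \<gamma> (p * q) = tensor_map \<gamma> p * tensor_map \<gamma> q"
  "tensor_map \<gamma> (Poly_Mapping.single 0 a) = Poly_Mapping.single 0 a"
  by (simp_all add: tensor_map_free_lift)

lemma tensor_map_sum: "tensor_map \<gamma> (sum f S) = (\<Sum>i\<in>S. tensor_map \<gamma> (f i))"
  by (simp add: tensor_map_free_lift tensor.free_lift_sum)

lemma tensor_map_letter:
  "tensor_map \<gamma> (Poly_Mapping.single (Word [l]) 1) = tensor_of (\<gamma> (basis_vector l))"
  by (simp add: tensor_map_free_lift tensor.free_lift_letter)

text \<open>
  Pairs have no scalar multiplication by complex numbers, so the complex vector space structure of
  \<open>V\<close> and its linear maps are spelled out.
\<close>

definition dscale :: "complex \<Rightarrow> 'n::finite double \<Rightarrow> 'n double" where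
  "dscale k v = (k *s fst v, k *s snd v)"

definition dlinear :: "('n::finite double \<Rightarrow> 'n double) \<Rightarrow> bool" where
  "dlinear \<gamma> \<longleftrightarrow> (\<forall>v v'. \<gamma> (v + v') = \<gamma> v + \<gamma> v') \<and> (\<forall>k v. \<gamma> (dscale k v) = dscale k (\<gamma> v))"

lemma dlinear_add: "dlinear \<gamma> \<Longrightarrow> \<gamma> (v + v') = \<gamma> v + \<gamma> v'"
  and dlinear_scale: "dlinear \<gamma> \<Longrightarrow> \<gamma> (dscale k v) = dscale k (\<gamma> v)"
  unfolding dlinear_def by blast+

lemma dlinear_zero: "dlinear \<gamma> \<Longrightarrow> \<gamma> 0 = 0"
  using dlinear_add[of \<gamma> 0 0] by simp

lemma tensor_of_add: "tensor_of (v + v') = tensor_of v + tensor_of v'"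
  by (simp add: tensor_of_def single_add sum.distrib)

lemma tensor_of_scale: "tensor_of (dscale k v) = Poly_Mapping.single 0 k * tensor_of v"
  by (simp add: tensor_of_def dscale_def distrib_left sum_distrib_left mult_single)

lemma tensor_of_zero [simp]: "tensor_of 0 = 0"
  by (simp add: tensor_of_def)

lemma tensor_of_sum: "tensor_of (sum f S) = (\<Sum>i\<in>S. tensor_of (f i))"
  by (induction S rule: infinite_finite_induct) (auto simp: tensor_of_add)

lemma dlinear_sum: "dlinear \<gamma> \<Longrightarrow> \<gamma> (sum f S) = (\<Sum>i\<in>S. \<gamma> (f i))"
  by (induction S rule: infinite_finite_induct) (auto simp: dlinear_zero dlinear_add)

definition dcoord :: "'n + 'n \<Rightarrow> 'n::finite double \<Rightarrow> complex" where
  "dcoord l v = (case l of Inl i \<Rightarrow> fst v $ i | Inr i \<Rightarrow> snd v $ i)"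

lemma sum_UNIV_Plus: "(\<Sum>l\<in>(UNIV::('a::finite + 'a) set). f l) = (\<Sum>i\<in>UNIV. f (Inl i)) + (\<Sum>i\<in>UNIV. f (Inr i))"
proof -
  have "(\<Sum>l\<in>(UNIV::('a + 'a) set). f l) = (\<Sum>l\<in>UNIV <+> UNIV. f l)" by simp
  also have "\<dots> = sum (f \<circ> Inl) UNIV + sum (f \<circ> Inr) UNIV"
    by (rule sum.Plus) auto
  finally show ?thesis by (simp add: o_def)
qed

lemma fst_sum': "fst (\<Sum>i\<in>S. f i) = (\<Sum>i\<in>S. fst (f i))"
  by (induction S rule: infinite_finite_induct) auto

lemma snd_sum': "snd (\<Sum>i\<in>S. f i) = (\<Sum>i\<in>S. snd (f i))"
  by (induction S rule: infinite_finite_induct) auto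

lemma double_expansion: "v = (\<Sum>l\<in>UNIV. dscale (dcoord l v) (basis_vector l))"
proof -
  have *: "(\<Sum>i\<in>UNIV. (x $ i) *s axis i 1) = (x :: complex^'n)" for x
    by (simp add: vec_eq_iff axis_def if_distrib cong: if_cong)
  show ?thesis
    by (cases v) (simp add: prod_eq_iff sum_UNIV_Plus dcoord_def dscale_def basis_vector_def fst_sum' snd_sum' *)
qed

lemma tensor_of_basis: "tensor_of (basis_vector l) = Poly_Mapping.single (Word [l]) 1"
proof -
  have eq: "(\<Sum>i\<in>UNIV. Poly_Mapping.single (Word [f i]) (axis j (1::complex) $ i)) =
      Poly_Mapping.single (Word [f j]) 1" for f :: "'n::finite \<Rightarrow> 'n + 'n" and j
  proof -
    have "(\<Sum>i\<in>UNIV. Poly_Mapping.single (Word [f i]) (axis j (1::complex) $ i)) =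
          (\<Sum>i\<in>UNIV. if i = j then Poly_Mapping.single (Word [f i]) 1 else 0)"
      by (rule sum.cong) (auto simp: axis_def)
    then show ?thesis by simp
  qed
  show ?thesis
    by (cases l) (simp_all add: tensor_of_def basis_vector_def eq)
qed

lemma tensor_of_expansion:
  "tensor_of v = (\<Sum>l\<in>UNIV. Poly_Mapping.single 0 (dcoord l v) * Poly_Mapping.single (Word [l]) 1)"
  by (subst double_expansion[of v]) (simp add: tensor_of_sum tensor_of_scale tensor_of_basis)

text \<open>
  By definition a tensor map is known on basis vectors only; linearity gives it on all vectors.
\<close>

lemma tensor_map_tensor_of:
  assumes "dlinear \<gamma>"
  shows "tensor_map \<gamma> (tensor_of v) = tensor_of (\<gamma> v)"
proof -
  have "\<gamma> v = (\<Sum>l\<in>UNIV. dscale (dcoord l v) (\<gamma> (basis_vector l)))"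
    using assms by (subst double_expansion[of v]) (simp add: dlinear_sum dlinear_scale)
  then show ?thesis
    by (simp add: tensor_of_expansion[of v] tensor_map_sum tensor_map_letter tensor_of_sum tensor_of_scale)
qed

lemma tensor_map_comp:
  assumes "dlinear \<gamma>"
  shows "tensor_map \<gamma> (tensor_map \<delta> p) = tensor_map (\<lambda>v. \<gamma> (\<delta> v)) p"
  unfolding tensor_map_free_lift[of "\<lambda>v. \<gamma> (\<delta> v)"]
  by (rule tensor.free_lift_unique) (simp_all add: tensor_map_letter tensor_map_tensor_of assms)

lemma tensor_map_id: "tensor_map (\<lambda>v. v) p = p"
  unfolding tensor_map_free_lift
  by (rule tensor.free_lift_unique[symmetric]) (simp_all add: tensor_of_basis)

section \<open>Crossed products\<close>

text \<open>The element \<open>r g\<close> of a crossed product.\<close>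

definition coefficient_at :: "'g \<Rightarrow> 'r::zero \<Rightarrow> 'g \<Rightarrow> 'r" where
  "coefficient_at g r = (\<lambda>h. if h = g then r else 0)"

locale crossed_action = group G for G :: "('g, 'm) monoid_scheme" (structure) +
  fixes scl :: "complex \<Rightarrow> 'r \<Rightarrow> 'r::ring_1" and act :: "'g \<Rightarrow> 'r \<Rightarrow> 'r"
  assumes finite_group: "finite (carrier G)"
    and act_add: "\<And>g r s. g \<in> carrier G \<Longrightarrow> act g (r + s) = act g r + act g s"
    and act_mult: "\<And>g r s. g \<in> carrier G \<Longrightarrow> act g (r * s) = act g r * act g s"
    and act_unit: "\<And>g. g \<in> carrier G \<Longrightarrow> act g 1 = 1"
    and act_one: "\<And>r. act \<one> r = r"
    and act_act: "\<And>g h r. g \<in> carrier G \<Longrightarrow> h \<in> carrier G \<Longrightarrow> act g (act h r) = act (g \<otimes> h) r"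
begin

abbreviation "CP \<equiv> crossed_product G scl act"

lemma act_zero: "g \<in> carrier G \<Longrightarrow> act g 0 = 0"
  using act_add[of g 0 0] by simp

lemma act_sum: "g \<in> carrier G \<Longrightarrow> act g (sum f S) = (\<Sum>i\<in>S. act g (f i))"
  by (induction S rule: infinite_finite_induct) (auto simp: act_zero act_add)

lemma CP_carrier: "carrier CP = {f. \<forall>g. g \<notin> carrier G \<longrightarrow> f g = 0}"
  and CP_zero: "\<zero>\<^bsub>CP\<^esub> = (\<lambda>g. 0)"
  and CP_one: "\<one>\<^bsub>CP\<^esub> = coefficient_at \<one> 1"
  and CP_add: "f \<oplus>\<^bsub>CP\<^esub> h = (\<lambda>g. f g + h g)"
  and CP_smult: "a \<odot>\<^bsub>CP\<^esub> f = (\<lambda>g. scl a (f g))"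
  by (auto simp: crossed_product_def coefficient_at_def)

text \<open>
  The convolution product as a single sum over the group, the second factor being determined by
  the first one.
\<close>

lemma CP_mult:
  "f \<otimes>\<^bsub>CP\<^esub> h = (\<lambda>k. if k \<in> carrier G then \<Sum>a\<in>carrier G. f a * act a (h (inv a \<otimes> k)) else 0)"
proof
  fix k
  let ?S = "{(a, b). a \<in> carrier G \<and> b \<in> carrier G \<and> a \<otimes> b = k}"
  have *: "(f \<otimes>\<^bsub>CP\<^esub> h) k = (\<Sum>(a, b) \<in> ?S. f a * act a (h b))"
    by (simp add: crossed_product_def)
  show "(f \<otimes>\<^bsub>CP\<^esub> h) k = (if k \<in> carrier G then \<Sum>a\<in>carrier G. f a * act a (h (inv a \<otimes> k)) else 0)"
  proof (cases "k \<in> carrier G")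
    case True
    have "(\<Sum>(a, b) \<in> ?S. f a * act a (h b)) = (\<Sum>a\<in>carrier G. f a * act a (h (inv a \<otimes> k)))"
      by (rule sum.reindex_bij_witness[where i = "\<lambda>a. (a, inv a \<otimes> k)" and j = fst])
        (use True in \<open>auto simp: m_assoc[symmetric]\<close>)
    then show ?thesis using True * by simp
  next
    case False
    then have S: "?S = {}" by auto
    show ?thesis unfolding * S using False by simp
  qed
qed

lemma CP_at_mult:
  assumes "a \<in> carrier G" "b \<in> carrier G"
  shows "coefficient_at a r \<otimes>\<^bsub>CP\<^esub> coefficient_at b s = coefficient_at (a \<otimes> b) (r * act a s)"
proof
  fix k
  show "(coefficient_at a r \<otimes>\<^bsub>CP\<^esub> coefficient_at b s) k = coefficient_at (a \<otimes> b) (r * act a s) k"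
  proof (cases "k \<in> carrier G")
    case True
    have "(\<Sum>x\<in>carrier G. coefficient_at a r x * act x (coefficient_at b s (inv x \<otimes> k)))
       = (\<Sum>x\<in>carrier G. if x = a then r * act a (coefficient_at b s (inv a \<otimes> k)) else 0)"
      by (rule sum.cong) (auto simp: coefficient_at_def)
    also have "\<dots> = r * act a (coefficient_at b s (inv a \<otimes> k))"
      using assms finite_group by simp
    also have "\<dots> = coefficient_at (a \<otimes> b) (r * act a s) k"
    proof -
      have "inv a \<otimes> k = b \<longleftrightarrow> k = a \<otimes> b"
        using assms True inv_solve_left' by auto
      then show ?thesis using assms by (simp add: coefficient_at_def act_zero)
    qed
    finally show ?thesis using True by (simp add: CP_mult)
  next
    case False
    then show ?thesis using assms by (auto simp: CP_mult coefficient_at_def)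
  qed
qed

lemma CP_mult_closed: "f \<otimes>\<^bsub>CP\<^esub> h \<in> carrier CP"
  by (simp add: CP_mult CP_carrier)

lemma CP_assoc: "(f \<otimes>\<^bsub>CP\<^esub> h) \<otimes>\<^bsub>CP\<^esub> l = f \<otimes>\<^bsub>CP\<^esub> (h \<otimes>\<^bsub>CP\<^esub> l)"
proof
  fix k
  show "((f \<otimes>\<^bsub>CP\<^esub> h) \<otimes>\<^bsub>CP\<^esub> l) k = (f \<otimes>\<^bsub>CP\<^esub> (h \<otimes>\<^bsub>CP\<^esub> l)) k"
  proof (cases "k \<in> carrier G")
    case k: True
    let ?C = "carrier G"
    have "((f \<otimes>\<^bsub>CP\<^esub> h) \<otimes>\<^bsub>CP\<^esub> l) k =
        (\<Sum>a\<in>?C. \<Sum>b\<in>?C. f b * act b (h (inv b \<otimes> a)) * act a (l (inv a \<otimes> k)))"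
      using k by (simp add: CP_mult sum_distrib_right)
    also have "\<dots> = (\<Sum>b\<in>?C. \<Sum>a\<in>?C. f b * act b (h (inv b \<otimes> a)) * act a (l (inv a \<otimes> k)))"
      by (rule sum.swap)
    also have "\<dots> = (\<Sum>b\<in>?C. \<Sum>c\<in>?C. f b * act b (h c) * act (b \<otimes> c) (l (inv (b \<otimes> c) \<otimes> k)))"
    proof (rule sum.cong[OF refl])
      fix b assume b: "b \<in> ?C"
      show "(\<Sum>a\<in>?C. f b * act b (h (inv b \<otimes> a)) * act a (l (inv a \<otimes> k))) =
            (\<Sum>c\<in>?C. f b * act b (h c) * act (b \<otimes> c) (l (inv (b \<otimes> c) \<otimes> k)))"
        by (rule sum.reindex_bij_witness[where i = "\<lambda>c. b \<otimes> c" and j = "\<lambda>a. inv b \<otimes> a"])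
          (use b in \<open>auto simp: m_assoc[symmetric]\<close>)
    qed
    also have "\<dots> = (f \<otimes>\<^bsub>CP\<^esub> (h \<otimes>\<^bsub>CP\<^esub> l)) k"
      using k by (auto simp: CP_mult sum_distrib_left act_sum act_mult act_act inv_mult_group m_assoc mult.assoc
          intro!: sum.cong)
    finally show ?thesis .
  next
    case False
    then show ?thesis by (simp add: CP_mult)
  qed
qed

lemma CP_ring: "ring CP"
proof (rule ringI)
  show "abelian_group CP"
  proof (rule abelian_groupI)
    fix f assume "f \<in> carrier CP"
    then show "\<exists>y\<in>carrier CP. y \<oplus>\<^bsub>CP\<^esub> f = \<zero>\<^bsub>CP\<^esub>"
      by (intro bexI[of _ "\<lambda>g. - f g"]) (auto simp: CP_carrier CP_add CP_zero)
  qed (auto simp: CP_carrier CP_add CP_zero add.assoc add.commute)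
  show "Group.monoid CP"
  proof (rule monoidI)
    fix f assume f: "f \<in> carrier CP"
    show "\<one>\<^bsub>CP\<^esub> \<otimes>\<^bsub>CP\<^esub> f = f"
    proof
      fix k
      have "(\<Sum>a\<in>carrier G. coefficient_at \<one> 1 a * act a (f (inv a \<otimes> k)))
          = (\<Sum>a\<in>carrier G. if a = \<one> then f (inv \<one> \<otimes> k) else 0)"
        by (rule sum.cong) (auto simp: coefficient_at_def act_one)
      then show "(\<one>\<^bsub>CP\<^esub> \<otimes>\<^bsub>CP\<^esub> f) k = f k"
        using f finite_group by (auto simp: CP_mult CP_one CP_carrier)
    qed
    show "f \<otimes>\<^bsub>CP\<^esub> \<one>\<^bsub>CP\<^esub> = f"
    proof
      fix k
      show "(f \<otimes>\<^bsub>CP\<^esub> \<one>\<^bsub>CP\<^esub>) k = f k"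
      proof (cases "k \<in> carrier G")
        case True
        have "(\<Sum>a\<in>carrier G. f a * act a (coefficient_at \<one> 1 (inv a \<otimes> k)))
            = (\<Sum>a\<in>carrier G. if a = k then f k else 0)"
          using True by (intro sum.cong) (auto simp: coefficient_at_def act_unit act_zero inv_solve_left')
        then show ?thesis
          using True finite_group by (auto simp: CP_mult CP_one)
      qed (use f in \<open>auto simp: CP_mult CP_carrier\<close>)
    qed
  qed (auto simp: CP_mult_closed CP_assoc, auto simp: CP_one CP_carrier coefficient_at_def)
qed (auto simp: CP_mult CP_add act_add distrib_left distrib_right sum.distrib)

sublocale CP: ring CP
  by (rule CP_ring)

lemma CP_at_carrier: "g \<in> carrier G \<Longrightarrow> coefficient_at g r \<in> carrier CP"
  by (auto simp: CP_carrier coefficient_at_def)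

lemma CP_uminus: "f \<in> carrier CP \<Longrightarrow> \<ominus>\<^bsub>CP\<^esub> f = (\<lambda>g. - f g)"
  by (rule CP.minus_equality) (auto simp: CP_carrier CP_add CP_zero)

lemma CP_minus: "f \<in> carrier CP \<Longrightarrow> h \<in> carrier CP \<Longrightarrow> f \<ominus>\<^bsub>CP\<^esub> h = (\<lambda>g. f g - h g)"
  by (simp add: a_minus_def CP_uminus CP_add)

lemma CP_finsum: "(\<And>i. i \<in> S \<Longrightarrow> f i \<in> carrier CP) \<Longrightarrow> finite S \<Longrightarrow>
   (\<Oplus>\<^bsub>CP\<^esub>i\<in>S. f i) = (\<lambda>g. \<Sum>i\<in>S. f i g)"
proof (induction S rule: infinite_finite_induct)
  case (insert x F)
  then show ?case by (subst CP.finsum_insert) (auto simp: CP_add Pi_def)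
qed (auto simp: CP_zero)

lemma CP_expansion: "f \<in> carrier CP \<Longrightarrow> f = (\<lambda>h. \<Sum>g\<in>carrier G. coefficient_at g (f g) h)"
  using finite_group by (auto simp: coefficient_at_def CP_carrier)

end

section \<open>Operators on polynomial-valued functions\<close>

text \<open>
  Operators on functions from a set of points to one-variable polynomials that are linear over the
  polynomials. The points are pairs of a position and a momentum, and the variable of the
  polynomials records the degree in the momenta. Thus an operator that is polynomial in the
  momenta has, at each point, coefficients whose leading terms can be compared.
\<close>

typedef 'p operator =
  "{f :: ('p \<Rightarrow> complex poly) \<Rightarrow> ('p \<Rightarrow> complex poly).
     (\<forall>a b. f (\<lambda>p. a p + b p) = (\<lambda>p. f a p + f b p)) \<and>
     (\<forall>q a. f (\<lambda>p. q * a p) = (\<lambda>p. q * f a p))}"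
  morphisms app Operator
  by (rule exI[of _ id]) auto

lemma app_add: "app A (\<lambda>p. F p + F' p) = (\<lambda>p. app A F p + app A F' p)"
  and app_scale: "app A (\<lambda>p. q * F p) = (\<lambda>p. q * app A F p)"
  using app[of A] by blast+

lemma operator_eqI: "(\<And>F p. app A F p = app B F p) \<Longrightarrow> A = B"
  using app_inject by blast

instantiation operator :: (type) ring_1
begin

definition "0 = Operator (\<lambda>F p. 0)"
definition "1 = Operator (\<lambda>F. F)"
definition "A + B = Operator (\<lambda>F p. app A F p + app B F p)"
definition "A - B = Operator (\<lambda>F p. app A F p - app B F p)"
definition "- A = Operator (\<lambda>F p. - app A F p)"
definition "A * B = Operator (\<lambda>F. app A (app B F))"

lemma app_zero_operator: "app 0 F p = 0"
  unfolding zero_operator_def by (subst Operator_inverse) auto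

lemma app_one_operator: "app 1 F = F"
  unfolding one_operator_def by (subst Operator_inverse) auto

lemma app_plus_operator: "app (A + B) F p = app A F p + app B F p"
  unfolding plus_operator_def by (subst Operator_inverse) (auto simp: app_add app_scale algebra_simps)

lemma app_minus_operator: "app (A - B) F p = app A F p - app B F p"
  unfolding minus_operator_def by (subst Operator_inverse) (auto simp: app_add app_scale algebra_simps)

lemma app_uminus_operator: "app (- A) F p = - app A F p"
  unfolding uminus_operator_def by (subst Operator_inverse) (auto simp: app_add app_scale algebra_simps)

lemma app_times_operator: "app (A * B) F = app A (app B F)"
  unfolding times_operator_def by (subst Operator_inverse) (auto simp: app_add app_scale algebra_simps)

lemmas app_simps = app_zero_operator app_one_operator app_plus_operator app_minus_operator
  app_uminus_operator app_times_operator

instance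
proof
  fix A B C :: "'a operator"
  have ext: "app A (app (B + C) F) = app A (\<lambda>p. app B F p + app C F p)" for F
    by (rule arg_cong[where f = "app A"]) (rule ext, rule app_plus_operator)
  show "A * (B + C) = A * B + A * C"
    by (rule operator_eqI) (simp add: app_simps ext app_add)
  show "(0::'a operator) \<noteq> 1"
  proof
    assume "(0::'a operator) = 1"
    then have "app (0::'a operator) (\<lambda>_. 1) undefined = app 1 (\<lambda>_. 1) undefined" by simp
    then show False by (simp add: app_simps)
  qed
qed (rule operator_eqI, simp add: app_simps algebra_simps)+

end

lemma app_sum: "app (\<Sum>i\<in>S. A i) F p = (\<Sum>i\<in>S. app (A i) F p)"
  by (induction S rule: infinite_finite_induct) (auto simp: app_simps)

definition mul :: "('p \<Rightarrow> complex poly) \<Rightarrow> 'p operator" where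
  "mul f = Operator (\<lambda>F p. f p * F p)"

definition shift :: "('p \<Rightarrow> 'p) \<Rightarrow> 'p operator" where
  "shift g = Operator (\<lambda>F p. F (g p))"

lemma app_mul: "app (mul f) F p = f p * F p"
  unfolding mul_def by (subst Operator_inverse) (auto simp: algebra_simps)

lemma app_shift: "app (shift g) F p = F (g p)"
  unfolding shift_def by (subst Operator_inverse) auto

lemma mul_mult: "mul f * mul g = mul (\<lambda>p. f p * g p)"
  by (rule operator_eqI) (simp add: app_simps app_mul)

definition scalar_operator :: "complex \<Rightarrow> 'p operator" where
  "scalar_operator a = mul (\<lambda>_. [:a:])"

interpretation operator: central_scalars scalar_operator
proof
  fix a b :: complex and r :: "'p operator"
  show "scalar_operator (a + b) = (scalar_operator a + scalar_operator b :: 'p operator)"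
    by (rule operator_eqI) (simp add: scalar_operator_def app_simps app_mul smult_add_left)
  show "scalar_operator (a * b) = (scalar_operator a * scalar_operator b :: 'p operator)"
    by (rule operator_eqI) (simp add: scalar_operator_def app_simps app_mul mult.commute)
  show "scalar_operator 1 = (1 :: 'p operator)"
    by (rule operator_eqI) (simp add: scalar_operator_def app_simps app_mul)
  have "app r (app (mul (\<lambda>_. [:a:])) F) p = [:a:] * app r F p" for F p
  proof -
    have "app (mul (\<lambda>_. [:a:])) F = (\<lambda>p. [:a:] * F p)" by (rule ext) (simp add: app_mul)
    then show ?thesis by (simp only: app_scale)
  qed
  then show "scalar_operator a * r = r * scalar_operator a"
    by (intro operator_eqI) (simp add: scalar_operator_def app_simps app_mul)
qed

lemma app_scalar: "app (scalar_operator a) F p = Polynomial.smult a (F p)"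
  by (simp add: scalar_operator_def app_mul)

section \<open>Polynomial functions on the double\<close>

text \<open>
  Functions on \<open>V\<close> given by polynomials in the coordinates. Only their zeros matter, so they
  take the place of polynomials in several variables.
\<close>

inductive_set polyfun :: "('n::finite double \<Rightarrow> complex) set" where
  polyfun_const: "(\<lambda>p. a) \<in> polyfun"
| polyfun_coord: "dcoord l \<in> polyfun"
| polyfun_add: "f \<in> polyfun \<Longrightarrow> g \<in> polyfun \<Longrightarrow> (\<lambda>p. f p + g p) \<in> polyfun"
| polyfun_mult: "f \<in> polyfun \<Longrightarrow> g \<in> polyfun \<Longrightarrow> (\<lambda>p. f p * g p) \<in> polyfun"

lemma polyfun_coord': "(\<lambda>p. fst p $ i) \<in> polyfun" "(\<lambda>p. snd p $ i) \<in> polyfun"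
  using polyfun_coord[of "Inl i"] polyfun_coord[of "Inr i"] by (auto simp: dcoord_def[abs_def])

lemma polyfun_uminus: "f \<in> polyfun \<Longrightarrow> (\<lambda>p. - f p) \<in> polyfun"
  using polyfun_mult[OF polyfun_const[of "-1"], of f] by simp

lemma polyfun_diff: "f \<in> polyfun \<Longrightarrow> g \<in> polyfun \<Longrightarrow> (\<lambda>p. f p - g p) \<in> polyfun"
  using polyfun_add[OF _ polyfun_uminus, of f g] by simp

lemma polyfun_sum: "(\<And>i. i \<in> S \<Longrightarrow> f i \<in> polyfun) \<Longrightarrow> (\<lambda>p. \<Sum>i\<in>S. f i p) \<in> polyfun"
  by (induction S rule: infinite_finite_induct) (auto intro: polyfun_const polyfun_add)

lemma polyfun_pairing_fst: "(\<lambda>p. pairing x (fst p)) \<in> polyfun"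
  and polyfun_pairing_snd: "(\<lambda>p. pairing (snd p) y) \<in> polyfun"
  unfolding pairing_def by (auto intro!: polyfun_sum polyfun_mult polyfun_const polyfun_coord')

lemma polyfun_compose_linear:
  assumes f: "f \<in> polyfun" and "dlinear \<gamma>"
  shows "(\<lambda>p. f (\<gamma> p)) \<in> polyfun"
  using f
proof induction
  case (polyfun_coord l)
  have d: "dcoord l (a + b) = dcoord l a + dcoord l b" "dcoord l (dscale k b) = k * dcoord l b"
    "dcoord l 0 = 0" for a b :: "'a double" and k
    by (auto simp: dcoord_def dscale_def split: sum.split)
  have ds: "dcoord l (sum h S) = (\<Sum>i\<in>S. dcoord l (h i))" for h :: "'b \<Rightarrow> 'a double" and S
    by (induction S rule: infinite_finite_induct) (auto simp: d)
  have "dcoord l (\<gamma> p) = (\<Sum>k\<in>UNIV. dcoord k p * dcoord l (\<gamma> (basis_vector k)))" for p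
  proof -
    have "\<gamma> p = \<gamma> (\<Sum>k\<in>UNIV. dscale (dcoord k p) (basis_vector k))"
      by (simp only: double_expansion[of p, symmetric])
    also have "\<dots> = (\<Sum>k\<in>UNIV. dscale (dcoord k p) (\<gamma> (basis_vector k)))"
      by (simp only: dlinear_sum[OF assms(2)] dlinear_scale[OF assms(2)])
    finally have "dcoord l (\<gamma> p) = dcoord l (\<Sum>k\<in>UNIV. dscale (dcoord k p) (\<gamma> (basis_vector k)))"
      by (rule arg_cong)
    then show ?thesis by (simp only: ds d(2))
  qed
  then have "(\<lambda>p. dcoord l (\<gamma> p)) = (\<lambda>p. \<Sum>k\<in>UNIV. dcoord k p * dcoord l (\<gamma> (basis_vector k)))"
    by (rule ext)
  moreover have "(\<lambda>p. \<Sum>k\<in>UNIV. dcoord k p * dcoord l (\<gamma> (basis_vector k))) \<in> polyfun"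
    by (intro polyfun_sum polyfun_mult polyfun.polyfun_coord polyfun_const)
  ultimately show ?case by (rule ssubst[where P = "\<lambda>f. f \<in> polyfun"])
qed (auto intro: polyfun.intros)

text \<open>
  Along a line a polynomial function is a polynomial in one variable, so finitely many nonzero
  polynomial functions have a common point where none of them vanishes.
\<close>

lemma polyfun_line:
  assumes "f \<in> polyfun"
  shows "\<exists>q. \<forall>t. f (u + dscale t v) = poly q t"
  using assms
proof induction
  case (polyfun_const a)
  show ?case by (rule exI[of _ "[:a:]"]) simp
next
  case (polyfun_coord l)
  show ?case
    by (rule exI[of _ "[:dcoord l u, dcoord l v:]"])
      (auto simp: dcoord_def dscale_def mult.commute split: sum.split)
next
  case (polyfun_add f g)
  then obtain q r where "\<forall>t. f (u + dscale t v) = poly q t" "\<forall>t. g (u + dscale t v) = poly r t" by blast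
  then show ?case by (intro exI[of _ "q + r"]) simp
next
  case (polyfun_mult f g)
  then obtain q r where "\<forall>t. f (u + dscale t v) = poly q t" "\<forall>t. g (u + dscale t v) = poly r t" by blast
  then show ?case by (intro exI[of _ "q * r"]) simp
qed

lemma polyfun_mult_nonzero:
  assumes f: "f \<in> polyfun" "f u \<noteq> 0" and g: "g \<in> polyfun" "g v \<noteq> 0"
  shows "\<exists>p. f p \<noteq> 0 \<and> g p \<noteq> 0"
proof -
  obtain q where q: "\<And>t. f (u + dscale t (v - u)) = poly q t" using polyfun_line[OF f(1)] by blast
  obtain r where r: "\<And>t. g (u + dscale t (v - u)) = poly r t" using polyfun_line[OF g(1)] by blast
  have "u + dscale 0 (v - u) = u" "u + dscale 1 (v - u) = v"
    by (auto simp: dscale_def prod_eq_iff)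
  then have "poly q 0 \<noteq> 0" "poly r 1 \<noteq> 0" using q[of 0] f(2) r[of 1] g(2) by auto
  then have "q \<noteq> 0" "r \<noteq> 0" by auto
  then have "finite ({t. poly q t = 0} \<union> {t. poly r t = 0})" by (simp add: poly_roots_finite)
  then obtain t where "t \<notin> {t. poly q t = 0} \<union> {t. poly r t = 0}"
    using ex_new_if_finite infinite_UNIV_char_0 by blast
  then show ?thesis using q r by (metis (mono_tags) Un_iff mem_Collect_eq)
qed

lemma polyfun_common_nonzero:
  assumes "finite P" "P \<subseteq> polyfun" "\<And>f. f \<in> P \<Longrightarrow> \<exists>p. f p \<noteq> 0"
  shows "\<exists>p. \<forall>f\<in>P. f p \<noteq> 0"
proof -
  have "\<exists>g\<in>polyfun. (\<exists>p. g p \<noteq> 0) \<and> (\<forall>p. g p \<noteq> 0 \<longrightarrow> (\<forall>f\<in>P. f p \<noteq> 0))"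
    using assms
  proof (induction P rule: finite_induct)
    case empty
    show ?case by (rule bexI[of _ "\<lambda>p. 1"]) (auto intro: polyfun_const)
  next
    case (insert f P)
    then obtain g u where g: "g \<in> polyfun" "g u \<noteq> 0" "\<And>p. g p \<noteq> 0 \<Longrightarrow> \<forall>f\<in>P. f p \<noteq> 0" by blast
    obtain v where v: "f v \<noteq> 0" "f \<in> polyfun" using insert by blast
    from polyfun_mult_nonzero[OF v(2,1) g(1,2)] show ?case
      using g v by (intro bexI[of _ "\<lambda>p. f p * g p"]) (auto intro: polyfun_mult)
  qed
  then show ?thesis by blast
qed

text \<open>
  Distinct monomials are distinct multiplicative functions of the coordinates, hence linearly
  independent by the argument of Dedekind.
\<close>

lemma multiplicative_independent:
  fixes ch :: "'i \<Rightarrow> 'm \<Rightarrow> complex" and comb :: "'m \<Rightarrow> 'm \<Rightarrow> 'm"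
  assumes mult: "\<And>i a b. ch i (comb a b) = ch i a * ch i b"
    and unit: "\<And>i. ch i u = 1"
    and distinct: "\<And>i j. i \<noteq> j \<Longrightarrow> \<exists>a. ch i a \<noteq> ch j a"
    and "finite S" "\<And>a. (\<Sum>i\<in>S. g i * ch i a) = 0" "i \<in> S"
  shows "g i = 0"
  using assms(4-6)
proof (induction S arbitrary: g i rule: finite_induct)
  case (insert j S)
  have S0: "g k = 0" if "k \<in> S" for k
  proof -
    obtain b where b: "ch k b \<noteq> ch j b" using distinct[of k j] insert(2) \<open>k \<in> S\<close> by blast
    have "(\<Sum>i\<in>S. g i * (ch i b - ch j b) * ch i a) = 0" for a
    proof -
      have "0 = (\<Sum>i\<in>insert j S. g i * ch i (comb b a)) - ch j b * (\<Sum>i\<in>insert j S. g i * ch i a)"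
        by (simp only: insert.prems(1)) simp
      also have "\<dots> = (\<Sum>i\<in>S. g i * ch i (comb b a)) - ch j b * (\<Sum>i\<in>S. g i * ch i a)"
        using insert(1,2) by (simp add: mult distrib_left)
      also have "\<dots> = (\<Sum>i\<in>S. g i * (ch i b - ch j b) * ch i a)"
        unfolding mult sum_distrib_left sum_subtractf[symmetric]
        by (rule sum.cong) (auto simp: algebra_simps)
      finally show ?thesis by simp
    qed
    from insert.IH[OF this that] show ?thesis using b by simp
  qed
  have "g j = 0" using insert.prems(1)[of u] insert(1,2) S0 by (simp add: unit)
  then show ?case using S0 insert.prems(2) by auto
qed simp

lemma power_two_complex_inj: "(2::complex) ^ a = 2 ^ b \<longleftrightarrow> a = b"
proof
  assume "(2::complex) ^ a = 2 ^ b"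
  then have "norm ((2::complex) ^ a) = norm ((2::complex) ^ b)" by simp
  then have "(2::real) ^ a = 2 ^ b" by (simp add: norm_power)
  then show "a = b" using power_inject_exp[of "2::real" a b] by simp
qed simp

lemma monomials_independent:
  fixes g :: "('n::finite + 'n) multiset \<Rightarrow> complex"
  assumes "finite S" "\<And>p. (\<Sum>m\<in>S. g m * (\<Prod>l\<in>#m. dcoord l p)) = 0" "m \<in> S"
  shows "g m = 0"
proof -
  define point :: "('n + 'n \<Rightarrow> complex) \<Rightarrow> 'n double" where
    "point a = ((\<chi> i. a (Inl i)), (\<chi> i. a (Inr i)))" for a
  have point: "dcoord l (point a) = a l" for l a
    by (cases l) (auto simp: dcoord_def point_def)
  define ch where "ch m a = (\<Prod>l\<in>#m. a l :: complex)" for m :: "('n + 'n) multiset" and a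
  show ?thesis
  proof (rule multiplicative_independent[of ch "\<lambda>a b l. a l * b l" "\<lambda>l. 1" S g m])
    fix m m' :: "('n + 'n) multiset" assume "m \<noteq> m'"
    then obtain l where l: "count m l \<noteq> count m' l" by (meson multiset_eqI)
    have "ch m (\<lambda>k. if k = l then 2 else 1) = 2 ^ count m l" for m
      by (induction m) (auto simp: ch_def)
    then show "\<exists>a. ch m a \<noteq> ch m' a" using l
      by (intro exI[of _ "\<lambda>k. if k = l then 2 else 1"]) (simp add: power_two_complex_inj)
  next
    fix a
    show "(\<Sum>m\<in>S. g m * ch m a) = 0"
      using assms(2)[of "point a"] by (simp add: ch_def point)
  qed (use assms in \<open>auto simp: ch_def prod_mset.distrib\<close>)
qed

section \<open>Groups of matrices\<close>

lemma matrix_inv_invertible: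
  assumes "invertible (A :: complex^'n^'n)"
  shows "A ** matrix_inv A = mat 1" "matrix_inv A ** A = mat 1"
proof -
  have "A ** matrix_inv A = mat 1 \<and> matrix_inv A ** A = mat 1"
    using assms unfolding invertible_def matrix_inv_def by (rule someI_ex)
  then show "A ** matrix_inv A = mat 1" "matrix_inv A ** A = mat 1" by blast+
qed

lemma invertible_matrix_inv: "invertible A \<Longrightarrow> invertible (matrix_inv (A :: complex^'n^'n))"
  using matrix_inv_invertible unfolding invertible_def[of "matrix_inv A"] by blast

lemma invertible_one: "invertible (mat 1 :: complex^'n^'n)"
  unfolding invertible_def by (rule exI[of _ "mat 1"]) simp

lemma group_GL: "group (GL :: (complex^'n^'n) monoid)"
proof (rule groupI)
  fix A :: "complex^'n^'n" assume "A \<in> carrier GL"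
  then show "\<exists>B\<in>carrier GL. B \<otimes>\<^bsub>GL\<^esub> A = \<one>\<^bsub>GL\<^esub>"
    by (intro bexI[of _ "matrix_inv A"])
      (auto simp: GL_def matrix_inv_invertible invertible_matrix_inv)
qed (auto simp: GL_def invertible_mult matrix_mul_assoc invertible_one)

lemma inv_GL: "invertible (A :: complex^'n^'n) \<Longrightarrow> inv\<^bsub>GL\<^esub> A = matrix_inv A"
  by (rule group.inv_equality[OF group_GL])
    (auto simp: GL_def matrix_inv_invertible invertible_matrix_inv)

lemma matrix_mult_diff: "A ** (B - C) = A ** B - A ** (C :: complex^'n^'n)"
  "(B' - C') ** A = B' ** A - C' ** (A :: complex^'n^'n)"
  by (simp_all add: vec_eq_iff matrix_matrix_mult_def algebra_simps sum_subtractf)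

lemma rank_mult_left_le: "rank (B ** A) \<le> rank (A :: complex^'n^'m)"
proof -
  have "rows (B ** A) \<subseteq> vec.span (rows A)"
  proof
    fix r assume "r \<in> rows (B ** A)"
    then obtain i where r: "r = row i (B ** A)" by (auto simp: rows_def)
    have "r = (\<Sum>j\<in>UNIV. B $ i $ j *s row j A)"
      unfolding r by (simp add: vec_eq_iff row_def matrix_matrix_mult_def)
    also have "\<dots> \<in> vec.span (rows A)"
      by (intro vec.span_sum vec.span_scale vec.span_base) (auto simp: rows_def)
    finally show "r \<in> vec.span (rows A)" .
  qed
  then show ?thesis unfolding row_rank_def_gen by (rule vec.dim_mono)
qed

lemma rank_mult_right_le: "rank (A ** B) \<le> rank (A :: complex^'n^'m)"
proof -
  have lin: "Vector_Spaces.linear (*s) (*s) (\<lambda>x. x v* B)"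
    unfolding transpose_matrix_vector[symmetric] by (rule matrix_vector_mul_linear_gen)
  have "rows (A ** B) = (\<lambda>x. x v* B) ` rows A"
    by (auto simp: rows_def row_def vec_eq_iff matrix_matrix_mult_def vector_matrix_mult_def image_def mult.commute)
  then show ?thesis unfolding row_rank_def_gen
    using vec.dim_image_le[OF lin] by simp
qed

text \<open>Rank is invariant under conjugation, so conjugates of reflections are reflections.\<close>

lemma rank_conj:
  assumes "invertible (w :: complex^'n^'n)"
  shows "rank (w ** A ** matrix_inv w) = rank A"
proof (rule antisym)
  have le: "rank (X ** Y ** Z) \<le> rank Y" for X Y Z :: "complex^'n^'n"
    by (rule le_trans[OF rank_mult_right_le rank_mult_left_le])
  show "rank (w ** A ** matrix_inv w) \<le> rank A" by (rule le)
  have "matrix_inv w ** (w ** A ** matrix_inv w) ** w = (matrix_inv w ** w) ** A ** (matrix_inv w ** w)"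
    by (simp only: matrix_mul_assoc)
  also have "\<dots> = A" by (simp add: matrix_inv_invertible[OF assms])
  finally have eq: "matrix_inv w ** (w ** A ** matrix_inv w) ** w = A" .
  show "rank A \<le> rank (w ** A ** matrix_inv w)"
    using le[of "matrix_inv w" "w ** A ** matrix_inv w" w] unfolding eq .
qed

lemma pairing_mult: "pairing (x v* A) y = pairing x (A *v y)"
proof -
  have "pairing (x v* A) y = (\<Sum>j\<in>UNIV. \<Sum>i\<in>UNIV. x $ i * (A $ i $ j * y $ j))"
    unfolding pairing_def vector_matrix_mult_def
    by (auto simp: sum_distrib_right intro!: sum.cong)
  also have "\<dots> = (\<Sum>i\<in>UNIV. \<Sum>j\<in>UNIV. x $ i * (A $ i $ j * y $ j))" by (rule sum.swap)
  also have "\<dots> = pairing x (A *v y)"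
    unfolding pairing_def matrix_vector_mult_def by (simp add: sum_distrib_left)
  finally show ?thesis .
qed

lemma pairing_add: "pairing (x + x') y = pairing x y + pairing x' y"
  "pairing x (y + y') = pairing x y + pairing x y'"
  by (simp_all add: pairing_def algebra_simps sum.distrib)

lemma pairing_scale: "pairing (k *s x) y = k * pairing x y" "pairing x (k *s y) = k * pairing x y"
  by (simp_all add: pairing_def algebra_simps sum_distrib_left)

lemma pairing_minus: "pairing (x - x') y = pairing x y - pairing x' y"
  "pairing x (y - y') = pairing x y - pairing x y'"
  by (simp_all add: pairing_def algebra_simps sum_subtractf)

lemma pairing_zero [simp]: "pairing 0 y = 0" "pairing x 0 = 0"
  by (simp_all add: pairing_def)

lemma pairing_axis [simp]: "pairing (axis i 1) y = y $ i" "pairing x (axis i 1) = x $ i"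
  by (simp_all add: pairing_def axis_def if_distrib if_distribR cong: if_cong)

text \<open>A linear form that vanishes on the kernel of another one is a multiple of it.\<close>

lemma pairing_proportional:
  assumes "\<And>y. pairing b y = 0 \<Longrightarrow> pairing a y = 0"
  shows "pairing a y * pairing b v = pairing a v * pairing b y"
proof -
  have "pairing b (pairing b v *s y - pairing b y *s v) = 0"
    by (simp add: pairing_minus pairing_scale)
  from assms[OF this] show ?thesis by (simp add: pairing_minus pairing_scale mult.commute)
qed

lemma double_act_linear: "dlinear (double_act w)"
  by (auto simp: dlinear_def double_act_def dscale_def matrix_vector_right_distrib
      vector_matrix_left_distrib vector_scalar_commute scalar_vector_matrix_assoc)

lemma double_act_id [simp]:
  fixes p :: "'n::finite double"
  shows "double_act (mat 1) p = p"
proof -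
  have "matrix_inv (mat 1) = (mat 1 :: complex^'n^'n)"
    using matrix_inv_invertible(1)[of "mat 1 :: complex^'n^'n"] by (simp add: invertible_one)
  then show ?thesis by (simp add: double_act_def)
qed

locale finite_matrix_group =
  fixes W :: "(complex^'n^'n) set"
  assumes finite_W: "finite W" and subgroup_W: "subgroup W GL"
begin

lemma W_invertible: "w \<in> W \<Longrightarrow> invertible w"
  using subgroup.mem_carrier[OF subgroup_W] by (auto simp: GL_def)

lemma W_one [simp]: "mat 1 \<in> W"
  using subgroup.one_closed[OF subgroup_W] by (simp add: GL_def)

lemma W_mult [simp]: "a \<in> W \<Longrightarrow> b \<in> W \<Longrightarrow> a ** b \<in> W"
  using subgroup.m_closed[OF subgroup_W] by (simp add: GL_def)

lemma W_inv [simp]: "w \<in> W \<Longrightarrow> matrix_inv w \<in> W"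
  using subgroup.m_inv_closed[OF subgroup_W] by (simp add: inv_GL W_invertible)

lemma W_inverses [simp]: "w \<in> W \<Longrightarrow> w ** matrix_inv w = mat 1" "w \<in> W \<Longrightarrow> matrix_inv w ** w = mat 1"
  by (simp_all add: matrix_inv_invertible W_invertible)

lemma W_cancel [simp]:
  "w \<in> W \<Longrightarrow> w ** (matrix_inv w ** a) = a" "w \<in> W \<Longrightarrow> matrix_inv w ** (w ** a) = a"
  "w \<in> W \<Longrightarrow> a ** w ** matrix_inv w = a" "w \<in> W \<Longrightarrow> a ** matrix_inv w ** w = a"
proof -
  assume w: "w \<in> W"
  show "w ** (matrix_inv w ** a) = a" "matrix_inv w ** (w ** a) = a"
    by (simp_all only: matrix_mul_assoc W_inverses[OF w] matrix_mul_lid)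
  show "a ** w ** matrix_inv w = a" "a ** matrix_inv w ** w = a"
    by (simp_all only: matrix_mul_assoc[symmetric] W_inverses[OF w] matrix_mul_rid)
qed

lemma W_inv_inv [simp]: "w \<in> W \<Longrightarrow> matrix_inv (matrix_inv w) = w"
  by (metis W_cancel(1) W_inv W_inverses(1) matrix_mul_rid)

lemma W_inv_unique: "a \<in> W \<Longrightarrow> a ** b = mat 1 \<Longrightarrow> b = matrix_inv a"
  by (metis W_cancel(2) matrix_mul_rid)

lemma W_inv_mult: "a \<in> W \<Longrightarrow> b \<in> W \<Longrightarrow> matrix_inv (a ** b) = matrix_inv b ** matrix_inv a"
  by (rule W_inv_unique[symmetric]) (simp_all add: matrix_mul_assoc)

lemma matrix_group_simps [simp]:
  "carrier (matrix_group W) = W" "\<one>\<^bsub>matrix_group W\<^esub> = mat 1" "a \<otimes>\<^bsub>matrix_group W\<^esub> b = a ** b"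
  by (simp_all add: matrix_group_def GL_def)

lemma group_W: "group (matrix_group W)"
  unfolding matrix_group_def by (rule subgroup.subgroup_is_group[OF subgroup_W group_GL])

lemma inv_W: "w \<in> W \<Longrightarrow> inv\<^bsub>matrix_group W\<^esub> w = matrix_inv w"
  by (rule group.inv_equality[OF group_W]) auto

lemma double_act_mult: "a \<in> W \<Longrightarrow> b \<in> W \<Longrightarrow> double_act (a ** b) p = double_act a (double_act b p)"
  by (simp add: double_act_def matrix_vector_mul_assoc vector_matrix_mul_assoc W_inv_mult)

lemma double_act_cancel [simp]:
  "w \<in> W \<Longrightarrow> double_act w (double_act (matrix_inv w) p) = p"
  "w \<in> W \<Longrightarrow> double_act (matrix_inv w) (double_act w p) = p"
  by (simp_all flip: double_act_mult)

lemma pairing_double_act: "w \<in> W \<Longrightarrow> pairing (snd (double_act w p)) (w *v y) = pairing (snd p) y"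
  by (simp add: double_act_def pairing_mult matrix_vector_mul_assoc)

lemma tensor_map_act_mult:
  assumes "a \<in> W" "b \<in> W"
  shows "tensor_map (double_act a) (tensor_map (double_act b) r) = tensor_map (double_act (a ** b)) r"
proof -
  have "(\<lambda>v. double_act a (double_act b v)) = double_act (a ** b)"
    using assms by (auto simp: double_act_mult)
  then show ?thesis by (simp add: tensor_map_comp double_act_linear)
qed

lemma tensor_map_act_one:
  fixes r :: "'n tensor_alg"
  shows "tensor_map (double_act (mat 1)) r = r"
proof -
  have "double_act (mat 1) = (\<lambda>p :: 'n double. p)" by auto
  then show ?thesis by (simp add: tensor_map_id)
qed

lemma crossed_smash: "crossed_action (matrix_group W) (\<lambda>w. tensor_map (double_act w))"
proof -
  interpret group "matrix_group W" by (rule group_W)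
  show ?thesis
    by unfold_locales
      (auto simp: finite_W tensor_map_act_mult tensor_map_act_one)
qed

sublocale smash: crossed_action "matrix_group W" tensor_scale "\<lambda>w. tensor_map (double_act w)"
  rewrites "crossed_product (matrix_group W) tensor_scale (\<lambda>w. tensor_map (double_act w)) = smash_algebra W"
  by (rule crossed_smash) (simp add: smash_algebra_def)

end

section \<open>Reflections\<close>

locale reflection_data = finite_matrix_group W
  for W :: "(complex^'n^'n) set" +
  fixes \<alpha> \<alpha>v :: "complex^'n^'n \<Rightarrow> complex^'n" and c :: "complex^'n^'n \<Rightarrow> complex"
  assumes root_data: "root_data W \<alpha> \<alpha>v"
    and conjugation_invariant: "conjugation_invariant W c"
begin

abbreviation "S \<equiv> reflections W"

lemma finite_S [simp]: "finite S"
  using finite_W by (simp add: reflections_def)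

lemma S_iff: "s \<in> S \<longleftrightarrow> s \<in> W \<and> complex_reflection s"
  by (simp add: reflections_def)

lemma S_in_W [simp]: "s \<in> S \<Longrightarrow> s \<in> W"
  by (simp only: S_iff)

lemma root_kernel: "s \<in> S \<Longrightarrow> pairing (\<alpha> s) y = 0 \<longleftrightarrow> s *v y = y"
  using root_data unfolding root_data_def by blast

lemma coroot_nonzero: "s \<in> S \<Longrightarrow> \<alpha>v s \<noteq> 0"
  using root_data unfolding root_data_def by blast

definition eigen :: "complex^'n^'n \<Rightarrow> complex" where
  "eigen s = (SOME \<zeta>. \<zeta> \<noteq> 1 \<and> s *v \<alpha>v s = \<zeta> *s \<alpha>v s)"

lemma eigen: "s \<in> S \<Longrightarrow> eigen s \<noteq> 1" "s \<in> S \<Longrightarrow> s *v \<alpha>v s = eigen s *s \<alpha>v s"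
proof -
  assume "s \<in> S"
  then have "\<exists>\<zeta>. \<zeta> \<noteq> 1 \<and> s *v \<alpha>v s = \<zeta> *s \<alpha>v s" using root_data unfolding root_data_def by blast
  from someI_ex[OF this] show "eigen s \<noteq> 1" "s *v \<alpha>v s = eigen s *s \<alpha>v s"
    unfolding eigen_def by blast+
qed

lemma eigen_nonzero: "s \<in> S \<Longrightarrow> eigen s \<noteq> 0"
proof
  assume s: "s \<in> S" and "eigen s = 0"
  then have "s *v \<alpha>v s = 0" using eigen(2)[of s] by simp
  then have "matrix_inv s *v (s *v \<alpha>v s) = 0" by simp
  then show False using s coroot_nonzero[OF s] by (simp add: matrix_vector_mul_assoc)
qed

lemma root_coroot_nonzero: "s \<in> S \<Longrightarrow> pairing (\<alpha> s) (\<alpha>v s) \<noteq> 0"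
proof
  assume s: "s \<in> S" and "pairing (\<alpha> s) (\<alpha>v s) = 0"
  then have "eigen s *s \<alpha>v s = \<alpha>v s" using root_kernel[OF s] eigen(2)[OF s] by simp
  then have "(eigen s - 1) *s \<alpha>v s = 0" by (simp only: vec.scale_left_diff_distrib vec.scale_one diff_self)
  then have "eigen s - 1 = 0 \<or> \<alpha>v s = 0" by (simp only: vec.scale_eq_0_iff)
  then show False using coroot_nonzero[OF s] eigen(1)[OF s] by simp
qed

text \<open>
  A reflection fixes the kernel of its root pointwise and scales its coroot, and these two span
  the space.
\<close>

lemma reflection_formula:
  assumes s: "s \<in> S"
  shows "s *v v = v + ((eigen s - 1) * pairing (\<alpha> s) v / pairing (\<alpha> s) (\<alpha>v s)) *s \<alpha>v s"
proof -
  define a where "a = pairing (\<alpha> s) v / pairing (\<alpha> s) (\<alpha>v s)"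
  have "pairing (\<alpha> s) (v - a *s \<alpha>v s) = 0"
    using root_coroot_nonzero[OF s] by (simp add: pairing_minus pairing_scale a_def)
  then have "s *v (v - a *s \<alpha>v s) = v - a *s \<alpha>v s" using root_kernel[OF s] by simp
  then have "s *v v = v - a *s \<alpha>v s + a *s (eigen s *s \<alpha>v s)"
    by (simp add: matrix_vector_mult_diff_distrib vector_scalar_commute eigen(2)[OF s] algebra_simps)
  then have "s *v v = v + ((eigen s - 1) * a) *s \<alpha>v s" by (simp add: vec_eq_iff algebra_simps)
  then show ?thesis by (simp add: a_def)
qed

lemma inverse_reflection_formula:
  assumes s: "s \<in> S"
  shows "matrix_inv s *v v =
    v + ((inverse (eigen s) - 1) * pairing (\<alpha> s) v / pairing (\<alpha> s) (\<alpha>v s)) *s \<alpha>v s"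
proof -
  define a where "a = pairing (\<alpha> s) v / pairing (\<alpha> s) (\<alpha>v s)"
  let ?u = "v + ((inverse (eigen s) - 1) * a) *s \<alpha>v s"
  have "s *v ?u = s *v v + ((inverse (eigen s) - 1) * a) *s (s *v \<alpha>v s)"
    by (simp add: matrix_vector_right_distrib vector_scalar_commute)
  also have "\<dots> = v + ((eigen s - 1) * a) *s \<alpha>v s + ((inverse (eigen s) - 1) * a) *s (eigen s *s \<alpha>v s)"
    using reflection_formula[OF s, of v] eigen(2)[OF s] by (simp add: a_def)
  also have "\<dots> = v + ((eigen s - 1) * a + (inverse (eigen s) - 1) * a * eigen s) *s \<alpha>v s"
    by (simp only: vec.scale_left_distrib vec.scale_scale add.assoc)
  also have "(eigen s - 1) * a + (inverse (eigen s) - 1) * a * eigen s = 0"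
    using eigen_nonzero[OF s] by (simp add: field_simps)
  also have "v + 0 *s \<alpha>v s = v" by simp
  finally have "matrix_inv s *v v = matrix_inv s *v (s *v ?u)" by (rule arg_cong[OF sym])
  also have "\<dots> = (matrix_inv s ** s) *v ?u" by (rule matrix_vector_mul_assoc)
  also have "\<dots> = ?u" using s by (simp only: W_inverses S_in_W matrix_vector_mul_lid)
  finally show ?thesis by (simp add: a_def)
qed

lemma S_conj:
  assumes s: "s \<in> S" and w: "w \<in> W"
  shows "w ** s ** matrix_inv w \<in> S"
proof -
  interpret GL: group "GL :: (complex^'n^'n) monoid" by (rule group_GL)
  let ?t = "w ** s ** matrix_inv w"
  from s have cs: "complex_reflection s" by (simp only: S_iff)
  then obtain k where k: "k > 0" "s [^]\<^bsub>GL\<^esub> (k::nat) = \<one>\<^bsub>GL\<^esub>" by (auto simp: complex_reflection_def)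
  have GLW: "x \<in> carrier GL" if "x \<in> W" for x using W_invertible[OF that] by (simp add: GL_def)
  have pow: "?t [^]\<^bsub>GL\<^esub> j = w ** (s [^]\<^bsub>GL\<^esub> j) ** matrix_inv w" for j :: nat
  proof (induction j)
    case 0
    show ?case using w by (simp add: GL_def)
  next
    case (Suc j)
    have "?t [^]\<^bsub>GL\<^esub> Suc j = ?t [^]\<^bsub>GL\<^esub> j ** ?t" by (simp add: GL_def)
    also have "\<dots> = w ** (s [^]\<^bsub>GL\<^esub> j) ** (matrix_inv w ** w) ** s ** matrix_inv w"
      by (simp only: Suc matrix_mul_assoc)
    also have "\<dots> = w ** (s [^]\<^bsub>GL\<^esub> j ** s) ** matrix_inv w" using w by (simp add: matrix_mul_assoc)
    finally show ?case by (simp add: GL_def)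
  qed
  have "?t [^]\<^bsub>GL\<^esub> k = \<one>\<^bsub>GL\<^esub>" unfolding pow k(2) using w by (simp add: GL_def)
  moreover have "?t - mat 1 = w ** (s - mat 1) ** matrix_inv w"
    using w by (simp add: matrix_mult_diff)
  then have "rank (?t - mat 1) = 1"
    using cs rank_conj[OF W_invertible[OF w]] by (simp add: complex_reflection_def)
  ultimately have "complex_reflection ?t"
    using k(1) GLW[of ?t] s w unfolding complex_reflection_def by auto
  moreover have "?t \<in> W" using s w by simp
  ultimately show ?thesis by (simp only: S_iff)
qed

lemma c_conj: "s \<in> S \<Longrightarrow> w \<in> W \<Longrightarrow> c (w ** s ** matrix_inv w) = c s"
proof -
  assume s: "s \<in> S" and w: "w \<in> W"
  then have "c (w \<otimes>\<^bsub>GL\<^esub> s \<otimes>\<^bsub>GL\<^esub> inv\<^bsub>GL\<^esub> w) = c s"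
    using conjugation_invariant unfolding conjugation_invariant_def by blast
  then show ?thesis unfolding inv_GL[OF W_invertible[OF w]] by (simp add: GL_def)
qed

text \<open>
  The hyperplane of a conjugate of \<open>s\<close> is the image of the hyperplane of
  \<open>s\<close>. Roots are only defined up to a scalar, so the statement is cross-multiplied.
\<close>

lemma root_conj:
  assumes s: "s \<in> S" and w: "w \<in> W"
  shows "pairing (\<alpha> (w ** s ** matrix_inv w)) (w *v y) * pairing (\<alpha> s) v =
         pairing (\<alpha> (w ** s ** matrix_inv w)) (w *v v) * pairing (\<alpha> s) y"
proof -
  let ?t = "w ** s ** matrix_inv w"
  have "pairing (\<alpha> ?t v* w) y = 0" if "pairing (\<alpha> s) y = 0" for y
  proof -
    have "?t *v (w *v y) = w *v (s *v y)"
      using w by (simp add: matrix_vector_mul_assoc)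
    also have "\<dots> = w *v y" using that root_kernel[OF s] by simp
    finally show ?thesis using root_kernel[OF S_conj[OF s w]] by (simp add: pairing_mult)
  qed
  from pairing_proportional[OF this] show ?thesis by (simp add: pairing_mult)
qed

text \<open>
  The eigenvalue \<open>\<noteq> 1\<close> does not depend on the chosen coroot: it is a
  conjugation invariant of \<open>s\<close>.
\<close>

lemma eigen_conj:
  assumes s: "s \<in> S" and w: "w \<in> W"
  shows "eigen (w ** s ** matrix_inv w) = eigen s"
proof -
  let ?t = "w ** s ** matrix_inv w"
  have t: "?t \<in> S" by (rule S_conj[OF s w])
  define u where "u = w *v \<alpha>v s"
  have "u \<noteq> 0"
  proof
    assume "u = 0"
    then have "matrix_inv w *v (w *v \<alpha>v s) = 0" by (simp add: u_def)
    then show False using w coroot_nonzero[OF s] by (simp add: matrix_vector_mul_assoc)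
  qed
  have "?t *v u = w *v (s *v \<alpha>v s)" using w by (simp add: u_def matrix_vector_mul_assoc)
  also have "\<dots> = eigen s *s u" using eigen(2)[OF s] by (simp add: u_def vector_scalar_commute)
  finally have tu: "?t *v u = eigen s *s u" .
  define m where "m = ((eigen ?t - 1) * pairing (\<alpha> ?t) u / pairing (\<alpha> ?t) (\<alpha>v ?t)) / (eigen s - 1)"
  have "(eigen s - 1) *s u = ((eigen ?t - 1) * pairing (\<alpha> ?t) u / pairing (\<alpha> ?t) (\<alpha>v ?t)) *s \<alpha>v ?t"
    using reflection_formula[OF t, of u] tu by (simp add: vec.scale_left_diff_distrib)
  then have "inverse (eigen s - 1) *s ((eigen s - 1) *s u) = m *s \<alpha>v ?t"
    unfolding m_def by (simp only: vec.scale_scale divide_inverse mult_ac)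
  then have "u = m *s \<alpha>v ?t"
    using eigen(1)[OF s] by (simp only: vec.scale_scale left_inverse right_minus_eq vec.scale_one not_False_eq_True)
  then have "?t *v u = eigen ?t *s u"
    using eigen(2)[OF t] by (simp add: vector_scalar_commute mult.commute)
  with tu have "(eigen s - eigen ?t) *s u = 0" by (simp only: vec.scale_left_diff_distrib diff_self)
  then have "eigen s - eigen ?t = 0 \<or> u = 0" by (simp only: vec.scale_eq_0_iff)
  then show ?thesis using \<open>u \<noteq> 0\<close> by simp
qed

text \<open>A reflection and its inverse have the same hyperplane.\<close>

lemma S_inverse:
  assumes s: "s \<in> S" and s': "matrix_inv s \<in> S"
  shows "pairing (\<alpha> (matrix_inv s)) y * pairing (\<alpha> s) v =
         pairing (\<alpha> (matrix_inv s)) v * pairing (\<alpha> s) y"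
proof (rule pairing_proportional)
  fix y assume "pairing (\<alpha> s) y = 0"
  then have "s *v y = y" using root_kernel[OF s] by simp
  then have "matrix_inv s *v y = matrix_inv s *v (s *v y)" by simp
  then have "matrix_inv s *v y = y" using s by (simp add: matrix_vector_mul_assoc)
  then show "pairing (\<alpha> (matrix_inv s)) y = 0" using root_kernel[OF s'] by simp
qed

end

section \<open>Dunkl operators\<close>

lemma smult_sum_right: "Polynomial.smult a (sum f I) = (\<Sum>i\<in>I. Polynomial.smult a (f i))"
  by (induction I rule: infinite_finite_induct) (auto simp: smult_add_right)

text \<open>
  A set \<open>G\<close> of generic points: stable under \<open>W\<close>, with free action on the
  positions, and dense for the purpose of polynomial identities. On it the group elements are
  linearly independent over functions. Positions with a vanishing coordinate are excluded to make
  the coordinates invertible.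
\<close>

locale dunkl = reflection_data W \<alpha> \<alpha>v c
  for W :: "(complex^'n^'n) set" and \<alpha> \<alpha>v c +
  fixes G :: "'n double set"
  assumes G_stable: "p \<in> G \<Longrightarrow> w \<in> W \<Longrightarrow> double_act w p \<in> G"
    and G_free: "p \<in> G \<Longrightarrow> w \<in> W \<Longrightarrow> w *v fst p = fst p \<Longrightarrow> w = mat 1"
    and G_coord: "p \<in> G \<Longrightarrow> fst p $ i \<noteq> 0"
    and G_dense: "f \<in> polyfun \<Longrightarrow> (\<And>p. p \<in> G \<Longrightarrow> f p = 0) \<Longrightarrow> f q = 0"
begin

text \<open>The action of \<open>w\<close> on functions is composition with this map.\<close>

abbreviation bk :: "complex^'n^'n \<Rightarrow> 'n double \<Rightarrow> 'n double" where
  "bk w \<equiv> double_act (matrix_inv w)"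

lemma back_G [simp]: "p \<in> G \<Longrightarrow> w \<in> W \<Longrightarrow> bk w p \<in> G"
  by (simp add: G_stable)

lemma back_inj: "p \<in> G \<Longrightarrow> v \<in> W \<Longrightarrow> w \<in> W \<Longrightarrow> bk v p = bk w p \<longleftrightarrow> v = w"
proof
  assume p: "p \<in> G" and vw: "v \<in> W" "w \<in> W" and eq: "bk v p = bk w p"
  have "double_act (w ** matrix_inv v) p = p" using vw eq by (simp add: double_act_mult)
  then have "(w ** matrix_inv v) *v fst p = fst p" by (metis double_act_def fst_conv)
  then have "w ** matrix_inv v = mat 1" using G_free[OF p] vw by simp
  then show "v = w" using vw by (metis W_cancel(4) matrix_mul_lid)
qed simp

lemma back_mult: "v \<in> W \<Longrightarrow> w \<in> W \<Longrightarrow> bk (v ** w) p = bk w (bk v p)"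
  by (simp add: W_inv_mult double_act_mult)

lemma bk_one [simp]: "bk (mat 1) p = p"
proof -
  have "matrix_inv (mat 1) = (mat 1 :: complex^'n^'n)"
    using W_inv_unique[OF W_one, of "mat 1"] by simp
  then show ?thesis by simp
qed

lemma S_not_one: "mat 1 \<notin> S"
proof
  assume s: "mat 1 \<in> S"
  have "pairing (\<alpha> (mat 1)) (\<alpha>v (mat 1)) = 0" using root_kernel[OF s] by simp
  then show False using root_coroot_nonzero[OF s] by simp
qed

lemma root_nonzero: "p \<in> G \<Longrightarrow> s \<in> S \<Longrightarrow> pairing (\<alpha> s) (fst p) \<noteq> 0"
  using root_kernel G_free S_not_one by (metis S_in_W)

text \<open>
  The idempotent that restricts functions to \<open>G\<close> is built in, so that \<open>U (mat
  1)\<close> is the restriction, not the identity.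
\<close>

definition U :: "complex^'n^'n \<Rightarrow> 'n double operator" where
  "U w = mul (\<lambda>p. if p \<in> G then 1 else 0) * shift (bk w)"

lemma app_U: "app (U w) F p = (if p \<in> G then F (bk w p) else 0)"
  by (simp add: U_def app_simps app_mul app_shift)

lemma U_mult: "a \<in> W \<Longrightarrow> b \<in> W \<Longrightarrow> U a * U b = U (a ** b)"
  by (rule operator_eqI) (simp add: app_simps app_U back_mult)

text \<open>
  The denominator cancels the eigenvalue factor in the difference of a coordinate and its
  translate under \<open>s\<close>; what remains is the coefficient in the defining relations.
\<close>

definition kap :: "complex^'n^'n \<Rightarrow> complex" where
  "kap s = - 2 * c s / (inverse (eigen s) - 1)"

definition Xop :: "complex^'n \<Rightarrow> 'n double operator" where
  "Xop x = mul (\<lambda>p. [:pairing x (fst p):])"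

definition rootfun :: "complex^'n^'n \<Rightarrow> complex^'n \<Rightarrow> 'n double \<Rightarrow> complex" where
  "rootfun s y p = kap s * pairing (\<alpha> s) y / pairing (\<alpha> s) (fst p)"

text \<open>
  The Dunkl operator at \<open>t = 0\<close>: the derivative along \<open>y\<close> degenerates to
  multiplication by the momentum coordinate \<open>y\<close>.
\<close>

definition Dop :: "complex^'n \<Rightarrow> 'n double operator" where
  "Dop y = mul (\<lambda>p. [:0, pairing (snd p) y:]) + (\<Sum>s\<in>S. mul (\<lambda>p. [:rootfun s y p:]) * U s)"

definition Vop :: "'n double \<Rightarrow> 'n double operator" where
  "Vop v = Xop (snd v) + Dop (fst v)"

lemma app_X: "app (Xop x) F p = [:pairing x (fst p):] * F p"
  by (simp add: Xop_def app_mul)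

lemma app_D: "app (Dop y) F p = [:0, pairing (snd p) y:] * F p +
    (\<Sum>s\<in>S. [:rootfun s y p:] * (if p \<in> G then F (bk s p) else 0))"
  by (simp add: Dop_def app_simps app_mul app_sum app_U)

lemma X_add: "Xop (x + x') = Xop x + Xop x'"
  by (rule operator_eqI) (simp add: app_simps app_X pairing_add smult_add_left)

lemma X_scale: "Xop (k *s x) = scalar_operator k * Xop x"
  by (rule operator_eqI) (simp add: app_simps app_X app_scalar pairing_scale)

lemma D_add: "Dop (y + y') = Dop y + Dop y'"
  by (rule operator_eqI)
    (simp add: app_simps app_D pairing_add rootfun_def distrib_left add_divide_distrib
      smult_add_left sum.distrib algebra_simps)

lemma D_scale: "Dop (k *s y) = scalar_operator k * Dop y"
proof (rule operator_eqI)
  fix F p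
  have "rootfun s (k *s y) p = k * rootfun s y p" for s by (simp add: rootfun_def pairing_scale)
  then show "app (Dop (k *s y)) F p = app (scalar_operator k * Dop y) F p"
    by (simp add: app_simps app_D app_scalar pairing_scale smult_add_right smult_sum_right)
qed

lemma V_add: "Vop (v + v') = Vop v + Vop v'"
  by (simp add: Vop_def X_add D_add)

lemma V_scale: "Vop (dscale k v) = scalar_operator k * Vop v"
  by (simp add: Vop_def X_scale D_scale dscale_def distrib_left)

lemma U_X: "w \<in> W \<Longrightarrow> U w * Xop x = Xop (x v* matrix_inv w) * U w"
  by (rule operator_eqI) (simp add: app_simps app_U app_X pairing_mult double_act_def)

lemma bij_conj: "w \<in> W \<Longrightarrow> bij_betw (\<lambda>s. w ** s ** matrix_inv w) S S"
proof (rule bij_betw_byWitness[where f' = "\<lambda>t. matrix_inv w ** t ** w"])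
  assume w: "w \<in> W"
  show "\<forall>s\<in>S. matrix_inv w ** (w ** s ** matrix_inv w) ** w = s"
    using w by (metis W_cancel(2,4) matrix_mul_assoc)
  show "\<forall>t\<in>S. w ** (matrix_inv w ** t ** w) ** matrix_inv w = t"
    using w by (metis W_cancel(1,3) matrix_mul_assoc)
  show "(\<lambda>s. w ** s ** matrix_inv w) ` S \<subseteq> S" using w S_conj by blast
  show "(\<lambda>t. matrix_inv w ** t ** w) ` S \<subseteq> S"
    using w S_conj[of _ "matrix_inv w"] by auto
qed

text \<open>
  The quotient does not change when the root is rescaled, so the choice of roots is harmless.
\<close>

lemma rootfun_conj:
  assumes s: "s \<in> S" and w: "w \<in> W" and p: "p \<in> G"
  shows "rootfun (w ** s ** matrix_inv w) (w *v y) p = rootfun s y (bk w p)"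
proof -
  let ?t = "w ** s ** matrix_inv w"
  have v: "w *v fst (bk w p) = fst p" using w by (simp add: double_act_def matrix_vector_mul_assoc)
  have nz: "pairing (\<alpha> s) (fst (bk w p)) \<noteq> 0" "pairing (\<alpha> ?t) (fst p) \<noteq> 0"
    using root_nonzero s w p S_conj by auto
  have "pairing (\<alpha> ?t) (w *v y) / pairing (\<alpha> ?t) (fst p) = pairing (\<alpha> s) y / pairing (\<alpha> s) (fst (bk w p))"
    using root_conj[OF s w, of y "fst (bk w p)"] nz unfolding v by (simp add: field_simps)
  moreover have "kap ?t = kap s" by (simp add: kap_def eigen_conj[OF s w] c_conj[OF s w])
  ultimately show ?thesis unfolding rootfun_def times_divide_eq_right[symmetric] by simp
qed

lemma U_D: assumes w: "w \<in> W" shows "U w * Dop y = Dop (w *v y) * U w"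
proof (rule operator_eqI)
  fix F p
  show "app (U w * Dop y) F p = app (Dop (w *v y) * U w) F p"
  proof (cases "p \<in> G")
    case p: True
    have "pairing (snd (bk w p)) y = pairing (snd p) (w *v y)"
      using pairing_double_act[of "matrix_inv w" p "w *v y"] w by (simp add: matrix_vector_mul_assoc)
    moreover have "(\<Sum>s\<in>S. [:rootfun s y (bk w p):] * F (bk s (bk w p))) =
        (\<Sum>t\<in>S. [:rootfun t (w *v y) p:] * F (bk w (bk t p)))"
    proof (rule sum.reindex_bij_betw[OF bij_conj[OF w], THEN subst])
      show "(\<Sum>s\<in>S. [:rootfun s y (bk w p):] * F (bk s (bk w p))) =
         (\<Sum>s\<in>S. [:rootfun (w ** s ** matrix_inv w) (w *v y) p:] * F (bk w (bk (w ** s ** matrix_inv w) p)))"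
        using w p by (intro sum.cong) (auto simp: rootfun_conj back_mult[symmetric])
    qed
    ultimately show ?thesis using p w by (simp add: app_simps app_U app_D)
  qed (simp add: app_simps app_U app_D)
qed

lemma U_V: "w \<in> W \<Longrightarrow> U w * Vop v = Vop (double_act w v) * U w"
  by (simp add: Vop_def distrib_left distrib_right U_X U_D double_act_def)

lemma comm_X_X: "Xop x * Xop x' = Xop x' * Xop x"
  by (rule operator_eqI) (simp add: app_simps app_X mult.commute)

definition comm_coeff :: "complex^'n \<Rightarrow> complex^'n \<Rightarrow> complex^'n^'n \<Rightarrow> complex" where
  "comm_coeff y x s = 2 * c s / pairing (\<alpha> s) (\<alpha>v s) * pairing x (\<alpha>v s) * pairing (\<alpha> s) y"

text \<open>
  Only the reflection part contributes: \<open>x - s x\<close> is a multiple of the root, which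
  cancels the denominator.
\<close>

lemma comm_D_X: "Dop y * Xop x - Xop x * Dop y = - (\<Sum>s\<in>S. scalar_operator (comm_coeff y x s) * U s)"
proof (rule operator_eqI)
  fix F p
  show "app (Dop y * Xop x - Xop x * Dop y) F p =
        app (- (\<Sum>s\<in>S. scalar_operator (comm_coeff y x s) * U s)) F p"
  proof (cases "p \<in> G")
    case p: True
    have coef: "rootfun s y p * pairing x (fst (bk s p)) - pairing x (fst p) * rootfun s y p =
        - comm_coeff y x s" if s: "s \<in> S" for s
    proof -
      define e where "e = inverse (eigen s) - 1"
      have "e \<noteq> 0" using eigen(1)[OF s] by (simp add: e_def inverse_eq_1_iff)
      have "pairing x (fst (bk s p)) - pairing x (fst p) =
          e * pairing (\<alpha> s) (fst p) / pairing (\<alpha> s) (\<alpha>v s) * pairing x (\<alpha>v s)"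
        using inverse_reflection_formula[OF s, of "fst p"]
        by (simp add: double_act_def pairing_add pairing_scale flip: e_def)
      then have "rootfun s y p * pairing x (fst (bk s p)) - pairing x (fst p) * rootfun s y p =
          rootfun s y p * (e * pairing (\<alpha> s) (fst p) / pairing (\<alpha> s) (\<alpha>v s) * pairing x (\<alpha>v s))"
        by (metis mult.commute right_diff_distrib)
      also have "\<dots> = - comm_coeff y x s"
        using root_nonzero[OF p s] \<open>e \<noteq> 0\<close> root_coroot_nonzero[OF s]
        by (simp add: rootfun_def comm_coeff_def kap_def flip: e_def)
      finally show ?thesis .
    qed
    have "app (Dop y * Xop x - Xop x * Dop y) F p =
        (\<Sum>s\<in>S. [:rootfun s y p * pairing x (fst (bk s p)) - pairing x (fst p) * rootfun s y p:] * F (bk s p))"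
      using p by (simp add: app_simps app_X app_D smult_add_right smult_sum_right sum_subtractf
          smult_diff_left mult.commute)
    also have "\<dots> = (\<Sum>s\<in>S. - ([:comm_coeff y x s:] * F (bk s p)))"
      by (rule sum.cong) (auto simp: coef)
    finally show ?thesis
      using p by (simp add: app_simps app_sum app_U app_scalar sum_negf)
  qed (simp add: app_simps app_X app_D app_sum app_U app_scalar mult.commute)
qed

subsection \<open>Coefficients of an operator\<close>

text \<open>
  The matrix entry of an operator between the point \<open>p\<close> and its translate: the
  coefficient of \<open>w\<close> at \<open>p\<close>, as \<open>W\<close> acts freely on
  \<open>G\<close>.
\<close>

definition coef :: "'n double operator \<Rightarrow> complex^'n^'n \<Rightarrow> 'n double \<Rightarrow> complex poly" where
  "coef A w p = app A (\<lambda>q. if q = bk w p then 1 else 0) p"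

lemma coef_zero [simp]: "coef 0 w p = 0"
  and coef_add: "coef (A + B) w p = coef A w p + coef B w p"
  and coef_diff: "coef (A - B) w p = coef A w p - coef B w p"
  and coef_uminus: "coef (- A) w p = - coef A w p"
  and coef_sum: "coef (\<Sum>i\<in>I. C i) w p = (\<Sum>i\<in>I. coef (C i) w p)"
  and coef_mul_left: "coef (mul f * A) w p = f p * coef A w p"
  and coef_scalar: "coef (scalar_operator a * A) w p = Polynomial.smult a (coef A w p)"
  by (simp_all add: coef_def app_simps app_sum app_mul app_scalar)

lemma coef_mul_right: "coef (A * mul f) w p = f (bk w p) * coef A w p"
proof -
  have "app (mul f) (\<lambda>q. if q = bk w p then 1 else 0) = (\<lambda>q. f (bk w p) * (if q = bk w p then 1 else 0))"
    by (rule ext) (simp add: app_mul)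
  then show ?thesis by (simp add: coef_def app_simps app_scale)
qed

lemma coef_U_left:
  assumes "p \<in> G" "v \<in> W" "w \<in> W"
  shows "coef (U v * A) w p = coef A (matrix_inv v ** w) (bk v p)"
  using assms by (simp add: coef_def app_simps app_U back_mult)

lemma coef_U_right:
  assumes "p \<in> G" "v \<in> W" "w \<in> W"
  shows "coef (A * U v) w p = coef A (w ** matrix_inv v) p"
proof -
  have "app (U v) (\<lambda>q. if q = bk w p then 1 else 0) = (\<lambda>q. if q = bk (w ** matrix_inv v) p then 1 else 0)"
  proof
    fix q
    have "bk v q = bk w p \<longleftrightarrow> q = double_act v (bk w p)"
      using assms by (metis double_act_cancel)
    then show "app (U v) (\<lambda>q. if q = bk w p then 1 else 0) q = (if q = bk (w ** matrix_inv v) p then 1 else 0)"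
      using assms by (auto simp: app_U back_mult G_stable)
  qed
  then show ?thesis by (simp add: coef_def app_simps)
qed

lemma coef_U: "p \<in> G \<Longrightarrow> v \<in> W \<Longrightarrow> w \<in> W \<Longrightarrow> coef (U v) w p = (if w = v then 1 else 0)"
  by (auto simp: coef_def app_U back_inj)

lemma coef_X_left: "coef (Xop x * A) w p = [:pairing x (fst p):] * coef A w p"
  by (simp add: Xop_def coef_mul_left)

lemma coef_X_right: "coef (A * Xop x) w p = [:pairing x (fst (bk w p)):] * coef A w p"
  by (simp add: Xop_def coef_mul_right)

lemma coef_D_left:
  assumes "p \<in> G" "w \<in> W"
  shows "coef (Dop y * A) w p = [:0, pairing (snd p) y:] * coef A w p +
    (\<Sum>s\<in>S. [:rootfun s y p:] * coef A (matrix_inv s ** w) (bk s p))"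
  using assms by (simp add: Dop_def distrib_right coef_add sum_distrib_right coef_sum mult.assoc
      coef_mul_left coef_U_left)

lemma coef_one: "p \<in> G \<Longrightarrow> w \<in> W \<Longrightarrow> coef 1 w p = (if w = mat 1 then 1 else 0)"
  using back_inj[of p "mat 1" w] by (auto simp: coef_def app_simps)

text \<open>
  The operators that are sums of multiplication operators times elements of the group: the
  localized crossed product.
\<close>

definition Lop :: "'n double operator \<Rightarrow> bool" where
  "Lop A \<longleftrightarrow> (\<exists>g. \<forall>F p. app A F p = (if p \<in> G then \<Sum>w\<in>W. g w p * F (bk w p) else 0))"

lemma Lop_coef:
  assumes "Lop A"
  shows "app A F p = (if p \<in> G then \<Sum>w\<in>W. coef A w p * F (bk w p) else 0)"
proof -
  obtain g where g: "\<And>F p. app A F p = (if p \<in> G then \<Sum>w\<in>W. g w p * F (bk w p) else 0)"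
    using assms unfolding Lop_def by blast
  have "coef A w p = g w p" if p: "p \<in> G" and w: "w \<in> W" for w
  proof -
    have "coef A w p = (\<Sum>v\<in>W. g v p * (if bk v p = bk w p then 1 else 0))"
      using p by (simp add: coef_def g)
    also have "\<dots> = (\<Sum>v\<in>W. if v = w then g w p else 0)"
      using p w by (intro sum.cong) (auto simp: back_inj)
    finally show ?thesis using w finite_W by simp
  qed
  then show ?thesis by (simp add: g)
qed

lemma Lop_eqI:
  assumes "Lop A" "Lop B" "\<And>w p. w \<in> W \<Longrightarrow> p \<in> G \<Longrightarrow> coef A w p = coef B w p"
  shows "A = B"
  by (rule operator_eqI) (simp add: Lop_coef[OF assms(1)] Lop_coef[OF assms(2)] assms(3))

lemma LopI: "(\<And>F p. app A F p = (if p \<in> G then \<Sum>w\<in>W. g w p * F (bk w p) else 0)) \<Longrightarrow> Lop A"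
  unfolding Lop_def by blast

lemma Lop_zero: "Lop 0"
  by (rule LopI[of _ "\<lambda>w p. 0"]) (simp add: app_simps)

lemma Lop_add: "Lop A \<Longrightarrow> Lop B \<Longrightarrow> Lop (A + B)"
  by (rule LopI[of _ "\<lambda>w p. coef A w p + coef B w p"])
    (simp add: app_simps Lop_coef[of A] Lop_coef[of B] distrib_right sum.distrib)

lemma Lop_uminus: "Lop A \<Longrightarrow> Lop (- A)"
  by (rule LopI[of _ "\<lambda>w p. - coef A w p"]) (simp add: app_simps Lop_coef[of A] sum_negf)

lemma Lop_diff: "Lop A \<Longrightarrow> Lop B \<Longrightarrow> Lop (A - B)"
  using Lop_add[OF _ Lop_uminus] by fastforce

lemma Lop_sum: "(\<And>i. i \<in> I \<Longrightarrow> Lop (A i)) \<Longrightarrow> Lop (\<Sum>i\<in>I. A i)"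
  by (induction I rule: infinite_finite_induct) (auto intro: Lop_zero Lop_add)

lemma Lop_mul_left: "Lop A \<Longrightarrow> Lop (mul f * A)"
  by (rule LopI[of _ "\<lambda>w p. f p * coef A w p"])
    (simp add: app_simps app_mul Lop_coef[of A] sum_distrib_left mult.assoc)

lemma Lop_mul_right: "Lop A \<Longrightarrow> Lop (A * mul f)"
  by (rule LopI[of _ "\<lambda>w p. coef A w p * f (bk w p)"])
    (simp add: app_simps app_mul Lop_coef[of A] mult.assoc)

lemma Lop_U: "w \<in> W \<Longrightarrow> Lop (U w)"
proof (rule LopI)
  fix F :: "'n double \<Rightarrow> complex poly" and p assume w: "w \<in> W"
  have "(\<Sum>v\<in>W. (if v = w then 1 else 0) * F (bk v p)) = (\<Sum>v\<in>W. if v = w then F (bk w p) else 0)"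
    by (rule sum.cong) auto
  then show "app (U w) F p = (if p \<in> G then \<Sum>v\<in>W. (if v = w then 1 else 0) * F (bk v p) else 0)"
    using w finite_W by (simp add: app_U)
qed

lemma Lop_mult:
  assumes A: "Lop A" and B: "Lop B"
  shows "Lop (A * B)"
proof (rule LopI)
  fix F p
  show "app (A * B) F p = (if p \<in> G then \<Sum>u\<in>W.
      (\<Sum>w\<in>W. coef A w p * coef B (matrix_inv w ** u) (bk w p)) * F (bk u p) else 0)"
  proof (cases "p \<in> G")
    case p: True
    have "app (A * B) F p = (\<Sum>w\<in>W. \<Sum>v\<in>W. coef A w p * coef B v (bk w p) * F (bk v (bk w p)))"
      using p by (simp add: app_simps Lop_coef[OF A] Lop_coef[OF B] sum_distrib_left mult.assoc)
    also have "\<dots> = (\<Sum>w\<in>W. \<Sum>u\<in>W. coef A w p * coef B (matrix_inv w ** u) (bk w p) * F (bk u p))"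
    proof (rule sum.cong[OF refl])
      fix w assume w: "w \<in> W"
      show "(\<Sum>v\<in>W. coef A w p * coef B v (bk w p) * F (bk v (bk w p))) =
         (\<Sum>u\<in>W. coef A w p * coef B (matrix_inv w ** u) (bk w p) * F (bk u p))"
        by (rule sum.reindex_bij_witness[where i = "\<lambda>u. matrix_inv w ** u" and j = "\<lambda>v. w ** v"])
          (use w in \<open>auto simp: back_mult\<close>)
    qed
    also have "\<dots> = (\<Sum>u\<in>W. \<Sum>w\<in>W. coef A w p * coef B (matrix_inv w ** u) (bk w p) * F (bk u p))"
      by (rule sum.swap)
    finally show ?thesis using p by (simp add: sum_distrib_right)
  qed (simp add: app_simps Lop_coef[OF A])
qed

lemma Lop_X_left: "Lop A \<Longrightarrow> Lop (Xop x * A)"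
  by (simp add: Xop_def Lop_mul_left)

lemma Lop_scalar_left: "Lop A \<Longrightarrow> Lop (scalar_operator a * A)"
  by (simp add: scalar_operator_def Lop_mul_left)

lemma Lop_root_part: "Lop (\<Sum>s\<in>S. mul (\<lambda>p. [:rootfun s y p:]) * U s)"
  by (intro Lop_sum Lop_mul_left Lop_U) simp

lemma Lop_D_left: "Lop A \<Longrightarrow> Lop (Dop y * A)"
  unfolding Dop_def distrib_right by (intro Lop_add Lop_mul_left Lop_mult[OF Lop_root_part])

lemma Lop_V_left: "Lop A \<Longrightarrow> Lop (Vop v * A)"
  unfolding Vop_def distrib_right by (intro Lop_add Lop_X_left Lop_D_left)

subsection \<open>The Dunkl operators commute\<close>

text \<open>
  The product of the two momenta is not supported on \<open>G\<close>, hence not of the form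
  considered here; it cancels in the commutator.
\<close>

lemma Lop_comm_D_D: "Lop (Dop y * Dop y' - Dop y' * Dop y)"
proof -
  define T :: "complex^'n \<Rightarrow> 'n double operator"
    where "T y = mul (\<lambda>p. [:0, pairing (snd p) y:])" for y
  define R where "R y = (\<Sum>s\<in>S. mul (\<lambda>p. [:rootfun s y p:]) * U s)" for y
  have D: "Dop y = T y + R y" for y by (simp add: Dop_def T_def R_def)
  have TT: "T y * T y' = T y' * T y" by (simp add: T_def mul_mult mult.commute)
  have R: "Lop (R y)" for y unfolding R_def by (rule Lop_root_part)
  have "Dop y * Dop y' - Dop y' * Dop y = T y * R y' + R y * T y' + R y * R y' - (T y' * R y + R y' * T y + R y' * R y)"
    unfolding D using TT by (simp add: algebra_simps)
  moreover have "Lop (T y * R y' + R y * T y' + R y * R y' - (T y' * R y + R y' * T y + R y' * R y))"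
    unfolding T_def by (intro Lop_add Lop_diff Lop_mult Lop_mul_left Lop_mul_right R)
  ultimately show ?thesis by simp
qed

lemma comm_D_U: "s \<in> S \<Longrightarrow> Dop y * U s - U s * Dop y =
   - scalar_operator ((eigen s - 1) / pairing (\<alpha> s) (\<alpha>v s) * pairing (\<alpha> s) y) * Dop (\<alpha>v s) * U s"
proof -
  assume s: "s \<in> S"
  have "Dop (s *v y) = Dop y + scalar_operator ((eigen s - 1) / pairing (\<alpha> s) (\<alpha>v s) * pairing (\<alpha> s) y) * Dop (\<alpha>v s)"
    by (subst reflection_formula[OF s]) (simp add: D_add D_scale)
  then show ?thesis using U_D[of s y] s by (simp add: algebra_simps)
qed

text \<open>
  By the Jacobi identity and the commutators of \<open>D\<close> with \<open>x\<close> and with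
  reflections, the commutator \<open>\<Delta>\<close> of two Dunkl operators commutes with all
  coordinates. As these separate the points of an orbit, only the coefficient of the identity of
  \<open>\<Delta>\<close> can be nonzero. This coefficient vanishes by symmetry, since a
  reflection and its inverse have proportional roots.
\<close>

lemma comm_D_D: "Dop y * Dop y' = Dop y' * Dop y"
proof -
  define \<Delta> where "\<Delta> = Dop y * Dop y' - Dop y' * Dop y"
  have comm: "\<Delta> * Xop x = Xop x * \<Delta>" for x
  proof -
    define K where "K y = (\<Sum>s\<in>S. scalar_operator (comm_coeff y x s) * U s)" for y
    have DX: "Dop y * Xop x - Xop x * Dop y = - K y" for y unfolding K_def by (rule comm_D_X)
    have DK: "Dop y' * K y - K y * Dop y' = (\<Sum>s\<in>S. - scalar_operator (2 * c s / pairing (\<alpha> s) (\<alpha>v s)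
        * pairing x (\<alpha>v s) * (eigen s - 1) / pairing (\<alpha> s) (\<alpha>v s) * (pairing (\<alpha> s) y * pairing (\<alpha> s) y'))
        * Dop (\<alpha>v s) * U s)" for y y'
    proof -
      have scalar_left: "A * scalar_operator a * B = scalar_operator a * A * B" for A B :: "'n double operator" and a
        by (simp only: operator.scalar_central)
      have "Dop y' * K y - K y * Dop y' = (\<Sum>s\<in>S. scalar_operator (comm_coeff y x s) * (Dop y' * U s - U s * Dop y'))"
        unfolding K_def sum_distrib_left sum_distrib_right sum_subtractf[symmetric]
        by (rule sum.cong) (auto simp: right_diff_distrib mult.assoc[symmetric] scalar_left)
      also have "\<dots> = (\<Sum>s\<in>S. - scalar_operator (comm_coeff y x s * ((eigen s - 1) / pairing (\<alpha> s) (\<alpha>v s) * pairing (\<alpha> s) y'))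
          * Dop (\<alpha>v s) * U s)"
        by (rule sum.cong)
          (simp_all only: comm_D_U operator.scalar_mult mult_minus_left mult_minus_right mult.assoc)
      finally show ?thesis by (simp add: comm_coeff_def mult_ac)
    qed
    have sym: "Dop y' * K y - K y * Dop y' = Dop y * K y' - K y' * Dop y"
      unfolding DK by (simp add: mult.commute)
    have "\<Delta> * Xop x - Xop x * \<Delta> =
       Dop y * (Dop y' * Xop x - Xop x * Dop y') - (Dop y' * Xop x - Xop x * Dop y') * Dop y
       - (Dop y' * (Dop y * Xop x - Xop x * Dop y) - (Dop y * Xop x - Xop x * Dop y) * Dop y')"
      unfolding \<Delta>_def by (simp add: algebra_simps)
    also have "\<dots> = 0" unfolding DX using sym by (simp add: algebra_simps)
    finally show ?thesis by simp
  qed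
  have coef_D: "coef (Dop y) w p = (if w = mat 1 then [:0, pairing (snd p) y:] else 0) +
      (\<Sum>s\<in>S. if w = s then [:rootfun s y p:] else 0)" if "p \<in> G" "w \<in> W" for y w p
    using that coef_D_left[of p w y 1] coef_mul_left[of _ 1]
    by (simp add: Dop_def coef_add coef_sum coef_mul_left coef_U coef_one coef_mul_left[of _ 1, simplified]
        if_distrib cong: if_cong)
  have one: "coef \<Delta> (mat 1) p = 0" if p: "p \<in> G" for p
  proof -
    have D1: "coef (Dop y) (mat 1) p = [:0, pairing (snd p) y:]" for y
    proof -
      have "(\<Sum>s\<in>S. if mat 1 = s then [:rootfun s y p:] else 0) = 0"
        by (rule sum.neutral) (use S_not_one in auto)
      then show ?thesis using coef_D[OF p W_one] by simp
    qed
    have Dinv: "coef (Dop y) (matrix_inv s) (bk s p) = (if matrix_inv s \<in> S then [:rootfun (matrix_inv s) y (bk s p):] else 0)"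
      if s: "s \<in> S" for s y
    proof -
      have "matrix_inv s \<noteq> mat 1"
        using s S_not_one by (metis S_in_W W_inverses(1) matrix_mul_rid)
      then show ?thesis using coef_D[of "bk s p" "matrix_inv s" y] s p by simp
    qed
    have sym: "rootfun s y p * rootfun (matrix_inv s) y' q = rootfun s y' p * rootfun (matrix_inv s) y q"
      if "s \<in> S" "matrix_inv s \<in> S" for s q
      using S_inverse[OF that, of y y'] by (simp add: rootfun_def divide_simps mult_ac)
    show ?thesis
      unfolding \<Delta>_def using p
      by (auto simp: coef_diff coef_D_left D1 Dinv mult.commute sym intro!: sum.cong)
  qed
  have "coef \<Delta> w p = 0" if w: "w \<in> W" and p: "p \<in> G" for w p
  proof (cases "w = mat 1")
    case False
    have "fst (bk w p) \<noteq> fst p"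
    proof
      assume "fst (bk w p) = fst p"
      then have "matrix_inv w = mat 1" using G_free[OF p] w by (simp add: double_act_def)
      then show False using False w by (metis W_inverses(1) matrix_mul_rid)
    qed
    then obtain i where i: "fst (bk w p) $ i \<noteq> fst p $ i" by (auto simp: vec_eq_iff)
    have "coef (\<Delta> * Xop (axis i 1)) w p = coef (Xop (axis i 1) * \<Delta>) w p" by (simp only: comm)
    then have "Polynomial.smult (fst (bk w p) $ i - fst p $ i) (coef \<Delta> w p) = 0"
      by (simp add: coef_X_left coef_X_right smult_diff_left)
    then show ?thesis using i by simp
  qed (use one p in simp)
  then have "\<Delta> = 0"
    by (intro Lop_eqI Lop_zero) (auto simp: \<Delta>_def Lop_comm_D_D)
  then show ?thesis by (simp add: \<Delta>_def)
qed

end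

context finite_matrix_group
begin

abbreviation "A \<equiv> smash_algebra W"
abbreviation "elt \<equiv> coefficient_at"

lemma smash_carrier: "carrier A = {f. \<forall>g. g \<notin> W \<longrightarrow> f g = 0}"
  and smash_zero: "\<zero>\<^bsub>A\<^esub> = (\<lambda>g. 0)"
  and smash_one: "\<one>\<^bsub>A\<^esub> = elt (mat 1) 1"
  and smash_add: "f \<oplus>\<^bsub>A\<^esub> h = (\<lambda>g. f g + h g)"
  and smash_smult: "z \<odot>\<^bsub>A\<^esub> f = (\<lambda>g. Poly_Mapping.single 0 z * f g)"
  and smash_mult: "f \<otimes>\<^bsub>A\<^esub> h =
     (\<lambda>k. if k \<in> W then \<Sum>a\<in>W. f a * tensor_map (double_act a) (h (matrix_inv a ** k)) else 0)"
  and smash_uminus: "f \<in> carrier A \<Longrightarrow> \<ominus>\<^bsub>A\<^esub> f = (\<lambda>g. - f g)"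
  and smash_minus: "f \<in> carrier A \<Longrightarrow> h \<in> carrier A \<Longrightarrow> f \<ominus>\<^bsub>A\<^esub> h = (\<lambda>g. f g - h g)"
  and smash_finsum: "(\<And>i. i \<in> S \<Longrightarrow> F i \<in> carrier A) \<Longrightarrow> finite S \<Longrightarrow>
     (\<Oplus>\<^bsub>A\<^esub>i\<in>S. F i) = (\<lambda>g. \<Sum>i\<in>S. F i g)"
  and smash_at_mult: "a \<in> W \<Longrightarrow> b \<in> W \<Longrightarrow>
     elt a r \<otimes>\<^bsub>A\<^esub> elt b s = elt (a ** b) (r * tensor_map (double_act a) s)"
  and smash_at_carrier: "w \<in> W \<Longrightarrow> elt w r \<in> carrier A"
proof -
  show "(\<And>i. i \<in> S \<Longrightarrow> F i \<in> carrier A) \<Longrightarrow> finite S \<Longrightarrow> (\<Oplus>\<^bsub>A\<^esub>i\<in>S. F i) = (\<lambda>g. \<Sum>i\<in>S. F i g)"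
    by (rule smash.CP_finsum)
qed (use smash.CP_carrier smash.CP_zero smash.CP_one smash.CP_add smash.CP_smult smash.CP_mult
    smash.CP_uminus smash.CP_minus smash.CP_at_mult smash.CP_at_carrier
  in \<open>simp_all add: tensor_scale_def inv_W cong: sum.cong if_cong\<close>)

lemma smash_ring: "ring A"
  using smash.CP_ring by simp

lemma smash_expansion: "f \<in> carrier A \<Longrightarrow> f = (\<lambda>h. \<Sum>w\<in>W. elt w (f w) h)"
  using smash.CP_expansion[of f] by simp

lemma elt_zero [simp]: "elt w 0 = (\<lambda>g. 0)"
  by (simp add: coefficient_at_def)

lemma elt_add: "elt w (r + s :: 'n tensor_alg) = (\<lambda>g. elt w r g + elt w s g)"
  by (rule ext) (simp add: coefficient_at_def)

lemma elt_diff: "elt w (r - s :: 'n tensor_alg) = (\<lambda>g. elt w r g - elt w s g)"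
  by (rule ext) (simp add: coefficient_at_def)

lemma elt_sum: "elt w (sum r I :: 'n tensor_alg) = (\<lambda>g. \<Sum>i\<in>I. elt w (r i) g)"
  by (rule ext) (simp add: coefficient_at_def)

lemma smash_vector_at: "smash_vector v = elt (mat 1) (tensor_of v)"
  by (simp add: smash_vector_def coefficient_at_def)

lemma smash_group_at: "smash_group w = elt w 1"
  by (simp add: smash_group_def coefficient_at_def)

end

context dunkl
begin

section \<open>The Dunkl representation\<close>

definition T :: "'n tensor_alg \<Rightarrow> 'n double operator" where
  "T p = free_lift scalar_operator (\<lambda>l. Vop (basis_vector l)) p"

lemma T_hom [simp]:
  "T 0 = 0" "T 1 = 1" "T (p + q) = T p + T q" "T (p - q) = T p - T q" "T (- p) = - T p" "T (p * q) = T p * T q"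
  "T (Poly_Mapping.single 0 a) = scalar_operator a"
  by (simp_all add: T_def)

lemma T_sum: "T (sum f I) = (\<Sum>i\<in>I. T (f i))"
  by (simp add: T_def operator.free_lift_sum)

lemma V_zero: "Vop 0 = 0"
  using V_add[of 0 0] by simp

lemma V_sum: "Vop (sum f I) = (\<Sum>i\<in>I. Vop (f i))"
  by (induction I rule: infinite_finite_induct) (auto simp: V_add V_zero)

lemma T_letter: "T (Poly_Mapping.single (Word [l]) 1) = Vop (basis_vector l)"
  by (simp add: T_def operator.free_lift_letter operator.scalar_one)

lemma T_vector: "T (tensor_of v) = Vop v"
proof -
  have "Vop v = (\<Sum>l\<in>UNIV. scalar_operator (dcoord l v) * Vop (basis_vector l))"
    by (subst double_expansion[of v]) (simp add: V_sum V_scale)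
  then show ?thesis by (simp add: tensor_of_expansion[of v] T_sum T_letter)
qed

lemma single_Cons: "Poly_Mapping.single (Word (l # ls)) (a::complex) =
   Poly_Mapping.single (Word [l]) 1 * Poly_Mapping.single (Word ls) a"
  by (simp add: mult_single plus_free_monoid_def)

lemma single_append: "Poly_Mapping.single (Word (ls @ ms)) (a::complex) =
   Poly_Mapping.single (Word ls) 1 * Poly_Mapping.single (Word ms) a"
  by (simp add: mult_single plus_free_monoid_def)

lemma single_Nil: "Poly_Mapping.single (Word []) (a::complex) = Poly_Mapping.single 0 a"
  by (simp add: zero_free_monoid_def)

lemma tensor_alg_induct [case_names const letter add]:
  assumes "\<And>a. P (Poly_Mapping.single 0 a)"
    and "\<And>l p. P p \<Longrightarrow> P (Poly_Mapping.single (Word [l]) 1 * p)"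
    and "\<And>p q. P p \<Longrightarrow> P q \<Longrightarrow> P (p + q)"
  shows "P (p :: 'a free_monoid \<Rightarrow>\<^sub>0 complex)"
proof (induction p rule: poly_mapping_additive_induct)
  case zero
  show ?case using assms(1)[of 0] by simp
next
  case (single u a)
  have "P (Poly_Mapping.single (Word ls) a)" for ls
    by (induction ls) (auto simp: single_Nil single_Cons[of _ _ a] intro: assms)
  from this[of "letters u"] show ?case by simp
qed (rule assms)

text \<open>
  The compatibility that makes the representation of the tensor algebra extend to the crossed
  product.
\<close>

lemma U_T: "w \<in> W \<Longrightarrow> U w * T p = T (tensor_map (double_act w) p) * U w"
proof (induction p rule: tensor_alg_induct)
  case (const a)
  show ?case by (simp add: operator.scalar_central)
next
  case (letter l p)
  have "U w * T (Poly_Mapping.single (Word [l]) 1 * p) = U w * Vop (basis_vector l) * T p"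
    by (simp add: T_letter mult.assoc)
  also have "\<dots> = Vop (double_act w (basis_vector l)) * (U w * T p)"
    using letter.prems by (simp add: U_V mult.assoc)
  also have "\<dots> = T (tensor_map (double_act w) (Poly_Mapping.single (Word [l]) 1 * p)) * U w"
    using letter by (simp add: tensor_map_letter T_vector mult.assoc)
  finally show ?case .
qed (simp add: distrib_left distrib_right)

definition Theta :: "(complex^'n^'n \<Rightarrow> 'n tensor_alg) \<Rightarrow> 'n double operator" where
  "Theta f = (\<Sum>w\<in>W. T (f w) * U w)"

lemma Theta_at: "w \<in> W \<Longrightarrow> Theta (elt w r) = T r * U w"
proof -
  assume w: "w \<in> W"
  have "(\<Sum>v\<in>W. T (elt w r v) * U v) = (\<Sum>v\<in>W. if v = w then T r * U w else 0)"
    by (rule sum.cong) (auto simp: coefficient_at_def)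
  then show ?thesis using w finite_W by (simp add: Theta_def)
qed

lemma Theta_zero: "Theta (\<lambda>g. 0) = 0"
  and Theta_add: "Theta (\<lambda>g. f g + h g) = Theta f + Theta h"
  and Theta_diff: "Theta (\<lambda>g. f g - h g) = Theta f - Theta h"
  and Theta_uminus: "Theta (\<lambda>g. - f g) = - Theta f"
  and Theta_scale: "Theta (\<lambda>g. Poly_Mapping.single 0 a * f g) = scalar_operator a * Theta f"
  by (simp_all add: Theta_def distrib_right left_diff_distrib sum.distrib sum_subtractf sum_negf
      sum_distrib_left mult.assoc)

lemma Theta_sum: "Theta (\<lambda>g. \<Sum>i\<in>I. F i g) = (\<Sum>i\<in>I. Theta (F i))"
  by (induction I rule: infinite_finite_induct) (auto simp: Theta_zero Theta_add)

lemma Theta_mult: "Theta (f \<otimes>\<^bsub>A\<^esub> h) = Theta f * Theta h"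
proof -
  have "Theta (f \<otimes>\<^bsub>A\<^esub> h) =
      (\<Sum>k\<in>W. \<Sum>a\<in>W. T (f a) * T (tensor_map (double_act a) (h (matrix_inv a ** k))) * U k)"
    by (simp add: Theta_def smash_mult T_sum sum_distrib_right)
  also have "\<dots> = (\<Sum>a\<in>W. \<Sum>k\<in>W. T (f a) * T (tensor_map (double_act a) (h (matrix_inv a ** k))) * U k)"
    by (rule sum.swap)
  also have "\<dots> = (\<Sum>a\<in>W. \<Sum>b\<in>W. T (f a) * U a * (T (h b) * U b))"
  proof (rule sum.cong[OF refl])
    fix a assume a: "a \<in> W"
    show "(\<Sum>k\<in>W. T (f a) * T (tensor_map (double_act a) (h (matrix_inv a ** k))) * U k) =
        (\<Sum>b\<in>W. T (f a) * U a * (T (h b) * U b))"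
    proof (rule sum.reindex_bij_witness[where i = "\<lambda>b. a ** b" and j = "\<lambda>k. matrix_inv a ** k"])
      fix k assume k: "k \<in> W"
      have "T (f a) * U a * (T (h (matrix_inv a ** k)) * U (matrix_inv a ** k)) =
          T (f a) * (U a * T (h (matrix_inv a ** k))) * U (matrix_inv a ** k)"
        by (simp only: mult.assoc)
      also have "\<dots> = T (f a) * T (tensor_map (double_act a) (h (matrix_inv a ** k))) * (U a * U (matrix_inv a ** k))"
        by (simp only: U_T[OF a] mult.assoc)
      finally show "T (f a) * U a * (T (h (matrix_inv a ** k)) * U (matrix_inv a ** k)) =
        T (f a) * T (tensor_map (double_act a) (h (matrix_inv a ** k))) * U k"
        using a k by (simp add: U_mult)
    qed (use a in auto)
  qed
  finally show ?thesis by (simp add: Theta_def sum_product)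
qed

lemma Lop_T_U: "w \<in> W \<Longrightarrow> Lop (T p * U w)"
  by (induction p rule: tensor_alg_induct)
    (auto simp: Lop_U Lop_scalar_left Lop_V_left Lop_add T_letter mult.assoc distrib_right)

lemma Lop_Theta: "Lop (Theta f)"
  unfolding Theta_def by (intro Lop_sum Lop_T_U)

section \<open>The defining ideal\<close>

abbreviation "Ich \<equiv> cherednik_ideal W \<alpha> \<alpha>v 0 c"

text \<open>
  The skew forms on \<open>V\<close> for which \<open>[v, v']\<close> is minus the sum of the
  \<open>\<omega>\<^sub>s(v, v') s\<close>. In these terms the three families of relations become
  one.
\<close>

definition omega :: "complex^'n^'n \<Rightarrow> 'n double \<Rightarrow> 'n double \<Rightarrow> complex" where
  "omega s v v' = comm_coeff (fst v) (snd v') s - comm_coeff (fst v') (snd v) s"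

definition relation :: "'n double \<Rightarrow> 'n double \<Rightarrow> complex^'n^'n \<Rightarrow> 'n tensor_alg" where
  "relation v v' = (\<lambda>g. elt (mat 1) (tensor_of v * tensor_of v' - tensor_of v' * tensor_of v) g +
     (\<Sum>s\<in>S. elt s (Poly_Mapping.single 0 (omega s v v')) g))"

lemma commutator_vectors:
  "commutator A (smash_vector v) (smash_vector v') =
     elt (mat 1) (tensor_of v * tensor_of v' - tensor_of v' * tensor_of v)"
  by (simp add: commutator_def smash_vector_at smash_at_mult tensor_map_act_one smash_minus smash_at_carrier elt_diff)

lemma relation_yx: "commutator A (smash_vector (y, 0)) (smash_vector (0, x)) \<ominus>\<^bsub>A\<^esub>
          (((0 * pairing x y) \<odot>\<^bsub>A\<^esub> \<one>\<^bsub>A\<^esub>) \<ominus>\<^bsub>A\<^esub>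
           (\<Oplus>\<^bsub>A\<^esub>s\<in>S.
              (2 * c s / pairing (\<alpha> s) (\<alpha>v s) * pairing x (\<alpha>v s) * pairing (\<alpha> s) y)
                \<odot>\<^bsub>A\<^esub> smash_group s)) = relation (y, 0) (0, x)"
proof -
  let ?k = "\<lambda>s. 2 * c s / pairing (\<alpha> s) (\<alpha>v s) * pairing x (\<alpha>v s) * pairing (\<alpha> s) y"
  have s: "?k s \<odot>\<^bsub>A\<^esub> smash_group s = elt s (Poly_Mapping.single 0 (omega s (y, 0) (0, x)))" for s
    by (rule ext) (simp add: smash_smult smash_group_at coefficient_at_def omega_def comm_coeff_def)
  have car: "(\<lambda>g. \<Sum>s\<in>S. elt s (Poly_Mapping.single 0 (omega s (y, 0) (0, x))) g) \<in> carrier A"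
    by (auto simp: smash_carrier coefficient_at_def intro!: sum.neutral)
  have sum: "(\<Oplus>\<^bsub>A\<^esub>s\<in>S. elt s (Poly_Mapping.single 0 (omega s (y, 0) (0, x)))) =
      (\<lambda>g. \<Sum>s\<in>S. elt s (Poly_Mapping.single 0 (omega s (y, 0) (0, x))) g)"
    by (rule smash_finsum) (simp_all add: smash_at_carrier)
  have zero: "(0 * pairing x y) \<odot>\<^bsub>A\<^esub> \<one>\<^bsub>A\<^esub> = (\<lambda>g. 0)" by (simp add: smash_smult)
  have zero_car: "(\<lambda>g. 0) \<in> carrier A" "(\<lambda>g. - f g) \<in> carrier A" if "f \<in> carrier A" for f
    using that by (auto simp: smash_carrier)
  show ?thesis
    unfolding s commutator_vectors sum zero smash_minus[OF zero_car(1)[OF car] car]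
    by (simp add: smash_minus smash_at_carrier zero_car car relation_def)
qed

lemma relation_carrier: "relation v v' \<in> carrier A"
  by (auto simp: relation_def smash_carrier coefficient_at_def intro!: sum.neutral)

lemma relation_xx: "relation (0, x) (0, x') = commutator A (smash_vector (0, x)) (smash_vector (0, x'))"
  and relation_yy: "relation (y, 0) (y', 0) = commutator A (smash_vector (y, 0)) (smash_vector (y', 0))"
  by (simp_all add: relation_def commutator_vectors omega_def comm_coeff_def)

lemma cherednik_relations_eq:
  "cherednik_relations W \<alpha> \<alpha>v 0 c =
     {relation (0, x) (0, x') | x x'. True} \<union> {relation (y, 0) (y', 0) | y y'. True} \<union>
     {relation (y, 0) (0, x) | x y. True}"
  unfolding cherednik_relations_def Let_def relation_yx relation_xx relation_yy ..

text \<open>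
  The commutators of Dunkl operators and coordinates computed above are the defining relations.
\<close>

lemma Theta_relation: "Theta (relation v v') = 0"
proof -
  have "Theta (relation v v') = (Vop v * Vop v' - Vop v' * Vop v) * U (mat 1) +
      (\<Sum>s\<in>S. scalar_operator (omega s v v') * U s)"
    by (simp add: relation_def Theta_add Theta_sum Theta_at T_vector)
  also have "Vop v * Vop v' - Vop v' * Vop v = (Dop (fst v) * Xop (snd v') - Xop (snd v') * Dop (fst v))
      - (Dop (fst v') * Xop (snd v) - Xop (snd v) * Dop (fst v'))"
    by (simp add: Vop_def algebra_simps comm_X_X[of "snd v'" "snd v"] comm_D_D[of "fst v'" "fst v"])
  also have "\<dots> = - (\<Sum>s\<in>S. scalar_operator (omega s v v') * U s)"
    by (simp add: comm_D_X omega_def operator.scalar_diff left_diff_distrib sum_subtractf)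
  also have "\<dots> * U (mat 1) = - (\<Sum>s\<in>S. scalar_operator (omega s v v') * U s)"
    by (simp add: sum_distrib_right mult.assoc U_mult)
  finally show ?thesis by simp
qed

definition kernel :: "(complex^'n^'n \<Rightarrow> 'n tensor_alg) set" where
  "kernel = {f \<in> carrier A. Theta f = 0}"

lemma kernel_ideal: "ideal kernel A"
proof (rule idealI)
  show "subgroup kernel (add_monoid A)"
  proof (rule subgroup.intro)
    show "inv\<^bsub>add_monoid A\<^esub> f \<in> kernel" if "f \<in> kernel" for f
      using that smash.CP.a_inv_closed[of f] by (auto simp: kernel_def smash_uminus Theta_uminus simp flip: a_inv_def)
  qed (auto simp: kernel_def smash_add Theta_add smash_zero Theta_zero smash_carrier)
qed (auto simp: kernel_def smash_ring Theta_mult)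

lemma relations_carrier: "cherednik_relations W \<alpha> \<alpha>v 0 c \<subseteq> carrier A"
  unfolding cherednik_relations_eq using relation_carrier by auto

lemma Ich_ideal: "ideal Ich A"
  unfolding cherednik_ideal_def by (rule smash.CP.genideal_ideal[OF relations_carrier])

sublocale Ich: ideal Ich A
  by (rule Ich_ideal)

lemma Ich_kernel: "Ich \<subseteq> kernel"
  unfolding cherednik_ideal_def
  by (rule smash.CP.genideal_minimal[OF kernel_ideal])
    (auto simp: cherednik_relations_eq kernel_def relation_carrier Theta_relation)

lemma Ich_carrier: "f \<in> Ich \<Longrightarrow> f \<in> carrier A"
  using Ich.Icarr by blast

lemma Ich_zero: "(\<lambda>g. 0) \<in> Ich"
  using Ich.zero_closed by (simp add: smash_zero)

lemma Ich_add: "f \<in> Ich \<Longrightarrow> h \<in> Ich \<Longrightarrow> (\<lambda>g. f g + h g) \<in> Ich"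
  using Ich.a_closed[of f h] by (simp add: smash_add)

lemma Ich_left: "a \<in> carrier A \<Longrightarrow> f \<in> Ich \<Longrightarrow> a \<otimes>\<^bsub>A\<^esub> f \<in> Ich"
  and Ich_right: "a \<in> carrier A \<Longrightarrow> f \<in> Ich \<Longrightarrow> f \<otimes>\<^bsub>A\<^esub> a \<in> Ich"
  by (auto intro: Ich.I_l_closed Ich.I_r_closed)

lemma at_one_mult: "elt (mat 1) r \<otimes>\<^bsub>A\<^esub> f = (\<lambda>k. if k \<in> W then r * f k else 0)"
proof
  fix k
  have "(\<Sum>a\<in>W. elt (mat 1) r a * tensor_map (double_act a) (f (matrix_inv a ** k))) =
        (\<Sum>a\<in>W. if a = mat 1 then r * f k else 0)"
  proof (rule sum.cong[OF refl])
    fix a assume "a \<in> W"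
    have "matrix_inv (mat 1) = (mat 1 :: complex^'n^'n)" using W_inv_unique[OF W_one, of "mat 1"] by simp
    then show "elt (mat 1) r a * tensor_map (double_act a) (f (matrix_inv a ** k)) = (if a = mat 1 then r * f k else 0)"
      by (simp add: coefficient_at_def tensor_map_act_one)
  qed
  then show "(elt (mat 1) r \<otimes>\<^bsub>A\<^esub> f) k = (if k \<in> W then r * f k else 0)"
    using finite_W by (simp add: smash_mult)
qed

lemma at_one_mult': "f \<in> carrier A \<Longrightarrow> elt (mat 1) r \<otimes>\<^bsub>A\<^esub> f = (\<lambda>k. r * f k)"
  by (auto simp: at_one_mult smash_carrier)

lemma Ich_scale: "f \<in> Ich \<Longrightarrow> (\<lambda>g. r * f g) \<in> Ich"
  using Ich_left[OF smash_at_carrier[OF W_one], of f r] by (simp add: at_one_mult' Ich_carrier)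

lemma Ich_uminus: "f \<in> Ich \<Longrightarrow> (\<lambda>g. - f g) \<in> Ich"
  using Ich_scale[of f "-1"] by simp

lemma Ich_diff: "f \<in> Ich \<Longrightarrow> h \<in> Ich \<Longrightarrow> (\<lambda>g. f g - h g) \<in> Ich"
  using Ich_add[OF _ Ich_uminus, of f h] by simp

lemma relation_Ich: "relation v v' \<in> Ich"
proof -
  have gen: "r \<in> Ich" if "r \<in> cherednik_relations W \<alpha> \<alpha>v 0 c" for r
    using that smash.CP.genideal_self[OF relations_carrier] by (auto simp: cherednik_ideal_def)
  have xx: "relation (0, x) (0, x') \<in> Ich" and yy: "relation (y, 0) (y', 0) \<in> Ich"
    and yx: "relation (y, 0) (0, x) \<in> Ich" for x x' y y'
    by (rule gen, auto simp: cherednik_relations_eq)+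
  have split: "tensor_of v = tensor_of (fst v, 0) + tensor_of (0, snd v)" for v :: "'n double"
    by (simp flip: tensor_of_add)
  have "relation v v' = (\<lambda>g. (relation (0, snd v) (0, snd v') g + relation (fst v, 0) (fst v', 0) g) +
       (relation (fst v, 0) (0, snd v') g - relation (fst v', 0) (0, snd v) g))"
    by (rule ext) (simp add: relation_def coefficient_at_def omega_def comm_coeff_def split[of v] split[of v']
        algebra_simps single_diff if_distrib sum.distrib sum_subtractf cong: if_cong)
  then show ?thesis using xx yy yx Ich_add Ich_diff by presburger
qed

end

section \<open>Normal forms\<close>

text \<open>
  Normal words have all letters of the dual space in front; within the two groups the order does
  not matter, as these letters commute, and an arbitrary one is chosen for each multiset of
  letters.
\<close>

definition arrange :: "('n + 'n) multiset \<Rightarrow> ('n + 'n) list" where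
  "arrange m = (let l = (SOME l. mset l = m) in filter (\<lambda>x. \<not> isl x) l @ filter isl l)"

abbreviation ordered_word :: "'n list \<Rightarrow> 'n list \<Rightarrow> ('n + 'n) list" where
  "ordered_word xs ys \<equiv> map Inr xs @ map Inl ys"

abbreviation word :: "'a list \<Rightarrow> 'a free_monoid \<Rightarrow>\<^sub>0 complex" where
  "word ls \<equiv> Poly_Mapping.single (Word ls) 1"

lemma mset_arrange [simp]: "mset (arrange m) = m"
proof -
  have "mset (SOME l. mset l = m) = m" by (rule someI_ex) (rule ex_mset)
  then show ?thesis
    by (simp add: arrange_def Let_def)
qed

lemma arrange_ordered: "\<exists>xs ys. arrange m = ordered_word xs ys"
proof -
  define l where "l = (SOME l. mset l = m)"
  have "map Inr (map projr (filter (\<lambda>x. \<not> isl x) l)) = filter (\<lambda>x. \<not> isl x) l"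
    unfolding map_map by (rule map_idI) (simp add: sum.collapse(2))
  moreover have "map Inl (map projl (filter isl l)) = filter isl l"
    unfolding map_map by (rule map_idI) (simp add: sum.collapse(1))
  ultimately have "arrange m = ordered_word (map projr (filter (\<lambda>x. \<not> isl x) l)) (map projl (filter isl l))"
    by (simp only: arrange_def l_def Let_def)
  then show ?thesis by blast
qed

lemma mset_ordered_word_eq:
  assumes "mset (ordered_word xs ys) = mset (ordered_word xs' ys')"
  shows "mset xs = mset xs'" "mset ys = mset ys'"
proof -
  have "image_mset projr (filter_mset (\<lambda>x. \<not> isl x) (mset (ordered_word xs ys))) = mset xs"
    "image_mset projl (filter_mset isl (mset (ordered_word xs ys))) = mset ys" for xs ys :: "'a list"
    by (simp_all add: filter_mset_image_mset image_mset.compositionality o_def)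
  then show "mset xs = mset xs'" "mset ys = mset ys'" using assms by metis+
qed

definition normal_word :: "(('n + 'n) multiset \<Rightarrow>\<^sub>0 complex) \<Rightarrow> 'n tensor_alg" where
  "normal_word q = (\<Sum>m\<in>Poly_Mapping.keys q. Poly_Mapping.single (Word (arrange m)) (Poly_Mapping.lookup q m))"

lemma normal_word_superset:
  assumes "finite K" "Poly_Mapping.keys q \<subseteq> K"
  shows "normal_word q = (\<Sum>m\<in>K. Poly_Mapping.single (Word (arrange m)) (Poly_Mapping.lookup q m))"
  unfolding normal_word_def by (rule sum.mono_neutral_left) (use assms in \<open>auto simp: in_keys_iff\<close>)

lemma normal_word_add: "normal_word (p + q) = normal_word p + normal_word q"
proof -
  let ?K = "Poly_Mapping.keys p \<union> Poly_Mapping.keys q"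
  have "Poly_Mapping.keys (p + q) \<subseteq> ?K" by (rule Poly_Mapping.keys_add)
  then show ?thesis
    by (simp add: normal_word_superset[of ?K] lookup_add single_add sum.distrib)
qed

lemma normal_word_zero [simp]: "normal_word 0 = 0"
  by (simp add: normal_word_def)

lemma normal_word_single: "normal_word (Poly_Mapping.single m a) = Poly_Mapping.single (Word (arrange m)) a"
  by (subst normal_word_superset[of "{m}"]) auto

lemma normal_word_uminus: "normal_word (- p) = - normal_word p"
  using normal_word_add[of p "- p"] by (simp add: eq_neg_iff_add_eq_0 add.commute)

lemma normal_word_diff: "normal_word (p - q) = normal_word p - normal_word q"
  using normal_word_add[of p "- q"] by (simp add: normal_word_uminus)

lemma normal_word_scale: "normal_word (Poly_Mapping.single 0 a * q) = Poly_Mapping.single 0 a * normal_word q"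
  by (induction q rule: poly_mapping_additive_induct)
    (auto simp: mult_single normal_word_single distrib_left normal_word_add)

context dunkl
begin

subsection \<open>Ordered monomials span the algebra\<close>

text \<open>Equality in the Cherednik algebra of two elements of the tensor algebra.\<close>

definition teq :: "'n tensor_alg \<Rightarrow> 'n tensor_alg \<Rightarrow> bool" where
  "teq r r' \<longleftrightarrow> elt (mat 1) (r - r') \<in> Ich"

lemma letters_zero [simp]: "letters 0 = []"
  by (simp add: zero_free_monoid_def)

lemma teq_refl: "teq r r"
  by (simp add: teq_def Ich_zero)

lemma teq_trans: "teq r r' \<Longrightarrow> teq r' r'' \<Longrightarrow> teq r r''"
  unfolding teq_def using Ich_add[of "elt (mat 1) (r - r')" "elt (mat 1) (r' - r'')"]
  by (simp flip: elt_add)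

lemma Ich_elt_right:
  assumes "elt (mat 1) r \<in> Ich" "w \<in> W"
  shows "elt w (p * r * q) \<in> Ich"
proof -
  have "elt (mat 1) p \<otimes>\<^bsub>A\<^esub> (elt (mat 1) r \<otimes>\<^bsub>A\<^esub> elt w q) \<in> Ich"
    using assms by (intro Ich_left Ich_right smash_at_carrier) auto
  then show ?thesis using assms(2)
    by (simp add: smash_at_mult tensor_map_act_one mult.assoc)
qed

lemma teq_elt: "teq r r' \<Longrightarrow> w \<in> W \<Longrightarrow> elt w (p * (r - r') * q) \<in> Ich"
  unfolding teq_def by (rule Ich_elt_right)

lemma teq_mult: "teq r r' \<Longrightarrow> teq (p * r * q) (p * r' * q)"
  using teq_elt[of r r' "mat 1" p q] by (simp add: teq_def algebra_simps)

lemma relation_same: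
  assumes "isl l = isl l'"
  shows "teq (word [l] * word [l']) (word [l'] * word [l])"
proof -
  have "omega s (basis_vector l) (basis_vector l') = 0" for s
    using assms by (cases l; cases l') (auto simp: omega_def comm_coeff_def basis_vector_def)
  then have "relation (basis_vector l) (basis_vector l') = elt (mat 1) (word [l] * word [l'] - word [l'] * word [l])"
    by (simp add: relation_def tensor_of_basis)
  then show ?thesis using relation_Ich by (metis teq_def)
qed

lemma word_append: "word (ls @ ms) = word ls * word ms"
  by (rule single_append)

lemma word_Nil: "word [] = 1"
  by (simp add: single_Nil)

text \<open>Letters of the same kind commute modulo the relations.\<close>

lemma teq_move:
  assumes "\<And>k. k \<in> set ls \<Longrightarrow> isl k = isl l"
  shows "teq (word (l # ls)) (word (ls @ [l]))"
  using assms
proof (induction ls)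
  case (Cons k ls)
  have 1: "teq (word (l # k # ls)) (word (k # l # ls))"
    using teq_mult[OF relation_same[of l k], of 1 "word ls"] Cons.prems[of k]
    by (simp add: mult_single plus_free_monoid_def)
  have "teq (word (l # ls)) (word (ls @ [l]))" using Cons by auto
  from teq_mult[OF this, of "word [k]" 1]
  have 2: "teq (word (k # l # ls)) (word (k # ls @ [l]))"
    by (simp add: mult_single plus_free_monoid_def)
  show ?case using teq_trans[OF 1 2] by simp
qed (simp add: teq_refl)

lemma teq_permute:
  assumes "mset ls = mset ms" "\<And>k. k \<in> set ls \<Longrightarrow> isl k = b"
  shows "teq (word ls) (word ms)"
  using assms
proof (induction ls arbitrary: ms)
  case (Cons l ls)
  then have "l \<in> set ms" by (metis list.set_intros(1) mset_eq_setD)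
  then obtain p q where ms: "ms = p @ l # q" by (meson split_list)
  then have m: "mset ls = mset (p @ q)" using Cons.prems(1) by simp
  have same: "isl k = isl l" if "k \<in> set p" for k
    using Cons.prems that unfolding ms by (metis Un_iff list.set_intros(1) mset_eq_setD set_append)
  have "teq (word ls) (word (p @ q))" using Cons.IH[OF m] Cons.prems(2) by simp
  from teq_mult[OF this, of "word [l]" 1] have 1: "teq (word (l # ls)) (word (l # p @ q))"
    by (simp add: mult_single plus_free_monoid_def)
  have "teq (word (l # p)) (word (p @ [l]))" by (rule teq_move) (rule same)
  from teq_mult[OF this, of 1 "word q"] have 2: "teq (word (l # p @ q)) (word (p @ l # q))"
    by (simp add: mult_single plus_free_monoid_def)
  show ?case using teq_trans[OF 1 2] by (simp add: ms)
qed (simp add: teq_refl)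

lemma teq_arrange: "teq (word (ordered_word xs ys)) (word (arrange (mset (ordered_word xs ys))))"
proof -
  obtain xs' ys' where a: "arrange (mset (ordered_word xs ys)) = ordered_word xs' ys'"
    using arrange_ordered by blast
  then have m: "mset (ordered_word xs ys) = mset (ordered_word xs' ys')" by (metis mset_arrange)
  have "teq (word (map Inr xs)) (word (map Inr xs'))"
    using mset_ordered_word_eq(1)[OF m] by (intro teq_permute[where b = False]) auto
  then have 1: "teq (word (ordered_word xs ys)) (word (ordered_word xs' ys))"
    using teq_mult[of _ _ 1 "word (map Inl ys)"] by (simp only: word_append mult_1)
  have "teq (word (map Inl ys)) (word (map Inl ys'))"
    using mset_ordered_word_eq(2)[OF m] by (intro teq_permute[where b = True]) auto
  then have 2: "teq (word (ordered_word xs' ys)) (word (ordered_word xs' ys'))"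
    using teq_mult[of _ _ "word (map Inr xs')" 1] by (simp only: word_append mult_1_right)
  show ?thesis unfolding a by (rule teq_trans[OF 1 2])
qed

definition nform :: "(complex^'n^'n \<Rightarrow> ('n + 'n) multiset \<Rightarrow>\<^sub>0 complex) \<Rightarrow> complex^'n^'n \<Rightarrow> 'n tensor_alg" where
  "nform g = (\<lambda>w. if w \<in> W then normal_word (g w) else 0)"

lemma normal_carrier: "nform g \<in> carrier A"
  by (simp add: nform_def smash_carrier)

text \<open>
  The elements with a normal form: those congruent to a combination of normal words times group
  elements.
\<close>

definition nspan :: "(complex^'n^'n \<Rightarrow> 'n tensor_alg) set" where
  "nspan = {f \<in> carrier A. \<exists>g. (\<lambda>w. f w - nform g w) \<in> Ich}"

lemma span_zero: "(\<lambda>w. 0) \<in> nspan"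
proof -
  have "nform (\<lambda>w. 0) = (\<lambda>w. 0)" by (auto simp: nform_def)
  then have "(\<lambda>w. 0 - nform (\<lambda>w. 0) w) \<in> Ich" using Ich_zero by simp
  then show ?thesis by (auto simp: nspan_def smash_carrier)
qed

lemma span_add: "f \<in> nspan \<Longrightarrow> h \<in> nspan \<Longrightarrow> (\<lambda>w. f w + h w) \<in> nspan"
proof -
  assume "f \<in> nspan" "h \<in> nspan"
  then obtain a b where ab: "(\<lambda>w. f w - nform a w) \<in> Ich" "(\<lambda>w. h w - nform b w) \<in> Ich"
    and car: "f \<in> carrier A" "h \<in> carrier A" by (auto simp: nspan_def)
  have "(\<lambda>w. f w + h w - nform (\<lambda>w. a w + b w) w) = (\<lambda>w. (f w - nform a w) + (h w - nform b w))"
    by (rule ext) (simp add: nform_def normal_word_add)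
  then show ?thesis using Ich_add[OF ab] car by (auto simp: nspan_def smash_carrier intro!: exI[of _ "\<lambda>w. a w + b w"])
qed

lemma span_sum: "(\<And>i. i \<in> I \<Longrightarrow> F i \<in> nspan) \<Longrightarrow> (\<lambda>w. \<Sum>i\<in>I. F i w) \<in> nspan"
  by (induction I rule: infinite_finite_induct) (auto intro: span_zero span_add)

lemma span_scale: "f \<in> nspan \<Longrightarrow> (\<lambda>w. Poly_Mapping.single 0 a * f w) \<in> nspan"
proof -
  assume "f \<in> nspan"
  then obtain g where g: "(\<lambda>w. f w - nform g w) \<in> Ich" and car: "f \<in> carrier A" by (auto simp: nspan_def)
  have "(\<lambda>w. Poly_Mapping.single 0 a * f w - nform (\<lambda>w. Poly_Mapping.single 0 a * g w) w) =
      (\<lambda>w. Poly_Mapping.single 0 a * (f w - nform g w))"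
    by (rule ext) (simp add: nform_def normal_word_scale right_diff_distrib)
  then show ?thesis using Ich_scale[OF g] car
    by (auto simp: nspan_def smash_carrier intro!: exI[of _ "\<lambda>w. Poly_Mapping.single 0 a * g w"])
qed

lemma span_Ich:
  assumes "f \<in> nspan" "(\<lambda>w. h w - f w) \<in> Ich" "h \<in> carrier A"
  shows "h \<in> nspan"
proof -
  obtain g where "(\<lambda>w. f w - nform g w) \<in> Ich" using assms by (auto simp: nspan_def)
  from Ich_add[OF assms(2) this] show ?thesis using assms(3) by (auto simp: nspan_def)
qed

lemma span_ordered: "w \<in> W \<Longrightarrow> elt w (word (ordered_word xs ys)) \<in> nspan"
proof -
  assume w: "w \<in> W"
  let ?m = "mset (ordered_word xs ys)"
  let ?g = "\<lambda>v. if v = w then Poly_Mapping.single ?m 1 else 0"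
  have "nform ?g v = elt w (word (arrange ?m)) v" for v
    using w by (auto simp: nform_def coefficient_at_def normal_word_single)
  moreover have "elt w (1 * (word (ordered_word xs ys) - word (arrange ?m)) * 1) \<in> Ich"
    by (rule teq_elt[OF teq_arrange w])
  then have "(\<lambda>v. elt w (word (ordered_word xs ys)) v - elt w (word (arrange ?m)) v) \<in> Ich"
    by (simp only: mult_1 mult_1_right elt_diff)
  ultimately have "(\<lambda>v. elt w (word (ordered_word xs ys)) v - nform ?g v) \<in> Ich"
    by (simp only:)
  then show ?thesis using smash_at_carrier[OF w] unfolding nspan_def by blast
qed

lemma normal_expansion: "nform g = (\<lambda>k. \<Sum>w\<in>W. \<Sum>m\<in>Poly_Mapping.keys (g w).
    Poly_Mapping.single 0 (Poly_Mapping.lookup (g w) m) * elt w (word (arrange m)) k)"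
proof
  fix k
  have "nform g k = (\<Sum>w\<in>W. elt w (normal_word (g w)) k)"
    using smash_expansion[OF normal_carrier[of g]] finite_W
    by (auto simp: nform_def coefficient_at_def)
  also have "\<dots> = (\<Sum>w\<in>W. \<Sum>m\<in>Poly_Mapping.keys (g w).
      Poly_Mapping.single 0 (Poly_Mapping.lookup (g w) m) * elt w (word (arrange m)) k)"
    by (rule sum.cong) (auto simp: normal_word_def coefficient_at_def mult_single)
  finally show "nform g k = \<dots>" .
qed

lemma span_left:
  assumes p: "\<And>w xs ys. w \<in> W \<Longrightarrow> elt w (p * word (ordered_word xs ys)) \<in> nspan" and f: "f \<in> nspan"
  shows "(\<lambda>w. p * f w) \<in> nspan"
proof -
  obtain g where g: "(\<lambda>w. f w - nform g w) \<in> Ich" and car: "f \<in> carrier A" using f by (auto simp: nspan_def)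
  have pm: "elt w (p * word (arrange m)) \<in> nspan" if "w \<in> W" for w m
    using p[OF that] arrange_ordered[of m] by metis
  have "p * nform g k = (\<Sum>w\<in>W. \<Sum>m\<in>Poly_Mapping.keys (g w).
      Poly_Mapping.single 0 (Poly_Mapping.lookup (g w) m) * elt w (p * word (arrange m)) k)" for k
  proof -
    have "p * (Poly_Mapping.single 0 a * elt w r k) = Poly_Mapping.single 0 a * elt w (p * r) k" for a w r
      by (simp add: coefficient_at_def mult.assoc[symmetric] tensor.scalar_central)
    then show ?thesis unfolding normal_expansion[of g] by (simp add: sum_distrib_left)
  qed
  then have "(\<lambda>k. p * nform g k) \<in> nspan"
    by (simp only:) (intro span_sum span_scale pm)
  moreover have "(\<lambda>k. p * f k - p * nform g k) \<in> Ich"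
    using Ich_scale[OF g, of p] by (simp add: right_diff_distrib)
  ultimately show ?thesis by (rule span_Ich) (use car in \<open>auto simp: smash_carrier\<close>)
qed

lemma elt_scale: "elt w (p * r :: 'n tensor_alg) = (\<lambda>k. p * elt w r k)"
  by (rule ext) (simp add: coefficient_at_def)

lemma span_left_x: "f \<in> nspan \<Longrightarrow> (\<lambda>w. word [Inr i] * f w) \<in> nspan"
proof (rule span_left)
  fix w xs ys assume "w \<in> W"
  then show "elt w (word [Inr i] * word (ordered_word xs ys)) \<in> nspan"
    using span_ordered[of w "i # xs" ys] by (simp add: mult_single plus_free_monoid_def)
qed

lemma span_left_x_vector: "f \<in> nspan \<Longrightarrow> (\<lambda>w. tensor_of (0, x) * f w) \<in> nspan"
proof -
  assume f: "f \<in> nspan"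
  have "tensor_of (0, x) * f w = (\<Sum>i\<in>UNIV. Poly_Mapping.single 0 (x $ i) * (word [Inr i] * f w))" for w
    by (simp add: tensor_of_def sum_distrib_right mult.assoc[symmetric] mult_single)
  then show ?thesis using span_sum[of UNIV "\<lambda>i w. Poly_Mapping.single 0 (x $ i) * (word [Inr i] * f w)"]
    by (simp add: span_scale span_left_x f)
qed

lemma span_y_words: "w \<in> W \<Longrightarrow> elt w (prod_list (map (\<lambda>y. tensor_of (y, 0)) ys) * word (map Inl zs)) \<in> nspan"
proof (induction ys arbitrary: zs rule: rev_induct)
  case Nil
  show ?case using span_ordered[OF Nil, of "[]" zs] by simp
next
  case (snoc y ys)
  let ?P = "prod_list (map (\<lambda>y. tensor_of (y, 0)) ys)"
  have "tensor_of (y, 0) * word (map Inl zs) = (\<Sum>i\<in>UNIV. Poly_Mapping.single 0 (y $ i) * word (map Inl (i # zs)))"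
    by (simp add: tensor_of_def sum_distrib_right mult_single plus_free_monoid_def)
  then have "prod_list (map (\<lambda>y. tensor_of (y, 0)) (ys @ [y])) * word (map Inl zs) =
     ?P * (\<Sum>i\<in>UNIV. Poly_Mapping.single 0 (y $ i) * word (map Inl (i # zs)))"
    by (simp only: map_append prod_list.append list.map prod_list.Cons prod_list.Nil mult_1_right mult.assoc)
  also have "\<dots> = (\<Sum>i\<in>UNIV. Poly_Mapping.single 0 (y $ i) * (?P * word (map Inl (i # zs))))"
    unfolding sum_distrib_left
    by (rule sum.cong[OF refl]) (simp only: mult.assoc[symmetric] tensor.scalar_central[of _ ?P])
  finally have eq: "prod_list (map (\<lambda>y. tensor_of (y, 0)) (ys @ [y])) * word (map Inl zs) =
     (\<Sum>i\<in>UNIV. Poly_Mapping.single 0 (y $ i) * (?P * word (map Inl (i # zs))))" .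
  show ?case unfolding eq elt_sum
  proof (rule span_sum)
    fix i
    show "elt w (Poly_Mapping.single 0 (y $ i) * (?P * word (map Inl (i # zs)))) \<in> nspan"
      unfolding elt_scale[of w "Poly_Mapping.single 0 (y $ i)"] by (rule span_scale[OF snoc.IH[OF snoc.prems]])
  qed
qed

lemma span_products:
  assumes "w \<in> W"
  shows "elt w (prod_list (map (\<lambda>x. tensor_of (0, x)) xs) * prod_list (map (\<lambda>y. tensor_of (y, 0)) ys)) \<in> nspan"
proof (induction xs)
  case Nil
  show ?case using span_y_words[OF assms, of ys "[]"] by (simp add: word_Nil)
next
  case (Cons x xs)
  then show ?case using span_left_x_vector[OF Cons, of x]
    by (simp add: mult.assoc elt_scale[of w "tensor_of (0, x)"])
qed

lemma tensor_map_ordered: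
  "tensor_map (double_act s) (word (ordered_word xs ys)) =
     prod_list (map (\<lambda>x. tensor_of (0, x)) (map (\<lambda>i. axis i 1 v* matrix_inv s) xs)) *
     prod_list (map (\<lambda>y. tensor_of (y, 0)) (map (\<lambda>i. s *v axis i 1) ys))"
proof -
  have "tensor_map (double_act s) (word ls) = prod_list (map (\<lambda>l. tensor_of (double_act s (basis_vector l))) ls)" for ls
    by (simp add: tensor_map_free_lift tensor.free_lift_single)
  then show ?thesis by (simp add: o_def basis_vector_def double_act_def)
qed

text \<open>
  Induction on the number of dual letters: exchanging \<open>y\<close> with the first one leaves
  the same problem for a shorter word, and terms in which a reflection has moved to the right of a
  shorter word. The latter is then a product of vectors that are no longer basis vectors, but
  still ordered.
\<close>

lemma span_left_y_ordered: "w \<in> W \<Longrightarrow> elt w (word [Inl j] * word (ordered_word xs ys)) \<in> nspan"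
proof (induction xs)
  case Nil
  then show ?case using span_ordered[of w "[]" "j # ys"] by (simp add: mult_single plus_free_monoid_def)
next
  case (Cons i xs)
  let ?R = "word (ordered_word xs ys)"
  let ?y = "basis_vector (Inl j)" and ?x = "basis_vector (Inr i)"
  have "relation ?y ?x \<otimes>\<^bsub>A\<^esub> elt w ?R \<in> Ich"
    using Cons.prems by (intro Ich_right relation_Ich smash_at_carrier)
  moreover have "relation ?y ?x \<otimes>\<^bsub>A\<^esub> elt w ?R =
      (\<lambda>g. elt w (word [Inl j] * (word [Inr i] * ?R)) g -
        (word [Inr i] * elt w (word [Inl j] * ?R) g -
          (\<Sum>s\<in>S. Poly_Mapping.single 0 (omega s ?y ?x) * elt (s ** w) (tensor_map (double_act s) ?R) g)))"
  proof -
    have rel: "relation ?y ?x = elt (mat 1) (word [Inl j] * word [Inr i] - word [Inr i] * word [Inl j])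
        \<oplus>\<^bsub>A\<^esub> (\<Oplus>\<^bsub>A\<^esub>s\<in>S. elt s (Poly_Mapping.single 0 (omega s ?y ?x)))"
      by (simp add: relation_def smash_add smash_finsum smash_at_carrier tensor_of_basis)
    have "(\<Oplus>\<^bsub>A\<^esub>s\<in>S. elt s (Poly_Mapping.single 0 (omega s ?y ?x))) \<otimes>\<^bsub>A\<^esub> elt w ?R =
        (\<Oplus>\<^bsub>A\<^esub>s\<in>S. elt s (Poly_Mapping.single 0 (omega s ?y ?x)) \<otimes>\<^bsub>A\<^esub> elt w ?R)"
      using Cons.prems by (intro smash.CP.finsum_ldistr) (auto simp: smash_at_carrier)
    also have "\<dots> = (\<lambda>g. \<Sum>s\<in>S. (elt s (Poly_Mapping.single 0 (omega s ?y ?x)) \<otimes>\<^bsub>A\<^esub> elt w ?R) g)"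
      using Cons.prems by (intro smash_finsum smash.CP.m_closed smash_at_carrier) auto
    also have "\<dots> = (\<lambda>g. \<Sum>s\<in>S. Poly_Mapping.single 0 (omega s ?y ?x) * elt (s ** w) (tensor_map (double_act s) ?R) g)"
      using Cons.prems by (intro ext sum.cong refl) (simp only: smash_at_mult S_in_W elt_scale)
    finally have fin: "(\<Oplus>\<^bsub>A\<^esub>s\<in>S. elt s (Poly_Mapping.single 0 (omega s ?y ?x))) \<otimes>\<^bsub>A\<^esub> elt w ?R =
        (\<lambda>g. \<Sum>s\<in>S. Poly_Mapping.single 0 (omega s ?y ?x) * elt (s ** w) (tensor_map (double_act s) ?R) g)" .
    have first: "elt (mat 1) (word [Inl j] * word [Inr i] - word [Inr i] * word [Inl j]) \<otimes>\<^bsub>A\<^esub> elt w ?R =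
        (\<lambda>g. elt w (word [Inl j] * (word [Inr i] * ?R)) g - word [Inr i] * elt w (word [Inl j] * ?R) g)"
    proof -
      have "elt (mat 1) (word [Inl j] * word [Inr i] - word [Inr i] * word [Inl j]) \<otimes>\<^bsub>A\<^esub> elt w ?R =
          elt w ((word [Inl j] * word [Inr i] - word [Inr i] * word [Inl j]) * ?R)"
        by (simp only: smash_at_mult[OF W_one Cons.prems] tensor_map_act_one matrix_mul_lid)
      then show ?thesis
        unfolding left_diff_distrib mult.assoc elt_diff elt_scale[of w "word [Inr i]"] .
    qed
    have carriers: "elt (mat 1) (word [Inl j] * word [Inr i] - word [Inr i] * word [Inl j]) \<in> carrier A"
      "(\<Oplus>\<^bsub>A\<^esub>s\<in>S. elt s (Poly_Mapping.single 0 (omega s ?y ?x))) \<in> carrier A" "elt w ?R \<in> carrier A"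
      using Cons.prems by (auto intro!: smash.CP.finsum_closed simp: smash_at_carrier)
    show ?thesis unfolding rel smash.CP.l_distr[OF carriers] first fin
      by (rule ext) (simp add: smash_add)
  qed
  ultimately have ich: "(\<lambda>g. elt w (word [Inl j] * (word [Inr i] * ?R)) g -
        (word [Inr i] * elt w (word [Inl j] * ?R) g -
          (\<Sum>s\<in>S. Poly_Mapping.single 0 (omega s ?y ?x) * elt (s ** w) (tensor_map (double_act s) ?R) g))) \<in> Ich"
    by simp
  have 1: "(\<lambda>g. word [Inr i] * elt w (word [Inl j] * ?R) g) \<in> nspan"
    by (rule span_left_x[OF Cons.IH[OF Cons.prems]])
  have 2: "(\<lambda>g. \<Sum>s\<in>S. Poly_Mapping.single 0 (- omega s ?y ?x) * elt (s ** w) (tensor_map (double_act s) ?R) g) \<in> nspan"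
    using Cons.prems unfolding tensor_map_ordered by (intro span_sum span_scale span_products) auto
  have "(\<lambda>g. word [Inr i] * elt w (word [Inl j] * ?R) g -
          (\<Sum>s\<in>S. Poly_Mapping.single 0 (omega s ?y ?x) * elt (s ** w) (tensor_map (double_act s) ?R) g)) \<in> nspan"
    using span_add[OF 1 2] by (simp add: single_uminus sum_negf)
  from span_Ich[OF this ich] have "elt w (word [Inl j] * (word [Inr i] * ?R)) \<in> nspan"
    using smash_at_carrier[OF Cons.prems] by blast
  then show ?case by (simp add: mult_single plus_free_monoid_def)
qed

lemma span_carrier: "f \<in> carrier A \<Longrightarrow> f \<in> nspan"
proof -
  have letter_closed: "(\<lambda>w. word [l] * f w) \<in> nspan" if "f \<in> nspan" for l f
    using that by (cases l) (auto intro: span_left_x span_left[OF span_left_y_ordered])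
  have elt: "elt w r \<in> nspan" if w: "w \<in> W" for w r
  proof (induction r rule: tensor_alg_induct)
    case (const a)
    show ?case using span_scale[OF span_ordered[OF w, of "[]" "[]"], of a] elt_scale[of w "Poly_Mapping.single 0 a" 1]
      by (simp add: word_Nil)
  next
    case (letter l p)
    show ?case unfolding elt_scale by (rule letter_closed[OF letter])
  next
    case (add p q)
    show ?case unfolding elt_add by (rule span_add[OF add])
  qed
  assume "f \<in> carrier A"
  from smash_expansion[OF this] show ?thesis
    using span_sum[of W "\<lambda>w. elt w (f w)"] elt by metis
qed

subsection \<open>Ordered monomials are independent\<close>

text \<open>
  The leading term of a normal word is a monomial on \<open>V\<close>. A vector of the space is a
  function of the momentum and a covector one of the position, hence the exchange of the
  components.
\<close>

definition letter_fun :: "'n + 'n \<Rightarrow> 'n double \<Rightarrow> complex" where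
  "letter_fun l p = dcoord l (prod.swap p)"

lemma letter_fun_simps [simp]: "letter_fun (Inl j) p = snd p $ j" "letter_fun (Inr i) p = fst p $ i"
  by (simp_all add: letter_fun_def dcoord_def)

lemma polyfun_letters: "(\<lambda>p. \<Prod>l\<in>#m. letter_fun l p) \<in> polyfun"
proof (induction m)
  case (add l m)
  have "(\<lambda>p. letter_fun l p) \<in> polyfun"
    by (cases l) (simp_all add: polyfun_coord')
  then show ?case using polyfun_mult add by simp
qed (simp add: polyfun_const)

text \<open>
  The leading coefficients in the momenta: \<open>\<phi>\<close> is the coefficient in degree
  \<open>d\<close>, which bounds the degree.
\<close>

definition leading :: "nat \<Rightarrow> (complex^'n^'n \<Rightarrow> 'n double \<Rightarrow> complex) \<Rightarrow> 'n double operator \<Rightarrow> bool" where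
  "leading d \<phi> B \<longleftrightarrow> (\<forall>v\<in>W. \<forall>p\<in>G. degree (coef B v p) \<le> d \<and> poly.coeff (coef B v p) d = \<phi> v p)"

lemma leading_U: "w \<in> W \<Longrightarrow> leading 0 (\<lambda>v p. if v = w then 1 else 0) (U w)"
  by (auto simp: leading_def coef_U)

lemma leading_X: "leading d \<phi> B \<Longrightarrow> leading d (\<lambda>v p. pairing x (fst p) * \<phi> v p) (Xop x * B)"
  by (auto simp: leading_def coef_X_left intro: order.trans[OF degree_smult_le])

text \<open>The reflection part of a Dunkl operator does not raise the degree in the momenta.\<close>

lemma leading_D:
  assumes "leading d \<phi> B"
  shows "leading (Suc d) (\<lambda>v p. pairing (snd p) y * \<phi> v p) (Dop y * B)"
  unfolding leading_def
proof (intro ballI)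
  fix v p assume v: "v \<in> W" and p: "p \<in> G"
  have B: "degree (coef B v p) \<le> d" "poly.coeff (coef B v p) d = \<phi> v p" if "v \<in> W" "p \<in> G" for v p
    using assms that by (auto simp: leading_def)
  let ?R = "\<Sum>s\<in>S. [:rootfun s y p:] * coef B (matrix_inv s ** v) (bk s p)"
  have R: "degree ?R \<le> d"
    using v p by (intro degree_sum_le) (auto intro: order.trans[OF degree_smult_le] B)
  have L: "[:0, pairing (snd p) y:] * coef B v p = pCons 0 (Polynomial.smult (pairing (snd p) y) (coef B v p))"
    by simp
  have dL: "degree (pCons 0 (Polynomial.smult (pairing (snd p) y) (coef B v p))) \<le> Suc d"
    using B[OF v p] degree_smult_le[of "pairing (snd p) y" "coef B v p"]
    by (intro order.trans[OF degree_pCons_le]) simp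
  show "degree (coef (Dop y * B) v p) \<le> Suc d \<and> poly.coeff (coef (Dop y * B) v p) (Suc d) = pairing (snd p) y * \<phi> v p"
    unfolding coef_D_left[OF p v] L
  proof
    show "degree (pCons 0 (Polynomial.smult (pairing (snd p) y) (coef B v p)) + ?R) \<le> Suc d"
      using dL R by (intro degree_add_le) auto
    have "poly.coeff ?R (Suc d) = 0" using R by (intro coeff_eq_0) simp
    then show "poly.coeff (pCons 0 (Polynomial.smult (pairing (snd p) y) (coef B v p)) + ?R) (Suc d) =
      pairing (snd p) y * \<phi> v p"
      using B[OF v p] by simp
  qed
qed

lemma word_ordered_Cons:
  "word (ordered_word (x # xs) ys) = word [Inr x] * word (ordered_word xs ys)"
  "word (ordered_word [] (y # ys)) = word [Inl y] * word (ordered_word [] ys)"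
  by (simp_all add: mult_single plus_free_monoid_def)

lemma leading_word:
  assumes "w \<in> W"
  shows "leading (length ys) (\<lambda>v p. if v = w then \<Prod>l\<in>#mset (ordered_word xs ys). letter_fun l p else 0)
     (T (word (ordered_word xs ys)) * U w)"
proof (induction xs)
  case Nil
  show ?case
  proof (induction ys)
    case Nil
    show ?case using leading_U[OF assms] by (simp add: word_Nil cong: if_cong)
  next
    case (Cons y ys)
    have "Vop (basis_vector (Inl y)) = Dop (axis y 1)"
      using X_scale[of 0 0] by (simp add: Vop_def basis_vector_def operator.scalar_zero)
    then have "T (word (ordered_word [] (y # ys))) * U w = Dop (axis y 1) * (T (word (ordered_word [] ys)) * U w)"
      unfolding word_ordered_Cons T_hom T_letter mult.assoc by simp
    then show ?case using leading_D[OF Cons.IH, of "axis y 1"]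
      by (simp add: if_distrib cong: if_cong)
  qed
next
  case (Cons x xs)
  have "Vop (basis_vector (Inr x)) = Xop (axis x 1)"
    using D_scale[of 0 0] by (simp add: Vop_def basis_vector_def operator.scalar_zero)
  then have "T (word (ordered_word (x # xs) ys)) * U w = Xop (axis x 1) * (T (word (ordered_word xs ys)) * U w)"
    unfolding word_ordered_Cons T_hom T_letter mult.assoc by simp
  then show ?case using leading_X[OF Cons.IH, of "axis x 1"]
    by (simp add: if_distrib mult.assoc cong: if_cong)
qed

definition ydeg :: "('n + 'n) multiset \<Rightarrow> nat" where
  "ydeg m = size (filter_mset isl m)"

lemma leading_arrange:
  assumes "w \<in> W"
  shows "leading (ydeg m) (\<lambda>v p. if v = w then \<Prod>l\<in>#m. letter_fun l p else 0) (T (word (arrange m)) * U w)"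
proof -
  obtain xs ys where a: "arrange m = ordered_word xs ys" using arrange_ordered by blast
  have m: "mset (ordered_word xs ys) = m" using a by (metis mset_arrange)
  have "ydeg m = length ys"
    unfolding ydeg_def m[symmetric] by (simp add: filter_mset_image_mset)
  then show ?thesis using leading_word[OF assms, of ys xs] by (simp only: a m)
qed

text \<open>
  In a combination of normal words that is represented by zero, consider the words with the most
  letters from the space. The terms in the top degree give a linear relation between the
  corresponding monomials on \<open>G\<close>, hence everywhere; but monomials are independent.
\<close>

lemma normal_independent:
  assumes zero: "\<And>v p. v \<in> W \<Longrightarrow> p \<in> G \<Longrightarrow> coef (Theta (nform g)) v p = 0" and w: "w \<in> W"
  shows "g w = 0"
proof (rule ccontr)
  assume "g w \<noteq> 0"
  define K where "K = (SIGMA w:W. Poly_Mapping.keys (g w))"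
  have finK: "finite K" using finite_W by (simp add: K_def)
  obtain m where "m \<in> Poly_Mapping.keys (g w)" using \<open>g w \<noteq> 0\<close> by (metis all_not_in_conv keys_eq_empty)
  then have "(w, m) \<in> K" using w by (simp add: K_def)
  then have "K \<noteq> {}" by blast
  define d where "d = Max ((\<lambda>k. ydeg (snd k)) ` K)"
  have le: "ydeg m \<le> d" if "w \<in> W" "m \<in> Poly_Mapping.keys (g w)" for w m
    unfolding d_def using that finK by (intro Max_ge) (force simp: K_def)+
  have "d \<in> (\<lambda>k. ydeg (snd k)) ` K" unfolding d_def using finK \<open>K \<noteq> {}\<close> by (intro Max_in) auto
  then obtain w0 m0 where m0: "w0 \<in> W" "m0 \<in> Poly_Mapping.keys (g w0)" "ydeg m0 = d" by (auto simp: K_def)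
  define M where "M = {m \<in> Poly_Mapping.keys (g w0). ydeg m = d}"
  have vanish: "(\<Sum>m\<in>M. Poly_Mapping.lookup (g w0) m * (\<Prod>l\<in>#m. letter_fun l p)) = 0" if p: "p \<in> G" for p
  proof -
    have "Theta (nform g) = (\<Sum>w\<in>W. \<Sum>m\<in>Poly_Mapping.keys (g w).
        scalar_operator (Poly_Mapping.lookup (g w) m) * (T (word (arrange m)) * U w))"
      unfolding normal_expansion[of g] Theta_sum
      by (intro sum.cong refl) (simp add: Theta_scale Theta_at)
    then have "0 = poly.coeff (\<Sum>w\<in>W. \<Sum>m\<in>Poly_Mapping.keys (g w).
        Polynomial.smult (Poly_Mapping.lookup (g w) m) (coef (T (word (arrange m)) * U w) w0 p)) d"
      using zero[OF m0(1) p] by (simp add: coef_sum coef_scalar)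
    also have "\<dots> = (\<Sum>w\<in>W. \<Sum>m\<in>Poly_Mapping.keys (g w).
        Poly_Mapping.lookup (g w) m * (if w = w0 \<and> ydeg m = d then \<Prod>l\<in>#m. letter_fun l p else 0))"
      unfolding Polynomial.coeff_sum coeff_smult
    proof (intro sum.cong refl arg_cong2[where f = "(*)"])
      fix w m assume w: "w \<in> W" and m: "m \<in> Poly_Mapping.keys (g w)"
      have lead: "degree (coef (T (word (arrange m)) * U w) w0 p) \<le> ydeg m"
        "poly.coeff (coef (T (word (arrange m)) * U w) w0 p) (ydeg m) = (if w0 = w then \<Prod>l\<in>#m. letter_fun l p else 0)"
        using leading_arrange[OF w, of m] m0(1) p by (auto simp: leading_def)
      show "poly.coeff (coef (T (word (arrange m)) * U w) w0 p) d = (if w = w0 \<and> ydeg m = d then \<Prod>l\<in>#m. letter_fun l p else 0)"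
      proof (cases "ydeg m = d")
        case False
        then have "ydeg m < d" using le[OF w m] by simp
        then have "poly.coeff (coef (T (word (arrange m)) * U w) w0 p) d = 0"
          using lead(1) by (intro coeff_eq_0) simp
        then show ?thesis using False by simp
      qed (use lead in auto)
    qed
    also have "\<dots> = (\<Sum>w\<in>W. if w = w0 then (\<Sum>m\<in>M. Poly_Mapping.lookup (g w0) m * (\<Prod>l\<in>#m. letter_fun l p)) else 0)"
    proof (rule sum.cong[OF refl])
      fix w assume "w \<in> W"
      show "(\<Sum>m\<in>Poly_Mapping.keys (g w). Poly_Mapping.lookup (g w) m *
          (if w = w0 \<and> ydeg m = d then \<Prod>l\<in>#m. letter_fun l p else 0)) =
         (if w = w0 then (\<Sum>m\<in>M. Poly_Mapping.lookup (g w0) m * (\<Prod>l\<in>#m. letter_fun l p)) else 0)"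
        unfolding M_def by (auto simp: sum.inter_filter intro!: sum.cong)
    qed
    finally show ?thesis using m0(1) finite_W by simp
  qed
  have "(\<Sum>m\<in>M. Poly_Mapping.lookup (g w0) m * (\<Prod>l\<in>#m. letter_fun l p)) = 0" for p
    by (rule G_dense[OF _ vanish]) (intro polyfun_sum polyfun_mult polyfun_const polyfun_letters)
  from this[of "prod.swap p" for p]
  have "(\<Sum>m\<in>M. Poly_Mapping.lookup (g w0) m * (\<Prod>l\<in>#m. dcoord l p)) = 0" for p
    by (simp add: letter_fun_def)
  moreover have "finite M" "m0 \<in> M" using m0 by (auto simp: M_def)
  ultimately have "Poly_Mapping.lookup (g w0) m0 = 0" using monomials_independent by blast
  then show False using m0(2) by (simp add: in_keys_iff)
qed

text \<open>
  The Dunkl representation of the Cherednik algebra is faithful: every element is congruent to a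
  combination of normal words, and these are independent already in the representation. From here
  on equality in the Cherednik algebra is equality of the operators \<open>Theta\<close>.
\<close>

lemma kernel_eq_Ich:
  assumes f: "f \<in> carrier A" and zero: "\<And>v p. v \<in> W \<Longrightarrow> p \<in> G \<Longrightarrow> coef (Theta f) v p = 0"
  shows "f \<in> Ich"
proof -
  obtain g where g: "(\<lambda>w. f w - nform g w) \<in> Ich" using span_carrier[OF f] by (auto simp: nspan_def)
  then have "Theta (\<lambda>w. f w - nform g w) = 0" using Ich_kernel by (auto simp: kernel_def)
  then have "Theta f = Theta (nform g)" by (simp add: Theta_diff)
  then have "g w = 0" if "w \<in> W" for w using normal_independent[of g w] zero that by simp
  then have "nform g = (\<lambda>w. 0)" by (auto simp: nform_def)
  then show ?thesis using g by simp
qed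

lemma Ich_iff: "f \<in> Ich \<longleftrightarrow> f \<in> carrier A \<and> Theta f = 0"
  using Ich_kernel kernel_eq_Ich[of f] by (auto simp: kernel_def)

lemma normal_form_Theta: "f \<in> carrier A \<Longrightarrow> \<exists>g. Theta f = Theta (nform g)"
proof -
  assume "f \<in> carrier A"
  then obtain g where "(\<lambda>w. f w - nform g w) \<in> Ich" using span_carrier by (auto simp: nspan_def)
  then have "Theta (\<lambda>w. f w - nform g w) = 0" unfolding Ich_iff by blast
  then have "Theta f = Theta (nform g)" by (simp add: Theta_diff)
  then show ?thesis by blast
qed

subsection \<open>Regularity of the coordinates\<close>

text \<open>
  Multiplying a normal form by a coordinate gives a normal form again, as dual letters stand in
  front.
\<close>

lemma Theta_shift: "Theta (nform (\<lambda>w. Poly_Mapping.single {#Inr i#} 1 * g w)) = Xop (axis i 1) * Theta (nform g)"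
proof -
  have "T (normal_word (Poly_Mapping.single {#Inr i#} 1 * q)) * U w = Xop (axis i 1) * (T (normal_word q) * U w)"
    if w: "w \<in> W" for w q
  proof (induction q rule: poly_mapping_additive_induct)
    case (single m a)
    obtain xs ys where a: "arrange m = ordered_word xs ys" using arrange_ordered by blast
    have m: "mset (ordered_word (i # xs) ys) = {#Inr i#} + m" using a mset_arrange[of m] by simp
    have "elt w (1 * (word (ordered_word (i # xs) ys) - word (arrange ({#Inr i#} + m))) * 1) \<in> Ich"
      using teq_elt[OF teq_arrange w, of 1 "i # xs" ys 1] unfolding m .
    then have eq1: "T (word (ordered_word (i # xs) ys)) * U w = T (word (arrange ({#Inr i#} + m))) * U w"
      using w by (simp add: Ich_iff Theta_at left_diff_distrib)
    have eq2: "T (word (ordered_word (i # xs) ys)) = Xop (axis i 1) * T (word (arrange m))"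
      using D_scale[of 0 0] unfolding word_ordered_Cons T_hom T_letter a
      by (simp add: Vop_def basis_vector_def operator.scalar_zero)
    have eq3: "T (Poly_Mapping.single u a) = scalar_operator a * T (Poly_Mapping.single u 1)" for u
      using T_hom(6)[of "Poly_Mapping.single 0 a" "Poly_Mapping.single u 1"] by (simp add: mult_single)
    have "T (normal_word (Poly_Mapping.single {#Inr i#} 1 * Poly_Mapping.single m a)) * U w =
        scalar_operator a * (T (word (arrange ({#Inr i#} + m))) * U w)"
      unfolding mult_single mult_1 normal_word_single eq3[of "Word (arrange ({#Inr i#} + m))"] mult.assoc ..
    also have "\<dots> = scalar_operator a * Xop (axis i 1) * T (word (arrange m)) * U w"
      unfolding eq1[symmetric] eq2 mult.assoc ..
    also have "\<dots> = Xop (axis i 1) * (scalar_operator a * T (word (arrange m)) * U w)"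
      unfolding operator.scalar_central[of a "Xop (axis i 1)"] mult.assoc ..
    finally show ?case
      unfolding normal_word_single eq3[of "Word (arrange m)"] .
  qed (simp_all add: distrib_left distrib_right normal_word_add)
  then show ?thesis
    by (simp add: Theta_def nform_def sum_distrib_left)
qed

lemma lookup_shift: "Poly_Mapping.lookup (Poly_Mapping.single a 1 * q) m =
    (if a \<subseteq># m then Poly_Mapping.lookup q (m - a) else (0::complex))"
proof (induction q rule: poly_mapping_additive_induct)
  case (single k b)
  have "a + k = m \<longleftrightarrow> a \<subseteq># m \<and> k = m - a" by (auto simp: subset_mset.add_diff_inverse)
  then show ?case by (auto simp: mult_single lookup_single when_def)
qed (auto simp: lookup_add distrib_left)

lemma coprime_coordinates:
  assumes "i \<noteq> j" and eq: "Poly_Mapping.single {#Inr j#} 1 * q1 = Poly_Mapping.single {#Inr i#} 1 * (q2 :: ('n + 'n) multiset \<Rightarrow>\<^sub>0 complex)"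
  shows "\<exists>h. q1 = Poly_Mapping.single {#Inr i#} 1 * h"
proof
  have i: "Inr i \<in># m" if "m \<in> Poly_Mapping.keys q1" for m
  proof (rule ccontr)
    assume "Inr i \<notin># m"
    then have "\<not> {#Inr i#} \<subseteq># m + {#Inr j#}" using \<open>i \<noteq> j\<close> by simp
    then have "Poly_Mapping.lookup q1 m = 0"
      using arg_cong[OF eq, of "\<lambda>q. Poly_Mapping.lookup q (m + {#Inr j#})"] by (simp add: lookup_shift)
    then show False using that by (simp add: in_keys_iff)
  qed
  show "q1 = Poly_Mapping.single {#Inr i#} 1 *
      (\<Sum>m\<in>Poly_Mapping.keys q1. Poly_Mapping.single (m - {#Inr i#}) (Poly_Mapping.lookup q1 m))"
    using i by (simp add: sum_distrib_left mult_single sum_lookup_single)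
qed

text \<open>
  In normal form the algebra is free over the polynomials on the space, so two distinct
  coordinates form a regular sequence. This is what makes an element lie in the algebra when two
  of its multiples do.
\<close>

lemma coordinates_regular:
  assumes "i \<noteq> j" "f1 \<in> carrier A" "f2 \<in> carrier A"
    and eq: "Xop (axis j 1) * Theta f1 = Xop (axis i 1) * Theta f2"
  shows "\<exists>h\<in>carrier A. Theta f1 = Xop (axis i 1) * Theta h"
proof -
  let ?x = "\<lambda>i. Poly_Mapping.single {#Inr i#} (1::complex)"
  obtain g1 g2 where g: "Theta f1 = Theta (nform g1)" "Theta f2 = Theta (nform g2)"
    using normal_form_Theta assms(2,3) by metis
  have "Theta (nform (\<lambda>w. ?x j * g1 w)) = Theta (nform (\<lambda>w. ?x i * g2 w))"
    unfolding Theta_shift using eq g by simp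
  moreover have "nform (\<lambda>w. ?x j * g1 w - ?x i * g2 w) = (\<lambda>w. nform (\<lambda>w. ?x j * g1 w) w - nform (\<lambda>w. ?x i * g2 w) w)"
    by (rule ext) (simp add: nform_def normal_word_diff)
  ultimately have "Theta (nform (\<lambda>w. ?x j * g1 w - ?x i * g2 w)) = 0" by (simp add: Theta_diff)
  then have "?x j * g1 w = ?x i * g2 w" if "w \<in> W" for w
    using normal_independent[of "\<lambda>w. ?x j * g1 w - ?x i * g2 w" w] that by simp
  then have "\<exists>h. g1 w = ?x i * h" if "w \<in> W" for w
    using coprime_coordinates[OF assms(1)] that by blast
  then obtain h where h: "\<And>w. w \<in> W \<Longrightarrow> g1 w = ?x i * h w" by metis
  have "nform g1 = nform (\<lambda>w. ?x i * h w)" by (auto simp: nform_def h)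
  then have "Theta f1 = Xop (axis i 1) * Theta (nform h)" by (simp add: g Theta_shift)
  then show ?thesis using normal_carrier by blast
qed

end

section \<open>The centre of the invariant subalgebra\<close>

context finite_matrix_group
begin

definition Zc :: "(complex^'n^'n) set" where
  "Zc = {z \<in> W. \<forall>w\<in>W. z ** w = w ** z}"

lemma Zc_comm: "z \<in> Zc \<Longrightarrow> w \<in> W \<Longrightarrow> z ** w = w ** z"
  by (simp add: Zc_def)

lemma finite_Zc [simp]: "finite Zc"
  using finite_W by (simp add: Zc_def)

lemma Zc_W [simp]: "z \<in> Zc \<Longrightarrow> z \<in> W"
  by (simp add: Zc_def)

lemma smash_map_carrier: "f \<in> carrier A \<Longrightarrow> smash_map \<gamma> f \<in> carrier A"
  by (simp add: smash_carrier smash_map_def)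

lemma smash_map_elt: "smash_map \<gamma> (elt w r) = elt w (tensor_map \<gamma> r)"
  by (rule ext) (simp add: smash_map_def coefficient_at_def)

lemma smash_map_mult:
  assumes lin: "dlinear \<gamma>" and comm: "\<And>w v. w \<in> W \<Longrightarrow> \<gamma> (double_act w v) = double_act w (\<gamma> v)"
  shows "smash_map \<gamma> (f \<otimes>\<^bsub>A\<^esub> h) = smash_map \<gamma> f \<otimes>\<^bsub>A\<^esub> smash_map \<gamma> h"
proof -
  have "tensor_map \<gamma> (tensor_map (double_act w) r) = tensor_map (double_act w) (tensor_map \<gamma> r)"
    if "w \<in> W" for w r
  proof -
    have "(\<lambda>v. \<gamma> (double_act w v)) = (\<lambda>v. double_act w (\<gamma> v))" using comm[OF that] by auto
    then show ?thesis by (simp add: tensor_map_comp lin double_act_linear)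
  qed
  then show ?thesis
    by (auto simp: smash_map_def smash_mult tensor_map_sum intro!: sum.cong)
qed

end

text \<open>
  The list \<open>q\<close> of pairs \<open>(x, y)\<close> stands for the sum of the \<open>x y\<close>, where \<open>x\<close> is in the dual
  space and \<open>y\<close> in the space.
\<close>

definition quad_elt :: "((complex^'n) \<times> (complex^'n)) list \<Rightarrow> 'n::finite tensor_alg" where
  "quad_elt q = (\<Sum>(x, y)\<leftarrow>q. tensor_of (0, x) * tensor_of (y, 0))"

definition quad_fun :: "((complex^'n) \<times> (complex^'n)) list \<Rightarrow> 'n::finite double \<Rightarrow> complex" where
  "quad_fun q p = (\<Sum>(x, y)\<leftarrow>q. pairing x (fst p) * pairing (snd p) y)"

context dunkl
begin

lemma coef_times_X:
  "p \<in> G \<Longrightarrow> w \<in> W \<Longrightarrow> coef (B * (Xop x * U (mat 1))) w p = [:pairing x (fst (bk w p)):] * coef B w p"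
  using coef_U_right[of p "mat 1" w "B * Xop x"] coef_X_right[of B x w p]
proof -
  assume p: "p \<in> G" and w: "w \<in> W"
  have "coef (B * Xop x * U (mat 1)) w p = coef (B * Xop x) (w ** matrix_inv (mat 1)) p"
    by (rule coef_U_right[OF p W_one w])
  also have "w ** matrix_inv (mat 1) = w" using W_inv_unique[OF W_one, of "mat 1"] by simp
  finally show ?thesis by (simp only: coef_X_right mult.assoc)
qed

lemma coef_X_times:
  "p \<in> G \<Longrightarrow> w \<in> W \<Longrightarrow> coef (Xop x * U (mat 1) * B) w p = [:pairing x (fst p):] * coef B w p"
proof -
  assume p: "p \<in> G" and w: "w \<in> W"
  have "coef (U (mat 1) * B) w p = coef B (matrix_inv (mat 1) ** w) (bk (mat 1) p)"
    by (rule coef_U_left[OF p W_one w])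
  moreover have "matrix_inv (mat 1) ** w = w" using W_inv_unique[OF W_one, of "mat 1"] by simp
  ultimately show ?thesis by (simp only: coef_X_left mult.assoc bk_one)
qed

lemma coef_comm_U:
  assumes "B * U v = U v * B" "p \<in> G" "v \<in> W" "w \<in> W"
  shows "coef B w p = coef B (matrix_inv v ** w ** v) (bk v p)"
proof -
  have "coef (B * U v) (w ** v) p = coef B (w ** v ** matrix_inv v) p"
    using assms(2-4) by (intro coef_U_right) auto
  then have "coef B w p = coef (B * U v) (w ** v) p" using assms(3) by simp
  also have "\<dots> = coef (U v * B) (w ** v) p" by (simp only: assms(1))
  also have "\<dots> = coef B (matrix_inv v ** (w ** v)) (bk v p)" using assms by (intro coef_U_left) auto
  finally show ?thesis by (simp only: matrix_mul_assoc)
qed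

text \<open>All operators of this form are sums of functions times group elements.\<close>

lemma mul_invariant_central:
  assumes "\<And>v p. v \<in> W \<Longrightarrow> p \<in> G \<Longrightarrow> a (bk v p) = a p" and B: "Lop B"
  shows "mul a * B = B * mul a"
proof (rule operator_eqI)
  fix F p
  have "app B (app (mul a) F) p = (if p \<in> G then \<Sum>w\<in>W. coef B w p * (a (bk w p) * F (bk w p)) else 0)"
    by (simp add: Lop_coef[OF B] app_mul)
  also have "\<dots> = (if p \<in> G then \<Sum>w\<in>W. a p * (coef B w p * F (bk w p)) else 0)"
    by (simp add: assms(1) mult.left_commute)
  also have "\<dots> = a p * app B F p" by (simp add: Lop_coef[OF B] sum_distrib_left)
  finally show "app (mul a * B) F p = app (B * mul a) F p" by (simp add: app_simps app_mul)
qed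

definition central :: "(complex^'n^'n \<Rightarrow> 'n tensor_alg) \<Rightarrow> bool" where
  "central f \<longleftrightarrow> f \<in> carrier A \<and> (\<forall>h\<in>carrier A. Theta f * Theta h = Theta h * Theta f)"

lemma Theta_group: "w \<in> W \<Longrightarrow> Theta (elt w 1) = U w"
  by (simp add: Theta_at)

lemma Theta_x: "Theta (elt (mat 1) (tensor_of (0, x))) = Xop x * U (mat 1)"
proof -
  have "Dop 0 = 0" using D_scale[of 0 0] by (simp add: operator.scalar_zero)
  then show ?thesis by (simp add: Theta_at T_vector Vop_def)
qed

text \<open>The coordinates separate the points of an orbit.\<close>

lemma moved_coordinate:
  assumes "p \<in> G" "w \<in> W" "w \<noteq> mat 1"
  shows "\<exists>i. fst (bk w p) $ i \<noteq> fst p $ i"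
proof -
  have "fst (bk w p) \<noteq> fst p"
  proof
    assume "fst (bk w p) = fst p"
    then have "matrix_inv w = mat 1" using G_free[OF assms(1)] assms(2) by (simp add: double_act_def)
    then show False using assms by (metis W_inverses(1) matrix_mul_rid)
  qed
  then show ?thesis by (auto simp: vec_eq_iff)
qed

text \<open>
  Commuting with the coordinates forces a coefficient to vanish at group elements that move the
  point, and commuting with the group makes the remaining one invariant.
\<close>

lemma central_coef:
  assumes f: "central f" and w: "w \<in> W" and p: "p \<in> G"
  shows "w \<noteq> mat 1 \<Longrightarrow> coef (Theta f) w p = 0"
    and "v \<in> W \<Longrightarrow> coef (Theta f) (mat 1) (bk v p) = coef (Theta f) (mat 1) p"
proof -
  have comm: "Theta f * Theta h = Theta h * Theta f" if "h \<in> carrier A" for h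
    using f that by (auto simp: central_def)
  show "coef (Theta f) w p = 0" if ne: "w \<noteq> mat 1"
  proof -
    obtain i where i: "fst (bk w p) $ i \<noteq> fst p $ i" using moved_coordinate[OF p w ne] by blast
    have "Theta f * (Xop (axis i 1) * U (mat 1)) = Xop (axis i 1) * U (mat 1) * Theta f"
      using comm[OF smash_at_carrier[OF W_one, of "tensor_of (0, axis i 1)"]] by (simp only: Theta_x)
    then have "[:fst (bk w p) $ i:] * coef (Theta f) w p = [:fst p $ i:] * coef (Theta f) w p"
      using coef_times_X[of p w "Theta f" "axis i 1"] coef_X_times[of p w "axis i 1" "Theta f"] w p by simp
    then have "Polynomial.smult (fst (bk w p) $ i - fst p $ i) (coef (Theta f) w p) = 0"
      by (simp add: smult_diff_left)
    then show ?thesis using i by simp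
  qed
  show "coef (Theta f) (mat 1) (bk v p) = coef (Theta f) (mat 1) p" if v: "v \<in> W"
  proof -
    have "Theta f * U v = U v * Theta f" using comm[OF smash_at_carrier[OF v, of 1]] by (simp only: Theta_group[OF v])
    from coef_comm_U[OF this p v W_one] show ?thesis using v by simp
  qed
qed

lemma centralI:
  assumes f: "f \<in> carrier A"
    and off: "\<And>w p. w \<in> W \<Longrightarrow> p \<in> G \<Longrightarrow> w \<noteq> mat 1 \<Longrightarrow> coef (Theta f) w p = 0"
    and inv: "\<And>v p. v \<in> W \<Longrightarrow> p \<in> G \<Longrightarrow> coef (Theta f) (mat 1) (bk v p) = coef (Theta f) (mat 1) p"
  shows "central f"
proof -
  define a where "a = coef (Theta f) (mat 1)"
  have eq: "Theta f = mul a * U (mat 1)"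
  proof (rule Lop_eqI)
    show "Lop (Theta f)" by (rule Lop_Theta)
    show "Lop (mul a * U (mat 1))" by (intro Lop_mul_left Lop_U W_one)
    show "coef (Theta f) w p = coef (mul a * U (mat 1)) w p" if "w \<in> W" "p \<in> G" for w p
      using off[OF that] that by (simp add: coef_mul_left coef_U a_def)
  qed
  have one: "U (mat 1) * Theta h = Theta h" "Theta h * U (mat 1) = Theta h" if "h \<in> carrier A" for h
  proof -
    have unit: "\<one>\<^bsub>A\<^esub> \<otimes>\<^bsub>A\<^esub> h = h" "h \<otimes>\<^bsub>A\<^esub> \<one>\<^bsub>A\<^esub> = h" using that by simp_all
    show "U (mat 1) * Theta h = Theta h" "Theta h * U (mat 1) = Theta h"
      by (simp_all only: Theta_mult[symmetric] Theta_group[OF W_one, symmetric] unit[unfolded smash_one])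
  qed
  have comm: "mul a * Theta h = Theta h * mul a" for h
    by (rule mul_invariant_central[of a]) (use inv Lop_Theta in \<open>auto simp: a_def\<close>)
  have "Theta f * Theta h = Theta h * Theta f" if h: "h \<in> carrier A" for h
  proof -
    have "Theta f * Theta h = mul a * Theta h" unfolding eq mult.assoc one(1)[OF h] ..
    moreover have "Theta h * Theta f = mul a * Theta h"
      unfolding eq mult.assoc[symmetric] comm[symmetric] unfolding mult.assoc one(2)[OF h] ..
    ultimately show ?thesis by simp
  qed
  then show ?thesis using f unfolding central_def by blast
qed

text \<open>
  The leading part of a quadratic element is its function, times the identity of the group.
\<close>

lemma quad_operator:
  "\<exists>r. T (quad_elt q) = mul (\<lambda>p. [:0, quad_fun q p:]) + (\<Sum>s\<in>S. mul (\<lambda>p. [:r s p:]) * U s)"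
proof (induction q)
  case Nil
  show ?case
    by (rule exI[of _ "\<lambda>s p. 0"], rule operator_eqI)
      (simp add: quad_elt_def quad_fun_def app_simps app_mul app_sum)
next
  case (Cons a q)
  obtain x y where a: "a = (x, y)" by (cases a)
  obtain r where r: "T (quad_elt q) = mul (\<lambda>p. [:0, quad_fun q p:]) + (\<Sum>s\<in>S. mul (\<lambda>p. [:r s p:]) * U s)"
    using Cons.IH by blast
  have 0: "Dop 0 = 0" "Xop 0 = 0" using D_scale[of 0 0] X_scale[of 0 0] by (simp_all add: operator.scalar_zero)
  have "T (quad_elt (a # q)) = Xop x * Dop y + T (quad_elt q)"
    by (simp add: quad_elt_def a T_vector Vop_def 0)
  also have "\<dots> = mul (\<lambda>p. [:0, quad_fun (a # q) p:]) +
      (\<Sum>s\<in>S. mul (\<lambda>p. [:pairing x (fst p) * rootfun s y p + r s p:]) * U s)"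
    unfolding r
    by (rule operator_eqI)
      (simp add: quad_fun_def a app_simps app_mul app_sum app_X app_D app_U smult_add_right smult_add_left
        smult_sum_right sum.distrib algebra_simps)
  finally show ?case
    by (intro exI[of _ "\<lambda>s p. pairing x (fst p) * rootfun s y p + r s p"])
qed

text \<open>
  Compare in the commutator of \<open>B\<close> with the quadratic element the coefficients in one
  degree more than the maximal one on the orbit. Only the leading part of the quadratic element
  contributes, on either side by its value at one of the two points.
\<close>

lemma quad_fun_leading:
  assumes comm: "B * (T (quad_elt q) * U (mat 1)) = T (quad_elt q) * U (mat 1) * B"
    and p: "p \<in> G" and w: "w \<in> W" and nz: "coef B w p \<noteq> 0"
    and max: "\<And>v u. v \<in> W \<Longrightarrow> u \<in> W \<Longrightarrow> degree (coef B v (bk u p)) \<le> degree (coef B w p)"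
  shows "quad_fun q (bk w p) = quad_fun q p"
proof -
  obtain r where r: "T (quad_elt q) = mul (\<lambda>p. [:0, quad_fun q p:]) + (\<Sum>s\<in>S. mul (\<lambda>p. [:r s p:]) * U s)"
    using quad_operator by blast
  define d where "d = degree (coef B w p)"
  have one: "matrix_inv (mat 1) = (mat 1 :: complex^'n^'n)" using W_inv_unique[OF W_one, of "mat 1"] by simp
  have deg: "poly.coeff (coef B v (bk u p)) (Suc d) = 0" if "v \<in> W" "u \<in> W" for u v
    using max[OF that] by (intro coeff_eq_0) (simp add: d_def)
  have deg1: "poly.coeff (coef B v p) (Suc d) = 0" if "v \<in> W" for v
    using deg[OF that W_one] by simp
  have L: "coef (B * (T (quad_elt q) * U (mat 1))) w p = [:0, quad_fun q (bk w p):] * coef B w p +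
      (\<Sum>s\<in>S. [:r s (bk (w ** matrix_inv s) p):] * coef B (w ** matrix_inv s) p)"
    using p w unfolding r
    by (simp add: distrib_left distrib_right sum_distrib_left sum_distrib_right coef_add coef_sum
        mult.assoc[symmetric] coef_U_right coef_mul_right one)
  have R: "coef (T (quad_elt q) * U (mat 1) * B) w p = [:0, quad_fun q p:] * coef B w p +
      (\<Sum>s\<in>S. [:r s p:] * coef B (matrix_inv s ** w) (bk s p))"
    using p w unfolding r
    by (simp add: distrib_right sum_distrib_right coef_add coef_sum mult.assoc coef_U_left coef_mul_left one)
  have "poly.coeff ([:0, quad_fun q (bk w p):] * coef B w p) (Suc d) = poly.coeff ([:0, quad_fun q p:] * coef B w p) (Suc d)"
    using arg_cong[OF comm, of "\<lambda>C. poly.coeff (coef C w p) (Suc d)"] w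
    unfolding L R by (simp add: Polynomial.coeff_sum deg deg1)
  then have "quad_fun q (bk w p) * poly.coeff (coef B w p) d = quad_fun q p * poly.coeff (coef B w p) d"
    using w by (simp add: deg1)
  then show ?thesis using nz by (simp add: d_def)
qed

end

text \<open>
  What the torus and the special linear group have in common. The groups preserve the defining
  relations, contain the scalars in \<open>W\<close>, and have enough quadratic invariants to tell
  a generic point from its images under the nonscalar elements of \<open>W\<close>.
\<close>

locale gamma_setting = dunkl W \<alpha> \<alpha>v c G
  for W :: "(complex^'n^'n) set" and \<alpha> \<alpha>v c G +
  fixes \<Gamma> :: "('n double \<Rightarrow> 'n double) set"
  assumes centre_scalar: "\<And>z. z \<in> Zc \<Longrightarrow> \<exists>k. \<forall>v. z *v v = k *s v"
    and two_indices: "\<exists>i j :: 'n. i \<noteq> j"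
    and Gamma_linear: "\<And>\<gamma>. \<gamma> \<in> \<Gamma> \<Longrightarrow> dlinear \<gamma>"
    and Gamma_comm: "\<And>\<gamma> w v. \<gamma> \<in> \<Gamma> \<Longrightarrow> w \<in> W \<Longrightarrow> \<gamma> (double_act w v) = double_act w (\<gamma> v)"
    and Gamma_inv: "\<And>\<gamma>. \<gamma> \<in> \<Gamma> \<Longrightarrow> \<exists>\<delta>\<in>\<Gamma>. (\<forall>v. \<gamma> (\<delta> v) = v) \<and> (\<forall>v. \<delta> (\<gamma> v) = v)"
    and Gamma_omega: "\<And>\<gamma> s v v'. \<gamma> \<in> \<Gamma> \<Longrightarrow> s \<in> reflections W \<Longrightarrow> omega s (\<gamma> v) (\<gamma> v') = omega s v v'"
    and Gamma_centre: "\<And>z. z \<in> Zc \<Longrightarrow> double_act z \<in> \<Gamma>"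
    and Gamma_separates: "\<And>w p. w \<in> W \<Longrightarrow> w \<notin> Zc \<Longrightarrow> p \<in> G \<Longrightarrow>
      \<exists>q. (\<forall>\<gamma>\<in>\<Gamma>. coefficient_at (mat 1) (tensor_map \<gamma> (quad_elt q) - quad_elt q) \<in> cherednik_ideal W \<alpha> \<alpha>v 0 c) \<and>
          quad_fun q (double_act (matrix_inv w) p) \<noteq> quad_fun q p"
begin

lemma smash_map_hom: "\<gamma> \<in> \<Gamma> \<Longrightarrow> smash_map \<gamma> (f \<otimes>\<^bsub>A\<^esub> h) = smash_map \<gamma> f \<otimes>\<^bsub>A\<^esub> smash_map \<gamma> h"
  by (rule smash_map_mult[OF Gamma_linear Gamma_comm])

lemma smash_map_add: "smash_map \<gamma> (\<lambda>g. f g + h g) = (\<lambda>g. smash_map \<gamma> f g + smash_map \<gamma> h g)"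
  and smash_map_diff: "smash_map \<gamma> (\<lambda>g. f g - h g) = (\<lambda>g. smash_map \<gamma> f g - smash_map \<gamma> h g)"
  and smash_map_uminus: "smash_map \<gamma> (\<lambda>g. - f g) = (\<lambda>g. - smash_map \<gamma> f g)"
  and smash_map_zero: "smash_map \<gamma> (\<lambda>g. 0) = (\<lambda>g. 0)"
  and smash_map_sum: "smash_map \<gamma> (\<lambda>g. \<Sum>i\<in>I. F i g) = (\<lambda>g. \<Sum>i\<in>I. smash_map \<gamma> (F i) g)"
  by (simp_all add: smash_map_def tensor_map_sum)

lemma smash_map_relation: "\<gamma> \<in> \<Gamma> \<Longrightarrow> smash_map \<gamma> (relation v v') = relation (\<gamma> v) (\<gamma> v')"
proof -
  assume \<gamma>: "\<gamma> \<in> \<Gamma>"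
  have "smash_map \<gamma> (relation v v') = (\<lambda>g. elt (mat 1) (tensor_map \<gamma> (tensor_of v * tensor_of v' - tensor_of v' * tensor_of v)) g +
     (\<Sum>s\<in>S. elt s (tensor_map \<gamma> (Poly_Mapping.single 0 (omega s v v'))) g))"
    unfolding relation_def smash_map_add smash_map_sum smash_map_elt ..
  also have "\<dots> = relation (\<gamma> v) (\<gamma> v')"
    unfolding relation_def by (simp add: tensor_map_tensor_of[OF Gamma_linear[OF \<gamma>]] Gamma_omega[OF \<gamma>])
  finally show ?thesis .
qed

lemma smash_map_Ich:
  assumes \<gamma>: "\<gamma> \<in> \<Gamma>" and f: "f \<in> Ich"
  shows "smash_map \<gamma> f \<in> Ich"
proof -
  let ?J = "{f \<in> carrier A. smash_map \<gamma> f \<in> Ich}"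
  have "ideal ?J A"
  proof (rule idealI)
    show "subgroup ?J (add_monoid A)"
    proof (rule subgroup.intro)
      show "inv\<^bsub>add_monoid A\<^esub> f \<in> ?J" if "f \<in> ?J" for f
        using that smash.CP.a_inv_closed[of f] by (auto simp: smash_uminus smash_map_uminus Ich_uminus simp flip: a_inv_def)
    qed (auto simp: smash_add smash_map_add Ich_add smash_zero smash_map_zero Ich_zero smash_carrier)
  qed (auto simp: smash_ring smash_map_hom[OF \<gamma>] intro: Ich_left Ich_right smash_map_carrier)
  moreover have "cherednik_relations W \<alpha> \<alpha>v 0 c \<subseteq> ?J"
    unfolding cherednik_relations_eq by (auto simp: relation_carrier smash_map_relation[OF \<gamma>] relation_Ich)
  ultimately have "Ich \<subseteq> ?J"
    unfolding cherednik_ideal_def by (rule smash.CP.genideal_minimal)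
  then show ?thesis using f by blast
qed

lemma Theta_smash_map_cong:
  assumes "\<gamma> \<in> \<Gamma>" "f \<in> carrier A" "h \<in> carrier A" "Theta f = Theta h"
  shows "Theta (smash_map \<gamma> f) = Theta (smash_map \<gamma> h)"
proof -
  have "(\<lambda>g. f g - h g) \<in> Ich" using assms by (simp add: Ich_iff Theta_diff smash_carrier)
  from smash_map_Ich[OF assms(1) this] show ?thesis by (simp add: Ich_iff smash_map_diff Theta_diff)
qed

definition fixed :: "(complex^'n^'n \<Rightarrow> 'n tensor_alg) \<Rightarrow> bool" where
  "fixed f \<longleftrightarrow> f \<in> carrier A \<and> (\<forall>\<gamma>\<in>\<Gamma>. Theta (smash_map \<gamma> f) = Theta f)"

definition fixed_central :: "(complex^'n^'n \<Rightarrow> 'n tensor_alg) \<Rightarrow> bool" where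
  "fixed_central f \<longleftrightarrow> fixed f \<and> (\<forall>h. fixed h \<longrightarrow> Theta f * Theta h = Theta h * Theta f)"

lemma fixed_group: "w \<in> W \<Longrightarrow> fixed (elt w 1)"
  by (simp add: fixed_def smash_at_carrier smash_map_elt)

lemma fixed_mult: "fixed f \<Longrightarrow> fixed h \<Longrightarrow> fixed (f \<otimes>\<^bsub>A\<^esub> h)"
  by (auto simp: fixed_def smash_map_hom Theta_mult)

text \<open>
  A central \<open>z\<close> acts on the tensor algebra through an element of
  \<open>\<Gamma>\<close>, so conjugation by it fixes the invariants.
\<close>

lemma centre_commutes:
  assumes z: "z \<in> Zc" and f: "fixed f"
  shows "U z * Theta f = Theta f * U z"
proof -
  have "U z * (T (f w) * U w) = T (tensor_map (double_act z) (f w)) * U w * U z" if w: "w \<in> W" for w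
  proof -
    have "U z * (T (f w) * U w) = T (tensor_map (double_act z) (f w)) * (U z * U w)"
      using U_T[OF Zc_W[OF z], of "f w"] by (simp only: mult.assoc[symmetric])
    also have "U z * U w = U w * U z" using z w by (simp add: U_mult Zc_comm)
    finally show ?thesis by (simp only: mult.assoc)
  qed
  then have "U z * Theta f = Theta (smash_map (double_act z) f) * U z"
    by (simp add: Theta_def sum_distrib_left sum_distrib_right smash_map_def)
  then show ?thesis using f Gamma_centre[OF z] by (simp add: fixed_def)
qed

lemma fixed_central_group: "z \<in> Zc \<Longrightarrow> fixed_central (elt z 1)"
  by (simp add: fixed_central_def fixed_group Theta_group centre_commutes)

text \<open>
  Otherwise there is a coefficient of maximal degree among all coefficients on the orbit of a
  point. It belongs to a nonscalar element, so a quadratic invariant distinguishes the two points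
  that it connects; but the commutator with this invariant vanishes.
\<close>

lemma commutant_vanishes:
  assumes quad: "\<And>q. (\<forall>\<gamma>\<in>\<Gamma>. elt (mat 1) (tensor_map \<gamma> (quad_elt q) - quad_elt q) \<in> Ich) \<Longrightarrow>
      B * (T (quad_elt q) * U (mat 1)) = T (quad_elt q) * U (mat 1) * B"
    and scalar: "\<And>z p. z \<in> Zc \<Longrightarrow> p \<in> G \<Longrightarrow> coef B z p = 0"
    and w: "w \<in> W" and p: "p \<in> G"
  shows "coef B w p = 0"
proof (rule ccontr)
  assume nz: "coef B w p \<noteq> 0"
  define K where "K = {(v, u). v \<in> W \<and> u \<in> W \<and> coef B v (bk u p) \<noteq> 0}"
  have "K \<subseteq> W \<times> W" by (auto simp: K_def)
  then have fin: "finite K" using finite_W finite_subset by blast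
  have "(w, mat 1) \<in> K" using nz w by (simp add: K_def)
  then have ne: "K \<noteq> {}" by blast
  define deg where "deg k = degree (coef B (fst k) (bk (snd k) p))" for k
  have "Max (deg ` K) \<in> deg ` K" using fin ne by (intro Max_in) auto
  then obtain v u where vu: "(v, u) \<in> K" "deg (v, u) = Max (deg ` K)" by auto
  then have v: "v \<in> W" and u: "u \<in> W" and nz': "coef B v (bk u p) \<noteq> 0" by (auto simp: K_def)
  have le: "degree (coef B v' (bk u' (bk u p))) \<le> degree (coef B v (bk u p))" if v': "v' \<in> W" and u': "u' \<in> W" for v' u'
  proof (cases "coef B v' (bk u' (bk u p)) = 0")
    case False
    then have "(v', u ** u') \<in> K" using v' u' u by (simp add: K_def back_mult)
    then have "deg (v', u ** u') \<le> deg (v, u)" unfolding vu(2) using fin by (intro Max_ge) auto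
    then show ?thesis using u u' by (simp add: deg_def back_mult)
  qed simp
  have "v \<notin> Zc" using scalar[of v "bk u p"] nz' back_G[OF p u] by blast
  then obtain q where q: "\<forall>\<gamma>\<in>\<Gamma>. elt (mat 1) (tensor_map \<gamma> (quad_elt q) - quad_elt q) \<in> Ich"
    "quad_fun q (bk v (bk u p)) \<noteq> quad_fun q (bk u p)"
    using Gamma_separates[OF v, of "bk u p"] u p by auto
  have "quad_fun q (bk v (bk u p)) = quad_fun q (bk u p)"
    by (rule quad_fun_leading[OF quad[OF q(1)] _ v nz' le]) (use p u in auto)
  then show False using q(2) by simp
qed

lemma fixed_quad:
  assumes "\<forall>\<gamma>\<in>\<Gamma>. elt (mat 1) (tensor_map \<gamma> (quad_elt q) - quad_elt q) \<in> Ich"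
  shows "fixed (elt (mat 1) (quad_elt q))"
  using assms by (auto simp: fixed_def smash_at_carrier smash_map_elt Ich_iff Theta_at left_diff_distrib)

text \<open>
  The coefficients at scalars are invariant functions, since scalars commute with
  \<open>W\<close>. The part of \<open>f\<close> supported on scalars therefore commutes with the
  invariants, and so does the rest, to which the previous lemma applies.
\<close>

lemma fixed_central_support:
  assumes f: "fixed_central f"
  shows "z \<in> Zc \<Longrightarrow> p \<in> G \<Longrightarrow> v \<in> W \<Longrightarrow> coef (Theta f) z (bk v p) = coef (Theta f) z p"
    and "w \<in> W \<Longrightarrow> w \<notin> Zc \<Longrightarrow> p \<in> G \<Longrightarrow> coef (Theta f) w p = 0"
proof -
  have comm: "Theta f * Theta h = Theta h * Theta f" if "fixed h" for h
    using f that by (simp add: fixed_central_def)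
  have commU: "Theta f * U v = U v * Theta f" if "v \<in> W" for v
    using comm[OF fixed_group[OF that]] by (simp only: Theta_group[OF that])
  have inv: "coef (Theta f) z (bk v p) = coef (Theta f) z p" if "z \<in> Zc" "p \<in> G" "v \<in> W" for z p v
  proof -
    have "matrix_inv v ** z ** v = z"
      using that by (metis W_cancel(2) Zc_comm matrix_mul_assoc)
    then show ?thesis using coef_comm_U[OF commU that(2) that(3) Zc_W[OF that(1)]] that by simp
  qed
  show "z \<in> Zc \<Longrightarrow> p \<in> G \<Longrightarrow> v \<in> W \<Longrightarrow> coef (Theta f) z (bk v p) = coef (Theta f) z p" by (rule inv)
  define E where "E z = mul (coef (Theta f) z) * U z" for z
  define B where "B = Theta f - (\<Sum>z\<in>Zc. E z)"
  have coefE: "coef (E z) w p = (if w = z then coef (Theta f) z p else 0)" if "z \<in> Zc" "w \<in> W" "p \<in> G" for z w p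
    using that by (simp add: E_def coef_mul_left coef_U)
  have coefB: "coef B w p = coef (Theta f) w p - (if w \<in> Zc then coef (Theta f) w p else 0)" if "w \<in> W" "p \<in> G" for w p
  proof -
    have "(\<Sum>z\<in>Zc. coef (E z) w p) = (\<Sum>z\<in>Zc. if z = w then coef (Theta f) w p else 0)"
      using that by (intro sum.cong) (auto simp: coefE)
    then show ?thesis by (simp add: B_def coef_diff coef_sum)
  qed
  have commE: "E z * Theta h = Theta h * E z" if z: "z \<in> Zc" and h: "fixed h" for z h
  proof -
    have "E z * Theta h = mul (coef (Theta f) z) * Theta h * U z"
      unfolding E_def mult.assoc centre_commutes[OF z h] ..
    also have "mul (coef (Theta f) z) * Theta h = Theta h * mul (coef (Theta f) z)"
      by (rule mul_invariant_central[of "coef (Theta f) z"]) (use inv[OF z] Lop_Theta in auto)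
    finally show ?thesis unfolding E_def mult.assoc .
  qed
  have commB: "B * Theta h = Theta h * B" if "fixed h" for h
    unfolding B_def left_diff_distrib right_diff_distrib sum_distrib_left sum_distrib_right
    using comm[OF that] commE[OF _ that] by simp
  have "coef B w p = 0" if "w \<in> W" "p \<in> G" for w p
  proof (rule commutant_vanishes[OF _ _ that])
    fix q assume "\<forall>\<gamma>\<in>\<Gamma>. elt (mat 1) (tensor_map \<gamma> (quad_elt q) - quad_elt q) \<in> Ich"
    from commB[OF fixed_quad[OF this]]
    show "B * (T (quad_elt q) * U (mat 1)) = T (quad_elt q) * U (mat 1) * B" by (simp only: Theta_at[OF W_one])
  next
    fix z p assume "z \<in> Zc" "p \<in> G"
    then show "coef B z p = 0" by (simp add: coefB)
  qed
  then have diff: "coef (Theta f) w p - (if w \<in> Zc then coef (Theta f) w p else 0) = 0" if "w \<in> W" "p \<in> G" for w p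
    using coefB[OF that] that by metis
  then show "w \<in> W \<Longrightarrow> w \<notin> Zc \<Longrightarrow> p \<in> G \<Longrightarrow> coef (Theta f) w p = 0"
  proof -
    assume "w \<in> W" "w \<notin> Zc" "p \<in> G"
    with diff[of w p] show ?thesis by simp
  qed
qed

subsection \<open>Separating the central components\<close>

definition chi :: "complex^'n^'n \<Rightarrow> complex" where
  "chi z = (SOME k. \<forall>v. z *v v = k *s v)"

lemma chi: "z \<in> Zc \<Longrightarrow> z *v v = chi z *s v"
  unfolding chi_def using someI_ex[OF centre_scalar] by blast

lemma chi_nonzero: "z \<in> Zc \<Longrightarrow> chi z \<noteq> 0"
proof
  fix i :: 'n
  assume z: "z \<in> Zc" and "chi z = 0"
  then have "z *v axis i 1 = 0" using chi by simp
  then have "matrix_inv z *v (z *v axis i 1) = 0" by simp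
  then have "axis i (1::complex) = 0" using z by (simp add: matrix_vector_mul_assoc)
  then show False by (simp add: axis_eq_0_iff)
qed

lemma chi_inj: "z \<in> Zc \<Longrightarrow> z' \<in> Zc \<Longrightarrow> chi z = chi z' \<Longrightarrow> z = z'"
  by (subst matrix_eq) (simp add: chi)

lemma fst_bk_centre: "z \<in> Zc \<Longrightarrow> fst (bk z p) = inverse (chi z) *s fst p"
proof -
  assume z: "z \<in> Zc"
  have "fst p = z *v (matrix_inv z *v fst p)" using z by (simp add: matrix_vector_mul_assoc)
  also have "\<dots> = chi z *s (matrix_inv z *v fst p)" by (rule chi[OF z])
  finally have "inverse (chi z) *s fst p = inverse (chi z) *s (chi z *s (matrix_inv z *v fst p))" by (rule arg_cong)
  then show ?thesis using chi_nonzero[OF z] by (simp add: double_act_def)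
qed

text \<open>
  The localized elements, supported on scalars, that belong to the algebra. The components of a
  central element of the invariants are obviously localized elements, and the point is to show
  that each of them is realizable.
\<close>

definition realizable :: "(complex^'n^'n \<Rightarrow> 'n double \<Rightarrow> complex poly) \<Rightarrow> bool" where
  "realizable b \<longleftrightarrow> (\<exists>f\<in>carrier A. \<forall>w\<in>W. \<forall>p\<in>G. coef (Theta f) w p = (if w \<in> Zc then b w p else 0))"

lemma realizable_add: "realizable a \<Longrightarrow> realizable b \<Longrightarrow> realizable (\<lambda>z p. a z p + b z p)"
proof -
  assume "realizable a" "realizable b"
  then obtain f h where "f \<in> carrier A" "h \<in> carrier A"
    "\<forall>w\<in>W. \<forall>p\<in>G. coef (Theta f) w p = (if w \<in> Zc then a w p else 0)"
    "\<forall>w\<in>W. \<forall>p\<in>G. coef (Theta h) w p = (if w \<in> Zc then b w p else 0)" unfolding realizable_def by blast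
  then show ?thesis unfolding realizable_def
    by (intro bexI[of _ "\<lambda>g. f g + h g"]) (auto simp: Theta_add coef_add smash_carrier)
qed

lemma realizable_scale: "realizable a \<Longrightarrow> realizable (\<lambda>z p. Polynomial.smult k (a z p))"
proof -
  assume "realizable a"
  then obtain f where "f \<in> carrier A"
    "\<forall>w\<in>W. \<forall>p\<in>G. coef (Theta f) w p = (if w \<in> Zc then a w p else 0)" unfolding realizable_def by blast
  then show ?thesis unfolding realizable_def
    by (intro bexI[of _ "\<lambda>g. Poly_Mapping.single 0 k * f g"]) (auto simp: Theta_scale coef_scalar smash_carrier)
qed

lemma realizable_diff: "realizable a \<Longrightarrow> realizable b \<Longrightarrow> realizable (\<lambda>z p. a z p - b z p)"
  using realizable_add[OF _ realizable_scale[of b "-1"], of a] by simp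

lemma realizable_cong: "realizable a \<Longrightarrow> (\<And>z p. z \<in> Zc \<Longrightarrow> p \<in> G \<Longrightarrow> a z p = b z p) \<Longrightarrow> realizable b"
  unfolding realizable_def by (metis (no_types, lifting))

text \<open>
  Moving a coordinate \<open>x\<close> through a scalar \<open>z\<close> divides it by
  \<open>\<chi>(z)\<close>. Hence if \<open>f\<close> has the coefficients \<open>b\<close>, then
  \<open>f x = x f'\<close> where \<open>f'\<close> is the localized element with the twisted
  coefficients. So \<open>x f'\<close> lies in the algebra for two independent coordinates
  \<open>x\<close>, and then \<open>f'\<close> does, by regularity. This is where the dimension
  has to be greater than one.
\<close>

lemma realizable_twist:
  assumes "realizable b"
  shows "realizable (\<lambda>z p. Polynomial.smult (inverse (chi z)) (b z p))"
proof -
  obtain f where f: "f \<in> carrier A" and b: "\<And>w p. w \<in> W \<Longrightarrow> p \<in> G \<Longrightarrow> coef (Theta f) w p = (if w \<in> Zc then b w p else 0)"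
    using assms unfolding realizable_def by blast
  obtain i j :: 'n where ij: "i \<noteq> j" using two_indices by blast
  define h where "h i = f \<otimes>\<^bsub>A\<^esub> elt (mat 1) (tensor_of (0, axis i 1))" for i
  have h: "h i \<in> carrier A" for i unfolding h_def
    by (intro smash.CP.m_closed f smash_at_carrier W_one)
  have coefh: "coef (Theta (h i)) w p = (if w \<in> Zc then Polynomial.smult (fst p $ i * inverse (chi w)) (b w p) else 0)"
    if "w \<in> W" "p \<in> G" for w p i
  proof -
    have "coef (Theta (h i)) w p = [:fst (bk w p) $ i:] * coef (Theta f) w p"
      using coef_times_X[OF that(2,1), of "Theta f" "axis i 1"] by (simp add: h_def Theta_mult Theta_x)
    then show ?thesis using b[OF that] fst_bk_centre[of w p] by (simp add: mult.commute)
  qed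
  have "Xop (axis j 1) * Theta (h i) = Xop (axis i 1) * Theta (h j)"
    by (rule Lop_eqI) (auto simp: Lop_X_left Lop_Theta coef_X_left coefh mult_ac)
  from coordinates_regular[OF ij h h this]
  obtain k where k: "k \<in> carrier A" and eq: "Theta (h i) = Xop (axis i 1) * Theta k" by blast
  have "coef (Theta k) w p = (if w \<in> Zc then Polynomial.smult (inverse (chi w)) (b w p) else 0)"
    if w: "w \<in> W" and p: "p \<in> G" for w p
  proof -
    have "Polynomial.smult (fst p $ i) (coef (Theta k) w p) =
        Polynomial.smult (fst p $ i) (if w \<in> Zc then Polynomial.smult (inverse (chi w)) (b w p) else 0)"
      using arg_cong[OF eq, of "\<lambda>C. coef C w p"] coefh[OF w p, of i]
      by (cases "w \<in> Zc") (simp_all add: coef_X_left)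
    then have "Polynomial.smult (fst p $ i) (coef (Theta k) w p -
        (if w \<in> Zc then Polynomial.smult (inverse (chi w)) (b w p) else 0)) = 0"
      by (simp only: smult_diff_right diff_self)
    then show ?thesis using G_coord[OF p, of i] by (simp only: smult_eq_0_iff) simp
  qed
  then show ?thesis unfolding realizable_def using k by blast
qed

text \<open>
  The scalars \<open>\<chi>(z)\<close> are distinct, so twisting separates the components by the
  argument of Vandermonde.
\<close>

lemma realizable_component:
  assumes "finite K" "K \<subseteq> Zc" "realizable (\<lambda>z p. if z \<in> K then b z p else 0)" "k \<in> K"
  shows "realizable (\<lambda>z p. if z = k then b z p else 0)"
  using assms
proof (induction K arbitrary: b k rule: finite_induct)
  case (insert j K)
  have j: "j \<in> Zc" and K: "K \<subseteq> Zc" using insert.prems by auto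
  let ?b = "\<lambda>z p. if z \<in> insert j K then b z p else 0"
  have "realizable (\<lambda>z p. Polynomial.smult (inverse (chi z)) (?b z p) - Polynomial.smult (inverse (chi j)) (?b z p))"
    by (intro realizable_diff realizable_scale realizable_twist insert.prems(2))
  then have "realizable (\<lambda>z p. if z \<in> K then Polynomial.smult (inverse (chi z) - inverse (chi j)) (b z p) else 0)"
    by (rule realizable_cong) (use insert.hyps in \<open>auto simp: smult_diff_left\<close>)
  from insert.IH[OF K this]
  have tw: "realizable (\<lambda>z p. if z = l then Polynomial.smult (inverse (chi z) - inverse (chi j)) (b z p) else 0)" if "l \<in> K" for l
    using that by blast
  have comp: "realizable (\<lambda>z p. if z = l then b z p else 0)" if l: "l \<in> K" for l
  proof -
    have "chi l \<noteq> chi j" using chi_inj[of l j] l K j insert.hyps by blast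
    then have ne: "inverse (chi l) - inverse (chi j) \<noteq> 0" by (simp add: inverse_eq_iff_eq)
    show ?thesis
      by (rule realizable_cong[OF realizable_scale[OF tw[OF l], of "inverse (inverse (chi l) - inverse (chi j))"]])
        (use ne in simp)
  qed
  have sum: "realizable (\<lambda>z p. if z \<in> L then b z p else 0)" if "finite L" "L \<subseteq> K" for L
    using that
  proof (induction L rule: finite_induct)
    case empty
    have "realizable (\<lambda>z p. Polynomial.smult 0 (?b z p))" by (rule realizable_scale[OF insert.prems(2)])
    then show ?case by simp
  next
    case (insert l L)
    then have "realizable (\<lambda>z p. (if z = l then b z p else 0) + (if z \<in> L then b z p else 0))"
      by (intro realizable_add comp) auto
    then show ?case by (rule realizable_cong) (use insert in auto)
  qed
  have "realizable (\<lambda>z p. ?b z p - (if z \<in> K then b z p else 0))"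
    by (intro realizable_diff insert.prems(2) sum insert.hyps) auto
  then have "realizable (\<lambda>z p. if z = j then b z p else 0)"
    by (rule realizable_cong) (use insert.hyps in auto)
  then show ?case using insert.prems(3) comp by blast
qed simp

lemma central_component_coef:
  assumes "central f" "z \<in> Zc" "w \<in> W" "p \<in> G"
  shows "coef (Theta f * U z) w p = (if w = z then coef (Theta f) (mat 1) p else 0)"
proof -
  have "w ** matrix_inv z = mat 1 \<longleftrightarrow> w = z"
    using assms by (metis W_cancel(4) W_inverses(1) Zc_W matrix_mul_lid)
  then show ?thesis
    using assms central_coef(1)[OF assms(1), of "w ** matrix_inv z" p]
    by (auto simp: coef_U_right)
qed

lemma central_components_unique:
  assumes "\<And>z. z \<in> Zc \<Longrightarrow> central (f z)" "(\<Sum>z\<in>Zc. Theta (f z) * U z) = 0" "z \<in> Zc"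
  shows "Theta (f z) = 0"
proof (rule Lop_eqI[OF Lop_Theta Lop_zero])
  fix w p assume w: "w \<in> W" and p: "p \<in> G"
  have "0 = (\<Sum>z'\<in>Zc. coef (Theta (f z') * U z') z p)"
    using arg_cong[OF assms(2), of "\<lambda>C. coef C z p"] by (simp add: coef_sum)
  also have "\<dots> = (\<Sum>z'\<in>Zc. if z' = z then coef (Theta (f z)) (mat 1) p else 0)"
    using assms p by (intro sum.cong) (auto simp: central_component_coef)
  finally have "coef (Theta (f z)) (mat 1) p = 0" using assms(3) by simp
  then show "coef (Theta (f z)) w p = coef 0 w p"
    using central_coef(1)[OF assms(1)[OF assms(3)] w p] by (cases "w = mat 1") auto
qed

text \<open>
  Dividing the component at \<open>z\<close> by the group element \<open>z\<close> moves its
  support to the identity, where invariant functions are central.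
\<close>

lemma fixed_central_components:
  assumes f: "fixed_central f"
  shows "\<exists>h. (\<forall>z\<in>Zc. central (h z)) \<and> Theta f = (\<Sum>z\<in>Zc. Theta (h z) * U z)"
proof -
  define b where "b = coef (Theta f)"
  have car: "f \<in> carrier A" using f by (simp add: fixed_central_def fixed_def)
  have "realizable (\<lambda>z p. if z \<in> Zc then b z p else 0)"
    unfolding realizable_def using car fixed_central_support(2)[OF f] by (intro bexI[of _ f]) (auto simp: b_def)
  then have "realizable (\<lambda>z p. if z = k then b z p else 0)" if "k \<in> Zc" for k
    using realizable_component[of Zc b k] that by simp
  then have "\<exists>g\<in>carrier A. \<forall>w\<in>W. \<forall>p\<in>G. coef (Theta g) w p = (if w = k then b k p else 0)" if "k \<in> Zc" for k
    using that unfolding realizable_def by (metis (no_types, lifting))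
  then obtain g where g: "\<And>k. k \<in> Zc \<Longrightarrow> g k \<in> carrier A"
    "\<And>k w p. k \<in> Zc \<Longrightarrow> w \<in> W \<Longrightarrow> p \<in> G \<Longrightarrow> coef (Theta (g k)) w p = (if w = k then b k p else 0)" by metis
  define h where "h k = g k \<otimes>\<^bsub>A\<^esub> elt (matrix_inv k) 1" for k
  have h: "h k \<in> carrier A" if "k \<in> Zc" for k
    unfolding h_def using g(1)[OF that] that by (intro smash.CP.m_closed smash_at_carrier) auto
  have coefh: "coef (Theta (h k)) w p = (if w = mat 1 then b k p else 0)" if k: "k \<in> Zc" and w: "w \<in> W" and p: "p \<in> G" for k w p
  proof -
    have "coef (Theta (h k)) w p = coef (Theta (g k)) (w ** k) p"
      using k w p by (simp add: h_def Theta_mult Theta_group coef_U_right)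
    moreover have "w ** k = k \<longleftrightarrow> w = mat 1"
      using k w by (metis W_cancel(3) W_inverses(1) Zc_W matrix_mul_lid)
    ultimately show ?thesis using g(2)[OF k, of "w ** k" p] k w p by simp
  qed
  have cen: "central (h k)" if k: "k \<in> Zc" for k
  proof (rule centralI[OF h[OF k]])
    show "coef (Theta (h k)) w p = 0" if "w \<in> W" "p \<in> G" "w \<noteq> mat 1" for w p
      using coefh[OF k that(1,2)] that(3) by simp
    show "coef (Theta (h k)) (mat 1) (bk v p) = coef (Theta (h k)) (mat 1) p" if "v \<in> W" "p \<in> G" for v p
      using coefh[OF k W_one] that fixed_central_support(1)[OF f k] by (simp add: b_def)
  qed
  have "Theta f = (\<Sum>z\<in>Zc. Theta (h z) * U z)"
  proof (rule Lop_eqI)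
    show "Lop (Theta f)" by (rule Lop_Theta)
    show "Lop (\<Sum>z\<in>Zc. Theta (h z) * U z)" by (intro Lop_sum Lop_mult Lop_Theta Lop_U) simp
    fix w p assume w: "w \<in> W" and p: "p \<in> G"
    have "coef (\<Sum>z\<in>Zc. Theta (h z) * U z) w p = (\<Sum>z\<in>Zc. if w = z then b z p else 0)"
      unfolding coef_sum using w p
      by (intro sum.cong refl) (simp add: central_component_coef[OF cen] coefh)
    then show "coef (Theta f) w p = coef (\<Sum>z\<in>Zc. Theta (h z) * U z) w p"
      using fixed_central_support(2)[OF f w _ p] by (simp add: b_def)
  qed
  then show ?thesis using cen by (intro exI[of _ h]) simp
qed

lemma smash_map_inverse:
  assumes "\<gamma> \<in> \<Gamma>"
  obtains \<delta> where "\<delta> \<in> \<Gamma>" "\<And>f. smash_map \<gamma> (smash_map \<delta> f) = f"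
proof -
  obtain \<delta> where \<delta>: "\<delta> \<in> \<Gamma>" "\<And>v. \<gamma> (\<delta> v) = v" using Gamma_inv[OF assms] by blast
  have "smash_map \<gamma> (smash_map \<delta> f) = f" for f
    unfolding smash_map_def tensor_map_comp[OF Gamma_linear[OF assms]] \<delta>(2) tensor_map_id ..
  then show ?thesis using that \<delta>(1) by blast
qed

lemma smash_map_central:
  assumes \<gamma>: "\<gamma> \<in> \<Gamma>" and f: "central f"
  shows "central (smash_map \<gamma> f)"
  unfolding central_def
proof (intro conjI ballI)
  have car: "f \<in> carrier A" using f by (simp add: central_def)
  then show "smash_map \<gamma> f \<in> carrier A" by (rule smash_map_carrier)
  fix h assume h: "h \<in> carrier A"
  obtain \<delta> where \<delta>: "\<delta> \<in> \<Gamma>" "\<And>f. smash_map \<gamma> (smash_map \<delta> f) = f" using smash_map_inverse[OF \<gamma>] by blast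
  have h': "smash_map \<delta> h \<in> carrier A" using h by (rule smash_map_carrier)
  have "Theta (f \<otimes>\<^bsub>A\<^esub> smash_map \<delta> h) = Theta (smash_map \<delta> h \<otimes>\<^bsub>A\<^esub> f)"
    using f h' by (simp add: central_def Theta_mult)
  from Theta_smash_map_cong[OF \<gamma> _ _ this] car h'
  show "Theta (smash_map \<gamma> f) * Theta h = Theta h * Theta (smash_map \<gamma> f)"
    by (simp add: smash_map_hom[OF \<gamma>] \<delta>(2) Theta_mult)
qed

lemma central_diff: "central f \<Longrightarrow> central h \<Longrightarrow> central (\<lambda>g. f g - h g)"
  by (auto simp: central_def Theta_diff smash_carrier left_diff_distrib right_diff_distrib)

text \<open>
  The components are invariant under \<open>\<Gamma>\<close> because they are unique.
\<close>

theorem fixed_central_decomposition: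
  assumes f: "fixed_central f"
  shows "\<exists>h. (\<forall>z\<in>Zc. central (h z) \<and> fixed (h z)) \<and> Theta f = (\<Sum>z\<in>Zc. Theta (h z) * U z)"
proof -
  obtain h where h: "\<And>z. z \<in> Zc \<Longrightarrow> central (h z)" and eq: "Theta f = (\<Sum>z\<in>Zc. Theta (h z) * U z)"
    using fixed_central_components[OF f] by blast
  have hcar: "h z \<in> carrier A" if "z \<in> Zc" for z using h[OF that] by (simp add: central_def)
  have fcar: "f \<in> carrier A" and ffix: "\<And>\<gamma>. \<gamma> \<in> \<Gamma> \<Longrightarrow> Theta (smash_map \<gamma> f) = Theta f"
    using f by (auto simp: fixed_central_def fixed_def)
  have "Theta (smash_map \<gamma> (h z)) = Theta (h z)" if \<gamma>: "\<gamma> \<in> \<Gamma>" and z: "z \<in> Zc" for \<gamma> z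
  proof -
    define F where "F = (\<lambda>g. \<Sum>z\<in>Zc. (h z \<otimes>\<^bsub>A\<^esub> elt z 1) g)"
    have Fcar: "F \<in> carrier A"
    proof -
      have "h z \<otimes>\<^bsub>A\<^esub> elt z 1 \<in> carrier A" if "z \<in> Zc" for z
        using hcar that by (intro smash.CP.m_closed smash_at_carrier) auto
      then show ?thesis unfolding F_def by (auto simp: smash_carrier intro!: sum.neutral)
    qed
    have TF: "Theta F = Theta f" unfolding F_def eq by (simp add: Theta_sum Theta_mult Theta_group)
    have "Theta (smash_map \<gamma> F) = Theta f"
      using Theta_smash_map_cong[OF \<gamma> Fcar fcar TF] ffix[OF \<gamma>] by simp
    moreover have "Theta (smash_map \<gamma> F) = (\<Sum>z\<in>Zc. Theta (smash_map \<gamma> (h z)) * U z)"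
      unfolding F_def smash_map_sum Theta_sum smash_map_hom[OF \<gamma>] smash_map_elt
      by (simp add: Theta_mult Theta_group)
    ultimately have "(\<Sum>z\<in>Zc. Theta (\<lambda>g. smash_map \<gamma> (h z) g - h z g) * U z) = 0"
      using eq by (simp add: Theta_diff left_diff_distrib sum_subtractf)
    from central_components_unique[OF _ this z]
    have "Theta (\<lambda>g. smash_map \<gamma> (h z) g - h z g) = 0"
      using smash_map_central[OF \<gamma>] h central_diff by blast
    then show ?thesis by (simp add: Theta_diff)
  qed
  then have "\<forall>z\<in>Zc. central (h z) \<and> fixed (h z)" using h hcar by (auto simp: fixed_def)
  then show ?thesis using eq by (intro exI[of _ h]) simp
qed

end

section \<open>Tensor products over the group algebra\<close>

lemma group_algebra_simps:
  "carrier (group_algebra K) = {f. \<forall>g. g \<notin> carrier K \<longrightarrow> f g = 0}"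
  "\<zero>\<^bsub>group_algebra K\<^esub> = (\<lambda>g. 0)"
  "f \<oplus>\<^bsub>group_algebra K\<^esub> h = (\<lambda>g. f g + h g)"
  "z \<odot>\<^bsub>group_algebra K\<^esub> f = (\<lambda>g. z * f g)"
  "\<one>\<^bsub>group_algebra K\<^esub> = coefficient_at \<one>\<^bsub>K\<^esub> 1"
  by (auto simp: group_algebra_def crossed_product_def coefficient_at_def)

locale finite_group = group K for K :: "('g, 'm) monoid_scheme" (structure) +
  assumes finite_K: "finite (carrier K)"
begin

sublocale GA: crossed_action K "(*)" "\<lambda>g r :: complex. r"
  rewrites "crossed_product K (*) (\<lambda>g r :: complex. r) = group_algebra K"
proof -
  show "crossed_action K (\<lambda>g r :: complex. r)"
    by unfold_locales (auto simp: finite_K)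
qed (simp add: group_algebra_def)

lemma GA_expansion: "f \<in> carrier (group_algebra K) \<Longrightarrow> f = (\<lambda>h. \<Sum>g\<in>carrier K. f g * coefficient_at g 1 h)"
  using finite_K by (auto simp: group_algebra_simps coefficient_at_def if_distrib cong: if_cong)

end

text \<open>
  A commutative algebra \<open>C\<close> that is free over a subalgebra \<open>B\<close> on the image of the elements of
  a finite group. Algebras are records without axioms for the scalar multiplication, so those that
  are needed are listed.
\<close>

locale free_over_group = finite_group K for K :: "('g, 'm) monoid_scheme" (structure) +
  fixes B C :: "(complex, 'a) module" and \<iota> :: "('g \<Rightarrow> complex) \<Rightarrow> 'a"
  assumes C_cring: "cring C"
    and B_carrier: "carrier B \<subseteq> carrier C"
    and B_ops: "monoid.mult B = monoid.mult C" "one B = one C" "zero B = zero C" "add B = add C" "smult B = smult C"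
    and B_cring: "cring B"
    and B_smult: "\<And>z b. b \<in> carrier B \<Longrightarrow> z \<odot>\<^bsub>C\<^esub> b \<in> carrier B"
    and smult_add: "\<And>z z' b. b \<in> carrier C \<Longrightarrow> (z + z') \<odot>\<^bsub>C\<^esub> b = z \<odot>\<^bsub>C\<^esub> b \<oplus>\<^bsub>C\<^esub> z' \<odot>\<^bsub>C\<^esub> b"
    and smult_closed: "\<And>z b. b \<in> carrier C \<Longrightarrow> z \<odot>\<^bsub>C\<^esub> b \<in> carrier C"
    and smult_one: "\<And>b. b \<in> carrier C \<Longrightarrow> 1 \<odot>\<^bsub>C\<^esub> b = b"
    and smult_add_right: "\<And>z b b'. b \<in> carrier C \<Longrightarrow> b' \<in> carrier C \<Longrightarrow> z \<odot>\<^bsub>C\<^esub> (b \<oplus>\<^bsub>C\<^esub> b') = z \<odot>\<^bsub>C\<^esub> b \<oplus>\<^bsub>C\<^esub> z \<odot>\<^bsub>C\<^esub> b'"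
    and smult_smult: "\<And>z z' b. b \<in> carrier C \<Longrightarrow> z \<odot>\<^bsub>C\<^esub> (z' \<odot>\<^bsub>C\<^esub> b) = (z * z') \<odot>\<^bsub>C\<^esub> b"
    and smult_mult: "\<And>z b b'. b \<in> carrier C \<Longrightarrow> b' \<in> carrier C \<Longrightarrow> (z \<odot>\<^bsub>C\<^esub> b) \<otimes>\<^bsub>C\<^esub> b' = z \<odot>\<^bsub>C\<^esub> (b \<otimes>\<^bsub>C\<^esub> b')"
    and \<iota>_hom: "\<iota> \<in> ring_hom (group_algebra K) C"
    and \<iota>_smult: "\<And>z f. f \<in> carrier (group_algebra K) \<Longrightarrow> \<iota> (z \<odot>\<^bsub>group_algebra K\<^esub> f) = z \<odot>\<^bsub>C\<^esub> \<iota> f"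
    and spans: "\<And>x. x \<in> carrier C \<Longrightarrow> \<exists>b. b \<in> carrier K \<rightarrow> carrier B \<and> x = (\<Oplus>\<^bsub>C\<^esub>g\<in>carrier K. b g \<otimes>\<^bsub>C\<^esub> \<iota> (coefficient_at g 1))"
    and independent: "\<And>b g. b \<in> carrier K \<rightarrow> carrier B \<Longrightarrow>
      (\<Oplus>\<^bsub>C\<^esub>g\<in>carrier K. b g \<otimes>\<^bsub>C\<^esub> \<iota> (coefficient_at g 1)) = \<zero>\<^bsub>C\<^esub> \<Longrightarrow> g \<in> carrier K \<Longrightarrow> b g = \<zero>\<^bsub>C\<^esub>"
begin

sublocale C: cring C by (rule C_cring)
sublocale B: cring B by (rule B_cring)

abbreviation "GA \<equiv> group_algebra K"
abbreviation "\<delta> g \<equiv> (coefficient_at g 1 :: 'g \<Rightarrow> complex)"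
abbreviation "pair \<equiv> pair_algebra B GA"

lemma B_in_C [simp]: "b \<in> carrier B \<Longrightarrow> b \<in> carrier C"
  using B_carrier by blast

lemma \<iota>_closed [simp]: "f \<in> carrier GA \<Longrightarrow> \<iota> f \<in> carrier C"
  using ring_hom_closed[OF \<iota>_hom] .

lemma \<delta>_closed [simp]: "g \<in> carrier K \<Longrightarrow> \<delta> g \<in> carrier GA"
  by (auto simp: group_algebra_simps coefficient_at_def)

text \<open>The map induced by \<open>(b, f) \<mapsto> b \<iota>(f)\<close>.\<close>

definition ev :: "('a \<times> ('g \<Rightarrow> complex) \<Rightarrow>\<^sub>0 complex) \<Rightarrow> 'a" where
  "ev p = (\<Oplus>\<^bsub>C\<^esub>k\<in>Poly_Mapping.keys p. Poly_Mapping.lookup p k \<odot>\<^bsub>C\<^esub> (fst k \<otimes>\<^bsub>C\<^esub> \<iota> (snd k)))"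

lemma pair_simps:
  "carrier pair = {p. Poly_Mapping.keys p \<subseteq> carrier B \<times> carrier GA}"
  "\<one>\<^bsub>pair\<^esub> = Poly_Mapping.single (\<one>\<^bsub>B\<^esub>, \<one>\<^bsub>GA\<^esub>) 1"
  "\<zero>\<^bsub>pair\<^esub> = 0" "p \<oplus>\<^bsub>pair\<^esub> q = p + q"
  "p \<otimes>\<^bsub>pair\<^esub> q = (\<Sum>k\<in>Poly_Mapping.keys p. \<Sum>l\<in>Poly_Mapping.keys q.
      Poly_Mapping.single (fst k \<otimes>\<^bsub>B\<^esub> fst l, snd k \<otimes>\<^bsub>GA\<^esub> snd l) (Poly_Mapping.lookup p k * Poly_Mapping.lookup q l))"
  by (simp_all add: pair_algebra_def case_prod_beta)

lemma smult_zero: "b \<in> carrier C \<Longrightarrow> 0 \<odot>\<^bsub>C\<^esub> b = \<zero>\<^bsub>C\<^esub>"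
  using smult_add[of b 0 0] smult_closed[of b 0] by (metis C.add.l_cancel_one add_0)

lemma ev_superset:
  assumes "finite M" "Poly_Mapping.keys p \<subseteq> M" "M \<subseteq> carrier B \<times> carrier GA"
  shows "ev p = (\<Oplus>\<^bsub>C\<^esub>k\<in>M. Poly_Mapping.lookup p k \<odot>\<^bsub>C\<^esub> (fst k \<otimes>\<^bsub>C\<^esub> \<iota> (snd k)))"
  unfolding ev_def
  by (rule C.add.finprod_mono_neutral_cong_left)
    (use assms in \<open>auto simp: in_keys_iff smult_zero smult_closed subset_iff Pi_def\<close>)

lemma ev_closed: "p \<in> carrier pair \<Longrightarrow> ev p \<in> carrier C"
  unfolding ev_def by (rule C.finsum_closed) (auto simp: pair_simps smult_closed)

lemma ev_add: "p \<in> carrier pair \<Longrightarrow> q \<in> carrier pair \<Longrightarrow> ev (p + q) = ev p \<oplus>\<^bsub>C\<^esub> ev q"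
proof -
  assume p: "p \<in> carrier pair" and q: "q \<in> carrier pair"
  let ?M = "Poly_Mapping.keys p \<union> Poly_Mapping.keys q"
  have M: "finite ?M" "?M \<subseteq> carrier B \<times> carrier GA" using p q by (auto simp: pair_simps)
  have cl: "x \<in> ?M \<Longrightarrow> fst x \<otimes>\<^bsub>C\<^esub> \<iota> (snd x) \<in> carrier C" for x using M by auto
  let ?t = "\<lambda>k. fst k \<otimes>\<^bsub>C\<^esub> \<iota> (snd k)"
  have "ev (p + q) = (\<Oplus>\<^bsub>C\<^esub>k\<in>?M. Poly_Mapping.lookup p k \<odot>\<^bsub>C\<^esub> ?t k \<oplus>\<^bsub>C\<^esub> Poly_Mapping.lookup q k \<odot>\<^bsub>C\<^esub> ?t k)"
    unfolding ev_superset[OF M(1) Poly_Mapping.keys_add M(2)] lookup_add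
  proof (rule C.finsum_cong'[OF refl])
    show "(\<lambda>k. Poly_Mapping.lookup p k \<odot>\<^bsub>C\<^esub> ?t k \<oplus>\<^bsub>C\<^esub> Poly_Mapping.lookup q k \<odot>\<^bsub>C\<^esub> ?t k) \<in> ?M \<rightarrow> carrier C"
      by (intro Pi_I C.a_closed smult_closed cl)
  qed (rule smult_add[OF cl])
  also have "\<dots> = (\<Oplus>\<^bsub>C\<^esub>k\<in>?M. Poly_Mapping.lookup p k \<odot>\<^bsub>C\<^esub> ?t k) \<oplus>\<^bsub>C\<^esub> (\<Oplus>\<^bsub>C\<^esub>k\<in>?M. Poly_Mapping.lookup q k \<odot>\<^bsub>C\<^esub> ?t k)"
    by (intro C.finsum_addf Pi_I smult_closed cl)
  also have "\<dots> = ev p \<oplus>\<^bsub>C\<^esub> ev q"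
    using ev_superset[OF M(1) _ M(2), of p] ev_superset[OF M(1) _ M(2), of q] by simp
  finally show ?thesis .
qed

lemma ev_single: "b \<in> carrier B \<Longrightarrow> f \<in> carrier GA \<Longrightarrow> ev (Poly_Mapping.single (b, f) z) = z \<odot>\<^bsub>C\<^esub> (b \<otimes>\<^bsub>C\<^esub> \<iota> f)"
  by (subst ev_superset[of "{(b, f)}"]) (auto simp: smult_closed)

lemma pair_single_closed: "b \<in> carrier B \<Longrightarrow> f \<in> carrier GA \<Longrightarrow> Poly_Mapping.single (b, f) z \<in> carrier pair"
  by (simp add: pair_simps)

lemma pair_add_closed: "p \<in> carrier pair \<Longrightarrow> q \<in> carrier pair \<Longrightarrow> p + q \<in> carrier pair"
  using Poly_Mapping.keys_add[of p q] by (auto simp: pair_simps)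

lemma pair_diff_closed: "p \<in> carrier pair \<Longrightarrow> q \<in> carrier pair \<Longrightarrow> p - q \<in> carrier pair"
  using keys_diff[of p q] unfolding pair_simps(1) by blast

lemma pair_sum_closed: "(\<And>i. i \<in> I \<Longrightarrow> p i \<in> carrier pair) \<Longrightarrow> sum p I \<in> carrier pair"
  by (induction I rule: infinite_finite_induct) (auto simp: pair_add_closed, auto simp: pair_simps)

lemma pair_induct [consumes 1, case_names zero single add]:
  assumes p: "p \<in> carrier pair" and "P 0"
    and "\<And>b f z. b \<in> carrier B \<Longrightarrow> f \<in> carrier GA \<Longrightarrow> P (Poly_Mapping.single (b, f) z)"
    and "\<And>p q. p \<in> carrier pair \<Longrightarrow> q \<in> carrier pair \<Longrightarrow> P p \<Longrightarrow> P q \<Longrightarrow> P (p + q)"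
  shows "P p"
proof -
  have "P (\<Sum>k\<in>M. Poly_Mapping.single k (Poly_Mapping.lookup p k)) \<and> (\<Sum>k\<in>M. Poly_Mapping.single k (Poly_Mapping.lookup p k)) \<in> carrier pair"
    if "finite M" "M \<subseteq> Poly_Mapping.keys p" for M
    using that
  proof (induction M rule: finite_induct)
    case (insert k M)
    then have "k \<in> carrier B \<times> carrier GA" using p by (auto simp: pair_simps)
    then obtain b f where k: "k = (b, f)" "b \<in> carrier B" "f \<in> carrier GA" by auto
    then show ?case using insert assms(3)[OF k(2,3)] pair_single_closed[OF k(2,3)]
      by (auto intro: assms(4) pair_add_closed)
  qed (auto simp: assms(2) pair_simps)
  from this[of "Poly_Mapping.keys p"] show ?thesis by (simp add: sum_lookup_single)
qed

lemma pair_mult_superset: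
  assumes "finite M" "Poly_Mapping.keys p \<subseteq> M" "finite N" "Poly_Mapping.keys q \<subseteq> N"
  shows "p \<otimes>\<^bsub>pair\<^esub> q = (\<Sum>k\<in>M. \<Sum>l\<in>N.
      Poly_Mapping.single (fst k \<otimes>\<^bsub>B\<^esub> fst l, snd k \<otimes>\<^bsub>GA\<^esub> snd l) (Poly_Mapping.lookup p k * Poly_Mapping.lookup q l))"
proof -
  have "(\<Sum>l\<in>Poly_Mapping.keys q. Poly_Mapping.single (fst k \<otimes>\<^bsub>B\<^esub> fst l, snd k \<otimes>\<^bsub>GA\<^esub> snd l) (Poly_Mapping.lookup p k * Poly_Mapping.lookup q l))
     = (\<Sum>l\<in>N. Poly_Mapping.single (fst k \<otimes>\<^bsub>B\<^esub> fst l, snd k \<otimes>\<^bsub>GA\<^esub> snd l) (Poly_Mapping.lookup p k * Poly_Mapping.lookup q l))" for k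
    by (rule sum.mono_neutral_left) (use assms in \<open>auto simp: in_keys_iff\<close>)
  then show ?thesis unfolding pair_simps(5)
    by (simp add: sum.mono_neutral_left[OF assms(1,2)] in_keys_iff)
qed

lemma pair_mult_add: "p \<otimes>\<^bsub>pair\<^esub> (q + r) = p \<otimes>\<^bsub>pair\<^esub> q + p \<otimes>\<^bsub>pair\<^esub> r"
  "(q + r) \<otimes>\<^bsub>pair\<^esub> p = q \<otimes>\<^bsub>pair\<^esub> p + r \<otimes>\<^bsub>pair\<^esub> p"
proof -
  let ?N = "Poly_Mapping.keys q \<union> Poly_Mapping.keys r" and ?M = "Poly_Mapping.keys p"
  have N: "finite ?N" "Poly_Mapping.keys (q + r) \<subseteq> ?N" by (auto simp: Poly_Mapping.keys_add)
  show "p \<otimes>\<^bsub>pair\<^esub> (q + r) = p \<otimes>\<^bsub>pair\<^esub> q + p \<otimes>\<^bsub>pair\<^esub> r"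
    using N by (simp add: pair_mult_superset[of ?M p ?N] lookup_add distrib_left single_add sum.distrib)
  show "(q + r) \<otimes>\<^bsub>pair\<^esub> p = q \<otimes>\<^bsub>pair\<^esub> p + r \<otimes>\<^bsub>pair\<^esub> p"
    using N by (simp add: pair_mult_superset[of ?N _ ?M p] lookup_add distrib_right single_add sum.distrib)
qed

lemma pair_mult_zero: "p \<otimes>\<^bsub>pair\<^esub> 0 = 0" "0 \<otimes>\<^bsub>pair\<^esub> p = 0"
  by (simp_all add: pair_simps)

lemma pair_mult_single: "Poly_Mapping.single k z \<otimes>\<^bsub>pair\<^esub> Poly_Mapping.single l z' =
   Poly_Mapping.single (fst k \<otimes>\<^bsub>B\<^esub> fst l, snd k \<otimes>\<^bsub>GA\<^esub> snd l) (z * z')"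
  by (subst pair_mult_superset[of "{k}" _ "{l}"]) auto

lemma pair_mult_closed: "p \<in> carrier pair \<Longrightarrow> q \<in> carrier pair \<Longrightarrow> p \<otimes>\<^bsub>pair\<^esub> q \<in> carrier pair"
proof -
  assume "p \<in> carrier pair" "q \<in> carrier pair"
  then have "k \<in> carrier B \<times> carrier GA" if "k \<in> Poly_Mapping.keys p \<or> k \<in> Poly_Mapping.keys q" for k
    using that unfolding pair_simps(1) by blast
  then show ?thesis
    unfolding pair_simps(5)
    by (intro pair_sum_closed pair_single_closed B.m_closed GA.CP.m_closed) (simp_all add: mem_Times_iff)
qed

lemma pair_ring: "ring pair"
proof (rule ringI)
  show "abelian_group pair"
  proof (rule abelian_groupI)
    show "\<exists>q\<in>carrier pair. q \<oplus>\<^bsub>pair\<^esub> p = \<zero>\<^bsub>pair\<^esub>" if "p \<in> carrier pair" for p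
      by (rule bexI[of _ "- p"]) (use that in \<open>auto simp: pair_simps in_keys_iff\<close>)
  qed (auto simp: pair_simps(3,4) pair_add_closed add.assoc add.commute, auto simp: pair_simps)
  show "Group.monoid pair"
  proof (rule monoidI)
    fix p q r assume p: "p \<in> carrier pair" and q: "q \<in> carrier pair" and r: "r \<in> carrier pair"
    show "p \<otimes>\<^bsub>pair\<^esub> q \<otimes>\<^bsub>pair\<^esub> r = p \<otimes>\<^bsub>pair\<^esub> (q \<otimes>\<^bsub>pair\<^esub> r)"
      using p
    proof (induction p rule: pair_induct)
      case (single b f z)
      show ?case using q
      proof (induction q rule: pair_induct)
        case (single b' f' z')
        show ?case using r
        proof (induction r rule: pair_induct)
          case (single b'' f'' z'')
          show ?case using single \<open>b \<in> _\<close> \<open>f \<in> _\<close> \<open>b' \<in> _\<close> \<open>f' \<in> _\<close>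
            by (simp add: pair_mult_single B.m_assoc GA.CP.m_assoc mult.assoc)
        qed (simp_all add: pair_mult_zero pair_mult_add)
      qed (simp_all add: pair_mult_zero pair_mult_add)
    qed (simp_all add: pair_mult_zero pair_mult_add)
  next
    fix p assume p: "p \<in> carrier pair"
    show "\<one>\<^bsub>pair\<^esub> \<otimes>\<^bsub>pair\<^esub> p = p" "p \<otimes>\<^bsub>pair\<^esub> \<one>\<^bsub>pair\<^esub> = p"
      using p
      by (induction p rule: pair_induct)
        (simp_all add: pair_simps(2) pair_mult_single pair_mult_zero pair_mult_add)
  qed (auto simp: pair_mult_closed pair_simps(2) pair_single_closed)
qed (simp_all add: pair_simps(4) pair_mult_add)

lemma ev_hom: "ev \<in> ring_hom pair C"
proof (rule ring_hom_memI)
  fix p q assume p: "p \<in> carrier pair" and q: "q \<in> carrier pair"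
  show "ev p \<in> carrier C" by (rule ev_closed[OF p])
  show "ev (p \<oplus>\<^bsub>pair\<^esub> q) = ev p \<oplus>\<^bsub>C\<^esub> ev q" unfolding pair_simps(4) by (rule ev_add[OF p q])
  have ev0: "ev 0 = \<zero>\<^bsub>C\<^esub>" by (simp add: ev_def)
  show "ev (p \<otimes>\<^bsub>pair\<^esub> q) = ev p \<otimes>\<^bsub>C\<^esub> ev q"
    using p
  proof (induction p rule: pair_induct)
    case zero
    show ?case using ev_closed[OF q] by (simp add: pair_mult_zero ev0)
  next
    case (add p p')
    then show ?case using q by (simp add: pair_mult_add ev_add pair_mult_closed ev_closed C.l_distr)
  next
    case (single b f z)
    note bf = single
    show ?case using q
    proof (induction q rule: pair_induct)
      case zero
      show ?case using ev_closed[OF pair_single_closed[OF bf]] by (simp add: pair_mult_zero ev0)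
    next
      case (add q q')
      then show ?case using pair_single_closed[OF bf] by (simp add: pair_mult_add ev_add pair_mult_closed ev_closed C.r_distr)
    next
      case (single b' f' z')
      have BC: "b \<otimes>\<^bsub>B\<^esub> b' = b \<otimes>\<^bsub>C\<^esub> b'" by (simp add: B_ops)
      have b: "b \<in> carrier C" "b' \<in> carrier C" "\<iota> f \<in> carrier C" "\<iota> f' \<in> carrier C" using bf single by auto
      have "b \<otimes>\<^bsub>C\<^esub> b' \<otimes>\<^bsub>C\<^esub> (\<iota> f \<otimes>\<^bsub>C\<^esub> \<iota> f') = (b \<otimes>\<^bsub>C\<^esub> \<iota> f) \<otimes>\<^bsub>C\<^esub> (b' \<otimes>\<^bsub>C\<^esub> \<iota> f')"
        using b by (simp add: C.m_ac)
      moreover have "(z \<odot>\<^bsub>C\<^esub> x) \<otimes>\<^bsub>C\<^esub> (z' \<odot>\<^bsub>C\<^esub> y) = (z * z') \<odot>\<^bsub>C\<^esub> (x \<otimes>\<^bsub>C\<^esub> y)" if "x \<in> carrier C" "y \<in> carrier C" for x y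
        using that smult_mult smult_smult smult_closed C.m_comm C.m_closed by metis
      ultimately show ?case
        using bf single b B.m_closed[of b b'] GA.CP.m_closed[of f f']
        by (simp add: pair_mult_single ev_single BC ring_hom_mult[OF \<iota>_hom])
    qed
  qed
next
  show "ev \<one>\<^bsub>pair\<^esub> = \<one>\<^bsub>C\<^esub>"
    by (simp add: pair_simps(2) ev_single B_ops(2) ring_hom_one[OF \<iota>_hom] smult_one)
      (use B.one_closed in \<open>simp add: B_ops(2) smult_one ring_hom_one[OF \<iota>_hom] ev_single\<close>)
qed

lemma relations_closed: "bilinearity_relations B GA \<subseteq> carrier pair"
proof -
  have "z \<odot>\<^bsub>B\<^esub> b \<in> carrier B" if "b \<in> carrier B" for z b using B_smult[OF that] by (simp add: B_ops)
  then show ?thesis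
    unfolding bilinearity_relations_def
    by (auto intro!: pair_diff_closed pair_single_closed GA.CP.a_closed) (auto simp: group_algebra_simps)
qed

definition tens :: "('a \<times> ('g \<Rightarrow> complex) \<Rightarrow>\<^sub>0 complex) set" where
  "tens = tensor_ideal B GA"

lemma tens_ideal: "ideal tens pair"
  unfolding tens_def tensor_ideal_def by (rule ring.genideal_ideal[OF pair_ring relations_closed])

lemma ev_hom_ring: "ring_hom_ring pair C ev"
  by (rule ring_hom_ringI2[OF pair_ring C.ring_axioms ev_hom])

lemma ev_diff: "p \<in> carrier pair \<Longrightarrow> q \<in> carrier pair \<Longrightarrow> ev (p - q) = ev p \<ominus>\<^bsub>C\<^esub> ev q"
proof -
  assume p: "p \<in> carrier pair" and q: "q \<in> carrier pair"
  have d: "p - q \<in> carrier pair" by (rule pair_diff_closed[OF p q])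
  have "ev p = ev (p - q) \<oplus>\<^bsub>C\<^esub> ev q" using ev_add[OF d q] by simp
  then show ?thesis using ev_closed[OF d] ev_closed[OF q] by (simp add: C.minus_eq C.a_assoc C.r_neg)
qed

lemma tens_kernel: "tens \<subseteq> a_kernel pair C ev"
  unfolding tens_def tensor_ideal_def
proof (rule ring.genideal_minimal[OF pair_ring ring_hom_ring.kernel_is_ideal[OF ev_hom_ring]])
  have in_kernel: "p \<in> a_kernel pair C ev \<longleftrightarrow> p \<in> carrier pair \<and> ev p = \<zero>\<^bsub>C\<^esub>" for p
    by (simp add: a_kernel_def')
  have diff3: "p - q - r \<in> a_kernel pair C ev"
    if "p \<in> carrier pair" "q \<in> carrier pair" "r \<in> carrier pair" "ev p = ev q \<oplus>\<^bsub>C\<^esub> ev r" for p q r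
  proof -
    have d: "p - q \<in> carrier pair" "p - q - r \<in> carrier pair"
      using that by (intro pair_diff_closed; simp)+
    have "ev (p - q - r) = ev p \<ominus>\<^bsub>C\<^esub> ev q \<ominus>\<^bsub>C\<^esub> ev r" using that d by (simp add: ev_diff)
    also have "\<dots> = \<zero>\<^bsub>C\<^esub>" unfolding that(4) using ev_closed[OF that(2)] ev_closed[OF that(3)] by algebra
    finally show ?thesis using d by (simp add: in_kernel)
  qed
  have diff2: "p - q \<in> a_kernel pair C ev" if "p \<in> carrier pair" "q \<in> carrier pair" "ev p = ev q" for p q
  proof -
    have d: "p - q \<in> carrier pair" using that pair_diff_closed by blast
    have "ev (p - q) = \<zero>\<^bsub>C\<^esub>" using that ev_closed[OF that(2)] by (simp add: ev_diff C.r_neg C.minus_eq)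
    then show ?thesis using d by (simp add: in_kernel)
  qed
  have Bs: "z \<odot>\<^bsub>B\<^esub> b \<in> carrier B" if "b \<in> carrier B" for z b using B_smult[OF that] by (simp add: B_ops)
  have Gs: "z \<odot>\<^bsub>GA\<^esub> f \<in> carrier GA" if "f \<in> carrier GA" for z f using that by (auto simp: group_algebra_simps)
  have comm: "b \<otimes>\<^bsub>C\<^esub> (z \<odot>\<^bsub>C\<^esub> x) = z \<odot>\<^bsub>C\<^esub> (b \<otimes>\<^bsub>C\<^esub> x)" if "b \<in> carrier C" "x \<in> carrier C" for b z x
    using that smult_mult smult_closed C.m_comm by metis
  note ev1 = ev_single[where z = 1] smult_one
  show "bilinearity_relations B GA \<subseteq> a_kernel pair C ev"
    unfolding bilinearity_relations_def
  proof (intro Un_least; clarify)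
    fix b b' f assume 1: "b \<in> carrier B" "b' \<in> carrier B" "f \<in> carrier GA"
    have "b \<oplus>\<^bsub>B\<^esub> b' \<in> carrier B" using 1 by (intro B.a_closed)
    moreover have "b \<oplus>\<^bsub>B\<^esub> b' = b \<oplus>\<^bsub>C\<^esub> b'" by (simp add: B_ops)
    ultimately show "Poly_Mapping.single (b \<oplus>\<^bsub>B\<^esub> b', f) 1 - Poly_Mapping.single (b, f) 1 - Poly_Mapping.single (b', f) 1
        \<in> a_kernel pair C ev"
      using 1 by (intro diff3 pair_single_closed) (simp_all add: ev1 C.l_distr)
  next
    fix b f f' assume 2: "b \<in> carrier B" "f \<in> carrier GA" "f' \<in> carrier GA"
    have "f \<oplus>\<^bsub>GA\<^esub> f' \<in> carrier GA" using 2 by (intro GA.CP.a_closed)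
    then show "Poly_Mapping.single (b, f \<oplus>\<^bsub>GA\<^esub> f') 1 - Poly_Mapping.single (b, f) 1 - Poly_Mapping.single (b, f') 1
        \<in> a_kernel pair C ev"
      using 2 by (intro diff3 pair_single_closed) (simp_all add: ev1 ring_hom_add[OF \<iota>_hom] C.r_distr)
  next
    fix z b f assume 3: "b \<in> carrier B" "f \<in> carrier GA"
    have "z \<odot>\<^bsub>B\<^esub> b = z \<odot>\<^bsub>C\<^esub> b" by (simp add: B_ops)
    then show "Poly_Mapping.single (z \<odot>\<^bsub>B\<^esub> b, f) 1 - Poly_Mapping.single (b, f) z \<in> a_kernel pair C ev"
      using 3 Bs[OF 3(1), of z] by (intro diff2 pair_single_closed) (simp_all add: ev1 ev_single smult_mult smult_closed)
  next
    fix z b f assume 4: "b \<in> carrier B" "f \<in> carrier GA"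
    then show "Poly_Mapping.single (b, z \<odot>\<^bsub>GA\<^esub> f) 1 - Poly_Mapping.single (b, f) z \<in> a_kernel pair C ev"
      using Gs[OF 4(2), of z] by (intro diff2 pair_single_closed) (simp_all add: ev1 ev_single \<iota>_smult comm smult_closed)
  qed
qed

text \<open>
  Modulo the bilinearity relations every element is a sum of the \<open>(b\<^sub>g, g)\<close>, one for each group
  element. On these sums the map to \<open>C\<close> is injective by independence.
\<close>

lemma tens_closed:
  "p \<in> tens \<Longrightarrow> q \<in> tens \<Longrightarrow> p + q \<in> tens" "0 \<in> tens" "p \<in> tens \<Longrightarrow> - p \<in> tens" "p \<in> tens \<Longrightarrow> p \<in> carrier pair"
proof -
  interpret tens: ideal tens pair by (rule tens_ideal)
  have sub: "additive_subgroup tens pair" by (rule ideal.axioms(1)[OF tens_ideal])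
  show car: "p \<in> tens \<Longrightarrow> p \<in> carrier pair" by (rule tens.Icarr)
  show "p \<in> tens \<Longrightarrow> q \<in> tens \<Longrightarrow> p + q \<in> tens"
    using additive_subgroup.a_closed[OF sub, of p q] by (simp only: pair_simps(4))
  show "0 \<in> tens" using additive_subgroup.zero_closed[OF sub] by (simp only: pair_simps(3))
  show "- p \<in> tens" if "p \<in> tens"
  proof -
    have "0 - p \<in> carrier pair" using car[OF that] by (intro pair_diff_closed) (simp_all add: pair_simps)
    then have "\<ominus>\<^bsub>pair\<^esub> p = - p" using car[OF that] by (intro tens.minus_equality) (simp_all add: pair_simps(3,4))
    then show ?thesis using additive_subgroup.a_inv_closed[OF sub that] by simp
  qed
qed

lemma tens_rel: "r \<in> bilinearity_relations B GA \<Longrightarrow> r \<in> tens"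
  unfolding tens_def tensor_ideal_def using ring.genideal_self[OF pair_ring relations_closed] by blast

lemma tens_bilinear:
  "b \<in> carrier B \<Longrightarrow> b' \<in> carrier B \<Longrightarrow> f \<in> carrier GA \<Longrightarrow>
     Poly_Mapping.single (b \<oplus>\<^bsub>B\<^esub> b', f) 1 - Poly_Mapping.single (b, f) 1 - Poly_Mapping.single (b', f) 1 \<in> tens"
  "b \<in> carrier B \<Longrightarrow> f \<in> carrier GA \<Longrightarrow> f' \<in> carrier GA \<Longrightarrow>
     Poly_Mapping.single (b, f \<oplus>\<^bsub>GA\<^esub> f') 1 - Poly_Mapping.single (b, f) 1 - Poly_Mapping.single (b, f') 1 \<in> tens"
  "b \<in> carrier B \<Longrightarrow> f \<in> carrier GA \<Longrightarrow> Poly_Mapping.single (z \<odot>\<^bsub>B\<^esub> b, f) 1 - Poly_Mapping.single (b, f) z \<in> tens"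
  "b \<in> carrier B \<Longrightarrow> f \<in> carrier GA \<Longrightarrow> Poly_Mapping.single (b, z \<odot>\<^bsub>GA\<^esub> f) 1 - Poly_Mapping.single (b, f) z \<in> tens"
  by (rule tens_rel, unfold bilinearity_relations_def, rule UnI1, rule UnI1, rule UnI1, blast)
    (rule tens_rel, unfold bilinearity_relations_def, rule UnI1, rule UnI1, rule UnI2, blast,
     rule tens_rel, unfold bilinearity_relations_def, rule UnI1, rule UnI2, blast,
     rule tens_rel, unfold bilinearity_relations_def, rule UnI2, blast)

definition equiv_tens :: "('a \<times> ('g \<Rightarrow> complex) \<Rightarrow>\<^sub>0 complex) \<Rightarrow> _ \<Rightarrow> bool" where
  "equiv_tens p q \<longleftrightarrow> p - q \<in> tens"

lemma equiv_tens_trans: "equiv_tens p q \<Longrightarrow> equiv_tens q r \<Longrightarrow> equiv_tens p r"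
  unfolding equiv_tens_def using tens_closed(1)[of "p - q" "q - r"] by simp

lemma equiv_tens_sym: "equiv_tens p q \<Longrightarrow> equiv_tens q p"
  unfolding equiv_tens_def using tens_closed(3)[of "p - q"] by simp

lemma equiv_tens_add: "equiv_tens p q \<Longrightarrow> equiv_tens p' q' \<Longrightarrow> equiv_tens (p + p') (q + q')"
  unfolding equiv_tens_def using tens_closed(1)[of "p - q" "p' - q'"] by (simp add: algebra_simps)

lemma equiv_tens_refl: "equiv_tens p p"
  by (simp add: equiv_tens_def tens_closed)

lemma equiv_tens_sum: "(\<And>i. i \<in> I \<Longrightarrow> equiv_tens (p i) (q i)) \<Longrightarrow> equiv_tens (sum p I) (sum q I)"
  by (induction I rule: infinite_finite_induct) (auto intro: equiv_tens_refl equiv_tens_add)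

lemma equiv_tens_smult: "b \<in> carrier B \<Longrightarrow> f \<in> carrier GA \<Longrightarrow> equiv_tens (Poly_Mapping.single (b, f) z) (Poly_Mapping.single (z \<odot>\<^bsub>C\<^esub> b, f) 1)"
proof (rule equiv_tens_sym)
  assume "b \<in> carrier B" "f \<in> carrier GA"
  then show "equiv_tens (Poly_Mapping.single (z \<odot>\<^bsub>C\<^esub> b, f) 1) (Poly_Mapping.single (b, f) z)"
    using tens_bilinear(3)[of b f z] by (simp add: equiv_tens_def B_ops)
qed

lemma equiv_tens_split:
  assumes b: "b \<in> carrier B" and f: "f \<in> carrier GA"
  shows "equiv_tens (Poly_Mapping.single (b, f) 1) (\<Sum>g\<in>carrier K. Poly_Mapping.single (f g \<odot>\<^bsub>C\<^esub> b, \<delta> g) 1)"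
proof -
  have part: "equiv_tens (Poly_Mapping.single (b, \<lambda>h. \<Sum>g\<in>M. f g * \<delta> g h) 1) (\<Sum>g\<in>M. Poly_Mapping.single (f g \<odot>\<^bsub>C\<^esub> b, \<delta> g) 1)"
    if "finite M" "M \<subseteq> carrier K" for M
    using that
  proof (induction M rule: finite_induct)
    case empty
    have "(\<lambda>h. 0) \<in> carrier GA" by (simp add: group_algebra_simps)
    then have "Poly_Mapping.single (b, 0 \<odot>\<^bsub>GA\<^esub> (\<lambda>h. 0)) 1 - Poly_Mapping.single (b, \<lambda>h. 0) 0 \<in> tens"
      using b by (intro tens_bilinear)
    then show ?case by (simp add: equiv_tens_def group_algebra_simps)
  next
    case (insert g M)
    then have g: "g \<in> carrier K" by simp
    let ?r = "\<lambda>h. \<Sum>g\<in>M. f g * \<delta> g h"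
    have r: "?r \<in> carrier GA" "(\<lambda>h. f g * \<delta> g h) \<in> carrier GA"
      using insert.prems by (auto simp: group_algebra_simps coefficient_at_def intro!: sum.neutral)
    have "(\<lambda>h. \<Sum>g\<in>insert g M. f g * \<delta> g h) = (\<lambda>h. f g * \<delta> g h) \<oplus>\<^bsub>GA\<^esub> ?r"
      using insert by (simp add: group_algebra_simps)
    moreover have "Poly_Mapping.single (b, (\<lambda>h. f g * \<delta> g h) \<oplus>\<^bsub>GA\<^esub> ?r) 1 - Poly_Mapping.single (b, \<lambda>h. f g * \<delta> g h) 1
        - Poly_Mapping.single (b, ?r) 1 \<in> tens"
      using b r by (intro tens_bilinear)
    ultimately have 1: "equiv_tens (Poly_Mapping.single (b, \<lambda>h. \<Sum>g\<in>insert g M. f g * \<delta> g h) 1)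
        (Poly_Mapping.single (b, \<lambda>h. f g * \<delta> g h) 1 + Poly_Mapping.single (b, ?r) 1)"
      by (simp add: equiv_tens_def algebra_simps)
    have "Poly_Mapping.single (b, f g \<odot>\<^bsub>GA\<^esub> \<delta> g) 1 - Poly_Mapping.single (b, \<delta> g) (f g) \<in> tens"
      using b \<delta>_closed[OF g] by (intro tens_bilinear)
    then have 2: "equiv_tens (Poly_Mapping.single (b, \<lambda>h. f g * \<delta> g h) 1) (Poly_Mapping.single (b, \<delta> g) (f g))"
      by (simp add: equiv_tens_def group_algebra_simps)
    have 3: "equiv_tens (Poly_Mapping.single (b, \<lambda>h. f g * \<delta> g h) 1) (Poly_Mapping.single (f g \<odot>\<^bsub>C\<^esub> b, \<delta> g) 1)"
      using equiv_tens_trans[OF 2 equiv_tens_smult[OF b \<delta>_closed[OF g]]] .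
    show ?case
      using equiv_tens_trans[OF 1 equiv_tens_add[OF 3 insert.IH]] insert by simp
  qed
  show ?thesis using part[of "carrier K"] finite_K GA_expansion[OF f] by simp
qed

lemma equiv_tens_add_left:
  assumes "\<And>i. i \<in> I \<Longrightarrow> b i \<in> carrier B" "f \<in> carrier GA" "finite I"
  shows "equiv_tens (\<Sum>i\<in>I. Poly_Mapping.single (b i, f) 1) (Poly_Mapping.single (\<Oplus>\<^bsub>B\<^esub>i\<in>I. b i, f) 1)"
  using assms(3,1)
proof (induction I rule: finite_induct)
  case empty
  have "Poly_Mapping.single (0 \<odot>\<^bsub>B\<^esub> \<zero>\<^bsub>B\<^esub>, f) 1 - Poly_Mapping.single (\<zero>\<^bsub>B\<^esub>, f) 0 \<in> tens"
    using assms(2) B.zero_closed by (intro tens_bilinear)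
  moreover have "0 \<odot>\<^bsub>B\<^esub> \<zero>\<^bsub>B\<^esub> = \<zero>\<^bsub>B\<^esub>" by (simp add: B_ops smult_zero)
  ultimately have "equiv_tens (Poly_Mapping.single (\<zero>\<^bsub>B\<^esub>, f) 1) 0" by (simp add: equiv_tens_def)
  then show ?case by (simp add: equiv_tens_sym)
next
  case (insert i I)
  have cl: "b i \<in> carrier B" "(\<Oplus>\<^bsub>B\<^esub>i\<in>I. b i) \<in> carrier B" using insert.prems by (auto intro!: B.finsum_closed)
  have "Poly_Mapping.single (b i \<oplus>\<^bsub>B\<^esub> (\<Oplus>\<^bsub>B\<^esub>i\<in>I. b i), f) 1 - Poly_Mapping.single (b i, f) 1
      - Poly_Mapping.single (\<Oplus>\<^bsub>B\<^esub>i\<in>I. b i, f) 1 \<in> tens"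
    using assms(2) cl by (intro tens_bilinear)
  then have 1: "equiv_tens (Poly_Mapping.single (b i \<oplus>\<^bsub>B\<^esub> (\<Oplus>\<^bsub>B\<^esub>i\<in>I. b i), f) 1)
     (Poly_Mapping.single (b i, f) 1 + Poly_Mapping.single (\<Oplus>\<^bsub>B\<^esub>i\<in>I. b i, f) 1)"
    by (simp add: equiv_tens_def algebra_simps)
  have 2: "equiv_tens (Poly_Mapping.single (b i, f) 1 + (\<Sum>i\<in>I. Poly_Mapping.single (b i, f) 1))
     (Poly_Mapping.single (b i, f) 1 + Poly_Mapping.single (\<Oplus>\<^bsub>B\<^esub>i\<in>I. b i, f) 1)"
    using insert by (intro equiv_tens_add equiv_tens_refl) auto
  have "(\<Oplus>\<^bsub>B\<^esub>i\<in>insert i I. b i) = b i \<oplus>\<^bsub>B\<^esub> (\<Oplus>\<^bsub>B\<^esub>i\<in>I. b i)"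
    using insert by (intro B.finsum_insert) auto
  then show ?case using equiv_tens_trans[OF 2 equiv_tens_sym[OF 1]] insert.hyps by simp
qed

lemma equiv_tens_normal:
  assumes "p \<in> carrier pair"
  shows "\<exists>b. b \<in> carrier K \<rightarrow> carrier B \<and> equiv_tens p (\<Sum>g\<in>carrier K. Poly_Mapping.single (b g, \<delta> g) 1)"
  using assms
proof (induction p rule: pair_induct)
  case zero
  have "equiv_tens 0 (\<Sum>g\<in>carrier K. Poly_Mapping.single (\<zero>\<^bsub>B\<^esub>, \<delta> g) 1)"
    using equiv_tens_sum[of "carrier K" "\<lambda>g. 0" "\<lambda>g. Poly_Mapping.single (\<zero>\<^bsub>B\<^esub>, \<delta> g) 1"]
      equiv_tens_add_left[of "{}"] by simp
  then show ?case by (intro exI[of _ "\<lambda>g. \<zero>\<^bsub>B\<^esub>"]) auto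
next
  case (single b f z)
  have zb: "z \<odot>\<^bsub>C\<^esub> b \<in> carrier B" using B_smult single by blast
  have "equiv_tens (Poly_Mapping.single (b, f) z) (\<Sum>g\<in>carrier K. Poly_Mapping.single (f g \<odot>\<^bsub>C\<^esub> (z \<odot>\<^bsub>C\<^esub> b), \<delta> g) 1)"
    by (rule equiv_tens_trans[OF equiv_tens_smult[OF single] equiv_tens_split[OF zb single(2)]])
  then show ?case using B_smult[OF zb] by (intro exI[of _ "\<lambda>g. f g \<odot>\<^bsub>C\<^esub> (z \<odot>\<^bsub>C\<^esub> b)"]) auto
next
  case (add p q)
  then obtain b b' where b: "b \<in> carrier K \<rightarrow> carrier B" "b' \<in> carrier K \<rightarrow> carrier B"
    and e: "equiv_tens p (\<Sum>g\<in>carrier K. Poly_Mapping.single (b g, \<delta> g) 1)"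
      "equiv_tens q (\<Sum>g\<in>carrier K. Poly_Mapping.single (b' g, \<delta> g) 1)" by blast
  have "equiv_tens (Poly_Mapping.single (b g, \<delta> g) 1 + Poly_Mapping.single (b' g, \<delta> g) 1) (Poly_Mapping.single (b g \<oplus>\<^bsub>B\<^esub> b' g, \<delta> g) 1)"
    if g: "g \<in> carrier K" for g
  proof (rule equiv_tens_sym)
    have "Poly_Mapping.single (b g \<oplus>\<^bsub>B\<^esub> b' g, \<delta> g) 1 - Poly_Mapping.single (b g, \<delta> g) 1 - Poly_Mapping.single (b' g, \<delta> g) 1 \<in> tens"
      using b g \<delta>_closed[OF g] by (intro tens_bilinear) auto
    then show "equiv_tens (Poly_Mapping.single (b g \<oplus>\<^bsub>B\<^esub> b' g, \<delta> g) 1) (Poly_Mapping.single (b g, \<delta> g) 1 + Poly_Mapping.single (b' g, \<delta> g) 1)"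
      by (simp add: equiv_tens_def algebra_simps)
  qed
  then have "equiv_tens (\<Sum>g\<in>carrier K. Poly_Mapping.single (b g, \<delta> g) 1 + Poly_Mapping.single (b' g, \<delta> g) 1)
      (\<Sum>g\<in>carrier K. Poly_Mapping.single (b g \<oplus>\<^bsub>B\<^esub> b' g, \<delta> g) 1)"
    by (rule equiv_tens_sum)
  from equiv_tens_trans[OF equiv_tens_add[OF e, folded sum.distrib] this]
  show ?case using b by (intro exI[of _ "\<lambda>g. b g \<oplus>\<^bsub>B\<^esub> b' g"]) auto
qed

lemma ev_normal:
  assumes "b \<in> carrier K \<rightarrow> carrier B"
  shows "ev (\<Sum>g\<in>carrier K. Poly_Mapping.single (b g, \<delta> g) 1) = (\<Oplus>\<^bsub>C\<^esub>g\<in>carrier K. b g \<otimes>\<^bsub>C\<^esub> \<iota> (\<delta> g))"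
proof -
  have "ev (\<Sum>g\<in>M. Poly_Mapping.single (b g, \<delta> g) 1) = (\<Oplus>\<^bsub>C\<^esub>g\<in>M. b g \<otimes>\<^bsub>C\<^esub> \<iota> (\<delta> g))"
    if "finite M" "M \<subseteq> carrier K" for M
    using that
  proof (induction M rule: finite_induct)
    case empty
    show ?case by (simp add: ev_def)
  next
    case (insert g M)
    have g: "b g \<in> carrier B" "g \<in> carrier K" and M: "\<And>h. h \<in> M \<Longrightarrow> b h \<in> carrier B \<and> h \<in> carrier K"
      using insert.prems assms by auto
    have "(\<Sum>g\<in>M. Poly_Mapping.single (b g, \<delta> g) 1) \<in> carrier pair"
      using M by (intro pair_sum_closed pair_single_closed) auto
    then show ?case
      using insert g M by (simp add: ev_add pair_single_closed ev_single smult_one C.finsum_insert Pi_def)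
  qed
  then show ?thesis using finite_K by blast
qed

lemma kernel_tens: "a_kernel pair C ev = tens"
proof
  show "a_kernel pair C ev \<subseteq> tens"
  proof
    fix p assume "p \<in> a_kernel pair C ev"
    then have p: "p \<in> carrier pair" "ev p = \<zero>\<^bsub>C\<^esub>" by (auto simp: a_kernel_def')
    obtain b where b: "b \<in> carrier K \<rightarrow> carrier B"
      and e: "equiv_tens p (\<Sum>g\<in>carrier K. Poly_Mapping.single (b g, \<delta> g) 1)" using equiv_tens_normal[OF p(1)] by blast
    let ?n = "\<Sum>g\<in>carrier K. Poly_Mapping.single (b g, \<delta> g) 1"
    have n: "?n \<in> carrier pair" using b by (intro pair_sum_closed pair_single_closed) auto
    have "ev (p - ?n) = \<zero>\<^bsub>C\<^esub>" using e tens_kernel by (auto simp: equiv_tens_def a_kernel_def')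
    then have "ev ?n = \<zero>\<^bsub>C\<^esub>"
      using ev_diff[OF p(1) n] p(2) ev_closed[OF n] by (simp add: C.minus_eq)
    then have "b g = \<zero>\<^bsub>C\<^esub>" if "g \<in> carrier K" for g
      using independent[OF b _ that] by (simp add: ev_normal[OF b])
    then have n0: "?n = (\<Sum>g\<in>carrier K. Poly_Mapping.single (\<zero>\<^bsub>B\<^esub>, \<delta> g) 1)"
      by (intro sum.cong) (auto simp: B_ops)
    have "equiv_tens (\<Sum>g\<in>carrier K. Poly_Mapping.single (\<zero>\<^bsub>B\<^esub>, \<delta> g) 1) (\<Sum>g\<in>carrier K. 0)"
      using equiv_tens_add_left[of "{}"] by (intro equiv_tens_sum) (simp add: equiv_tens_sym)
    then have "equiv_tens p 0" using equiv_tens_trans[OF e] unfolding n0 by simp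
    then show "p \<in> tens" by (simp add: equiv_tens_def)
  qed
qed (rule tens_kernel)

text \<open>
  The isomorphism theorem for the evaluation map, whose kernel is generated by the bilinearity
  relations.
\<close>

theorem tensor_iso:
  "\<exists>\<phi> \<in> ring_iso (tensor_product B GA) C.
     \<forall>b\<in>carrier B. \<forall>f\<in>carrier GA. \<phi> (pure_tensor B GA b f) = b \<otimes>\<^bsub>C\<^esub> \<iota> f"
proof (rule bexI)
  interpret ev: ring_hom_ring pair C ev by (rule ev_hom_ring)
  have "ev ` carrier pair = carrier C"
  proof
    show "carrier C \<subseteq> ev ` carrier pair"
    proof
      fix x assume "x \<in> carrier C"
      then obtain b where b: "b \<in> carrier K \<rightarrow> carrier B" "x = (\<Oplus>\<^bsub>C\<^esub>g\<in>carrier K. b g \<otimes>\<^bsub>C\<^esub> \<iota> (\<delta> g))" using spans by blast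
      have n: "(\<Sum>g\<in>carrier K. Poly_Mapping.single (b g, \<delta> g) 1) \<in> carrier pair"
        using b(1) by (intro pair_sum_closed pair_single_closed) auto
      show "x \<in> ev ` carrier pair"
        unfolding b(2) ev_normal[OF b(1), symmetric] by (rule imageI[OF n])
    qed
  qed (auto simp: ev_closed)
  then have "(\<lambda>X. the_elem (ev ` X)) \<in> ring_iso (pair Quot (a_kernel pair C ev)) C"
    by (rule ev.FactRing_iso_set)
  then show "(\<lambda>X. the_elem (ev ` X)) \<in> ring_iso (tensor_product B GA) C"
    unfolding tensor_product_def kernel_tens tens_def .
  show "\<forall>b\<in>carrier B. \<forall>f\<in>carrier GA. the_elem (ev ` pure_tensor B GA b f) = b \<otimes>\<^bsub>C\<^esub> \<iota> f"
  proof (intro ballI)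
    fix b f assume bf: "b \<in> carrier B" "f \<in> carrier GA"
    let ?s = "Poly_Mapping.single (b, f) (1::complex)"
    have s: "?s \<in> carrier pair" by (rule pair_single_closed[OF bf])
    have const: "ev (k \<oplus>\<^bsub>pair\<^esub> ?s) = ev ?s" if "k \<in> tens" for k
    proof -
      have "k \<in> a_kernel pair C ev" using that tens_kernel by blast
      then have k: "k \<in> carrier pair" "ev k = \<zero>\<^bsub>C\<^esub>" unfolding a_kernel_def' by blast+
      show ?thesis
        by (simp only: ring_hom_add[OF ev_hom k(1) s] k(2) C.l_zero[OF ev_closed[OF s]])
    qed
    have "pure_tensor B GA b f = (\<Union>k\<in>tens. {k \<oplus>\<^bsub>pair\<^esub> ?s})"
      unfolding pure_tensor_def tens_def[symmetric] a_r_coset_def' ..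
    moreover have "ev ` (\<Union>k\<in>tens. {k \<oplus>\<^bsub>pair\<^esub> ?s}) = {ev ?s}"
    proof
      show "ev ` (\<Union>k\<in>tens. {k \<oplus>\<^bsub>pair\<^esub> ?s}) \<subseteq> {ev ?s}" using const by blast
      have "ev (0 \<oplus>\<^bsub>pair\<^esub> ?s) \<in> ev ` (\<Union>k\<in>tens. {k \<oplus>\<^bsub>pair\<^esub> ?s})" using tens_closed(2) by blast
      then show "{ev ?s} \<subseteq> ev ` (\<Union>k\<in>tens. {k \<oplus>\<^bsub>pair\<^esub> ?s})" using const[OF tens_closed(2)] by simp
    qed
    ultimately have "ev ` pure_tensor B GA b f = {ev ?s}" by (rule trans[OF arg_cong[where f = "image ev"]])
    then have "the_elem (ev ` pure_tensor B GA b f) = ev ?s" by (simp only: the_elem_eq)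
    then show "the_elem (ev ` pure_tensor B GA b f) = b \<otimes>\<^bsub>C\<^esub> \<iota> f" using bf by (simp add: ev_single smult_one)
  qed
qed

end

section \<open>Primitive idempotents\<close>

text \<open>The idempotent \<open>x\<close> splits as \<open>x y + x (1 - y)\<close>.\<close>

lemma (in cring) primitive_idempotents_orthogonal:
  assumes x: "x \<in> carrier R" "x \<otimes> x = x" and y: "y \<in> carrier R" "y \<otimes> y = y"
    and px: "\<And>f g. f \<in> carrier R \<Longrightarrow> g \<in> carrier R \<Longrightarrow> f \<otimes> f = f \<Longrightarrow> g \<otimes> g = g \<Longrightarrow> f \<otimes> g = \<zero> \<Longrightarrow>
        x = f \<oplus> g \<Longrightarrow> f = \<zero> \<or> g = \<zero>"
  shows "x \<otimes> y = \<zero> \<or> x \<otimes> y = x"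
proof -
  let ?f = "x \<otimes> y" and ?g = "x \<otimes> (\<one> \<ominus> y)"
  have car: "?f \<in> carrier R" "?g \<in> carrier R" using x y by auto
  have ff: "?f \<otimes> ?f = ?f"
  proof -
    have "?f \<otimes> ?f = (x \<otimes> x) \<otimes> (y \<otimes> y)" using x(1) y(1) by algebra
    then show ?thesis using x y by simp
  qed
  have ny: "(\<one> \<ominus> y) \<otimes> (\<one> \<ominus> y) = \<one> \<ominus> y"
  proof -
    have "(\<one> \<ominus> y) \<otimes> (\<one> \<ominus> y) = \<one> \<ominus> y \<ominus> y \<oplus> (y \<otimes> y)" using y(1) by algebra
    also have "\<dots> = \<one> \<ominus> y" unfolding y(2) using y(1) by algebra
    finally show ?thesis .
  qed
  have gg: "?g \<otimes> ?g = ?g"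
  proof -
    have "?g \<otimes> ?g = (x \<otimes> x) \<otimes> ((\<one> \<ominus> y) \<otimes> (\<one> \<ominus> y))" using x(1) y(1) by algebra
    then show ?thesis using x ny by simp
  qed
  have fg: "?f \<otimes> ?g = \<zero>"
  proof -
    have "?f \<otimes> ?g = (x \<otimes> x) \<otimes> (y \<ominus> y \<otimes> y)" using x(1) y(1) by algebra
    also have "\<dots> = \<zero>" unfolding y(2) x(2) using x(1) y(1) by algebra
    finally show ?thesis .
  qed
  have sum: "x = ?f \<oplus> ?g" using x(1) y(1) by algebra
  from px[OF car ff gg fg sum] show ?thesis
  proof
    assume "?g = \<zero>"
    then show ?thesis using sum car(1) by simp
  qed simp
qed

locale free_over_abelian_group = free_over_group K B C \<iota>
  for K :: "('g, 'm) monoid_scheme" (structure) and B C :: "(complex, 'a) module"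
    and \<iota> :: "('g \<Rightarrow> complex) \<Rightarrow> 'a" +
  assumes K_comm: "g \<in> carrier K \<Longrightarrow> h \<in> carrier K \<Longrightarrow> g \<otimes> h = h \<otimes> g"
begin

lemma GA_mult: "f \<otimes>\<^bsub>GA\<^esub> h = (\<lambda>k. if k \<in> carrier K then \<Sum>a\<in>carrier K. f a * h (inv a \<otimes> k) else 0)"
  using GA.CP_mult by simp

lemma GA_comm: "f \<otimes>\<^bsub>GA\<^esub> h = h \<otimes>\<^bsub>GA\<^esub> f"
proof
  fix k
  have "(\<Sum>a\<in>carrier K. f a * h (inv a \<otimes> k)) = (\<Sum>b\<in>carrier K. h b * f (inv b \<otimes> k))" if k: "k \<in> carrier K"
  proof (rule sum.reindex_bij_witness[where i = "\<lambda>b. inv b \<otimes> k" and j = "\<lambda>a. inv a \<otimes> k"])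
    fix a assume a: "a \<in> carrier K"
    have inv: "inv (inv a \<otimes> k) \<otimes> k = a"
    proof -
      have "inv (inv a \<otimes> k) \<otimes> k = inv k \<otimes> a \<otimes> k" using a k by (simp add: inv_mult_group)
      also have "\<dots> = inv k \<otimes> (k \<otimes> a)" using a k K_comm[of a k] by (simp add: m_assoc)
      also have "\<dots> = a" using a k by (simp add: m_assoc[symmetric])
      finally show ?thesis .
    qed
    show "inv (inv a \<otimes> k) \<otimes> k = a" "inv (inv a \<otimes> k) \<otimes> k = a" "inv a \<otimes> k \<in> carrier K" "inv a \<otimes> k \<in> carrier K"
      using a k inv by auto
    show "h (inv a \<otimes> k) * f (inv (inv a \<otimes> k) \<otimes> k) = f a * h (inv a \<otimes> k)"
      by (simp only: inv mult.commute)
  qed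
  then show "(f \<otimes>\<^bsub>GA\<^esub> h) k = (h \<otimes>\<^bsub>GA\<^esub> f) k" by (simp add: GA_mult)
qed

lemma GA_cring: "cring GA"
  by (intro cring.intro GA.CP_ring comm_monoid.intro GA.CP.monoid_axioms comm_monoid_axioms.intro)
    (rule GA_comm)

lemma GA_mult_sum: "(\<lambda>h. \<Sum>i\<in>I. z i * F i h) \<otimes>\<^bsub>GA\<^esub> f = (\<lambda>h. \<Sum>i\<in>I. z i * (F i \<otimes>\<^bsub>GA\<^esub> f) h)"
proof
  fix k
  have "(\<Sum>a\<in>carrier K. (\<Sum>i\<in>I. z i * F i a) * f (inv a \<otimes> k)) = (\<Sum>a\<in>carrier K. \<Sum>i\<in>I. z i * (F i a * f (inv a \<otimes> k)))"
    by (simp add: sum_distrib_right mult.assoc)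
  also have "\<dots> = (\<Sum>i\<in>I. \<Sum>a\<in>carrier K. z i * (F i a * f (inv a \<otimes> k)))" by (rule sum.swap)
  finally show "((\<lambda>h. \<Sum>i\<in>I. z i * F i h) \<otimes>\<^bsub>GA\<^esub> f) k = (\<Sum>i\<in>I. z i * (F i \<otimes>\<^bsub>GA\<^esub> f) k)"
    by (simp add: GA_mult sum_distrib_left)
qed

lemma \<iota>_sum:
  assumes "finite I" "\<And>i. i \<in> I \<Longrightarrow> F i \<in> carrier GA"
  shows "\<iota> (\<lambda>h. \<Sum>i\<in>I. z i * F i h) = (\<Oplus>\<^bsub>C\<^esub>i\<in>I. z i \<odot>\<^bsub>C\<^esub> \<iota> (F i))"
  using assms
proof (induction I rule: finite_induct)
  case empty
  have "\<iota> \<zero>\<^bsub>GA\<^esub> = \<zero>\<^bsub>C\<^esub>" using ring_hom_zero[OF \<iota>_hom GA.CP_ring C.ring_axioms] .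
  then show ?case by (simp add: group_algebra_simps)
next
  case (insert i I)
  have cl: "(\<lambda>h. z i * F i h) \<in> carrier GA" "(\<lambda>h. \<Sum>i\<in>I. z i * F i h) \<in> carrier GA"
    using insert.prems by (auto simp: group_algebra_simps intro!: sum.neutral)
  have "(\<lambda>h. \<Sum>i\<in>insert i I. z i * F i h) = (\<lambda>h. z i * F i h) \<oplus>\<^bsub>GA\<^esub> (\<lambda>h. \<Sum>i\<in>I. z i * F i h)"
    using insert by (simp add: group_algebra_simps)
  moreover have "\<iota> (\<lambda>h. z i * F i h) = z i \<odot>\<^bsub>C\<^esub> \<iota> (F i)"
    using \<iota>_smult[of "F i" "z i"] insert.prems by (simp add: group_algebra_simps)
  ultimately show ?case
    using insert by (simp add: ring_hom_add[OF \<iota>_hom cl] C.finsum_insert smult_closed Pi_def)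
qed

context
  fixes e :: "nat \<Rightarrow> 'g \<Rightarrow> complex"
  assumes bij: "bij_betw e {..<order K} {a. primitive_idempotent GA a}"
begin

abbreviation "I \<equiv> {..<order K}"

lemma prim: "i \<in> I \<Longrightarrow> primitive_idempotent GA (e i)"
  using bij_betwE[OF bij] by blast

lemma e_closed: "i \<in> I \<Longrightarrow> e i \<in> carrier GA"
  and e_idem: "i \<in> I \<Longrightarrow> e i \<otimes>\<^bsub>GA\<^esub> e i = e i"
  and e_nonzero: "i \<in> I \<Longrightarrow> e i \<noteq> (\<lambda>g. 0)"
  using prim[of i] by (auto simp: primitive_idempotent_def group_algebra_simps)

lemma e_inj: "i \<in> I \<Longrightarrow> j \<in> I \<Longrightarrow> e i = e j \<longleftrightarrow> i = j"
  using bij_betw_imp_inj_on[OF bij] by (auto dest: inj_onD)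

lemma e_orthogonal:
  assumes "i \<in> I" "j \<in> I" "i \<noteq> j"
  shows "e i \<otimes>\<^bsub>GA\<^esub> e j = (\<lambda>g. 0)"
proof -
  interpret GAc: cring GA by (rule GA_cring)
  have split: "f = \<zero>\<^bsub>GA\<^esub> \<or> g = \<zero>\<^bsub>GA\<^esub>" if "i \<in> I" "f \<in> carrier GA" "g \<in> carrier GA" "f \<otimes>\<^bsub>GA\<^esub> f = f" "g \<otimes>\<^bsub>GA\<^esub> g = g"
    "f \<otimes>\<^bsub>GA\<^esub> g = \<zero>\<^bsub>GA\<^esub>" "e i = f \<oplus>\<^bsub>GA\<^esub> g" for i f g
    using prim[OF that(1)] that(2-) GA_comm[of g f] unfolding primitive_idempotent_def by metis
  have "e i \<otimes>\<^bsub>GA\<^esub> e j = \<zero>\<^bsub>GA\<^esub> \<or> e i \<otimes>\<^bsub>GA\<^esub> e j = e i"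
    by (rule GAc.primitive_idempotents_orthogonal) (use assms e_closed e_idem split[of i] in auto)
  moreover have "e j \<otimes>\<^bsub>GA\<^esub> e i = \<zero>\<^bsub>GA\<^esub> \<or> e j \<otimes>\<^bsub>GA\<^esub> e i = e j"
    by (rule GAc.primitive_idempotents_orthogonal) (use assms e_closed e_idem split[of j] in auto)
  ultimately show ?thesis
    using GA_comm[of "e i" "e j"] e_inj[OF assms(1,2)] assms(3) by (auto simp: group_algebra_simps)
qed

lemma e_mult_combination:
  assumes "j \<in> I"
  shows "(\<lambda>h. \<Sum>i\<in>I. z i * e i h) \<otimes>\<^bsub>GA\<^esub> e j = (\<lambda>h. z j * e j h)"
proof -
  have "(\<Sum>i\<in>I. z i * (e i \<otimes>\<^bsub>GA\<^esub> e j) h) = (\<Sum>i\<in>I. if i = j then z j * e j h else 0)" for h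
    using assms by (intro sum.cong) (auto simp: e_orthogonal e_idem)
  then show ?thesis using assms unfolding GA_mult_sum by simp
qed

text \<open>
  Orthogonal idempotents are linearly independent. As there are as many as the dimension of the
  group algebra, they form a basis.
\<close>

lemma e_spans:
  assumes f: "f \<in> carrier GA"
  shows "\<exists>z. f = (\<lambda>h. \<Sum>i\<in>I. z i * e i h)"
proof -
  define sc :: "complex \<Rightarrow> ('g \<Rightarrow>\<^sub>0 complex) \<Rightarrow> ('g \<Rightarrow>\<^sub>0 complex)" where "sc a p = Poly_Mapping.map ((*) a) p" for a p
  have lookup_sc: "Poly_Mapping.lookup (sc a p) k = a * Poly_Mapping.lookup p k" for a p k
    by (simp add: sc_def Poly_Mapping.map.rep_eq when_def)
  interpret V: vector_space sc
    by unfold_locales (auto intro!: poly_mapping_eqI simp: lookup_sc lookup_add algebra_simps)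
  define pm where "pm f = (\<Sum>g\<in>carrier K. Poly_Mapping.single g (f g))" for f :: "'g \<Rightarrow> complex"
  have lookup_pm: "Poly_Mapping.lookup (pm f) k = f k" if "f \<in> carrier GA" for f k
    using that finite_K by (auto simp: pm_def lookup_sum lookup_single when_def group_algebra_simps)
  define T where "T = (\<lambda>g. Poly_Mapping.single g (1::complex)) ` carrier K"
  have T: "finite T" "card T \<le> order K"
    using finite_K card_image_le[of "carrier K"] by (auto simp: T_def order_def)
  have in_span: "pm f \<in> V.span T" for f
  proof -
    have "Poly_Mapping.single g (f g) = sc (f g) (Poly_Mapping.single g 1)" for g
      by (rule poly_mapping_eqI) (simp add: lookup_sc lookup_single when_def)
    then show ?thesis unfolding pm_def T_def by (intro V.span_sum) (simp add: V.span_scale V.span_base)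
  qed
  define E where "E = (\<lambda>i. pm (e i)) ` I"
  have inj: "inj_on (\<lambda>i. pm (e i)) I"
  proof (rule inj_onI)
    fix i j assume ij: "i \<in> I" "j \<in> I" and eq: "pm (e i) = pm (e j)"
    have "e i k = e j k" for k
      using arg_cong[OF eq, of "\<lambda>p. Poly_Mapping.lookup p k"] ij by (simp only: lookup_pm e_closed)
    then show "i = j" using e_inj[OF ij] by blast
  qed
  have lookup_comb: "Poly_Mapping.lookup (\<Sum>v\<in>E. sc (u v) v) k = (\<Sum>i\<in>I. u (pm (e i)) * e i k)" for u k
    unfolding E_def by (simp add: sum.reindex[OF inj] lookup_sum lookup_sc lookup_pm e_closed)
  have indep: "V.independent E"
  proof (rule V.independent_if_scalars_zero)
    fix u x assume zero: "(\<Sum>v\<in>E. sc (u v) v) = 0" and "x \<in> E"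
    then obtain j where j: "j \<in> I" "x = pm (e j)" by (auto simp: E_def)
    have "(\<lambda>h. \<Sum>i\<in>I. u (pm (e i)) * e i h) = (\<lambda>h. 0)"
      using lookup_comb[of u] by (simp add: zero)
    then have "(\<lambda>h. 0) \<otimes>\<^bsub>GA\<^esub> e j = (\<lambda>h. u (pm (e j)) * e j h)"
      using e_mult_combination[OF j(1), of "\<lambda>i. u (pm (e i))"] by simp
    moreover have "(\<lambda>h. 0) \<otimes>\<^bsub>GA\<^esub> e j = (\<lambda>h. 0)" by (rule ext) (simp add: GA_mult)
    ultimately have "(\<lambda>h. u (pm (e j)) * e j h) = (\<lambda>h. 0)" by simp
    then show "u x = 0" using e_nonzero[OF j(1)] j(2) by (metis mult_eq_0_iff)
  qed (simp add: E_def)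
  have cardE: "card E = order K" unfolding E_def by (simp add: card_image[OF inj])
  have finE: "finite E" by (simp add: E_def)
  have "pm f \<in> V.span E"
  proof (rule ccontr)
    assume out: "pm f \<notin> V.span E"
    have ind: "V.independent (insert (pm f) E)" using V.independent_insertI[OF out indep] .
    have "insert (pm f) E \<subseteq> V.span T" using in_span by (auto simp: E_def)
    from V.independent_span_bound[OF T(1) ind this] have "card (insert (pm f) E) \<le> card T" by blast
    moreover have "finite E" by (simp add: E_def)
    moreover have "pm f \<notin> E" using out V.span_base[of "pm f" E] by blast
    ultimately have "Suc (card E) \<le> card T" using card_insert_disjoint[of E "pm f"] by linarith
    then show False using T(2) cardE by linarith
  qed
  then obtain u where u: "pm f = (\<Sum>v\<in>E. sc (u v) v)"
    using V.span_finite[of E] finE by blast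
  have "f = (\<lambda>h. \<Sum>i\<in>I. u (pm (e i)) * e i h)"
  proof
    fix k
    show "f k = (\<Sum>i\<in>I. u (pm (e i)) * e i k)"
      using lookup_pm[OF f, of k] unfolding u lookup_comb by (rule sym)
  qed
  then show ?thesis by (rule exI[of _ "\<lambda>i. u (pm (e i))"])
qed

lemma e_unit: "\<one>\<^bsub>GA\<^esub> = (\<lambda>h. \<Sum>i\<in>I. e i h)"
proof -
  obtain z where z: "\<one>\<^bsub>GA\<^esub> = (\<lambda>h. \<Sum>i\<in>I. z i * e i h)" using e_spans[OF GA.CP.one_closed] by blast
  have "z j * e j h = e j h" if "j \<in> I" for j h
    using fun_cong[OF e_mult_combination[OF that, of z], of h] GA.CP.l_one[OF e_closed[OF that]]
    unfolding z[symmetric] by simp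
  then show ?thesis unfolding z by (intro ext sum.cong refl) blast
qed

abbreviation "N i \<equiv> {b \<otimes>\<^bsub>C\<^esub> \<iota> (e i) | b. b \<in> carrier B}"

lemma \<iota>e_closed [simp]: "i \<in> I \<Longrightarrow> \<iota> (e i) \<in> carrier C"
  by (simp add: e_closed)

lemma \<iota>e_mult: "i \<in> I \<Longrightarrow> j \<in> I \<Longrightarrow> \<iota> (e i) \<otimes>\<^bsub>C\<^esub> \<iota> (e j) = (if i = j then \<iota> (e i) else \<zero>\<^bsub>C\<^esub>)"
proof -
  assume ij: "i \<in> I" "j \<in> I"
  have "\<iota> \<zero>\<^bsub>GA\<^esub> = \<zero>\<^bsub>C\<^esub>" using ring_hom_zero[OF \<iota>_hom GA.CP_ring C.ring_axioms] .
  then show ?thesis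
    using ij e_orthogonal[OF ij] e_idem[of i] ring_hom_mult[OF \<iota>_hom e_closed[OF ij(1)] e_closed[OF ij(2)]]
    by (auto simp: group_algebra_simps)
qed

text \<open>
  Multiplication by \<open>e\<^sub>i\<close> turns each group element into a scalar multiple of
  \<open>e\<^sub>i\<close>, because the idempotents form a basis.
\<close>

lemma component:
  assumes m: "m \<in> carrier C" and i: "i \<in> I"
  shows "m \<otimes>\<^bsub>C\<^esub> \<iota> (e i) \<in> N i"
proof -
  obtain b where b: "b \<in> carrier K \<rightarrow> carrier B" "m = (\<Oplus>\<^bsub>C\<^esub>g\<in>carrier K. b g \<otimes>\<^bsub>C\<^esub> \<iota> (\<delta> g))"
    using spans[OF m] by blast
  have "\<exists>z. \<forall>g\<in>carrier K. \<delta> g \<otimes>\<^bsub>GA\<^esub> e i = (\<lambda>h. z g * e i h)"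
  proof (rule bchoice, rule ballI)
    fix g assume "g \<in> carrier K"
    then obtain z where "\<delta> g = (\<lambda>h. \<Sum>i\<in>I. z i * e i h)" using e_spans[OF \<delta>_closed] by blast
    then show "\<exists>z. \<delta> g \<otimes>\<^bsub>GA\<^esub> e i = (\<lambda>h. z * e i h)" using e_mult_combination[OF i, of z] by auto
  qed
  then obtain z where z: "\<And>g. g \<in> carrier K \<Longrightarrow> \<delta> g \<otimes>\<^bsub>GA\<^esub> e i = z g \<odot>\<^bsub>GA\<^esub> e i"
    by (auto simp: group_algebra_simps)
  have bg: "b g \<in> carrier B" if "g \<in> carrier K" for g using b(1) that by auto
  have trm: "b g \<otimes>\<^bsub>C\<^esub> \<iota> (\<delta> g) \<otimes>\<^bsub>C\<^esub> \<iota> (e i) = (z g \<odot>\<^bsub>C\<^esub> b g) \<otimes>\<^bsub>C\<^esub> \<iota> (e i)" if g: "g \<in> carrier K" for g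
  proof -
    have "\<iota> (\<delta> g) \<otimes>\<^bsub>C\<^esub> \<iota> (e i) = z g \<odot>\<^bsub>C\<^esub> \<iota> (e i)"
      using ring_hom_mult[OF \<iota>_hom \<delta>_closed[OF g] e_closed[OF i]] \<iota>_smult[OF e_closed[OF i]] z[OF g] by simp
    moreover have "b g \<otimes>\<^bsub>C\<^esub> (z g \<odot>\<^bsub>C\<^esub> \<iota> (e i)) = (z g \<odot>\<^bsub>C\<^esub> b g) \<otimes>\<^bsub>C\<^esub> \<iota> (e i)"
    proof -
      have bc: "b g \<in> carrier C" "\<iota> (e i) \<in> carrier C" using bg[OF g] i by auto
      have "b g \<otimes>\<^bsub>C\<^esub> (z g \<odot>\<^bsub>C\<^esub> \<iota> (e i)) = (z g \<odot>\<^bsub>C\<^esub> \<iota> (e i)) \<otimes>\<^bsub>C\<^esub> b g"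
        by (rule C.m_comm[OF bc(1) smult_closed[OF bc(2)]])
      also have "\<dots> = z g \<odot>\<^bsub>C\<^esub> (\<iota> (e i) \<otimes>\<^bsub>C\<^esub> b g)" by (rule smult_mult[OF bc(2,1)])
      also have "\<dots> = z g \<odot>\<^bsub>C\<^esub> (b g \<otimes>\<^bsub>C\<^esub> \<iota> (e i))" by (simp only: C.m_comm[OF bc(2,1)])
      also have "\<dots> = (z g \<odot>\<^bsub>C\<^esub> b g) \<otimes>\<^bsub>C\<^esub> \<iota> (e i)" by (rule smult_mult[OF bc, symmetric])
      finally show ?thesis .
    qed
    ultimately show ?thesis using bg[OF g] g i by (simp add: C.m_assoc)
  qed
  have zb: "z g \<odot>\<^bsub>C\<^esub> b g \<in> carrier B" if "g \<in> carrier K" for g by (rule B_smult[OF bg[OF that]])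
  have "m \<otimes>\<^bsub>C\<^esub> \<iota> (e i) = (\<Oplus>\<^bsub>C\<^esub>g\<in>carrier K. b g \<otimes>\<^bsub>C\<^esub> \<iota> (\<delta> g) \<otimes>\<^bsub>C\<^esub> \<iota> (e i))"
    unfolding b(2) using finite_K bg i by (intro C.finsum_ldistr) auto
  also have "\<dots> = (\<Oplus>\<^bsub>C\<^esub>g\<in>carrier K. (z g \<odot>\<^bsub>C\<^esub> b g) \<otimes>\<^bsub>C\<^esub> \<iota> (e i))"
    using zb i by (intro C.finsum_cong') (auto simp: trm)
  also have "\<dots> = (\<Oplus>\<^bsub>C\<^esub>g\<in>carrier K. z g \<odot>\<^bsub>C\<^esub> b g) \<otimes>\<^bsub>C\<^esub> \<iota> (e i)"
    using finite_K zb i by (intro C.finsum_ldistr[symmetric]) auto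
  finally have eq: "m \<otimes>\<^bsub>C\<^esub> \<iota> (e i) = (\<Oplus>\<^bsub>C\<^esub>g\<in>carrier K. z g \<odot>\<^bsub>C\<^esub> b g) \<otimes>\<^bsub>C\<^esub> \<iota> (e i)" .
  have "(\<Oplus>\<^bsub>C\<^esub>g\<in>M. z g \<odot>\<^bsub>C\<^esub> b g) \<in> carrier B" if "finite M" "M \<subseteq> carrier K" for M
    using that
  proof (induction M rule: finite_induct)
    case empty
    show ?case using B.zero_closed by (simp add: B_ops)
  next
    case (insert g M)
    have "(\<Oplus>\<^bsub>C\<^esub>g\<in>insert g M. z g \<odot>\<^bsub>C\<^esub> b g) = z g \<odot>\<^bsub>C\<^esub> b g \<oplus>\<^bsub>C\<^esub> (\<Oplus>\<^bsub>C\<^esub>g\<in>M. z g \<odot>\<^bsub>C\<^esub> b g)"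
      using insert zb by (intro C.finsum_insert) auto
    also have "\<dots> \<in> carrier B" using B.a_closed[of "z g \<odot>\<^bsub>C\<^esub> b g" "\<Oplus>\<^bsub>C\<^esub>g\<in>M. z g \<odot>\<^bsub>C\<^esub> b g"] insert zb
      by (simp add: B_ops)
    finally show ?case .
  qed
  from this[OF finite_K subset_refl] show ?thesis unfolding eq by blast
qed

text \<open>
  Multiplication by the orthogonal idempotents \<open>e\<^sub>i\<close>, whose sum is one, gives the components.
\<close>

theorem direct_sum: "internal_direct_sum B (ring_as_module C) I N"
  unfolding internal_direct_sum_def
proof (intro conjI ballI)
  let ?M = "ring_as_module C"
  have M: "carrier ?M = carrier C" "add ?M = add C" "zero ?M = zero C" "smult ?M = monoid.mult C"
    "monoid.mult ?M = monoid.mult C" "one ?M = one C"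
    by (simp_all add: ring_as_module_def)
  have abM: "abelian_group ?M"
  proof (rule abelian_groupI)
    fix x assume "x \<in> carrier ?M"
    then show "\<exists>y\<in>carrier ?M. y \<oplus>\<^bsub>?M\<^esub> x = \<zero>\<^bsub>?M\<^esub>"
      by (intro bexI[of _ "\<ominus>\<^bsub>C\<^esub> x"]) (simp_all add: M C.l_neg)
  qed (simp_all add: M C.a_ac)
  interpret abM: abelian_group ?M by (rule abM)
  have finsum: "finsum ?M f J = finsum C f J" if "finite J" "\<And>i. i \<in> J \<Longrightarrow> f i \<in> carrier C" for f :: "nat \<Rightarrow> 'a" and J
    using that
  proof (induction J rule: finite_induct)
    case (insert i J)
    have "finsum ?M f (insert i J) = f i \<oplus>\<^bsub>?M\<^esub> finsum ?M f J"
      using insert by (intro abM.finsum_insert) (auto simp: M)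
    also have "\<dots> = finsum C f (insert i J)"
      using insert by (simp add: M C.finsum_insert Pi_def)
    finally show ?case .
  qed (simp add: M)
  show mod: "module B ?M"
    by (rule moduleI[OF B_cring abM]) (simp_all add: M B_ops C.l_distr C.r_distr C.m_assoc)
  interpret M: module B ?M by (rule mod)
  show "submodule (N i) B ?M" if i: "i \<in> I" for i
  proof (rule M.submoduleI)
    show "N i \<subseteq> carrier ?M" using i by (auto simp: M)
    have "\<zero>\<^bsub>C\<^esub> = \<zero>\<^bsub>C\<^esub> \<otimes>\<^bsub>C\<^esub> \<iota> (e i)" using i by simp
    then show "\<zero>\<^bsub>?M\<^esub> \<in> N i" using B.zero_closed by (auto simp: M B_ops)
    fix x assume "x \<in> N i"
    then obtain b where b: "x = b \<otimes>\<^bsub>C\<^esub> \<iota> (e i)" "b \<in> carrier B" by blast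
    have Bminus: "\<ominus>\<^bsub>C\<^esub> b \<in> carrier B"
    proof -
      have "\<ominus>\<^bsub>B\<^esub> b \<oplus>\<^bsub>C\<^esub> b = \<zero>\<^bsub>C\<^esub>" using B.l_neg[OF b(2)] by (simp add: B_ops)
      then have "\<ominus>\<^bsub>C\<^esub> b = \<ominus>\<^bsub>B\<^esub> b" using b(2) B.a_inv_closed[OF b(2)] by (intro C.minus_equality) auto
      then show ?thesis using B.a_inv_closed[OF b(2)] by simp
    qed
    have "\<ominus>\<^bsub>?M\<^esub> x = \<ominus>\<^bsub>C\<^esub> x" using b i by (intro abM.minus_equality) (simp_all add: M C.l_neg)
    also have "\<dots> = (\<ominus>\<^bsub>C\<^esub> b) \<otimes>\<^bsub>C\<^esub> \<iota> (e i)" using b i by (simp add: C.l_minus)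
    finally show "\<ominus>\<^bsub>?M\<^esub> x \<in> N i" using Bminus by blast
    show "x \<oplus>\<^bsub>?M\<^esub> y \<in> N i" if y: "y \<in> N i" for y
    proof -
      obtain b' where b': "y = b' \<otimes>\<^bsub>C\<^esub> \<iota> (e i)" "b' \<in> carrier B" using y by blast
      have "x \<oplus>\<^bsub>?M\<^esub> y = (b \<oplus>\<^bsub>C\<^esub> b') \<otimes>\<^bsub>C\<^esub> \<iota> (e i)" using b b' i by (simp add: M C.l_distr)
      moreover have "b \<oplus>\<^bsub>C\<^esub> b' \<in> carrier B" using B.a_closed[OF b(2) b'(2)] by (simp add: B_ops)
      ultimately show ?thesis by blast
    qed
    show "a \<odot>\<^bsub>?M\<^esub> x \<in> N i" if a: "a \<in> carrier B" for a
    proof -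
      have "a \<odot>\<^bsub>?M\<^esub> x = (a \<otimes>\<^bsub>C\<^esub> b) \<otimes>\<^bsub>C\<^esub> \<iota> (e i)" using b a i by (simp add: M C.m_assoc)
      moreover have "a \<otimes>\<^bsub>C\<^esub> b \<in> carrier B" using B.m_closed[OF a b(2)] by (simp add: B_ops)
      ultimately show ?thesis by blast
    qed
  qed
  fix m assume "m \<in> carrier ?M"
  then have m: "m \<in> carrier C" by (simp add: M)
  have N_C: "x \<in> carrier C" if "x \<in> N i" "i \<in> I" for x i using that by auto
  show "\<exists>!f. f \<in> (\<Pi>\<^sub>E i\<in>I. N i) \<and> m = (\<Oplus>\<^bsub>?M\<^esub>i\<in>I. f i)"
  proof (rule ex1I[of _ "\<lambda>i\<in>I. m \<otimes>\<^bsub>C\<^esub> \<iota> (e i)"])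
    have "m = m \<otimes>\<^bsub>C\<^esub> \<iota> \<one>\<^bsub>GA\<^esub>" using m by (simp add: ring_hom_one[OF \<iota>_hom])
    also have "\<iota> \<one>\<^bsub>GA\<^esub> = (\<Oplus>\<^bsub>C\<^esub>i\<in>I. \<iota> (e i))"
    proof -
      have "\<iota> \<one>\<^bsub>GA\<^esub> = \<iota> (\<lambda>h. \<Sum>i\<in>I. 1 * e i h)" by (simp add: e_unit)
      also have "\<dots> = (\<Oplus>\<^bsub>C\<^esub>i\<in>I. 1 \<odot>\<^bsub>C\<^esub> \<iota> (e i))" by (rule \<iota>_sum) (use e_closed in auto)
      also have "\<dots> = (\<Oplus>\<^bsub>C\<^esub>i\<in>I. \<iota> (e i))"
        by (rule C.finsum_cong') (auto simp: smult_one e_closed)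
      finally show ?thesis .
    qed
    also have "m \<otimes>\<^bsub>C\<^esub> (\<Oplus>\<^bsub>C\<^esub>i\<in>I. \<iota> (e i)) = (\<Oplus>\<^bsub>C\<^esub>i\<in>I. m \<otimes>\<^bsub>C\<^esub> \<iota> (e i))"
      using m by (intro C.finsum_rdistr) auto
    also have "\<dots> = (\<Oplus>\<^bsub>C\<^esub>i\<in>I. (\<lambda>i\<in>I. m \<otimes>\<^bsub>C\<^esub> \<iota> (e i)) i)"
      using m by (intro C.finsum_cong') auto
    also have "\<dots> = (\<Oplus>\<^bsub>?M\<^esub>i\<in>I. (\<lambda>i\<in>I. m \<otimes>\<^bsub>C\<^esub> \<iota> (e i)) i)"
      using m by (intro finsum[symmetric]) auto
    finally show "(\<lambda>i\<in>I. m \<otimes>\<^bsub>C\<^esub> \<iota> (e i)) \<in> (\<Pi>\<^sub>E i\<in>I. N i) \<and> m = (\<Oplus>\<^bsub>?M\<^esub>i\<in>I. (\<lambda>i\<in>I. m \<otimes>\<^bsub>C\<^esub> \<iota> (e i)) i)"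
      using component[OF m] by (intro conjI PiE_I) (simp_all del: mem_Collect_eq)
  next
    fix f assume f: "f \<in> (\<Pi>\<^sub>E i\<in>I. N i) \<and> m = (\<Oplus>\<^bsub>?M\<^esub>i\<in>I. f i)"
    then have fN: "f i \<in> N i" if "i \<in> I" for i using that by blast
    have fC: "f i \<in> carrier C" if "i \<in> I" for i by (rule N_C[OF fN[OF that] that])
    have "m \<otimes>\<^bsub>C\<^esub> \<iota> (e j) = f j" if j: "j \<in> I" for j
    proof -
      have "f i \<otimes>\<^bsub>C\<^esub> \<iota> (e j) = (if i = j then f j else \<zero>\<^bsub>C\<^esub>)" if i: "i \<in> I" for i
      proof -
        obtain b where b: "f i = b \<otimes>\<^bsub>C\<^esub> \<iota> (e i)" "b \<in> carrier B" using fN[OF i] by blast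
        have "f i \<otimes>\<^bsub>C\<^esub> \<iota> (e j) = b \<otimes>\<^bsub>C\<^esub> (\<iota> (e i) \<otimes>\<^bsub>C\<^esub> \<iota> (e j))" using b i j by (simp add: C.m_assoc)
        then show ?thesis using b i j by (auto simp: \<iota>e_mult)
      qed
      then have "(\<Oplus>\<^bsub>C\<^esub>i\<in>I. f i \<otimes>\<^bsub>C\<^esub> \<iota> (e j)) = (\<Oplus>\<^bsub>C\<^esub>i\<in>I. if j = i then f i else \<zero>\<^bsub>C\<^esub>)"
        using fC by (intro C.finsum_cong') auto
      also have "\<dots> = f j" using j fC by (intro C.finsum_singleton) auto
      moreover have "m \<otimes>\<^bsub>C\<^esub> \<iota> (e j) = (\<Oplus>\<^bsub>C\<^esub>i\<in>I. f i \<otimes>\<^bsub>C\<^esub> \<iota> (e j))"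
      proof -
        have "m = (\<Oplus>\<^bsub>C\<^esub>i\<in>I. f i)" using f finsum[of I f] fC by simp
        then show ?thesis using fC j by (simp add: C.finsum_ldistr Pi_def)
      qed
      ultimately show ?thesis by simp
    qed
    then show "f = (\<lambda>i\<in>I. m \<otimes>\<^bsub>C\<^esub> \<iota> (e i))"
      using f by (intro ext) (auto simp: restrict_def PiE_def extensional_def)
  qed
qed

end

end

section \<open>Schur's lemma\<close>

definition matrix_poly :: "complex^'n^'n \<Rightarrow> complex poly \<Rightarrow> complex^'n \<Rightarrow> complex^'n" where
  "matrix_poly z q v = fold_coeffs (\<lambda>a u. a *s v + z *v u) q 0"

lemma matrix_poly_zero [simp]: "matrix_poly z 0 v = 0"
  by (simp add: matrix_poly_def)

lemma matrix_poly_pCons [simp]: "matrix_poly z (pCons a q) v = a *s v + z *v matrix_poly z q v"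
  by (cases "a = 0 \<and> q = 0") (auto simp: matrix_poly_def)

lemma matrix_poly_smult: "matrix_poly z (Polynomial.smult k q) v = k *s matrix_poly z q v"
  by (induction q) (simp_all add: vector_scalar_commute vec.scale_right_distrib)

lemma matrix_poly_add: "matrix_poly z (p + q) v = matrix_poly z p v + matrix_poly z q v"
  by (induction p q rule: poly_induct2)
    (simp_all add: matrix_vector_right_distrib vec.scale_left_distrib)

text \<open>A polynomial of minimal degree annihilating a nonzero vector splits off an eigenvector.\<close>

lemma eigenvector_exists:
  fixes z :: "complex^'n^'n"
  assumes "q \<noteq> 0" "matrix_poly z q v = 0" "v \<noteq> 0"
  shows "\<exists>k u. u \<noteq> 0 \<and> z *v u = k *s u"
  using assms
proof (induction "degree q" arbitrary: q rule: less_induct)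
  case less
  show ?case
  proof (cases "degree q = 0")
    case True
    then obtain a where a: "q = [:a:]" by (meson degree_eq_zeroE)
    then have "a *s v = 0" using less.prems(2) by simp
    then show ?thesis using a less.prems by simp
  next
    case False
    then have "\<not> constant (poly q)" by (simp add: constant_degree)
    then obtain k where "poly q k = 0" using fundamental_theorem_of_algebra by blast
    then obtain r where r: "q = [:- k, 1:] * r" by (meson dvdE poly_eq_0_iff_dvd)
    have "r \<noteq> 0" using less.prems(1) r by auto
    have "degree q = Suc (degree r)"
      unfolding r using \<open>r \<noteq> 0\<close> by (subst degree_mult_eq) auto
    then have deg: "degree r < degree q" by simp
    have "matrix_poly z q v = matrix_poly z (Polynomial.smult (- k) r + pCons 0 r) v" by (simp add: r)
    also have "\<dots> = z *v matrix_poly z r v - k *s matrix_poly z r v"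
      unfolding matrix_poly_add matrix_poly_smult matrix_poly_pCons by simp
    finally have eq: "z *v matrix_poly z r v = k *s matrix_poly z r v" using less.prems(2) by simp
    show ?thesis
    proof (cases "matrix_poly z r v = 0")
      case True
      then show ?thesis using less.hyps[OF deg \<open>r \<noteq> 0\<close> _ less.prems(3)] by simp
    qed (use eq in blast)
  qed
qed

context finite_matrix_group
begin

text \<open>The finite order of \<open>z\<close> provides the polynomial.\<close>

lemma W_annihilator: "z \<in> W \<Longrightarrow> \<exists>q. q \<noteq> 0 \<and> (\<forall>v. matrix_poly z q v = 0)"
proof -
  assume z: "z \<in> W"
  let ?N = "order (matrix_group W)"
  have "W \<noteq> {}" using W_one by blast
  then have "?N > 0" using finite_W by (simp add: order_def card_gt_0_iff)
  have pow: "matrix_poly z (Polynomial.monom a k) v = a *s ((z [^]\<^bsub>matrix_group W\<^esub> k) *v v)" for a k v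
  proof (induction k arbitrary: v)
    case (Suc k)
    have "z [^]\<^bsub>matrix_group W\<^esub> Suc k = z ** (z [^]\<^bsub>matrix_group W\<^esub> k)"
      using monoid.nat_pow_Suc2[OF group.is_monoid[OF group_W], of z k] z by simp
    then show ?case by (simp add: monom_Suc Suc vector_scalar_commute matrix_vector_mul_assoc)
  qed (simp add: monom_0)
  have one: "z [^]\<^bsub>matrix_group W\<^esub> ?N = mat 1" using group.pow_order_eq_1[OF group_W, of z] z by simp
  have "matrix_poly z (Polynomial.monom 1 ?N + Polynomial.monom (-1) 0) v = 0" for v
    unfolding matrix_poly_add pow one by simp
  moreover have "Polynomial.monom 1 ?N + Polynomial.monom (-1) 0 \<noteq> (0 :: complex poly)"
  proof
    assume "Polynomial.monom 1 ?N + Polynomial.monom (-1) 0 = (0 :: complex poly)"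
    then have "poly.coeff (Polynomial.monom 1 ?N + Polynomial.monom (-1) 0 :: complex poly) ?N = 0" by simp
    then show False using \<open>?N > 0\<close> by simp
  qed
  ultimately show ?thesis by blast
qed

lemma Schur:
  assumes irr: "\<And>V. vec.subspace V \<Longrightarrow> (\<And>w u. w \<in> W \<Longrightarrow> u \<in> V \<Longrightarrow> w *v u \<in> V) \<Longrightarrow> V = {0} \<or> V = UNIV"
    and z: "z \<in> Zc"
  shows "\<exists>k. \<forall>v. z *v v = k *s v"
proof -
  obtain i :: 'n where True by blast
  obtain q where "q \<noteq> 0" "matrix_poly z q (axis i 1) = 0" using W_annihilator[OF Zc_W[OF z]] by blast
  moreover have "axis i (1::complex) \<noteq> 0" by (simp add: axis_eq_0_iff)
  ultimately obtain k u where u: "u \<noteq> 0" "z *v u = k *s u" using eigenvector_exists by blast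
  define V where "V = {u. z *v u = k *s u}"
  have "vec.subspace V"
    by (rule vec.subspaceI)
      (auto simp: V_def matrix_vector_right_distrib vec.scale_right_distrib vector_scalar_commute mult.commute)
  moreover have "w *v u \<in> V" if "w \<in> W" "u \<in> V" for w u
  proof -
    have "z *v (w *v u) = w *v (z *v u)" using Zc_comm[OF z that(1)] by (simp add: matrix_vector_mul_assoc)
    then show ?thesis using that(2) by (simp add: V_def vector_scalar_commute)
  qed
  ultimately have "V = {0} \<or> V = UNIV" by (rule irr)
  moreover have "u \<in> V" using u by (simp add: V_def)
  ultimately have "V = UNIV" using u(1) by auto
  then show ?thesis by (auto simp: V_def)
qed

lemma scalar_Zc:
  assumes w: "w \<in> W" and k: "\<And>v. w *v v = k *s v"
  shows "w \<in> Zc"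
proof -
  have "w ** u = u ** w" for u
    by (subst matrix_eq) (simp add: k vector_scalar_commute flip: matrix_vector_mul_assoc)
  then show ?thesis using w by (simp only: Zc_def mem_Collect_eq) blast
qed

lemma inverse_scalar_Zc:
  assumes w: "w \<in> W" and k: "\<And>v. matrix_inv w *v v = k *s v"
  shows "w \<in> Zc"
proof -
  have inv: "matrix_inv w \<in> Zc" by (rule scalar_Zc[OF W_inv[OF w] k])
  have "w ** u = u ** w" if u: "u \<in> W" for u
  proof -
    have "w ** (u ** matrix_inv w) ** w = w ** (matrix_inv w ** u) ** w" using Zc_comm[OF inv u] by simp
    then show ?thesis using w by (simp add: matrix_mul_assoc)
  qed
  then show ?thesis using w by (simp only: Zc_def mem_Collect_eq) blast
qed

subsection \<open>Generic points\<close>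

text \<open>
  Finitely many open conditions, imposed at all points of an orbit, still leave a dense set.
\<close>

lemma generic_points:
  assumes "finite P" "P \<subseteq> polyfun" "\<forall>f\<in>P. \<exists>p. f p \<noteq> 0"
  defines "X \<equiv> {p :: 'n double. \<forall>u\<in>W. \<forall>f\<in>P. f (double_act u p) \<noteq> 0}"
  shows "\<And>p w. p \<in> X \<Longrightarrow> w \<in> W \<Longrightarrow> double_act w p \<in> X"
    and "\<And>f p. f \<in> P \<Longrightarrow> p \<in> X \<Longrightarrow> f p \<noteq> 0"
    and "\<And>f q. f \<in> polyfun \<Longrightarrow> (\<And>p. p \<in> X \<Longrightarrow> f p = 0) \<Longrightarrow> f q = 0"
proof -
  show "double_act w p \<in> X" if "p \<in> X" "w \<in> W" for p w
    using that by (auto simp: X_def double_act_mult[symmetric])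
  show "f p \<noteq> 0" if "f \<in> P" "p \<in> X" for f p
  proof -
    have "f (double_act (mat 1) p) \<noteq> 0" using that W_one unfolding X_def by blast
    then show ?thesis by simp
  qed
  show "f q = 0" if f: "f \<in> polyfun" and zero: "\<And>p. p \<in> X \<Longrightarrow> f p = 0" for f q
  proof (rule ccontr)
    assume "f q \<noteq> 0"
    let ?P = "insert f ((\<lambda>(u, h) p. h (double_act u p)) ` (W \<times> P))"
    have "\<exists>p. \<forall>h\<in>?P. h p \<noteq> 0"
    proof (rule polyfun_common_nonzero)
      show "finite ?P" using finite_W assms(1) by simp
      have "(\<lambda>p. h (double_act u p)) \<in> polyfun" if "h \<in> P" for u h
        using that assms(2) by (intro polyfun_compose_linear[OF _ double_act_linear]) blast
      then show "?P \<subseteq> polyfun" using f by auto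
      fix h assume "h \<in> ?P"
      then consider "h = f" | u g where "u \<in> W" "g \<in> P" "h = (\<lambda>p. g (double_act u p))" by auto
      then show "\<exists>p. h p \<noteq> 0"
      proof cases
        case 2
        obtain p where "g p \<noteq> 0" using assms(3) 2(2) by blast
        then have "h (double_act (matrix_inv u) p) \<noteq> 0" using 2 by simp
        then show ?thesis by blast
      qed (use \<open>f q \<noteq> 0\<close> in blast)
    qed
    then obtain p where p: "\<And>h. h \<in> ?P \<Longrightarrow> h p \<noteq> 0" by blast
    have "h (double_act u p) \<noteq> 0" if "u \<in> W" "h \<in> P" for u h
    proof -
      have "(\<lambda>p. h (double_act u p)) \<in> ?P" using that by (intro insertI2 image_eqI[of _ _ "(u, h)"]) auto
      from p[OF this] show ?thesis .
    qed
    then have "p \<in> X" unfolding X_def by blast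
    then show False using zero p[of f] by simp
  qed
qed

definition basic_conditions :: "('n double \<Rightarrow> complex) set" where
  "basic_conditions = range (\<lambda>i p. fst p $ i) \<union>
     (\<lambda>w p. (w *v fst p - fst p) $ (SOME i. \<exists>v. (w *v v - v) $ i \<noteq> 0)) ` (W - {mat 1})"

lemma basic_conditions:
  "finite basic_conditions" "basic_conditions \<subseteq> polyfun" "f \<in> basic_conditions \<Longrightarrow> \<exists>p. f p \<noteq> 0"
proof -
  show "finite basic_conditions" using finite_W by (simp add: basic_conditions_def)
  have lin: "(\<lambda>p :: 'n double. (w *v fst p) $ i) \<in> polyfun" for w :: "complex^'n^'n" and i
    unfolding matrix_vector_mult_def
    by (simp, intro polyfun_sum polyfun_mult polyfun_const polyfun_coord')
  show "basic_conditions \<subseteq> polyfun"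
    unfolding basic_conditions_def using lin polyfun_coord' by (auto simp: polyfun_diff)
  show "\<exists>p. f p \<noteq> 0" if "f \<in> basic_conditions"
  proof -
    from that consider i where "f = (\<lambda>p. fst p $ i)"
      | w where "w \<in> W" "w \<noteq> mat 1" "f = (\<lambda>p. (w *v fst p - fst p) $ (SOME i. \<exists>v. (w *v v - v) $ i \<noteq> 0))"
      unfolding basic_conditions_def by blast
    then show ?thesis
    proof cases
      case 1
      show ?thesis unfolding 1 by (rule exI[of _ "(axis i 1, 0)"]) simp
    next
      case 2
      have "\<exists>v. w *v v \<noteq> v" using 2(2) by (metis matrix_eq matrix_vector_mul_lid)
      then have "\<exists>i v. (w *v v - v) $ i \<noteq> 0" by (simp add: vec_eq_iff) blast
      from someI_ex[OF this] obtain v where "(w *v v - v) $ (SOME i. \<exists>v. (w *v v - v) $ i \<noteq> 0) \<noteq> 0" by blast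
      then show ?thesis unfolding 2(3) by (intro exI[of _ "(v, 0)"]) simp
    qed
  qed
qed

lemma basic_conditions_coord: "(\<lambda>p. fst p $ i) \<in> basic_conditions"
  by (auto simp: basic_conditions_def)

lemma basic_conditions_free:
  assumes "\<And>f. f \<in> basic_conditions \<Longrightarrow> f p \<noteq> 0" "w \<in> W" "w *v fst p = fst p"
  shows "w = mat 1"
proof (rule ccontr)
  assume "w \<noteq> mat 1"
  then have "(\<lambda>p. (w *v fst p - fst p) $ (SOME i. \<exists>v. (w *v v - v) $ i \<noteq> 0)) \<in> basic_conditions"
    unfolding basic_conditions_def using assms(2) by blast
  from assms(1)[OF this] show False using assms(3) by simp
qed

end

context reflection_data
begin

lemma dunkl_exists:
  assumes "finite P" "P \<subseteq> polyfun" "\<And>f. f \<in> P \<Longrightarrow> \<exists>p. f p \<noteq> 0"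
  shows "\<exists>G. dunkl W \<alpha> \<alpha>v c G \<and> (\<forall>p\<in>G. \<forall>f\<in>P. f p \<noteq> 0)"
proof -
  let ?P = "P \<union> basic_conditions"
  have P: "finite ?P" "?P \<subseteq> polyfun" "\<forall>f\<in>?P. \<exists>p. f p \<noteq> 0"
    using assms basic_conditions by blast+
  define X where "X = {p :: 'n double. \<forall>u\<in>W. \<forall>f\<in>?P. f (double_act u p) \<noteq> 0}"
  note gen = generic_points[OF P, folded X_def]
  have "dunkl W \<alpha> \<alpha>v c X"
  proof
    show "w = mat 1" if "p \<in> X" "w \<in> W" "w *v fst p = fst p" for p w
      using basic_conditions_free[of p w] gen(2)[OF _ that(1)] that by blast
    show "fst p $ i \<noteq> 0" if "p \<in> X" for p i
      using gen(2)[OF _ that] basic_conditions_coord by blast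
  qed (fact gen)+
  then show ?thesis using gen(2) by blast
qed

text \<open>
  For each nonscalar element one quadratic invariant that it moves is enough; that this invariant
  takes distinct values at a point and its image is one more open condition on the point.
\<close>

lemma gamma_setting_exists:
  assumes centre: "\<And>z. z \<in> Zc \<Longrightarrow> \<exists>k. \<forall>v. z *v v = k *s v"
    and two: "\<exists>i j :: 'n. i \<noteq> j"
    and lin: "\<And>\<gamma>. \<gamma> \<in> \<Gamma> \<Longrightarrow> dlinear \<gamma>"
    and comm: "\<And>\<gamma> w v. \<gamma> \<in> \<Gamma> \<Longrightarrow> w \<in> W \<Longrightarrow> \<gamma> (double_act w v) = double_act w (\<gamma> v)"
    and inv: "\<And>\<gamma>. \<gamma> \<in> \<Gamma> \<Longrightarrow> \<exists>\<delta>\<in>\<Gamma>. (\<forall>v. \<gamma> (\<delta> v) = v) \<and> (\<forall>v. \<delta> (\<gamma> v) = v)"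
    and omega: "\<And>\<gamma> s v v'. \<gamma> \<in> \<Gamma> \<Longrightarrow> s \<in> S \<Longrightarrow> dunkl.omega \<alpha> \<alpha>v c s (\<gamma> v) (\<gamma> v') = dunkl.omega \<alpha> \<alpha>v c s v v'"
    and Zc_Gamma: "\<And>z. z \<in> Zc \<Longrightarrow> double_act z \<in> \<Gamma>"
    and sep: "\<And>w. w \<in> W \<Longrightarrow> w \<notin> Zc \<Longrightarrow>
      \<exists>q. (\<forall>\<gamma>\<in>\<Gamma>. coefficient_at (mat 1) (tensor_map \<gamma> (quad_elt q) - quad_elt q) \<in> cherednik_ideal W \<alpha> \<alpha>v 0 c) \<and>
          (\<exists>p. quad_fun q (double_act (matrix_inv w) p) \<noteq> quad_fun q p)"
  shows "\<exists>G. gamma_setting W \<alpha> \<alpha>v c G \<Gamma>"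
proof -
  let ?ok = "\<lambda>w q. (\<forall>\<gamma>\<in>\<Gamma>. coefficient_at (mat 1) (tensor_map \<gamma> (quad_elt q) - quad_elt q) \<in> cherednik_ideal W \<alpha> \<alpha>v 0 c) \<and>
          (\<exists>p. quad_fun q (double_act (matrix_inv w) p) \<noteq> quad_fun q p)"
  define Q where "Q w = (SOME q. ?ok w q)" for w
  have Q: "?ok w (Q w)" if "w \<in> W" "w \<notin> Zc" for w
    unfolding Q_def by (rule someI_ex[OF sep[OF that]])
  define P where "P = (\<lambda>w p. quad_fun (Q w) (double_act (matrix_inv w) p) - quad_fun (Q w) p) ` (W - Zc)"
  have poly: "quad_fun q \<in> polyfun" for q :: "((complex^'n) \<times> (complex^'n)) list"
  proof (induction q)
    case Nil
    show ?case using polyfun_const[of 0] by (simp add: quad_fun_def[abs_def])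
  next
    case (Cons a q)
    obtain x y where a: "a = (x, y)" by (cases a)
    have "(\<lambda>p. pairing x (fst p) * pairing (snd p) y + quad_fun q p) \<in> polyfun"
      using Cons by (intro polyfun_add polyfun_mult polyfun_pairing_fst polyfun_pairing_snd) simp
    then show ?case by (simp add: quad_fun_def[abs_def] a)
  qed
  have "finite P" using finite_W by (simp add: P_def)
  moreover have "P \<subseteq> polyfun"
    unfolding P_def using polyfun_diff[OF polyfun_compose_linear[OF poly double_act_linear] poly] by auto
  moreover have "\<exists>p. f p \<noteq> 0" if "f \<in> P" for f
    using that Q unfolding P_def by fastforce
  ultimately obtain G where G: "dunkl W \<alpha> \<alpha>v c G" "\<And>p f. p \<in> G \<Longrightarrow> f \<in> P \<Longrightarrow> f p \<noteq> 0"
    using dunkl_exists[of P] by blast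
  interpret dunkl W \<alpha> \<alpha>v c G by (rule G(1))
  have "gamma_setting W \<alpha> \<alpha>v c G \<Gamma>"
  proof
    fix w p assume w: "w \<in> W" "w \<notin> Zc" and p: "p \<in> G"
    have "(\<lambda>p. quad_fun (Q w) (double_act (matrix_inv w) p) - quad_fun (Q w) p) \<in> P"
      using w by (auto simp: P_def)
    from G(2)[OF p this] show "\<exists>q. (\<forall>\<gamma>\<in>\<Gamma>. coefficient_at (mat 1) (tensor_map \<gamma> (quad_elt q) - quad_elt q) \<in> cherednik_ideal W \<alpha> \<alpha>v 0 c) \<and>
          quad_fun q (double_act (matrix_inv w) p) \<noteq> quad_fun q p"
      using Q[OF w] by (intro exI[of _ "Q w"]) simp
  qed (fact centre two lin comm inv omega Zc_Gamma)+
  then show ?thesis by blast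
qed

end

section \<open>The torus\<close>

lemma pairing_ext: "(\<And>y. pairing a y = pairing b y) \<Longrightarrow> a = b"
  by (simp add: vec_eq_iff) (metis pairing_axis(2))

lemma scalar_product:
  fixes p r :: "'n tensor_alg"
  shows "Poly_Mapping.single 0 x * p * (Poly_Mapping.single 0 y * r) = Poly_Mapping.single 0 (x * y) * (p * r)"
proof -
  let ?\<sigma> = "Poly_Mapping.single 0 :: complex \<Rightarrow> 'n tensor_alg"
  have "?\<sigma> x * p * (?\<sigma> y * r) = ?\<sigma> x * (p * ?\<sigma> y) * r" by (simp only: mult.assoc)
  also have "p * ?\<sigma> y = ?\<sigma> y * p" by (rule tensor.scalar_central[symmetric])
  also have "?\<sigma> x * (?\<sigma> y * p) * r = (?\<sigma> x * ?\<sigma> y) * (p * r)" by (simp only: mult.assoc)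
  finally show ?thesis by (simp add: mult_single)
qed

context reflection_data
begin

lemma centre_double_act:
  assumes z: "z \<in> Zc" and k: "\<And>v. z *v v = k *s v"
  shows "k \<noteq> 0" "double_act z p = (k *s fst p, inverse k *s snd p)"
proof -
  show k0: "k \<noteq> 0"
  proof
    fix i :: 'n assume "k = 0"
    then have "matrix_inv z *v (z *v axis i 1) = 0" using k by simp
    then have "axis i (1::complex) = 0" using z by (simp add: matrix_vector_mul_assoc)
    then show False by (simp add: axis_eq_0_iff)
  qed
  have inv: "matrix_inv z *v v = inverse k *s v" for v
  proof -
    have "k *s (matrix_inv z *v v) = z *v (matrix_inv z *v v)" by (rule k[symmetric])
    also have "\<dots> = v" using z by (simp add: matrix_vector_mul_assoc)
    finally have "inverse k *s (k *s (matrix_inv z *v v)) = inverse k *s v" by (rule arg_cong)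
    then show ?thesis using k0 by simp
  qed
  have "snd p v* matrix_inv z = inverse k *s snd p"
    by (rule pairing_ext) (simp add: pairing_mult inv pairing_scale)
  then show "double_act z p = (k *s fst p, inverse k *s snd p)" by (simp add: double_act_def k)
qed

text \<open>
  The quadratic invariants are the products \<open>x\<^sub>i y\<^sub>j\<close>. A matrix
  preserving all of them as functions on \<open>V\<close> is scalar.
\<close>

lemma torus_setting:
  assumes centre: "\<And>z. z \<in> Zc \<Longrightarrow> \<exists>k. \<forall>v. z *v v = k *s v" and two: "\<exists>i j :: 'n. i \<noteq> j"
  shows "\<exists>G. gamma_setting W \<alpha> \<alpha>v c G torus"
proof -
  \<comment> \<open>Some generic set is needed only to speak of the commutator form, which does not depend on it.\<close>
  obtain G where G: "dunkl W \<alpha> \<alpha>v c G" using dunkl_exists[of "{}"] by auto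
  interpret D: dunkl W \<alpha> \<alpha>v c G by (rule G)
  show ?thesis
  proof (rule gamma_setting_exists[OF centre two])
    fix \<gamma> :: "'n double \<Rightarrow> 'n double" assume "\<gamma> \<in> torus"
    then obtain k where k: "k \<noteq> 0" and \<gamma>: "\<gamma> = (\<lambda>v. (inverse k *s fst v, k *s snd v))"
      by (auto simp: torus_def)
    show "dlinear \<gamma>"
      unfolding dlinear_def \<gamma> by (auto simp: dscale_def vec.scale_right_distrib mult.commute)
    show "\<gamma> (double_act w v) = double_act w (\<gamma> v)" for w v
      by (simp add: \<gamma> double_act_def vector_scalar_commute scalar_vector_matrix_assoc)
    show "\<exists>\<delta>\<in>torus. (\<forall>v. \<gamma> (\<delta> v) = v) \<and> (\<forall>v. \<delta> (\<gamma> v) = v)"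
    proof (rule bexI[of _ "\<lambda>v. (inverse (inverse k) *s fst v, inverse k *s snd v)"])
      show "(\<lambda>v. (inverse (inverse k) *s fst v, inverse k *s snd v)) \<in> torus"
        unfolding torus_def mem_Collect_eq using k by (intro exI[of _ "inverse k"]) simp
    qed (use k in \<open>simp add: \<gamma>\<close>)
    show "dunkl.omega \<alpha> \<alpha>v c s (\<gamma> v) (\<gamma> v') = dunkl.omega \<alpha> \<alpha>v c s v v'" for s v v'
    proof -
      have "u * (k * a) * (inverse k * b) = u * a * b" for u a b using k by simp
      then show ?thesis by (simp only: D.omega_def D.comm_coeff_def \<gamma> pairing_scale fst_conv snd_conv)
    qed
  next
    fix z assume z: "z \<in> Zc"
    obtain k where k: "\<And>v. z *v v = k *s v" using centre[OF z] by blast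
    have "double_act z = (\<lambda>v. (inverse (inverse k) *s fst v, inverse k *s snd v))"
      using centre_double_act[OF z k] by (intro ext) simp
    then show "double_act z \<in> torus"
      unfolding torus_def mem_Collect_eq using centre_double_act(1)[OF z k] by (intro exI[of _ "inverse k"]) simp
  next
    fix w assume w: "w \<in> W" "w \<notin> Zc"
    define q :: "'n \<Rightarrow> 'n \<Rightarrow> ((complex^'n) \<times> (complex^'n)) list" where "q i j = [(axis i 1, axis j 1)]" for i j
    have inv: "coefficient_at (mat 1) (tensor_map \<gamma> (quad_elt (q i j)) - quad_elt (q i j)) \<in> cherednik_ideal W \<alpha> \<alpha>v 0 c"
      if \<gamma>: "\<gamma> \<in> torus" for \<gamma> i j
    proof -
      obtain k where k: "k \<noteq> 0" "\<gamma> = (\<lambda>v. (inverse k *s fst v, k *s snd v))" using \<gamma> by (auto simp: torus_def)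
      have lin: "dlinear \<gamma>" unfolding dlinear_def k by (auto simp: dscale_def vec.scale_right_distrib mult.commute)
      have "tensor_of (\<gamma> (0, x)) = Poly_Mapping.single 0 k * tensor_of (0, x)"
        "tensor_of (\<gamma> (y, 0)) = Poly_Mapping.single 0 (inverse k) * tensor_of (y, 0)" for x y
        by (simp_all add: tensor_of_scale[symmetric] dscale_def k(2))
      then have "tensor_map \<gamma> (quad_elt (q i j)) = Poly_Mapping.single 0 k * tensor_of (0, axis i 1) *
          (Poly_Mapping.single 0 (inverse k) * tensor_of (axis j 1, 0))"
        by (simp add: quad_elt_def q_def tensor_map_tensor_of[OF lin])
      also have "\<dots> = quad_elt (q i j)"
        unfolding scalar_product using k(1) by (simp add: quad_elt_def q_def)
      finally show ?thesis using D.Ich_zero by simp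
    qed
    have "\<exists>i j p. quad_fun (q i j) (double_act (matrix_inv w) p) \<noteq> quad_fun (q i j) p"
    proof (rule ccontr)
      assume "\<not> ?thesis"
      then have same: "quad_fun (q i j) (double_act (matrix_inv w) p) = quad_fun (q i j) p" for i j p by blast
      have eq: "fst (double_act (matrix_inv w) p) $ i * snd (double_act (matrix_inv w) p) $ j = fst p $ i * snd p $ j" for i j p
        using same[of i j p] by (simp add: quad_fun_def q_def)
      obtain j :: 'n where True by blast
      define \<xi> where "\<xi> = axis j 1 v* matrix_inv w"
      have "snd (double_act (matrix_inv w) (v, \<xi>)) = axis j 1" for v
        using w(1) by (simp add: double_act_def \<xi>_def vector_matrix_mul_assoc)
      then have "(matrix_inv w *v v) $ i = v $ i * \<xi> $ j" for v i
        using eq[of "(v, \<xi>)" i j] by (simp add: double_act_def)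
      then have "matrix_inv w *v v = (\<xi> $ j) *s v" for v by (simp add: vec_eq_iff mult.commute)
      then show False using inverse_scalar_Zc[OF w(1)] w(2) by blast
    qed
    then obtain i j p where "quad_fun (q i j) (double_act (matrix_inv w) p) \<noteq> quad_fun (q i j) p" by blast
    then show "\<exists>q. (\<forall>\<gamma>\<in>torus. coefficient_at (mat 1) (tensor_map \<gamma> (quad_elt q) - quad_elt q) \<in> cherednik_ideal W \<alpha> \<alpha>v 0 c) \<and>
          (\<exists>p. quad_fun q (double_act (matrix_inv w) p) \<noteq> quad_fun q p)"
      using inv by (intro exI[of _ "q i j"]) blast
  qed
qed

end

section \<open>The special linear group\<close>

text \<open>
  A linear map that preserves all bivectors is a scalar when the dimension is at least three: if
  \<open>a = t x\<close> and \<open>b = t y\<close> satisfy \<open>a \<and> b = x \<and> y\<close>, then \<open>a \<and> x \<and> y = 0\<close> for all \<open>y\<close>.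
\<close>

lemma bivector_preserving_scalar:
  fixes t :: "complex^'n^'n"
  assumes three: "\<And>i j :: 'n. \<exists>k. k \<noteq> i \<and> k \<noteq> j"
    and wedge: "\<And>x y j k. (t *v x) $ j * (t *v y) $ k - (t *v x) $ k * (t *v y) $ j = x $ j * y $ k - x $ k * y $ j"
  shows "\<exists>l. \<forall>v. t *v v = l *s v"
proof -
  have par: "(t *v x) $ i * x $ j = (t *v x) $ j * x $ i" for x i j
  proof (cases "i = j")
    case False
    obtain k where k: "k \<noteq> i" "k \<noteq> j" using three by blast
    define a b where "a = t *v x" and "b = t *v axis k 1"
    have M: "a $ p * b $ q - a $ q * b $ p = x $ p * axis k 1 $ q - x $ q * axis k 1 $ p" for p q
      unfolding a_def b_def by (rule wedge)
    \<comment> \<open>The determinant with rows \<open>a\<close>, \<open>a\<close>, \<open>b\<close>.\<close>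
    have "a $ i * (a $ j * b $ k - a $ k * b $ j) - a $ j * (a $ i * b $ k - a $ k * b $ i)
        + a $ k * (a $ i * b $ j - a $ j * b $ i) = 0"
      by (simp add: algebra_simps)
    then have "a $ i * x $ j - a $ j * x $ i = 0"
      unfolding M using k False by (simp add: axis_def)
    then show ?thesis by (simp add: a_def)
  qed simp
  have off: "(t *v axis i 1) $ j = 0" if "j \<noteq> i" for i j
    using par[of "axis i 1" i j] that by (simp add: axis_def)
  have diag: "(t *v axis i 1) $ i = (t *v axis j 1) $ j" for i j
  proof (cases "i = j")
    case False
    have "t *v (axis i 1 + axis j 1) = t *v axis i 1 + t *v axis j 1" by (rule matrix_vector_right_distrib)
    then show ?thesis
      using par[of "axis i 1 + axis j 1" i j] off[of i j] off[of j i] False by (simp add: axis_def)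
  qed simp
  obtain i0 :: 'n where True by blast
  define l where "l = (t *v axis i0 1) $ i0"
  have "t *v v = l *s v" for v
  proof -
    have entry: "t $ j $ i = (if i = j then l else 0)" for i j
    proof -
      have "(t *v axis i 1) $ j = t $ j $ i"
        by (simp add: matrix_vector_mult_def axis_def if_distrib cong: if_cong)
      then show ?thesis using off[of j i] diag[of i i0] by (auto simp: l_def)
    qed
    show ?thesis
      by (simp add: vec_eq_iff matrix_vector_mult_def entry if_distribR if_distrib cong: if_cong)
  qed
  then show ?thesis by blast
qed

locale real_reflection_data = reflection_data W \<alpha> \<alpha>v c
  for W :: "(complex^'n^'n) set" and \<alpha> \<alpha>v c +
  fixes R :: "(complex^'n) set" and B :: "complex^'n \<Rightarrow> complex^'n \<Rightarrow> complex"
  assumes real: "real_structure W R B"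
begin

lemma B_linear: "B v (y + y') = B v y + B v y'" "B v (k *s y) = k * B v y"
proof -
  have "Vector_Spaces.linear (*s) (*) (B v)" using real by (simp add: real_structure_def)
  then interpret L: Vector_Spaces.linear "(*s)" "(*)" "B v" .
  show "B v (y + y') = B v y + B v y'" "B v (k *s y) = k * B v y" by (rule L.add, rule L.scale)
qed

lemma B_sym: "B v v' = B v' v"
  using real by (simp add: real_structure_def)

lemma B_linear_left: "B (y + y') v = B y v + B y' v" "B (k *s y) v = k * B y v"
  by (simp_all add: B_sym[of _ v] B_linear)

lemma B_invariant: "w \<in> W \<Longrightarrow> B (w *v v) (w *v v') = B v v'"
  using real by (simp add: real_structure_def)

lemma B_flat: "pairing (flat B v) y = B v y"
proof -
  have sum: "B v (\<Sum>i\<in>I. f i) = (\<Sum>i\<in>I. B v (f i))" for f :: "'n \<Rightarrow> complex^'n" and I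
    using B_linear(2)[of v 0 0] by (induction I rule: infinite_finite_induct) (auto simp: B_linear)
  have "y = (\<Sum>i\<in>UNIV. y $ i *s axis i 1)"
    by (simp add: vec_eq_iff axis_def if_distrib cong: if_cong)
  then have "B v y = (\<Sum>i\<in>UNIV. y $ i * B v (axis i 1))" by (metis (no_types, lifting) B_linear(2) sum sum.cong)
  then show ?thesis by (simp add: pairing_def flat_def mult.commute)
qed

lemma flat_linear: "flat B (v + v') = flat B v + flat B v'" "flat B (k *s v) = k *s flat B v"
  by (simp_all add: flat_def vec_eq_iff B_linear_left)

text \<open>
  Evaluate the form at \<open>v = u + \<i> u'\<close> and the conjugate vector: the result is the
  sum of the two real squares.
\<close>

lemma B_nondegenerate:
  assumes "\<And>y. B v y = 0" shows "v = 0"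
proof -
  have "\<exists>!p. fst p \<in> R \<and> snd p \<in> R \<and> v = fst p + \<i> *s snd p" using real by (simp add: real_structure_def)
  then obtain u u' where u: "u \<in> R" "u' \<in> R" "v = u + \<i> *s u'" by auto
  have pos: "x \<in> R \<Longrightarrow> x \<noteq> 0 \<Longrightarrow> Re (B x x) > 0" for x using real by (simp add: real_structure_def)
  have zero: "B 0 0 = 0" using B_linear(2)[of 0 0 0] by simp
  have nonneg: "x \<in> R \<Longrightarrow> Re (B x x) \<ge> 0" for x using pos[of x] zero by (cases "x = 0") auto
  have "0 = B v (u + (- \<i>) *s u')" using assms by simp
  also have "\<dots> = B u u + B u' u'"
    unfolding u(3) B_linear B_linear_left using B_sym[of u u'] by (simp add: algebra_simps)
  finally have "Re (B u u) + Re (B u' u') = 0" by (metis plus_complex.sel(1) zero_complex.sel(1))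
  then have "Re (B u u) = 0" "Re (B u' u') = 0" using nonneg u by (smt (verit))+
  then have "u = 0" "u' = 0" using pos u by force+
  then show ?thesis by (simp add: u(3))
qed

lemma flat_bij: "bij (flat B)"
proof -
  have lin: "Vector_Spaces.linear (*s) (*s) (flat B)"
    by unfold_locales (simp_all add: flat_linear vec.scale_right_distrib vec.scale_left_distrib)
  have "inj (flat B)"
  proof (rule injI)
    fix v v' assume eq: "flat B v = flat B v'"
    have "B (v + (-1) *s v') y = 0" for y
      unfolding B_linear_left using eq by (simp flip: B_flat)
    then have "v + (-1) *s v' = 0" by (rule B_nondegenerate)
    then show "v = v'" by simp
  qed
  moreover have "surj (flat B)" using vec.linear_injective_imp_surjective[OF lin \<open>inj (flat B)\<close>] by simp
  ultimately show ?thesis by (simp add: bij_def)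
qed

abbreviation sharp :: "complex^'n \<Rightarrow> complex^'n" where
  "sharp \<equiv> inv_into UNIV (flat B)"

lemma flat_sharp [simp]: "flat B (sharp x) = x" and sharp_flat [simp]: "sharp (flat B v) = v"
  using flat_bij by (simp_all add: bij_is_surj surj_f_inv_f bij_is_inj inv_f_f)

lemma sharp_eqI: "flat B v = x \<Longrightarrow> sharp x = v"
  by auto

lemma sharp_linear: "sharp (x + x') = sharp x + sharp x'" "sharp (k *s x) = k *s sharp x"
  by (rule sharp_eqI, simp add: flat_linear)+

lemma flat_act: "w \<in> W \<Longrightarrow> flat B (w *v v) = flat B v v* matrix_inv w"
proof (rule pairing_ext)
  fix y assume w: "w \<in> W"
  have "B (w *v v) y = B (w *v v) (w *v (matrix_inv w *v y))" using w by (simp add: matrix_vector_mul_assoc)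
  also have "\<dots> = B v (matrix_inv w *v y)" by (rule B_invariant[OF w])
  finally show "pairing (flat B (w *v v)) y = pairing (flat B v v* matrix_inv w) y"
    by (simp add: B_flat pairing_mult)
qed

lemma sharp_act: "w \<in> W \<Longrightarrow> sharp (x v* matrix_inv w) = w *v sharp x"
  by (rule sharp_eqI) (simp add: flat_act)

text \<open>The coroot is orthogonal to the reflecting hyperplane.\<close>

lemma root_flat: "s \<in> S \<Longrightarrow> \<exists>m. \<forall>v. B v (\<alpha>v s) = m * pairing (\<alpha> s) v"
proof -
  assume s: "s \<in> S"
  have "pairing (flat B (\<alpha>v s)) y = 0" if y: "pairing (\<alpha> s) y = 0" for y
  proof -
    have "B (\<alpha>v s) y = B (s *v \<alpha>v s) (s *v y)" using s by (simp add: B_invariant)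
    also have "\<dots> = eigen s * B (\<alpha>v s) y" using root_kernel[OF s] y eigen(2)[OF s] by (simp add: B_linear_left)
    finally have "(1 - eigen s) * B (\<alpha>v s) y = 0" by (simp add: left_diff_distrib)
    then show ?thesis using eigen(1)[OF s] by (simp add: B_flat)
  qed
  from pairing_proportional[OF this]
  have "B (\<alpha>v s) v * pairing (\<alpha> s) (\<alpha>v s) = B (\<alpha>v s) (\<alpha>v s) * pairing (\<alpha> s) v" for v
    by (simp add: B_flat)
  then have "B v (\<alpha>v s) = B (\<alpha>v s) (\<alpha>v s) / pairing (\<alpha> s) (\<alpha>v s) * pairing (\<alpha> s) v" for v
    using root_coroot_nonzero[OF s] by (simp add: B_sym[of v] field_simps)
  then show ?thesis by blast
qed

text \<open>
  Identify the dual space with the space by the form. The commutator form of each reflection is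
  then a multiple of the standard symplectic form in the two coordinates along the root, so it is
  invariant. The quadratic invariants are the bivectors \<open>u\<^sup>* v - v\<^sup>* u\<close>,
  invariant modulo the relations; they are \<open>x\<^sub>i y\<^sub>j - x\<^sub>j
  y\<^sub>i\<close> as functions on \<open>V\<close>.
\<close>

lemma sl2_setting:
  assumes centre: "\<And>z. z \<in> Zc \<Longrightarrow> \<exists>k. \<forall>v. z *v v = k *s v"
    and three: "\<And>i j :: 'n. \<exists>k. k \<noteq> i \<and> k \<noteq> j"
  shows "\<exists>G. gamma_setting W \<alpha> \<alpha>v c G (sl2 B)"
proof -
  \<comment> \<open>Some generic set is needed only to speak of the commutator form, which does not depend on it.\<close>
  obtain G where G: "dunkl W \<alpha> \<alpha>v c G" using dunkl_exists[of "{}"] by auto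
  interpret D: dunkl W \<alpha> \<alpha>v c G by (rule G)
  define act where "act a b k d = (\<lambda>v :: 'n double. (a *s fst v + k *s sharp (snd v), b *s flat B (fst v) + d *s snd v))"
    for a b k d
  have sl2E: "\<exists>a b k d. \<gamma> = act a b k d \<and> a * d - b * k = 1" if "\<gamma> \<in> sl2 B" for \<gamma>
    using that unfolding sl2_def act_def by (auto simp: det_2)
  have sl2I: "act a b k d \<in> sl2 B" if "a * d - b * k = 1" for a b k d
  proof -
    define g :: "complex^2^2" where "g = vector [vector [a, b], vector [k, d]]"
    have g: "g$1$1 = a" "g$1$2 = b" "g$2$1 = k" "g$2$2 = d" by (simp_all add: g_def)
    have "det g = 1" using that by (simp add: det_2 g)
    then show ?thesis unfolding sl2_def act_def by (auto simp: g intro!: exI[of _ g])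
  qed
  have lin: "dlinear (act a b k d)" for a b k d
    unfolding dlinear_def act_def
    by (auto simp: dscale_def flat_linear sharp_linear vec.scale_right_distrib mult.commute algebra_simps)
  have om: "\<exists>M. \<forall>v v'. dunkl.omega \<alpha> \<alpha>v c s v v' =
      M * (pairing (\<alpha> s) (sharp (snd v')) * pairing (\<alpha> s) (fst v) - pairing (\<alpha> s) (sharp (snd v)) * pairing (\<alpha> s) (fst v'))"
    if s: "s \<in> S" for s
  proof -
    obtain m where m: "\<And>v. B v (\<alpha>v s) = m * pairing (\<alpha> s) v" using root_flat[OF s] by blast
    have "pairing x (\<alpha>v s) = m * pairing (\<alpha> s) (sharp x)" for x
      using B_flat[of "sharp x" "\<alpha>v s"] m by simp
    then show ?thesis
      by (intro exI[of _ "2 * c s / pairing (\<alpha> s) (\<alpha>v s) * m"])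
        (simp add: D.omega_def D.comm_coeff_def algebra_simps)
  qed
  show ?thesis
  proof (rule gamma_setting_exists[OF centre])
    show "\<exists>i j :: 'n. i \<noteq> j" using three by blast
  next
    fix \<gamma> :: "'n double \<Rightarrow> 'n double" assume "\<gamma> \<in> sl2 B"
    then obtain a b k d where \<gamma>: "\<gamma> = act a b k d" and det: "a * d - b * k = 1" using sl2E by blast
    show "dlinear \<gamma>" unfolding \<gamma> by (rule lin)
    show "\<gamma> (double_act w v) = double_act w (\<gamma> v)" if "w \<in> W" for w v
      using that by (simp add: \<gamma> act_def double_act_def flat_act sharp_act matrix_vector_right_distrib
          vector_matrix_left_distrib vector_scalar_commute scalar_vector_matrix_assoc)
    show "\<exists>\<delta>\<in>sl2 B. (\<forall>v. \<gamma> (\<delta> v) = v) \<and> (\<forall>v. \<delta> (\<gamma> v) = v)"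
    proof (rule bexI[of _ "act d (- b) (- k) a"])
      show "act d (- b) (- k) a \<in> sl2 B" using det by (intro sl2I) (simp add: mult.commute)
      have comp: "act a b k d (act a' b' k' d' v) = v"
        if "a * a' + k * b' = 1" "a * k' + k * d' = 0" "b * a' + d * b' = 0" "b * k' + d * d' = 1" for a b k d a' b' k' d' v
      proof (rule prod_eqI)
        have "fst (act a b k d (act a' b' k' d' v)) = (a * a' + k * b') *s fst v + (a * k' + k * d') *s sharp (snd v)"
          by (simp add: act_def sharp_linear vec_eq_iff algebra_simps)
        then show "fst (act a b k d (act a' b' k' d' v)) = fst v" by (simp add: that)
        have "snd (act a b k d (act a' b' k' d' v)) = (b * a' + d * b') *s flat B (fst v) + (b * k' + d * d') *s snd v"
          by (simp add: act_def flat_linear vec_eq_iff algebra_simps)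
        then show "snd (act a b k d (act a' b' k' d' v)) = snd v" by (simp add: that)
      qed
      show "(\<forall>v. \<gamma> (act d (- b) (- k) a v) = v) \<and> (\<forall>v. act d (- b) (- k) a (\<gamma> v) = v)"
        unfolding \<gamma> using det by (intro conjI allI comp) (simp_all add: algebra_simps)
    qed
    show "dunkl.omega \<alpha> \<alpha>v c s (\<gamma> v) (\<gamma> v') = dunkl.omega \<alpha> \<alpha>v c s v v'" if s: "s \<in> S" for s v v'
    proof -
      obtain M where M: "\<And>v v'. dunkl.omega \<alpha> \<alpha>v c s v v' =
        M * (pairing (\<alpha> s) (sharp (snd v')) * pairing (\<alpha> s) (fst v) - pairing (\<alpha> s) (sharp (snd v)) * pairing (\<alpha> s) (fst v'))"
        using om[OF s] by blast
      define Y Q Y' Q' where "Y = pairing (\<alpha> s) (fst v)" and "Q = pairing (\<alpha> s) (sharp (snd v))"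
        and "Y' = pairing (\<alpha> s) (fst v')" and "Q' = pairing (\<alpha> s) (sharp (snd v'))"
      have "dunkl.omega \<alpha> \<alpha>v c s (\<gamma> v) (\<gamma> v') = M * ((b * Y' + d * Q') * (a * Y + k * Q) - (b * Y + d * Q) * (a * Y' + k * Q'))"
        unfolding M \<gamma> act_def Y_def Q_def Y'_def Q'_def by (simp add: sharp_linear pairing_add pairing_scale)
      also have "\<dots> = M * ((a * d - b * k) * (Q' * Y - Q * Y'))" by (simp add: algebra_simps)
      finally show ?thesis unfolding M det Y_def Q_def Y'_def Q'_def by simp
    qed
  next
    fix z assume z: "z \<in> Zc"
    obtain k where k: "\<And>v. z *v v = k *s v" using centre[OF z] by blast
    have "k * k = 1"
    proof -
      have "axis undefined (1::complex) \<noteq> (0 :: complex^'n)" by (simp add: axis_eq_0_iff)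
      then obtain y where y: "B (axis undefined 1) y \<noteq> 0" using B_nondegenerate by blast
      have "B (z *v axis undefined 1) (z *v y) = B (axis undefined 1) y" using B_invariant z by simp
      then show ?thesis using y by (simp add: k B_linear B_linear_left)
    qed
    moreover have "inverse k = k" using \<open>k * k = 1\<close> by (metis inverse_unique)
    moreover have "double_act z = act k 0 0 k"
      using centre_double_act(2)[OF z k] \<open>inverse k = k\<close> by (intro ext) (simp add: act_def)
    ultimately show "double_act z \<in> sl2 B" using sl2I by simp
  next
    fix w assume w: "w \<in> W" "w \<notin> Zc"
    define q where "q u v = [(flat B u, v), (- flat B v, u)]" for u v
    have inv: "coefficient_at (mat 1) (tensor_map \<gamma> (quad_elt (q u v)) - quad_elt (q u v)) \<in> cherednik_ideal W \<alpha> \<alpha>v 0 c"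
      if \<gamma>_in: "\<gamma> \<in> sl2 B" for \<gamma> u v
    proof -
      obtain a b k d where \<gamma>: "\<gamma> = act a b k d" and det: "a * d - b * k = 1" using sl2E[OF \<gamma>_in] by blast
      let ?\<sigma> = "Poly_Mapping.single 0 :: complex \<Rightarrow> 'n tensor_alg"
      let ?u = "tensor_of (u, 0)" and ?v = "tensor_of (v, 0)" and ?U = "tensor_of (0, flat B u)" and ?V = "tensor_of (0, flat B v)"
      have quad: "quad_elt (q u v) = ?U * ?v - ?V * ?u"
      proof -
        have "tensor_of (0, - flat B v) = - ?V"
          using tensor_of_scale[of "-1" "(0, flat B v)"] by (simp add: dscale_def single_uminus)
        then show ?thesis by (simp add: quad_elt_def q_def)
      qed
      have sharp0: "sharp 0 = 0" using sharp_linear(2)[of 0 0] by simp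
      have flat0: "flat B 0 = 0" using flat_linear(2)[of 0 0] by simp
      have img: "tensor_of (act a b k d (y, 0)) = ?\<sigma> a * tensor_of (y, 0) + ?\<sigma> b * tensor_of (0, flat B y)"
        "tensor_of (act a b k d (0, flat B y)) = ?\<sigma> k * tensor_of (y, 0) + ?\<sigma> d * tensor_of (0, flat B y)" for y
        by (simp_all add: act_def sharp0 flat0 dscale_def flip: tensor_of_scale tensor_of_add)
      have "tensor_map \<gamma> (quad_elt (q u v)) = (?\<sigma> k * ?u + ?\<sigma> d * ?U) * (?\<sigma> a * ?v + ?\<sigma> b * ?V) -
          (?\<sigma> k * ?v + ?\<sigma> d * ?V) * (?\<sigma> a * ?u + ?\<sigma> b * ?U)"
        unfolding quad by (simp add: tensor_map_tensor_of[OF lin] \<gamma> img)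
      also have "\<dots> = ?\<sigma> (k * a) * (?u * ?v - ?v * ?u) + ?\<sigma> (d * b) * (?U * ?V - ?V * ?U)
          + ?\<sigma> (k * b) * ((?u * ?V - ?V * ?u) - (?v * ?U - ?U * ?v)) + ?\<sigma> (d * a - k * b) * (?U * ?v - ?V * ?u)"
        by (simp add: distrib_left distrib_right scalar_product right_diff_distrib left_diff_distrib single_diff)
      also have "d * a - k * b = 1" using det by (simp add: mult.commute)
      finally have diff: "tensor_map \<gamma> (quad_elt (q u v)) - quad_elt (q u v) =
          ?\<sigma> (k * a) * (?u * ?v - ?v * ?u) + ?\<sigma> (d * b) * (?U * ?V - ?V * ?U)
          + ?\<sigma> (k * b) * ((?u * ?V - ?V * ?u) - (?v * ?U - ?U * ?v))"
        by (simp add: quad)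
      let ?r = D.relation
      have 1: "coefficient_at (mat 1) (?u * ?v - ?v * ?u) = ?r (u, 0) (v, 0)"
        "coefficient_at (mat 1) (?U * ?V - ?V * ?U) = ?r (0, flat B u) (0, flat B v)"
        by (simp_all add: D.relation_def D.omega_def D.comm_coeff_def)
      have omega_sym: "dunkl.omega \<alpha> \<alpha>v c s (u, 0) (0, flat B v) = dunkl.omega \<alpha> \<alpha>v c s (v, 0) (0, flat B u)"
        if "s \<in> S" for s
        using om[OF that] by (auto simp: sharp0)
      have 2: "coefficient_at (mat 1) ((?u * ?V - ?V * ?u) - (?v * ?U - ?U * ?v)) =
          (\<lambda>g. ?r (u, 0) (0, flat B v) g - ?r (v, 0) (0, flat B u) g)"
        unfolding elt_diff D.relation_def by (rule ext) (simp add: omega_sym)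
      have "coefficient_at (mat 1) (tensor_map \<gamma> (quad_elt (q u v)) - quad_elt (q u v)) =
         (\<lambda>g. (?\<sigma> (k * a) * ?r (u, 0) (v, 0) g + ?\<sigma> (d * b) * ?r (0, flat B u) (0, flat B v) g) +
            ?\<sigma> (k * b) * (?r (u, 0) (0, flat B v) g - ?r (v, 0) (0, flat B u) g))"
      proof -
        have "coefficient_at (mat 1) (?\<sigma> x * r) g = ?\<sigma> x * coefficient_at (mat 1) r g"
          for x r and g :: "complex^'n^'n"
          by (simp add: coefficient_at_def)
        then show ?thesis unfolding diff elt_add by (simp only: 1 2)
      qed
      moreover have "\<dots> \<in> cherednik_ideal W \<alpha> \<alpha>v 0 c"
        by (intro D.Ich_add D.Ich_scale D.Ich_diff D.relation_Ich)
      ultimately show ?thesis by simp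
    qed
    have "\<exists>u v p. quad_fun (q u v) (double_act (matrix_inv w) p) \<noteq> quad_fun (q u v) p"
    proof (rule ccontr)
      assume "\<not> ?thesis"
      then have eq: "quad_fun (q u v) (double_act (matrix_inv w) p) = quad_fun (q u v) p" for u v p by blast
      have neg: "pairing (- x) y = - pairing x y" for x y :: "complex^'n"
        using pairing_scale(1)[of "-1" x y] by simp
      have val: "quad_fun (q (sharp (axis j 1)) (sharp (axis k 1))) (x, flat B y) = x $ j * y $ k - x $ k * y $ j" for x y j k
      proof -
        have "pairing (flat B y) (sharp (axis i 1)) = y $ i" for i
        proof -
          have "pairing (flat B y) (sharp (axis i 1)) = pairing (flat B (sharp (axis i 1))) y"
            by (simp only: B_flat B_sym)
          then show ?thesis by simp
        qed
        then show ?thesis by (simp add: quad_fun_def q_def neg)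
      qed
      have act: "double_act (matrix_inv w) (x, flat B y) = (matrix_inv w *v x, flat B (matrix_inv w *v y))" for x y
        using flat_act[OF W_inv[OF w(1)], of y] by (simp add: double_act_def)
      have "(matrix_inv w *v x) $ j * (matrix_inv w *v y) $ k - (matrix_inv w *v x) $ k * (matrix_inv w *v y) $ j =
          x $ j * y $ k - x $ k * y $ j" for x y j k
        using eq[of "sharp (axis j 1)" "sharp (axis k 1)" "(x, flat B y)"] unfolding act val .
      from bivector_preserving_scalar[OF three this]
      show False using inverse_scalar_Zc[OF w(1)] w(2) by blast
    qed
    then obtain u v p where "quad_fun (q u v) (double_act (matrix_inv w) p) \<noteq> quad_fun (q u v) p" by blast
    then show "\<exists>q. (\<forall>\<gamma>\<in>sl2 B. coefficient_at (mat 1) (tensor_map \<gamma> (quad_elt q) - quad_elt q) \<in> cherednik_ideal W \<alpha> \<alpha>v 0 c) \<and>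
          (\<exists>p. quad_fun q (double_act (matrix_inv w) p) \<noteq> quad_fun q p)"
      using inv by (intro exI[of _ "q u v"]) blast
  qed
qed

end

section \<open>The centre of the algebra of invariants\<close>

context gamma_setting
begin

text \<open>
  Elements of the Cherednik algebra are cosets; this names the coset of an element of the crossed
  product.
\<close>

definition cls :: "(complex^'n^'n \<Rightarrow> 'n tensor_alg) \<Rightarrow> (complex^'n^'n \<Rightarrow> 'n tensor_alg) set" where
  "cls f = Ich +>\<^bsub>A\<^esub> f"

abbreviation "Hc \<equiv> cherednik_algebra W \<alpha> \<alpha>v 0 c"
abbreviation "Bc \<equiv> fixed_subalgebra \<Gamma> (center Hc)"
abbreviation "Cc \<equiv> center (fixed_subalgebra \<Gamma> Hc)"

lemma mem_cls: "f \<in> carrier A \<Longrightarrow> h \<in> cls f \<longleftrightarrow> h \<in> carrier A \<and> Theta h = Theta f"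
proof -
  assume f: "f \<in> carrier A"
  have "h \<in> cls f \<longleftrightarrow> (\<exists>i\<in>Ich. h = (\<lambda>g. i g + f g))"
    by (auto simp: cls_def a_r_coset_def' smash_add)
  also have "\<dots> \<longleftrightarrow> (\<lambda>g. h g - f g) \<in> Ich"
  proof
    assume "\<exists>i\<in>Ich. h = (\<lambda>g. i g + f g)"
    then show "(\<lambda>g. h g - f g) \<in> Ich" by auto
  next
    assume i: "(\<lambda>g. h g - f g) \<in> Ich"
    show "\<exists>i\<in>Ich. h = (\<lambda>g. i g + f g)" by (rule bexI[OF _ i]) auto
  qed
  also have "\<dots> \<longleftrightarrow> h \<in> carrier A \<and> Theta h = Theta f"
    using f by (auto simp: Ich_iff Theta_diff smash_carrier)
  finally show ?thesis .
qed

lemma cls_eq: "f \<in> carrier A \<Longrightarrow> h \<in> carrier A \<Longrightarrow> cls f = cls h \<longleftrightarrow> Theta f = Theta h"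
  using mem_cls by (metis (no_types, lifting) subsetI subset_antisym)

lemma Hc_carrier: "carrier Hc = cls ` carrier A"
  by (auto simp: cherednik_algebra_def quotient_algebra_def ring.defs module.defs FactRing_def A_RCOSETS_def' cls_def)

lemma Hc_ops:
  "monoid.mult Hc = rcoset_mult A Ich" "add Hc = set_add A" "one Hc = cls \<one>\<^bsub>A\<^esub>" "zero Hc = Ich"
  "z \<odot>\<^bsub>Hc\<^esub> X = (\<Union>x\<in>X. cls (z \<odot>\<^bsub>A\<^esub> x))"
  by (simp_all add: cherednik_algebra_def quotient_algebra_def ring.defs module.defs FactRing_def cls_def)

lemma cls_mult: "f \<in> carrier A \<Longrightarrow> h \<in> carrier A \<Longrightarrow> cls f \<otimes>\<^bsub>Hc\<^esub> cls h = cls (f \<otimes>\<^bsub>A\<^esub> h)"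
  by (simp add: Hc_ops cls_def Ich.rcoset_mult_add)

lemma cls_add: "f \<in> carrier A \<Longrightarrow> h \<in> carrier A \<Longrightarrow> cls f \<oplus>\<^bsub>Hc\<^esub> cls h = cls (f \<oplus>\<^bsub>A\<^esub> h)"
  by (simp add: Hc_ops cls_def Ich.a_rcos_sum)

lemma cls_one: "\<one>\<^bsub>Hc\<^esub> = cls \<one>\<^bsub>A\<^esub>"
  by (simp add: Hc_ops)

lemma cls_zero: "\<zero>\<^bsub>Hc\<^esub> = cls \<zero>\<^bsub>A\<^esub>"
  using mem_cls[of "\<zero>\<^bsub>A\<^esub>"] by (auto simp: Hc_ops Ich_iff smash_zero Theta_zero smash_carrier)

lemma smult_carrier: "f \<in> carrier A \<Longrightarrow> z \<odot>\<^bsub>A\<^esub> f \<in> carrier A"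
  by (simp add: smash_smult smash_carrier)

lemma cls_smult: "f \<in> carrier A \<Longrightarrow> z \<odot>\<^bsub>Hc\<^esub> cls f = cls (z \<odot>\<^bsub>A\<^esub> f)"
proof -
  assume f: "f \<in> carrier A"
  have "cls (z \<odot>\<^bsub>A\<^esub> h) = cls (z \<odot>\<^bsub>A\<^esub> f)" if "h \<in> cls f" for h
    using that f by (subst cls_eq) (auto simp: mem_cls smult_carrier, simp add: smash_smult Theta_scale)
  then have "z \<odot>\<^bsub>Hc\<^esub> cls f = (\<Union>h\<in>cls f. cls (z \<odot>\<^bsub>A\<^esub> f))"
    unfolding Hc_ops by (intro SUP_cong refl)
  moreover have "cls f \<noteq> {}" using f mem_cls[of f f] by blast
  ultimately show ?thesis by (simp only: UN_constant if_False)
qed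

lemma Hc_ring: "ring Hc"
proof -
  interpret Q: ring "A Quot Ich" by (rule Ich.quotient_is_ring)
  have eqs: "carrier Hc = carrier (A Quot Ich)" "monoid.mult Hc = monoid.mult (A Quot Ich)"
    "add Hc = add (A Quot Ich)" "one Hc = one (A Quot Ich)" "zero Hc = zero (A Quot Ich)"
    by (simp_all add: cherednik_algebra_def quotient_algebra_def ring.defs module.defs)
  show ?thesis
  proof (rule ringI)
    show "abelian_group Hc"
      by (rule abelian_groupI) (simp_all add: eqs Q.a_assoc Q.add.l_inv_ex, rule Q.a_comm)
    show "monoid Hc" by (rule monoidI) (auto simp: eqs Q.m_assoc)
  qed (auto simp: eqs Q.l_distr Q.r_distr)
qed

text \<open>The inverse of \<open>\<gamma>\<close> shows that the image is the whole coset.\<close>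

lemma smash_map_cls:
  assumes \<gamma>: "\<gamma> \<in> \<Gamma>" and f: "f \<in> carrier A"
  shows "smash_map \<gamma> ` cls f = cls (smash_map \<gamma> f)"
proof
  show "smash_map \<gamma> ` cls f \<subseteq> cls (smash_map \<gamma> f)"
    using f \<gamma> by (auto simp: mem_cls smash_map_carrier intro: Theta_smash_map_cong)
  obtain \<delta> where \<delta>: "\<delta> \<in> \<Gamma>" "\<And>v. \<gamma> (\<delta> v) = v" "\<And>v. \<delta> (\<gamma> v) = v" using Gamma_inv[OF \<gamma>] by blast
  have id: "smash_map \<gamma> (smash_map \<delta> h) = h" "smash_map \<delta> (smash_map \<gamma> h) = h" for h
    unfolding smash_map_def tensor_map_comp[OF Gamma_linear[OF \<gamma>]] tensor_map_comp[OF Gamma_linear[OF \<delta>(1)]] \<delta> tensor_map_id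
    by (rule refl)+
  show "cls (smash_map \<gamma> f) \<subseteq> smash_map \<gamma> ` cls f"
  proof
    fix h assume h: "h \<in> cls (smash_map \<gamma> f)"
    then have "h \<in> carrier A" "Theta h = Theta (smash_map \<gamma> f)" using f by (simp_all add: mem_cls smash_map_carrier)
    then have "smash_map \<delta> h \<in> cls f"
      using Theta_smash_map_cong[OF \<delta>(1), of h "smash_map \<gamma> f"] f by (simp add: mem_cls smash_map_carrier id)
    then show "h \<in> smash_map \<gamma> ` cls f" using id(1)[of h] by (metis image_eqI)
  qed
qed

lemma fixedD: "fixed f \<Longrightarrow> f \<in> carrier A"
  and centralD: "central f \<Longrightarrow> f \<in> carrier A"
  and fixed_centralD: "fixed_central f \<Longrightarrow> fixed f"
    "fixed_central f \<Longrightarrow> fixed h \<Longrightarrow> Theta f * Theta h = Theta h * Theta f"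
  by (simp_all add: fixed_def central_def fixed_central_def)

lemma fixed_cls_iff: "f \<in> carrier A \<Longrightarrow> (\<forall>\<gamma>\<in>\<Gamma>. smash_map \<gamma> ` cls f = cls f) \<longleftrightarrow> fixed f"
  by (simp add: fixed_def smash_map_cls cls_eq smash_map_carrier)

lemma commuting_cls_iff: "f \<in> carrier A \<Longrightarrow> h \<in> carrier A \<Longrightarrow>
    cls f \<otimes>\<^bsub>Hc\<^esub> cls h = cls h \<otimes>\<^bsub>Hc\<^esub> cls f \<longleftrightarrow> Theta f * Theta h = Theta h * Theta f"
  by (simp add: cls_mult cls_eq Theta_mult)

lemma fixed_carrier: "carrier (fixed_subalgebra \<Gamma> Hc) = cls ` {f. fixed f}"
proof -
  have "carrier (fixed_subalgebra \<Gamma> Hc) = cls ` {f \<in> carrier A. \<forall>\<gamma>\<in>\<Gamma>. smash_map \<gamma> ` cls f = cls f}"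
    unfolding fixed_subalgebra_def Hc_carrier by (simp, blast)
  also have "{f \<in> carrier A. \<forall>\<gamma>\<in>\<Gamma>. smash_map \<gamma> ` cls f = cls f} = {f. fixed f}"
    using fixed_cls_iff fixedD by blast
  finally show ?thesis .
qed

lemma center_carrier: "carrier (center Hc) = cls ` {f. central f}"
proof -
  have "carrier (center Hc) = cls ` {f \<in> carrier A. \<forall>h\<in>carrier A. cls f \<otimes>\<^bsub>Hc\<^esub> cls h = cls h \<otimes>\<^bsub>Hc\<^esub> cls f}"
    unfolding center_def Hc_carrier by (simp, blast)
  also have "{f \<in> carrier A. \<forall>h\<in>carrier A. cls f \<otimes>\<^bsub>Hc\<^esub> cls h = cls h \<otimes>\<^bsub>Hc\<^esub> cls f} = {f. central f}"
    by (intro Collect_cong) (simp add: central_def commuting_cls_iff cong: conj_cong)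
  finally show ?thesis .
qed

lemma Bc_carrier: "carrier Bc = cls ` {f. central f \<and> fixed f}"
proof -
  have "carrier Bc = {X \<in> cls ` {f. central f}. \<forall>\<gamma>\<in>\<Gamma>. smash_map \<gamma> ` X = X}"
    by (simp add: fixed_subalgebra_def flip: center_carrier)
  also have "\<dots> = cls ` {f. central f \<and> (\<forall>\<gamma>\<in>\<Gamma>. smash_map \<gamma> ` cls f = cls f)}" by blast
  also have "{f. central f \<and> (\<forall>\<gamma>\<in>\<Gamma>. smash_map \<gamma> ` cls f = cls f)} = {f. central f \<and> fixed f}"
    using fixed_cls_iff centralD by blast
  finally show ?thesis .
qed

lemma Cc_carrier: "carrier Cc = cls ` {f. fixed_central f}"
proof -
  have "carrier Cc = {X \<in> cls ` {f. fixed f}. \<forall>Y\<in>cls ` {f. fixed f}. X \<otimes>\<^bsub>Hc\<^esub> Y = Y \<otimes>\<^bsub>Hc\<^esub> X}"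
    by (simp add: center_def fixed_subalgebra_def flip: fixed_carrier)
  also have "\<dots> = cls ` {f. fixed f \<and> (\<forall>h. fixed h \<longrightarrow> cls f \<otimes>\<^bsub>Hc\<^esub> cls h = cls h \<otimes>\<^bsub>Hc\<^esub> cls f)}" by blast
  also have "{f. fixed f \<and> (\<forall>h. fixed h \<longrightarrow> cls f \<otimes>\<^bsub>Hc\<^esub> cls h = cls h \<otimes>\<^bsub>Hc\<^esub> cls f)} = {f. fixed_central f}"
    unfolding fixed_central_def using commuting_cls_iff fixedD by blast
  finally show ?thesis .
qed

lemma Bc_ops: "monoid.mult Bc = monoid.mult Hc" "add Bc = add Hc" "one Bc = one Hc" "zero Bc = zero Hc" "smult Bc = smult Hc"
  and Cc_ops: "monoid.mult Cc = monoid.mult Hc" "add Cc = add Hc" "one Cc = one Hc" "zero Cc = zero Hc" "smult Cc = smult Hc"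
  by (simp_all add: center_def fixed_subalgebra_def)

lemma fixed_closed: "fixed f \<Longrightarrow> fixed h \<Longrightarrow> fixed (f \<oplus>\<^bsub>A\<^esub> h)" "fixed \<zero>\<^bsub>A\<^esub>" "fixed \<one>\<^bsub>A\<^esub>"
  "fixed f \<Longrightarrow> fixed (\<lambda>g. - f g)" "fixed f \<Longrightarrow> fixed (z \<odot>\<^bsub>A\<^esub> f)"
proof -
  show "fixed \<one>\<^bsub>A\<^esub>" using fixed_group[OF W_one] by (simp add: smash_one)
  show "fixed f \<Longrightarrow> fixed (z \<odot>\<^bsub>A\<^esub> f)"
  proof -
    have "smash_map \<gamma> (\<lambda>g. Poly_Mapping.single 0 z * f g) = (\<lambda>g. Poly_Mapping.single 0 z * smash_map \<gamma> f g)" for \<gamma>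
      by (simp add: smash_map_def)
    then show "fixed f \<Longrightarrow> fixed (z \<odot>\<^bsub>A\<^esub> f)" by (simp add: fixed_def smash_smult smash_carrier Theta_scale)
  qed
qed (auto simp: fixed_def smash_carrier smash_add smash_zero smash_map_add smash_map_zero smash_map_uminus
    Theta_add Theta_uminus)

lemma scalar_operator_comm: "scalar_operator z * X = X * scalar_operator z"
  by (rule operator.scalar_central)

lemma commuting_closed:
  assumes "Theta f * X = X * Theta f"
  shows "Theta h * X = X * Theta h \<Longrightarrow> Theta (f \<oplus>\<^bsub>A\<^esub> h) * X = X * Theta (f \<oplus>\<^bsub>A\<^esub> h)"
    "Theta h * X = X * Theta h \<Longrightarrow> Theta (f \<otimes>\<^bsub>A\<^esub> h) * X = X * Theta (f \<otimes>\<^bsub>A\<^esub> h)"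
    "Theta (\<lambda>g. - f g) * X = X * Theta (\<lambda>g. - f g)" "Theta (z \<odot>\<^bsub>A\<^esub> f) * X = X * Theta (z \<odot>\<^bsub>A\<^esub> f)"
proof -
  show "Theta (f \<otimes>\<^bsub>A\<^esub> h) * X = X * Theta (f \<otimes>\<^bsub>A\<^esub> h)" if "Theta h * X = X * Theta h"
    using assms that unfolding Theta_mult by (metis mult.assoc)
  show "Theta (z \<odot>\<^bsub>A\<^esub> f) * X = X * Theta (z \<odot>\<^bsub>A\<^esub> f)"
    using assms scalar_operator_comm[of z X] unfolding smash_smult Theta_scale by (metis mult.assoc)
qed (use assms in \<open>simp_all add: smash_add Theta_add Theta_uminus distrib_left distrib_right\<close>)

text \<open>
  Both the invariant part of the centre and the centre of the invariants are described by closed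
  conditions on representatives.
\<close>

lemma cring_of_commuting_classes:
  assumes R: "monoid.mult R = monoid.mult Hc" "add R = add Hc" "one R = one Hc" "zero R = zero Hc"
    and car: "carrier R = cls ` P" and sub: "P \<subseteq> carrier A"
    and ops: "\<And>f h. f \<in> P \<Longrightarrow> h \<in> P \<Longrightarrow> f \<oplus>\<^bsub>A\<^esub> h \<in> P" "\<And>f h. f \<in> P \<Longrightarrow> h \<in> P \<Longrightarrow> f \<otimes>\<^bsub>A\<^esub> h \<in> P"
      "\<zero>\<^bsub>A\<^esub> \<in> P" "\<one>\<^bsub>A\<^esub> \<in> P" "\<And>f. f \<in> P \<Longrightarrow> (\<lambda>g. - f g) \<in> P"
    and comm: "\<And>f h. f \<in> P \<Longrightarrow> h \<in> P \<Longrightarrow> Theta f * Theta h = Theta h * Theta f"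
  shows "cring R"
proof -
  interpret H: ring Hc by (rule Hc_ring)
  have sub': "f \<in> P \<Longrightarrow> f \<in> carrier A" for f using sub by blast
  have inH: "x \<in> carrier R \<Longrightarrow> x \<in> carrier Hc" for x using sub by (auto simp: car Hc_carrier)
  have neg: "cls (\<lambda>g. - f g) \<oplus>\<^bsub>Hc\<^esub> cls f = \<zero>\<^bsub>Hc\<^esub>" if "f \<in> P" for f
    using sub'[OF that] sub'[OF ops(5)[OF that]] by (simp add: cls_add cls_zero smash_add smash_zero)
  have mult: "x \<otimes>\<^bsub>Hc\<^esub> y \<in> carrier R" if "x \<in> carrier R" "y \<in> carrier R" for x y
    using that ops(2) sub' by (auto simp: car cls_mult)
  have mcomm: "x \<otimes>\<^bsub>Hc\<^esub> y = y \<otimes>\<^bsub>Hc\<^esub> x" if xy: "x \<in> carrier R" "y \<in> carrier R" for x y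
  proof -
    obtain f h where "f \<in> P" "h \<in> P" "x = cls f" "y = cls h" using xy unfolding car by blast
    then show ?thesis using commuting_cls_iff[OF sub' sub', of f h] comm[of f h] by simp
  qed
  have one: "\<one>\<^bsub>Hc\<^esub> \<in> carrier R" using ops(4) by (auto simp: car cls_one)
  show ?thesis
  proof (rule cringI)
    show "abelian_group R"
    proof (rule abelian_groupI, goal_cases)
      case (6 x)
      then show ?case using neg ops(5) by (auto simp: R car)
    next
      case (1 x y)
      then show ?case using ops(1) sub' by (auto simp: R car cls_add)
    next
      case 2
      then show ?case using ops(3) by (auto simp: R car cls_zero)
    qed (simp_all add: R inH H.a_assoc, simp add: inH H.a_comm)
    show "Group.comm_monoid R"
      by (rule comm_monoidI) (simp_all add: R inH mult one H.m_assoc, erule (1) mcomm)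
  qed (simp add: R inH H.l_distr)
qed

lemma Theta_one_comm: "h \<in> carrier A \<Longrightarrow> Theta \<one>\<^bsub>A\<^esub> * Theta h = Theta h * Theta \<one>\<^bsub>A\<^esub>"
  by (simp flip: Theta_mult)

lemma Cc_cring: "cring Cc"
proof (rule cring_of_commuting_classes[OF Cc_ops(1-4) Cc_carrier])
  show "{f. fixed_central f} \<subseteq> carrier A" using fixedD fixed_centralD(1) by blast
  show "\<zero>\<^bsub>A\<^esub> \<in> {f. fixed_central f}" "\<one>\<^bsub>A\<^esub> \<in> {f. fixed_central f}"
    using fixed_closed(2,3) Theta_one_comm fixedD by (simp_all add: fixed_central_def smash_zero Theta_zero)
  fix f h assume "f \<in> {f. fixed_central f}"
  then have f: "fixed f" "\<And>h. fixed h \<Longrightarrow> Theta f * Theta h = Theta h * Theta f" using fixed_centralD by blast+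
  show "(\<lambda>g. - f g) \<in> {f. fixed_central f}"
    unfolding fixed_central_def using fixed_closed(4)[OF f(1)] commuting_closed(3)[OF f(2)] by blast
  assume "h \<in> {f. fixed_central f}"
  then have h: "fixed h" "\<And>f. fixed f \<Longrightarrow> Theta h * Theta f = Theta f * Theta h" using fixed_centralD by blast+
  show "f \<oplus>\<^bsub>A\<^esub> h \<in> {f. fixed_central f}"
    unfolding fixed_central_def using fixed_closed(1)[OF f(1) h(1)] commuting_closed(1)[OF f(2) h(2)] by blast
  show "f \<otimes>\<^bsub>A\<^esub> h \<in> {f. fixed_central f}"
    unfolding fixed_central_def using fixed_mult[OF f(1) h(1)] commuting_closed(2)[OF f(2) h(2)] by blast
  show "Theta f * Theta h = Theta h * Theta f" by (rule f(2)[OF h(1)])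
qed

lemma central_closed:
  assumes "central f"
  shows "central h \<Longrightarrow> central (f \<oplus>\<^bsub>A\<^esub> h)" "central h \<Longrightarrow> central (f \<otimes>\<^bsub>A\<^esub> h)"
    "central (\<lambda>g. - f g)" "central (z \<odot>\<^bsub>A\<^esub> f)"
proof -
  have f: "f \<in> carrier A" "\<And>h. h \<in> carrier A \<Longrightarrow> Theta f * Theta h = Theta h * Theta f"
    using assms unfolding central_def by blast+
  have neg: "(\<lambda>g. - f g) \<in> carrier A" using f(1) by (simp add: smash_carrier)
  show "central (\<lambda>g. - f g)" unfolding central_def using commuting_closed(3)[OF f(2)] neg by blast
  show "central (z \<odot>\<^bsub>A\<^esub> f)" unfolding central_def using commuting_closed(4)[OF f(2)] smult_carrier[OF f(1)] by blast
  assume "central h"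
  then have h: "h \<in> carrier A" "\<And>f. f \<in> carrier A \<Longrightarrow> Theta h * Theta f = Theta f * Theta h"
    unfolding central_def by blast+
  show "central (f \<oplus>\<^bsub>A\<^esub> h)"
    unfolding central_def using commuting_closed(1)[OF f(2) h(2)] smash.CP.a_closed[OF f(1) h(1)] by blast
  show "central (f \<otimes>\<^bsub>A\<^esub> h)"
    unfolding central_def using commuting_closed(2)[OF f(2) h(2)] smash.CP.m_closed[OF f(1) h(1)] by blast
qed

lemma Bc_cring: "cring Bc"
proof (rule cring_of_commuting_classes[OF Bc_ops(1-4) Bc_carrier])
  show "{f. central f \<and> fixed f} \<subseteq> carrier A" using fixedD by blast
  have "central \<zero>\<^bsub>A\<^esub>" by (simp add: central_def smash_zero Theta_zero smash_carrier)
  moreover have "central \<one>\<^bsub>A\<^esub>" unfolding central_def using Theta_one_comm smash.CP.one_closed by blast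
  ultimately show "\<zero>\<^bsub>A\<^esub> \<in> {f. central f \<and> fixed f}" "\<one>\<^bsub>A\<^esub> \<in> {f. central f \<and> fixed f}"
    using fixed_closed(2,3) by simp_all
  fix f h assume f: "f \<in> {f. central f \<and> fixed f}"
  then show "(\<lambda>g. - f g) \<in> {f. central f \<and> fixed f}" by (simp add: fixed_closed(4) central_closed(3))
  assume h: "h \<in> {f. central f \<and> fixed f}"
  show "f \<oplus>\<^bsub>A\<^esub> h \<in> {f. central f \<and> fixed f}" "f \<otimes>\<^bsub>A\<^esub> h \<in> {f. central f \<and> fixed f}"
    using f h by (simp_all add: fixed_closed(1) fixed_mult central_closed(1,2))
  show "Theta f * Theta h = Theta h * Theta f" using f h fixedD unfolding central_def by blast
qed

section \<open>The group algebra of the centre\<close>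

abbreviation "ZW \<equiv> group_center (matrix_group W)"
abbreviation "\<iota> \<equiv> cherednik_group_map W \<alpha> \<alpha>v 0 c"

lemma ZW_simps [simp]: "carrier ZW = Zc" "monoid.mult ZW = (**)" "one ZW = mat 1"
  by (simp_all only: group_center_def Zc_def) (simp_all add: matrix_group_def GL_def)

lemma ZW_group: "finite_group ZW"
proof -
  have inv: "matrix_inv z \<in> Zc" if z: "z \<in> Zc" for z
  proof -
    obtain k where "\<And>v. z *v v = k *s v" using centre_scalar[OF z] by blast
    then have "matrix_inv (matrix_inv z) *v v = k *s v" for v using z by simp
    from inverse_scalar_Zc[OF W_inv this] show ?thesis using z by simp
  qed
  have mult: "z ** z' \<in> Zc" if "z \<in> Zc" "z' \<in> Zc" for z z'
  proof -
    have "\<forall>w\<in>W. z ** z' ** w = w ** (z ** z')"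
    proof
      fix w assume "w \<in> W"
      then show "z ** z' ** w = w ** (z ** z')"
        using Zc_comm[OF \<open>z \<in> Zc\<close>] Zc_comm[OF \<open>z' \<in> Zc\<close>] by (metis matrix_mul_assoc)
    qed
    then show ?thesis
      unfolding Zc_def[THEN eqset_imp_iff] mem_Collect_eq using W_mult[OF Zc_W[OF that(1)] Zc_W[OF that(2)]] by blast
  qed
  have one: "mat 1 \<in> Zc" by (simp only: Zc_def mem_Collect_eq W_one) simp
  have "group ZW"
  proof (rule groupI)
    show "\<exists>y\<in>carrier ZW. y \<otimes>\<^bsub>ZW\<^esub> x = \<one>\<^bsub>ZW\<^esub>" if "x \<in> carrier ZW" for x
      using that inv by (intro bexI[of _ "matrix_inv x"]) simp_all
  qed (simp_all add: mult one matrix_mul_assoc)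
  then show ?thesis by (simp add: finite_group_def finite_group_axioms_def)
qed

text \<open>A representative in the crossed product of an element of the group algebra.\<close>

definition scalars :: "(complex^'n^'n \<Rightarrow> complex) \<Rightarrow> complex^'n^'n \<Rightarrow> 'n tensor_alg" where
  "scalars b = (\<lambda>g. Poly_Mapping.single 0 (b g))"

lemma \<iota>_cls: "\<iota> b = cls (scalars b)"
  by (simp add: cherednik_group_map_def cls_def scalars_def)

lemma GA_carrier: "b \<in> carrier (group_algebra ZW) \<longleftrightarrow> (\<forall>g. g \<notin> Zc \<longrightarrow> b g = 0)"
  by (simp add: group_algebra_simps)

lemma scalars_carrier: "b \<in> carrier (group_algebra ZW) \<Longrightarrow> scalars b \<in> carrier A"
proof -
  assume b: "b \<in> carrier (group_algebra ZW)"
  have "b g = 0" if "g \<notin> W" for g using that b Zc_W[of g] unfolding GA_carrier by blast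
  then show ?thesis by (simp add: smash_carrier scalars_def)
qed

lemma scalars_delta: "scalars (coefficient_at z 1) = elt z 1"
  by (auto simp: scalars_def coefficient_at_def)

lemma Theta_scalars:
  assumes "b \<in> carrier (group_algebra ZW)"
  shows "Theta (scalars b) = (\<Sum>z\<in>Zc. scalar_operator (b z) * U z)"
proof -
  have "Theta (scalars b) = (\<Sum>w\<in>W. scalar_operator (b w) * U w)"
    by (simp add: Theta_def scalars_def)
  also have "\<dots> = (\<Sum>z\<in>Zc. scalar_operator (b z) * U z)"
  proof (rule sum.mono_neutral_right)
    have "scalar_operator 0 = (0 :: 'n double operator)" using T_hom(1,7) by (metis single_zero)
    then show "\<forall>i\<in>W - Zc. scalar_operator (b i) * U i = 0" using assms by (simp add: GA_carrier)
  qed (use finite_W Zc_W in blast)+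
  finally show ?thesis .
qed

lemma scalars_fixed_central:
  assumes b: "b \<in> carrier (group_algebra ZW)"
  shows "fixed_central (scalars b)"
  unfolding fixed_central_def
proof (intro conjI allI impI)
  have "smash_map \<gamma> (scalars b) = scalars b" for \<gamma> by (simp add: smash_map_def scalars_def)
  then show "fixed (scalars b)" using scalars_carrier[OF b] by (simp add: fixed_def)
  fix h assume h: "fixed h"
  have "scalar_operator (b z) * U z * Theta h = Theta h * (scalar_operator (b z) * U z)" if z: "z \<in> Zc" for z
  proof -
    have "scalar_operator (b z) * U z * Theta h = scalar_operator (b z) * (Theta h * U z)"
      by (simp only: mult.assoc centre_commutes[OF z h])
    also have "\<dots> = Theta h * scalar_operator (b z) * U z"
      by (simp only: mult.assoc[symmetric] scalar_operator_comm)
    finally show ?thesis by (simp only: mult.assoc)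
  qed
  then show "Theta (scalars b) * Theta h = Theta h * Theta (scalars b)"
    unfolding Theta_scalars[OF b] sum_distrib_left sum_distrib_right by (intro sum.cong refl)
qed

lemma scalars_mult:
  assumes b: "b \<in> carrier (group_algebra ZW)" and b': "b' \<in> carrier (group_algebra ZW)"
  shows "scalars b \<otimes>\<^bsub>A\<^esub> scalars b' = scalars (b \<otimes>\<^bsub>group_algebra ZW\<^esub> b')"
proof
  fix k
  interpret Z: finite_group ZW by (rule ZW_group)
  have inv: "inv\<^bsub>ZW\<^esub> a = matrix_inv a" if "a \<in> Zc" for a
  proof -
    have "a ** (inv\<^bsub>ZW\<^esub> a) = mat 1" using Z.r_inv[of a] that by simp
    then show ?thesis using W_inv_unique that by simp
  qed
  have mult: "b \<otimes>\<^bsub>group_algebra ZW\<^esub> b' = (\<lambda>k. if k \<in> Zc then \<Sum>a\<in>Zc. b a * b' (matrix_inv a ** k) else 0)"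
    using Z.GA.CP_mult[of b b'] by (auto simp: inv cong: if_cong sum.cong)
  have out: "b' (matrix_inv a ** k) = 0" if "a \<in> Zc" "k \<notin> Zc" for a
  proof -
    have "matrix_inv a ** k \<notin> Zc"
    proof
      assume "matrix_inv a ** k \<in> Zc"
      then have "a ** (matrix_inv a ** k) \<in> Zc"
        using Z.m_closed[of a "matrix_inv a ** k"] that(1) by (simp only: ZW_simps)
      then show False using that(2)
        by (simp only: matrix_mul_assoc W_inverses[OF Zc_W[OF that(1)]] matrix_mul_lid)
    qed
    then show ?thesis using b' by (simp add: GA_carrier)
  qed
  have "(scalars b \<otimes>\<^bsub>A\<^esub> scalars b') k = (if k \<in> W then \<Sum>a\<in>W. Poly_Mapping.single 0 (b a * b' (matrix_inv a ** k)) else 0)"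
    by (simp add: smash_mult scalars_def mult_single)
  also have "(\<Sum>a\<in>W. Poly_Mapping.single 0 (b a * b' (matrix_inv a ** k))) =
      (\<Sum>a\<in>Zc. Poly_Mapping.single 0 (b a * b' (matrix_inv a ** k)) :: 'n tensor_alg)"
    by (rule sum.mono_neutral_right) (use b Zc_W finite_W in \<open>auto simp: GA_carrier\<close>)
  also have "\<dots> = Poly_Mapping.single 0 (\<Sum>a\<in>Zc. b a * b' (matrix_inv a ** k))"
    by (induction rule: finite_induct[OF finite_Zc]) (simp_all add: single_add)
  finally show "(scalars b \<otimes>\<^bsub>A\<^esub> scalars b') k = scalars (b \<otimes>\<^bsub>group_algebra ZW\<^esub> b') k"
    using Zc_W out by (auto simp: mult scalars_def)
qed

lemma Cc_mem: "fixed_central f \<Longrightarrow> cls f \<in> carrier Cc"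
  by (simp add: Cc_carrier)

lemma fixed_centralI: "central f \<Longrightarrow> fixed f \<Longrightarrow> fixed_central f"
  using fixedD unfolding fixed_central_def central_def by blast

lemma cls_finsum:
  assumes "finite I" "\<And>i. i \<in> I \<Longrightarrow> F i \<in> carrier A" "\<And>i. i \<in> I \<Longrightarrow> cls (F i) \<in> carrier Cc"
  shows "(\<Oplus>\<^bsub>Cc\<^esub>i\<in>I. cls (F i)) = cls (\<lambda>g. \<Sum>i\<in>I. F i g)"
  using assms
proof (induction I rule: finite_induct)
  interpret C: cring Cc by (rule Cc_cring)
  case empty
  then show ?case by (simp only: C.finsum_empty Cc_ops cls_zero smash_zero sum.empty)
next
  interpret C: cring Cc by (rule Cc_cring)
  case (insert i I)
  have car: "(\<lambda>g. \<Sum>i\<in>I. F i g) \<in> carrier A" using insert.prems(1) by (auto simp: smash_carrier intro!: sum.neutral)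
  have "(\<Oplus>\<^bsub>Cc\<^esub>i\<in>insert i I. cls (F i)) = cls (F i) \<oplus>\<^bsub>Cc\<^esub> (\<Oplus>\<^bsub>Cc\<^esub>i\<in>I. cls (F i))"
    using insert by (intro C.finsum_insert) auto
  also have "\<dots> = cls (F i) \<oplus>\<^bsub>Hc\<^esub> cls (\<lambda>g. \<Sum>i\<in>I. F i g)"
    using insert.IH[OF insert.prems(1)[OF insertI2] insert.prems(2)[OF insertI2]] by (simp only: Cc_ops)
  also have "\<dots> = cls (\<lambda>g. \<Sum>i\<in>insert i I. F i g)"
    using insert.prems(1)[of i] insert.hyps car by (simp add: cls_add smash_add)
  finally show ?case .
qed

lemma centre_sum:
  assumes h: "\<And>z. z \<in> Zc \<Longrightarrow> central (h z) \<and> fixed (h z)"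
  obtains f where "f \<in> carrier A" "Theta f = (\<Sum>z\<in>Zc. Theta (h z) * U z)"
    "(\<Oplus>\<^bsub>Cc\<^esub>z\<in>Zc. cls (h z) \<otimes>\<^bsub>Cc\<^esub> \<iota> (coefficient_at z 1)) = cls f"
proof -
  interpret C: cring Cc by (rule Cc_cring)
  let ?F = "\<lambda>z. h z \<otimes>\<^bsub>A\<^esub> elt z 1"
  have car: "h z \<in> carrier A" "elt z 1 \<in> carrier A" if "z \<in> Zc" for z
    using h[OF that] fixedD smash_at_carrier[OF Zc_W[OF that]] by blast+
  have F: "?F z \<in> carrier A" if "z \<in> Zc" for z using car[OF that] by (rule smash.CP.m_closed)
  have eq: "cls (h z) \<otimes>\<^bsub>Cc\<^esub> \<iota> (coefficient_at z 1) = cls (?F z)" if "z \<in> Zc" for z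
    using car[OF that] by (simp only: \<iota>_cls scalars_delta Cc_ops cls_mult)
  have mem: "cls (?F z) \<in> carrier Cc" if z: "z \<in> Zc" for z
    using C.m_closed[OF Cc_mem[OF fixed_centralI] Cc_mem[OF fixed_central_group[OF z]], of "h z"] h[OF z] eq[OF z]
    by (simp only: \<iota>_cls scalars_delta)
  have "(\<Oplus>\<^bsub>Cc\<^esub>z\<in>Zc. cls (h z) \<otimes>\<^bsub>Cc\<^esub> \<iota> (coefficient_at z 1)) = (\<Oplus>\<^bsub>Cc\<^esub>z\<in>Zc. cls (?F z))"
    using mem by (intro C.finsum_cong' refl eq Pi_I)
  also have "\<dots> = cls (\<lambda>g. \<Sum>z\<in>Zc. ?F z g)" by (rule cls_finsum[OF finite_Zc F mem])
  finally have 1: "(\<Oplus>\<^bsub>Cc\<^esub>z\<in>Zc. cls (h z) \<otimes>\<^bsub>Cc\<^esub> \<iota> (coefficient_at z 1)) = cls (\<lambda>g. \<Sum>z\<in>Zc. ?F z g)" .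
  have 2: "(\<lambda>g. \<Sum>z\<in>Zc. ?F z g) \<in> carrier A" using F by (auto simp: smash_carrier intro!: sum.neutral)
  have 3: "Theta (\<lambda>g. \<Sum>z\<in>Zc. ?F z g) = (\<Sum>z\<in>Zc. Theta (h z) * U z)"
    by (simp add: Theta_sum Theta_mult Theta_group)
  show ?thesis by (rule that[OF 2 3 1])
qed

text \<open>
  Spanning is the decomposition of the central elements of the invariants, independence the
  uniqueness of its components.
\<close>

lemma centre_free: "free_over_abelian_group ZW Bc Cc \<iota>"
proof -
  interpret H: ring Hc by (rule Hc_ring)
  have CA: "\<exists>f. f \<in> carrier A \<and> fixed_central f \<and> x = cls f" if "x \<in> carrier Cc" for x
    using that fixedD fixed_centralD(1) unfolding Cc_carrier by blast
  have BA: "\<exists>f. central f \<and> fixed f \<and> x = cls f" if "x \<in> carrier Bc" for x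
    using that unfolding Bc_carrier by blast
  have smult: "fixed_central (z \<odot>\<^bsub>A\<^esub> f)" if f: "fixed_central f" for z f
    unfolding fixed_central_def
    using fixed_closed(5)[OF fixed_centralD(1)[OF f]] commuting_closed(4)[OF fixed_centralD(2)[OF f]] by blast
  show ?thesis
  proof (intro free_over_abelian_group.intro free_over_group.intro free_over_group_axioms.intro
      free_over_abelian_group_axioms.intro ZW_group Cc_cring Bc_cring)
    show "carrier Bc \<subseteq> carrier Cc" unfolding Bc_carrier Cc_carrier using fixed_centralI by blast
    show "monoid.mult Bc = monoid.mult Cc" "one Bc = one Cc" "zero Bc = zero Cc" "add Bc = add Cc" "smult Bc = smult Cc"
      by (simp_all only: Bc_ops Cc_ops)
    show "z \<odot>\<^bsub>Cc\<^esub> b \<in> carrier Bc" if b: "b \<in> carrier Bc" for z b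
    proof -
      obtain f where f: "central f" "fixed f" "b = cls f" using BA[OF b] by blast
      then show ?thesis
        using central_closed(4)[OF f(1), of z] fixed_closed(5)[OF f(2), of z] fixedD[OF f(2)]
        by (simp only: Cc_ops cls_smult Bc_carrier) blast
    qed
    show "z \<odot>\<^bsub>Cc\<^esub> b \<in> carrier Cc" if b: "b \<in> carrier Cc" for z b
    proof -
      obtain f where f: "f \<in> carrier A" "fixed_central f" "b = cls f" using CA[OF b] by blast
      then show ?thesis using Cc_mem[OF smult[OF f(2)]] by (simp only: Cc_ops cls_smult)
    qed
    fix z z' b assume b: "b \<in> carrier Cc"
    obtain f where f: "f \<in> carrier A" "b = cls f" using CA[OF b] by blast
    have s: "k \<odot>\<^bsub>A\<^esub> f \<in> carrier A" for k using f(1) by (rule smult_carrier)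
    show "(z + z') \<odot>\<^bsub>Cc\<^esub> b = z \<odot>\<^bsub>Cc\<^esub> b \<oplus>\<^bsub>Cc\<^esub> z' \<odot>\<^bsub>Cc\<^esub> b"
      unfolding f(2) Cc_ops cls_smult[OF f(1)] cls_add[OF s s]
      by (simp add: smash_smult smash_add single_add distrib_right)
    show "1 \<odot>\<^bsub>Cc\<^esub> b = b"
      unfolding f(2) Cc_ops cls_smult[OF f(1)] by (simp add: smash_smult)
    show "z \<odot>\<^bsub>Cc\<^esub> (z' \<odot>\<^bsub>Cc\<^esub> b) = (z * z') \<odot>\<^bsub>Cc\<^esub> b"
      unfolding f(2) Cc_ops cls_smult[OF f(1)] cls_smult[OF s]
      by (simp add: smash_smult mult_single flip: mult.assoc)
    fix b' assume b': "b' \<in> carrier Cc"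
    obtain f' where f': "f' \<in> carrier A" "b' = cls f'" using CA[OF b'] by blast
    have s': "k \<odot>\<^bsub>A\<^esub> f' \<in> carrier A" for k using f'(1) by (rule smult_carrier)
    show "z \<odot>\<^bsub>Cc\<^esub> (b \<oplus>\<^bsub>Cc\<^esub> b') = z \<odot>\<^bsub>Cc\<^esub> b \<oplus>\<^bsub>Cc\<^esub> z \<odot>\<^bsub>Cc\<^esub> b'"
      unfolding f(2) f'(2) Cc_ops cls_smult[OF f(1)] cls_smult[OF f'(1)] cls_add[OF s s'] cls_add[OF f(1) f'(1)]
        cls_smult[OF smash.CP.a_closed[OF f(1) f'(1)]]
      by (simp add: smash_smult smash_add distrib_left)
    show "(z \<odot>\<^bsub>Cc\<^esub> b) \<otimes>\<^bsub>Cc\<^esub> b' = z \<odot>\<^bsub>Cc\<^esub> (b \<otimes>\<^bsub>Cc\<^esub> b')"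
      unfolding f(2) f'(2) Cc_ops cls_smult[OF f(1)] cls_mult[OF s f'(1)] cls_mult[OF f(1) f'(1)]
        cls_smult[OF smash.CP.m_closed[OF f(1) f'(1)]]
      by (intro arg_cong[of _ _ cls] ext) (simp add: smash_smult smash_mult sum_distrib_left mult.assoc)
  next
    show "\<iota> \<in> ring_hom (group_algebra ZW) Cc"
    proof (rule ring_hom_memI)
      fix b assume b: "b \<in> carrier (group_algebra ZW)"
      show "\<iota> b \<in> carrier Cc" unfolding \<iota>_cls by (rule Cc_mem[OF scalars_fixed_central[OF b]])
      fix b' assume b': "b' \<in> carrier (group_algebra ZW)"
      show "\<iota> (b \<otimes>\<^bsub>group_algebra ZW\<^esub> b') = \<iota> b \<otimes>\<^bsub>Cc\<^esub> \<iota> b'"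
        unfolding \<iota>_cls Cc_ops cls_mult[OF scalars_carrier[OF b] scalars_carrier[OF b']] scalars_mult[OF b b'] ..
      show "\<iota> (b \<oplus>\<^bsub>group_algebra ZW\<^esub> b') = \<iota> b \<oplus>\<^bsub>Cc\<^esub> \<iota> b'"
        unfolding \<iota>_cls Cc_ops cls_add[OF scalars_carrier[OF b] scalars_carrier[OF b']]
        by (simp add: scalars_def smash_add group_algebra_simps single_add)
    next
      show "\<iota> \<one>\<^bsub>group_algebra ZW\<^esub> = \<one>\<^bsub>Cc\<^esub>"
        by (simp only: \<iota>_cls Cc_ops cls_one group_algebra_simps ZW_simps scalars_delta smash_one)
    qed
    show "\<iota> (z \<odot>\<^bsub>group_algebra ZW\<^esub> b) = z \<odot>\<^bsub>Cc\<^esub> \<iota> b" if b: "b \<in> carrier (group_algebra ZW)" for z b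
      unfolding \<iota>_cls Cc_ops cls_smult[OF scalars_carrier[OF b]]
      by (simp add: scalars_def smash_smult group_algebra_simps mult_single)
    show "g \<otimes>\<^bsub>ZW\<^esub> h = h \<otimes>\<^bsub>ZW\<^esub> g" if "g \<in> carrier ZW" "h \<in> carrier ZW" for g h
      using that Zc_comm[OF _ Zc_W] by simp
  next
    fix x assume "x \<in> carrier Cc"
    then obtain f where f: "f \<in> carrier A" "fixed_central f" "x = cls f" using CA by blast
    obtain h where h: "\<And>z. z \<in> Zc \<Longrightarrow> central (h z) \<and> fixed (h z)" "Theta f = (\<Sum>z\<in>Zc. Theta (h z) * U z)"
      using fixed_central_decomposition[OF f(2)] by blast
    obtain f' where f': "f' \<in> carrier A" "Theta f' = (\<Sum>z\<in>Zc. Theta (h z) * U z)"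
      "(\<Oplus>\<^bsub>Cc\<^esub>z\<in>Zc. cls (h z) \<otimes>\<^bsub>Cc\<^esub> \<iota> (coefficient_at z 1)) = cls f'"
      using centre_sum[of h] h(1) by blast
    have "x = (\<Oplus>\<^bsub>Cc\<^esub>z\<in>Zc. cls (h z) \<otimes>\<^bsub>Cc\<^esub> \<iota> (coefficient_at z 1))"
      unfolding f'(3) f(3) using cls_eq[OF f(1) f'(1)] f'(2) h(2) by simp
    moreover have "(\<lambda>z. cls (h z)) \<in> carrier ZW \<rightarrow> carrier Bc" using h(1) by (auto simp: Bc_carrier)
    ultimately show "\<exists>b. b \<in> carrier ZW \<rightarrow> carrier Bc \<and>
        x = (\<Oplus>\<^bsub>Cc\<^esub>g\<in>carrier ZW. b g \<otimes>\<^bsub>Cc\<^esub> \<iota> (coefficient_at g 1))"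
      unfolding ZW_simps by (intro exI[of _ "\<lambda>z. cls (h z)"] conjI)
  next
    fix b g assume b: "b \<in> carrier ZW \<rightarrow> carrier Bc" and g: "g \<in> carrier ZW"
      and zero: "(\<Oplus>\<^bsub>Cc\<^esub>g\<in>carrier ZW. b g \<otimes>\<^bsub>Cc\<^esub> \<iota> (coefficient_at g 1)) = \<zero>\<^bsub>Cc\<^esub>"
    have "\<forall>z\<in>Zc. \<exists>f. central f \<and> fixed f \<and> b z = cls f" using b BA by auto
    then obtain h where h: "\<And>z. z \<in> Zc \<Longrightarrow> central (h z) \<and> fixed (h z)" "\<And>z. z \<in> Zc \<Longrightarrow> b z = cls (h z)"
      by metis
    obtain f' where f': "f' \<in> carrier A" "Theta f' = (\<Sum>z\<in>Zc. Theta (h z) * U z)"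
      "(\<Oplus>\<^bsub>Cc\<^esub>z\<in>Zc. cls (h z) \<otimes>\<^bsub>Cc\<^esub> \<iota> (coefficient_at z 1)) = cls f'"
      using centre_sum[of h] h(1) by blast
    interpret C: cring Cc by (rule Cc_cring)
    have mem: "cls (h z) \<otimes>\<^bsub>Cc\<^esub> \<iota> (coefficient_at z 1) \<in> carrier Cc" if z: "z \<in> Zc" for z
      unfolding \<iota>_cls scalars_delta
      using h(1)[OF z] by (intro C.m_closed Cc_mem fixed_central_group z) (simp add: fixed_centralI)
    have "(\<Oplus>\<^bsub>Cc\<^esub>g\<in>carrier ZW. b g \<otimes>\<^bsub>Cc\<^esub> \<iota> (coefficient_at g 1)) = cls f'"
      unfolding ZW_simps f'(3)[symmetric] using mem h(2) by (intro C.finsum_cong') auto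
    then have "cls f' = cls \<zero>\<^bsub>A\<^esub>" using zero by (simp only: Cc_ops cls_zero)
    then have "Theta f' = 0" using cls_eq[OF f'(1) smash.CP.zero_closed] by (simp add: smash_zero Theta_zero)
    then have "(\<Sum>z\<in>Zc. Theta (h z) * U z) = 0" using f'(2) by simp
    from central_components_unique[OF _ this, of g] have T0: "Theta (h g) = 0" using h(1) g by simp
    have "h g \<in> carrier A" using h(1)[of g] g fixedD by simp
    then have "cls (h g) = cls \<zero>\<^bsub>A\<^esub>" using cls_eq[OF _ smash.CP.zero_closed, of "h g"] T0 by (simp add: smash_zero Theta_zero)
    then show "b g = \<zero>\<^bsub>Cc\<^esub>" using h(2)[of g] g by (simp only: ZW_simps Cc_ops cls_zero)
  qed
qed

theorem centre_of_invariants: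
  assumes bij: "bij_betw e {..<order ZW} {a. primitive_idempotent (group_algebra ZW) a}"
  shows "cring Cc \<and>
    (\<exists>\<phi> \<in> ring_iso (tensor_product Bc (group_algebra ZW)) Cc.
       \<forall>a\<in>carrier Bc. \<forall>b\<in>carrier (group_algebra ZW).
         \<phi> (pure_tensor Bc (group_algebra ZW) a b) = a \<otimes>\<^bsub>Hc\<^esub> \<iota> b) \<and>
    internal_direct_sum Bc (ring_as_module Cc) {..<order ZW} (\<lambda>i. {a \<otimes>\<^bsub>Hc\<^esub> \<iota> (e i) | a. a \<in> carrier Bc})"
proof -
  interpret F: free_over_abelian_group ZW Bc Cc \<iota> by (rule centre_free)
  show ?thesis using F.tensor_iso F.direct_sum[OF bij] Cc_cring by (simp only: Cc_ops)
qed

end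

lemma card_distinct: "CARD('n::finite) > 1 \<Longrightarrow> \<exists>i j :: 'n. i \<noteq> j"
  by (metis (full_types) One_nat_def UNIV_I card_le_Suc0_iff_eq finite_code not_less)

lemma card_avoid: "CARD('n::finite) > 2 \<Longrightarrow> \<exists>k :: 'n. k \<noteq> i \<and> k \<noteq> j"
proof (rule ccontr)
  assume "CARD('n) > 2" and "\<not> ?thesis"
  then have "(UNIV :: 'n set) \<subseteq> {i, j}" by blast
  then have "CARD('n) \<le> card {i, j}" by (intro card_mono) auto
  also have "\<dots> \<le> 2" by (simp add: card_insert_if)
  finally show False using \<open>CARD('n) > 2\<close> by simp
qed

theorem corollary7p7:
  fixes W :: "(complex^'n^'n) set"
    and \<alpha> \<alpha>v :: "complex^'n^'n \<Rightarrow> complex^'n"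
    and c :: "complex^'n^'n \<Rightarrow> complex"
    and \<Gamma> :: "('n double \<Rightarrow> 'n double) set"
    and e :: "nat \<Rightarrow> complex^'n^'n \<Rightarrow> complex"
  defines "H \<equiv> cherednik_algebra W \<alpha> \<alpha>v 0 c"
    and "ZW \<equiv> group_center (matrix_group W)"
    and "\<iota> \<equiv> cherednik_group_map W \<alpha> \<alpha>v 0 c"
  assumes "irreducible_reflection_group W"
    and "root_data W \<alpha> \<alpha>v"
    and "conjugation_invariant W c"
    and "(\<Gamma> = torus \<and> CARD('n) > 1) \<or>
         ((\<exists>U B. real_structure W U B \<and> \<Gamma> = sl2 B) \<and> CARD('n) > 2)"
    and "bij_betw e {..<order ZW} {a. primitive_idempotent (group_algebra ZW) a}"
  shows "cring (center (fixed_subalgebra \<Gamma> H)) \<and>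
         (\<exists>\<phi> \<in> ring_iso (tensor_product (fixed_subalgebra \<Gamma> (center H)) (group_algebra ZW))
                    (center (fixed_subalgebra \<Gamma> H)).
            \<forall>a\<in>carrier (fixed_subalgebra \<Gamma> (center H)). \<forall>b\<in>carrier (group_algebra ZW).
              \<phi> (pure_tensor (fixed_subalgebra \<Gamma> (center H)) (group_algebra ZW) a b)
                = a \<otimes>\<^bsub>H\<^esub> \<iota> b) \<and>
         internal_direct_sum (fixed_subalgebra \<Gamma> (center H))
           (ring_as_module (center (fixed_subalgebra \<Gamma> H))) {..<order ZW}
           (\<lambda>i. {a \<otimes>\<^bsub>H\<^esub> \<iota> (e i) | a. a \<in> carrier (fixed_subalgebra \<Gamma> (center H))})"
proof -
  have W: "finite W" "subgroup W GL"
    using assms(4) by (simp_all add: irreducible_reflection_group_def complex_reflection_group_def)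
  interpret reflection_data W \<alpha> \<alpha>v c
    by (intro reflection_data.intro finite_matrix_group.intro reflection_data_axioms.intro W assms(5,6))
  have irr: "V = {0} \<or> V = UNIV" if "vec.subspace V" "\<And>w u. w \<in> W \<Longrightarrow> u \<in> V \<Longrightarrow> w *v u \<in> V" for V
    using assms(4) that unfolding irreducible_reflection_group_def by blast
  have centre: "\<exists>k. \<forall>v. z *v v = k *s v" if "z \<in> Zc" for z
    using Schur[OF irr that] by blast
  have "\<exists>G. gamma_setting W \<alpha> \<alpha>v c G \<Gamma>"
    using assms(7)
  proof
    assume "\<Gamma> = torus \<and> CARD('n) > 1"
    then show ?thesis using torus_setting[OF centre card_distinct] by simp
  next
    assume "(\<exists>U B. real_structure W U B \<and> \<Gamma> = sl2 B) \<and> CARD('n) > 2"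
    then obtain R B where B: "real_structure W R B" "\<Gamma> = sl2 B" and three: "CARD('n) > 2" by blast
    interpret real_reflection_data W \<alpha> \<alpha>v c R B by unfold_locales (rule B(1))
    show ?thesis unfolding B(2) by (rule sl2_setting[OF centre card_avoid[OF three]])
  qed
  then obtain G where "gamma_setting W \<alpha> \<alpha>v c G \<Gamma>" by blast
  then interpret gamma_setting W \<alpha> \<alpha>v c G \<Gamma> .
  show ?thesis
    unfolding H_def \<iota>_def ZW_def by (rule centre_of_invariants[OF assms(8)[unfolded ZW_def]])
qed

end
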